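(* Let $d\ge1$, $H\in(0,1/2)$, and let $B$ be an $\mathbb R^d$-valued $\mathbb F$-fBm with Hurst parameter $H$. Let $\varepsilon\in(0,\frac12)$ and $m\in[2,\infty)$. There exists a constant $C>0$ such that for any $\mathbb R^d$-valued stochastic process $(\psi_t)_{t\in[0,1]}$ adapted to $\mathbb F$, any $f\in\mathcal C^1_b(\mathbb R^d,\mathbb R^d)$, any $h\in(0,1)$ and any $0\le s<t\le1$, $$\Big\|\int_s^tf(\psi_r+B_r)-f(\psi_r+B_{r_h})\,dr\Big\|_{L^m}\le C\Big(\|f\|_\infty h^{\frac12-\varepsilon}(t-s)^{\frac12+\frac\varepsilon2}+\|f\|_{\mathcal C^1}[\psi]_{\mathcal C^1_{[0,1]}L^\infty}h^{1-\varepsilon}(t-s)^{1+\frac\varepsilon2}\Big),$$ where $r_h=h\lfloor r/h\rfloor$.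
   Context: Probability setting: $(\Omega,\mathcal F,\mathbb F=(\mathcal F_t)_{t\in[0,1]},\mathbb P)$ is a filtered probability space satisfying the usual conditions and $L^m=L^m(\Omega)$. $\mathbb F$-fBm: a real fractional Brownian motion $B$ with Hurst parameter $H$ determines a Brownian motion $W=\mathcal A_HB$ ($\mathcal A_H$ a one-to-one operator), characterised for $H<1/2$ by $B_t=\int_0^tK_H(t,s)\,dW_s$ with $K_H(t,s)=c_H\big[(t/s)^{H-1/2}(t-s)^{H-1/2}-(H-\tfrac12)s^{1/2-H}\int_s^tu^{H-3/2}(u-s)^{H-1/2}du\big]$ ($c_H$ the normalising constant). $B$ is an $\mathbb F$-fBm if $W$ is an $\mathbb F$-Brownian motion. An $\mathbb R^d$-valued $\mathbb F$-fBm has independent components, each an $\mathbb F$-fBm. $[\psi]_{\mathcal C^1_{[0,1]}L^\infty}=\sup_{0\le s<t\le1}\frac{\|\psi_t-\psi_s\|_{L^\infty}}{t-s}$ (possibly infinite); $\|f\|_\infty=\sup|f|$, $\|f\|_{\mathcal C^1}=\|f\|_\infty+\sup_{x\ne y}\frac{|f(x)-f(y)|}{|x-y|}$; $\mathcal C^1_b$ denotes the $\mathcal C^1$ functions with $\|f\|_{\mathcal C^1}<\infty$. *)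

theory Defs
  imports "HOL-Probability.Probability"
begin

section \<open>Filtered probability spaces over the time interval [0,1]\<close>

text \<open>Only the values \<open>F t\<close> with \<open>t \<in> {0..1}\<close> matter. The last three assumptions are the usual
  conditions: \<open>M\<close> is complete, \<open>F 0\<close> contains all null sets, and \<open>F\<close> is right-continuous.\<close>

locale filtered_prob_space = prob_space M + complete_measure M
  for M :: "'a measure" and F :: "real \<Rightarrow> 'a measure" +
  assumes subalgebra_F: "t \<in> {0..1} \<Longrightarrow> subalgebra M (F t)"
    and F_mono: "0 \<le> s \<Longrightarrow> s \<le> t \<Longrightarrow> t \<le> 1 \<Longrightarrow> sets (F s) \<subseteq> sets (F t)"
    and null_sets_F: "null_sets M \<subseteq> sets (F 0)"
    and F_right_cont: "0 \<le> t \<Longrightarrow> t < 1 \<Longrightarrow> sets (F t) = (\<Inter>s\<in>{t<..1}. sets (F s))"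

definition adapted_process :: "(real \<Rightarrow> 'a measure) \<Rightarrow> (real \<Rightarrow> 'a \<Rightarrow> 'b::topological_space) \<Rightarrow> bool" where
  "adapted_process F X \<longleftrightarrow> (\<forall>t\<in>{0..1}. X t \<in> borel_measurable (F t))"

text \<open>Joint measurability in time and \<open>\<omega>\<close>, up to a null set of the product measure. This is implied
  both by joint measurability with respect to the product sigma-algebra and by almost sure
  continuity of the paths; it is what makes time integrals along the paths meaningful.\<close>

definition jointly_measurable_process ::
    "'a measure \<Rightarrow> (real \<Rightarrow> 'a \<Rightarrow> 'b::topological_space) \<Rightarrow> bool" where
  "jointly_measurable_process M X \<longleftrightarrow>
     (\<lambda>(t, \<omega>). X t \<omega>) \<in> borel_measurable (completion (restrict_space lborel {0..1} \<Otimes>\<^sub>M M))"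

section \<open>Brownian motion and Wiener integrals\<close>

definition F_brownian_motion ::
    "'a measure \<Rightarrow> (real \<Rightarrow> 'a measure) \<Rightarrow> (real \<Rightarrow> 'a \<Rightarrow> real) \<Rightarrow> bool" where
  "F_brownian_motion M F W \<longleftrightarrow>
     adapted_process F W \<and>
     (AE \<omega> in M. W 0 \<omega> = 0) \<and>
     (AE \<omega> in M. continuous_on {0..1} (\<lambda>t. W t \<omega>)) \<and>
     (\<forall>s t. 0 \<le> s \<longrightarrow> s < t \<longrightarrow> t \<le> 1 \<longrightarrow>
        distributed M lborel (\<lambda>\<omega>. W t \<omega> - W s \<omega>) (normal_density 0 (sqrt (t - s))) \<and>
        prob_space.indep_set M (sets (F s))
          {(\<lambda>\<omega>. W t \<omega> - W s \<omega>) -` A \<inter> space M |A. A \<in> sets borel})"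

text \<open>\<open>X\<close> is a version of the Wiener integral of \<open>\<phi>\<close> against \<open>W\<close> over \<open>[0,t]\<close>: there are step functions
  \<open>\<Sum>i<n k. c k i * indicator {a k i<..b k i}\<close> that converge to \<open>\<phi>\<close> in \<open>L\<^sup>2([0,t])\<close> as \<open>k \<rightarrow> \<infinity>\<close>, and whose
  elementary integrals converge to \<open>X\<close> in \<open>L\<^sup>2(\<Omega>)\<close>.\<close>

definition is_wiener_integral ::
    "'a measure \<Rightarrow> (real \<Rightarrow> 'a \<Rightarrow> real) \<Rightarrow> real \<Rightarrow> (real \<Rightarrow> real) \<Rightarrow> ('a \<Rightarrow> real) \<Rightarrow> bool" where
  "is_wiener_integral M W t \<phi> X \<longleftrightarrow>
     X \<in> borel_measurable M \<and>
     set_borel_measurable lborel {0..t} \<phi> \<and>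
     (\<exists>(n :: nat \<Rightarrow> nat) (c :: nat \<Rightarrow> nat \<Rightarrow> real) (a :: nat \<Rightarrow> nat \<Rightarrow> real) (b :: nat \<Rightarrow> nat \<Rightarrow> real).
        (\<forall>k. \<forall>i<n k. 0 \<le> a k i \<and> a k i \<le> b k i \<and> b k i \<le> t) \<and>
        (\<lambda>k. \<integral>\<^sup>+u\<in>{0..t}. ennreal ((\<phi> u - (\<Sum>i<n k. c k i * indicator {a k i<..b k i} u))\<^sup>2) \<partial>lborel)
          \<longlonglongrightarrow> 0 \<and>
        (\<lambda>k. \<integral>\<^sup>+\<omega>. ennreal ((X \<omega> - (\<Sum>i<n k. c k i * (W (b k i) \<omega> - W (a k i) \<omega>)))\<^sup>2) \<partial>M)
          \<longlonglongrightarrow> 0)"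

section \<open>Fractional Brownian motion\<close>

text \<open>Possibly degenerate normal random variables.\<close>

definition gaussian_rv :: "'a measure \<Rightarrow> ('a \<Rightarrow> real) \<Rightarrow> bool" where
  "gaussian_rv M X \<longleftrightarrow> X \<in> borel_measurable M \<and>
     (\<exists>\<mu> \<sigma>. (\<sigma> = 0 \<and> (AE \<omega> in M. X \<omega> = \<mu>)) \<or>
            (\<sigma> > 0 \<and> distributed M lborel X (normal_density \<mu> \<sigma>)))"

definition gaussian_process :: "'a measure \<Rightarrow> (real \<Rightarrow> 'a \<Rightarrow> real) \<Rightarrow> bool" where
  "gaussian_process M X \<longleftrightarrow>
     (\<forall>J c. finite J \<longrightarrow> J \<subseteq> {0..1} \<longrightarrow> gaussian_rv M (\<lambda>\<omega>. \<Sum>t\<in>J. c t * X t \<omega>))"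

definition fractional_brownian_motion ::
    "'a measure \<Rightarrow> real \<Rightarrow> (real \<Rightarrow> 'a \<Rightarrow> real) \<Rightarrow> bool" where
  "fractional_brownian_motion M H B \<longleftrightarrow>
     gaussian_process M B \<and>
     (\<forall>t\<in>{0..1}. prob_space.expectation M (B t) = 0) \<and>
     (\<forall>s\<in>{0..1}. \<forall>t\<in>{0..1}. prob_space.expectation M (\<lambda>\<omega>. B s \<omega> * B t \<omega>) =
        (s powr (2 * H) + t powr (2 * H) - \<bar>t - s\<bar> powr (2 * H)) / 2) \<and>
     (AE \<omega> in M. continuous_on {0..1} (\<lambda>t. B t \<omega>))"

text \<open>The Volterra kernel for \<open>0 < s < t\<close> and \<open>H < 1/2\<close>, first without its constant. Values for other
  \<open>s\<close> and \<open>t\<close> are irrelevant.\<close>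

definition fbm_kernel_unnormalised :: "real \<Rightarrow> real \<Rightarrow> real \<Rightarrow> real" where
  "fbm_kernel_unnormalised H t s =
     (t / s) powr (H - 1/2) * (t - s) powr (H - 1/2)
     - (H - 1/2) * s powr (1/2 - H) *
         (LINT u:{s..t}|lborel. u powr (H - 3/2) * (u - s) powr (H - 1/2))"

text \<open>The constant is fixed by \<open>\<integral>\<^sub>0\<^sup>1 K\<^sub>H(1,s)\<^sup>2 ds = 1\<close>, that is, by \<open>\<E>[B\<^sub>1\<^sup>2] = 1\<close>.\<close>

definition fbm_const :: "real \<Rightarrow> real" where
  "fbm_const H = 1 / sqrt (LINT s:{0<..<1}|lborel. (fbm_kernel_unnormalised H 1 s)\<^sup>2)"

definition fbm_kernel :: "real \<Rightarrow> real \<Rightarrow> real \<Rightarrow> real" where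
  "fbm_kernel H t s = fbm_const H * fbm_kernel_unnormalised H t s"

text \<open>For \<open>H < 1/2\<close> the representation determines \<open>W\<close> up to modification, because the functions
  \<open>indicator {0..t} * fbm_kernel H t\<close> with \<open>t \<in> {0..1}\<close> are total in \<open>L\<^sup>2([0,1])\<close>. So the existential
  quantifier says that the process \<open>W\<close> determined by \<open>B\<close> is an \<open>F\<close>-Brownian motion.\<close>

definition F_fbm_real ::
    "'a measure \<Rightarrow> (real \<Rightarrow> 'a measure) \<Rightarrow> real \<Rightarrow> (real \<Rightarrow> 'a \<Rightarrow> real) \<Rightarrow> bool" where
  "F_fbm_real M F H B \<longleftrightarrow>
     fractional_brownian_motion M H B \<and>
     (\<exists>W. F_brownian_motion M F W \<and>
          (\<forall>t\<in>{0..1}. is_wiener_integral M W t (fbm_kernel H t) (B t)))"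

definition F_fbm ::
    "'a measure \<Rightarrow> (real \<Rightarrow> 'a measure) \<Rightarrow> real \<Rightarrow> (real \<Rightarrow> 'a \<Rightarrow> real ^ 'd) \<Rightarrow> bool" where
  "F_fbm M F H B \<longleftrightarrow>
     (\<forall>i. F_fbm_real M F H (\<lambda>t \<omega>. B t \<omega> $ i)) \<and>
     prob_space.indep_vars M (\<lambda>i. Pi\<^sub>M {0..1} (\<lambda>t. borel))
       (\<lambda>i \<omega>. \<lambda>t\<in>{0..1}. B t \<omega> $ i) UNIV"

section \<open>Norms\<close>

text \<open>All norms are extended nonnegative reals, where \<open>0 * \<infinity> = 0\<close>.\<close>

definition Lm_norm :: "'a measure \<Rightarrow> real \<Rightarrow> ('a \<Rightarrow> 'b::real_normed_vector) \<Rightarrow> ennreal" where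
  "Lm_norm M m X = (let I = \<integral>\<^sup>+\<omega>. ennreal (norm (X \<omega>) powr m) \<partial>M in
     if I = \<infinity> then \<infinity> else ennreal (enn2real I powr (1 / m)))"

definition Linf_norm :: "'a measure \<Rightarrow> ('a \<Rightarrow> 'b::real_normed_vector) \<Rightarrow> ennreal" where
  "Linf_norm M X = esssup M (\<lambda>\<omega>. ennreal (norm (X \<omega>)))"

definition C1_Linf_seminorm ::
    "'a measure \<Rightarrow> (real \<Rightarrow> 'a \<Rightarrow> 'b::real_normed_vector) \<Rightarrow> ennreal" where
  "C1_Linf_seminorm M \<psi> =
     (SUP (s, t)\<in>{(s, t). 0 \<le> s \<and> s < t \<and> t \<le> 1}.
        Linf_norm M (\<lambda>\<omega>. \<psi> t \<omega> - \<psi> s \<omega>) / ennreal (t - s))"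

definition sup_norm :: "('b \<Rightarrow> 'c::real_normed_vector) \<Rightarrow> ennreal" where
  "sup_norm f = (SUP x. ennreal (norm (f x)))"

definition C1_norm :: "('b::real_normed_vector \<Rightarrow> 'c::real_normed_vector) \<Rightarrow> ennreal" where
  "C1_norm f = sup_norm f +
     (SUP (x, y)\<in>{(x, y). x \<noteq> y}. ennreal (norm (f x - f y) / norm (x - y)))"

definition C1_bounded :: "('b::real_normed_vector \<Rightarrow> 'c::real_normed_vector) \<Rightarrow> bool" where
  "C1_bounded f \<longleftrightarrow>
     (\<exists>f' :: 'b \<Rightarrow> 'b \<Rightarrow>\<^sub>L 'c. (\<forall>x. (f has_derivative blinfun_apply (f' x)) (at x)) \<and>
        continuous_on UNIV f') \<and>
     C1_norm f < \<infinity>"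

definition grid_floor :: "real \<Rightarrow> real \<Rightarrow> real" where
  "grid_floor h r = h * of_int \<lfloor>r / h\<rfloor>"

end

theory Submission
  imports Defs
begin

text \<open>
  On each cell \<open>[k h, (k + 1) h]\<close> the drift \<open>\<psi>\<close> is replaced by its value at an earlier grid point; the Lipschitz
  bounds on \<open>f\<close> and \<open>\<psi>\<close> control the error. Let \<open>y k j\<close> be the cell with \<open>\<psi>\<close> frozen at \<open>(k - j) h\<close>. Given
  the past up to \<open>u\<close>, the components of \<open>B r\<close> are independent normal variables with variance at least
  \<open>(r - u)\<^sup>2\<^sup>H / 2\<close>, and moving from \<open>r'\<close> to \<open>r\<close> changes this conditional law by
  \<open>O((r - r') / (r' - u))\<close> in total variation. So the conditional expectation of \<open>y k j\<close> at time \<open>(k - j) h\<close> is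
  of order \<open>h / j\<close>, and it changes by order \<open>h\<^sup>2 / j\<close> when \<open>\<psi>\<close> is frozen one step earlier. Going back into
  the past one grid step at a time writes \<open>\<Sum>k. y k 1\<close> as a sum over \<open>j\<close> of martingale differences in \<open>k\<close> and of
  these small terms. With \<open>n\<close> cells this gives \<open>(\<surd>n h + n h\<^sup>2) ln n\<close>, and the powers of
  \<open>\<epsilon>\<close> absorb the logarithm.
\<close>

section \<open>Square-integrable functions\<close>

text \<open>The hypotheses make each driving process \<open>W l\<close> an F-Brownian motion and the
  components of \<open>B\<close> independent of one another; they say nothing about several
  components jointly with the filtration. Conditional independence of the components of
  \<open>B r\<close> is therefore the main obstacle. It rests on the totality of the kernels in L2:
  increments of \<open>W l\<close> are limits of linear combinations of values of component
  \<open>l\<close> of \<open>B\<close>, so independence passes to the \<open>W l\<close>. About the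
  kernel the estimates use only that it is nonnegative, decreasing and convex in time. With the
  known covariance of \<open>B\<close> this controls the conditional mean and variance without any
  asymptotics. Total variation is the right distance because the first term sees only the sup norm
  of \<open>f\<close>. The same bound for \<open>f (\<psi> u + x) - f (\<psi> v + x)\<close>, whose
  sup norm is at most a Lipschitz constant times the drift increment, gives the second term.
  Orthogonality in \<open>k\<close> produces \<open>\<surd>n\<close>, the triangle inequality over
  \<open>j\<close> produces \<open>ln n\<close>. Since \<open>n\<close> is about
  \<open>(t - s) / h\<close>, the products \<open>\<surd>n h\<close> and \<open>n h^2\<close> are
  \<open>h^(1/2) (t - s)^(1/2)\<close> and \<open>h (t - s)\<close>.\<close>

definition square_integrable :: "'a measure \<Rightarrow> ('a \<Rightarrow> real) \<Rightarrow> bool" where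
  "square_integrable M f \<longleftrightarrow> f \<in> borel_measurable M \<and> integrable M (\<lambda>x. (f x)\<^sup>2)"

lemma square_integrableD:
  assumes "square_integrable M f"
  shows "f \<in> borel_measurable M" "integrable M (\<lambda>x. (f x)\<^sup>2)"
  using assms by (auto simp: square_integrable_def)

lemma square_integrable_mult:
  assumes "square_integrable M f" "square_integrable M g"
  shows "integrable M (\<lambda>x. f x * g x)"
proof (rule Bochner_Integration.integrable_bound)
  show "integrable M (\<lambda>x. (f x)\<^sup>2 + (g x)\<^sup>2)"
    using assms by (auto simp: square_integrable_def)
  show "(\<lambda>x. f x * g x) \<in> borel_measurable M"
    using assms by (auto simp: square_integrable_def)
  show "AE x in M. norm (f x * g x) \<le> norm ((f x)\<^sup>2 + (g x)\<^sup>2)"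
  proof (rule AE_I2)
    fix x
    have "0 \<le> (\<bar>f x\<bar> - \<bar>g x\<bar>)\<^sup>2" by simp
    then have "2 * (\<bar>f x\<bar> * \<bar>g x\<bar>) \<le> (f x)\<^sup>2 + (g x)\<^sup>2"
      by (simp add: power2_diff)
    moreover have "0 \<le> \<bar>f x\<bar> * \<bar>g x\<bar>" by simp
    ultimately show "norm (f x * g x) \<le> norm ((f x)\<^sup>2 + (g x)\<^sup>2)"
      unfolding real_norm_def abs_mult by linarith
  qed
qed

lemma square_integrable_add:
  assumes "square_integrable M f" "square_integrable M g"
  shows "square_integrable M (\<lambda>x. f x + g x)"
  unfolding square_integrable_def power2_sum mult.assoc
  using assms square_integrable_mult[OF assms] by (auto simp: square_integrable_def)

lemma square_integrable_cmult:
  assumes "square_integrable M f"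
  shows "square_integrable M (\<lambda>x. c * f x)"
  using assms by (auto simp: square_integrable_def power_mult_distrib)

lemma square_integrable_diff:
  assumes "square_integrable M f" "square_integrable M g"
  shows "square_integrable M (\<lambda>x. f x - g x)"
  using square_integrable_add[OF assms(1) square_integrable_cmult[OF assms(2), of "-1"]] by simp

lemma square_integrable_zero: "square_integrable M (\<lambda>x. 0)"
  by (simp add: square_integrable_def)

lemma square_integrable_sum:
  assumes "\<And>i. i \<in> I \<Longrightarrow> square_integrable M (f i)"
  shows "square_integrable M (\<lambda>x. \<Sum>i\<in>I. f i x)"
  using assms
  by (induction I rule: infinite_finite_induct)
     (auto intro: square_integrable_add square_integrable_zero)

lemma square_integrable_cong_AE:
  assumes "square_integrable M f" "g \<in> borel_measurable M" "AE x in M. f x = g x"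
  shows "square_integrable M g"
proof -
  have "AE x in M. (f x)\<^sup>2 = (g x)\<^sup>2" using assms(3) by eventually_elim simp
  from integrable_cong_AE_imp[OF square_integrableD(2)[OF assms(1)] _ this] assms(2)
  have "integrable M (\<lambda>x. (g x)\<^sup>2)" by simp
  with assms(2) show ?thesis by (simp add: square_integrable_def)
qed

lemma Cauchy_Schwarz_integral:
  assumes f: "square_integrable M f" and g: "square_integrable M g"
  shows "\<bar>\<integral>x. f x * g x \<partial>M\<bar> \<le> sqrt (LINT x|M. (f x)\<^sup>2) * sqrt (LINT x|M. (g x)\<^sup>2)"
proof -
  define a b c where "a = (LINT x|M. (f x)\<^sup>2)" and "b = (LINT x|M. f x * g x)"
    and "c = (LINT x|M. (g x)\<^sup>2)"
  have a0: "a \<ge> 0" and c0: "c \<ge> 0" by (auto simp: a_def c_def)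
  have quad: "0 \<le> a + 2 * t * b + t\<^sup>2 * c" for t
  proof -
    have "0 \<le> (LINT x|M. (f x + t * g x)\<^sup>2)" by simp
    also have "\<dots> = (LINT x|M. ((f x)\<^sup>2 + (2 * t) * (f x * g x)) + t\<^sup>2 * (g x)\<^sup>2)"
      by (intro Bochner_Integration.integral_cong refl) (simp add: power2_sum power_mult_distrib)
    also have "\<dots> = a + 2 * t * b + t\<^sup>2 * c"
      using square_integrableD(2)[OF f] square_integrableD(2)[OF g] square_integrable_mult[OF f g]
      by (simp add: a_def b_def c_def)
    finally show ?thesis .
  qed
  have "b\<^sup>2 \<le> a * c"
  proof (cases "c = 0")
    case True
    have "b = 0"
    proof (rule ccontr)
      assume "b \<noteq> 0"
      \<comment> \<open>With \<open>c = 0\<close> the quadratic is affine in \<open>t\<close>; this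
        \<open>t\<close> gives it the value \<open>-1\<close>.\<close>
      have "a + 2 * (- (a + 1) / (2 * b)) * b = -1" using \<open>b \<noteq> 0\<close> by (simp add: field_simps)
      then show False using quad[of "- (a + 1) / (2 * b)"] True by simp
    qed
    then show ?thesis using True by simp
  next
    case False
    then have "c > 0" using c0 by simp
    have "0 \<le> c * (a + 2 * (- b / c) * b + (- b / c)\<^sup>2 * c)"
      using quad[of "- b / c"] \<open>c > 0\<close> by simp
    also have "\<dots> = a * c - b\<^sup>2"
      using \<open>c > 0\<close> by (simp add: field_simps power2_eq_square)
    finally show ?thesis by simp
  qed
  then have "\<bar>b\<bar> \<le> sqrt (a * c)" by (simp add: real_le_rsqrt)
  then show ?thesis by (simp add: a_def b_def c_def real_sqrt_mult)
qed

text \<open>Square integrability is part of the notion because the Bochner integral of a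
  non-integrable function is 0, and the limit alone would then say nothing.\<close>

definition L2_tendsto :: "'a measure \<Rightarrow> (nat \<Rightarrow> 'a \<Rightarrow> real) \<Rightarrow> ('a \<Rightarrow> real) \<Rightarrow> bool" where
  "L2_tendsto M fs f \<longleftrightarrow> (\<forall>k. square_integrable M (fs k)) \<and> square_integrable M f \<and>
     (\<lambda>k. \<integral>x. (f x - fs k x)\<^sup>2 \<partial>M) \<longlonglongrightarrow> 0"

lemma L2_tendstoD:
  assumes "L2_tendsto M fs f"
  shows "square_integrable M (fs k)" "square_integrable M f"
    "(\<lambda>k. \<integral>x. (f x - fs k x)\<^sup>2 \<partial>M) \<longlonglongrightarrow> 0"
  using assms by (auto simp: L2_tendsto_def)

lemma L2_tendsto_const: "square_integrable M f \<Longrightarrow> L2_tendsto M (\<lambda>k. f) f"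
  by (simp add: L2_tendsto_def)

text \<open>A finite distance to a single square-integrable \<open>fs k\<close> makes
  \<open>f\<close> square-integrable, and then both kinds of integral agree. The lemma imports the
  limits of \<open>is_wiener_integral\<close>, which are stated with nonnegative integrals.\<close>

lemma L2_tendstoI_nn:
  assumes fs: "\<And>k. square_integrable M (fs k)" and f: "f \<in> borel_measurable M"
    and lim: "(\<lambda>k. \<integral>\<^sup>+x. ennreal ((f x - fs k x)\<^sup>2) \<partial>M) \<longlonglongrightarrow> 0"
  shows "L2_tendsto M fs f"
proof -
  have [measurable]: "fs k \<in> borel_measurable M" for k using fs by (simp add: square_integrable_def)
  note f[measurable]
  have "eventually (\<lambda>k. (\<integral>\<^sup>+x. ennreal ((f x - fs k x)\<^sup>2) \<partial>M) < 1) sequentially"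
    using order_tendstoD(2)[OF lim, of 1] by simp
  then obtain k where "(\<integral>\<^sup>+x. ennreal ((f x - fs k x)\<^sup>2) \<partial>M) < 1"
    by (auto simp: eventually_sequentially)
  then have "integrable M (\<lambda>x. (f x - fs k x)\<^sup>2)"
    by (intro integrableI_nonneg) (auto intro: less_trans[of _ 1])
  then have "square_integrable M (\<lambda>x. f x - fs k x)"
    by (simp add: square_integrable_def)
  from square_integrable_add[OF this fs[of k]] have f2: "square_integrable M f" by simp
  have int: "integrable M (\<lambda>x. (f x - fs k x)\<^sup>2)" for k
    using square_integrable_diff[OF f2 fs[of k]] by (simp add: square_integrable_def)
  have "(\<lambda>k. ennreal (LINT x|M. (f x - fs k x)\<^sup>2)) \<longlonglongrightarrow> ennreal 0"
    using lim by (simp add: nn_integral_eq_integral[OF int])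
  then have "(\<lambda>k. \<integral>x. (f x - fs k x)\<^sup>2 \<partial>M) \<longlonglongrightarrow> 0"
    by (subst (asm) tendsto_ennreal_iff) auto
  with fs f2 show ?thesis by (simp add: L2_tendsto_def)
qed

lemma L2_tendsto_le:
  assumes "\<And>k. square_integrable M (fs k)" "square_integrable M f"
    and "\<And>k. (LINT x|M. (f x - fs k x)\<^sup>2) \<le> b k" "b \<longlonglongrightarrow> 0"
  shows "L2_tendsto M fs f"
  unfolding L2_tendsto_def using assms
  by (auto intro!: tendsto_sandwich[OF _ _ tendsto_const assms(4)])

lemma integral_power2_sum_le:
  assumes f: "square_integrable M f" and g: "square_integrable M g"
  shows "(LINT x|M. (f x + g x)\<^sup>2) \<le> 2 * (LINT x|M. (f x)\<^sup>2) + 2 * (LINT x|M. (g x)\<^sup>2)"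
proof -
  have "(LINT x|M. (f x + g x)\<^sup>2) \<le> (LINT x|M. 2 * (f x)\<^sup>2 + 2 * (g x)\<^sup>2)"
  proof (rule integral_mono)
    show "integrable M (\<lambda>x. (f x + g x)\<^sup>2)"
      using square_integrable_add[OF f g] by (simp add: square_integrable_def)
    show "integrable M (\<lambda>x. 2 * (f x)\<^sup>2 + 2 * (g x)\<^sup>2)"
      using f g by (simp add: square_integrable_def)
    fix x have "0 \<le> (f x - g x)\<^sup>2" by simp
    then show "(f x + g x)\<^sup>2 \<le> 2 * (f x)\<^sup>2 + 2 * (g x)\<^sup>2" by (simp add: power2_diff power2_sum)
  qed
  also have "\<dots> = 2 * (LINT x|M. (f x)\<^sup>2) + 2 * (LINT x|M. (g x)\<^sup>2)"
    using f g by (simp add: square_integrable_def)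
  finally show ?thesis .
qed

lemma L2_tendsto_add:
  assumes f: "L2_tendsto M fs f" and g: "L2_tendsto M gs g"
  shows "L2_tendsto M (\<lambda>k x. fs k x + gs k x) (\<lambda>x. f x + g x)"
proof (rule L2_tendsto_le)
  note F = L2_tendstoD[OF f] and G = L2_tendstoD[OF g]
  show "square_integrable M (\<lambda>x. fs k x + gs k x)" for k using F G by (auto intro: square_integrable_add)
  show "square_integrable M (\<lambda>x. f x + g x)" using F G by (auto intro: square_integrable_add)
  show "(\<lambda>k. 2 * (LINT x|M. (f x - fs k x)\<^sup>2) + 2 * (LINT x|M. (g x - gs k x)\<^sup>2)) \<longlonglongrightarrow> 0"
    using tendsto_add[OF tendsto_mult_left[OF F(3), of 2] tendsto_mult_left[OF G(3), of 2]] by simp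
  fix k
  show "(LINT x|M. (f x + g x - (fs k x + gs k x))\<^sup>2) \<le>
      2 * (LINT x|M. (f x - fs k x)\<^sup>2) + 2 * (LINT x|M. (g x - gs k x)\<^sup>2)"
    using integral_power2_sum_le[OF square_integrable_diff[OF F(2) F(1)[of k]]
        square_integrable_diff[OF G(2) G(1)[of k]]] by (simp add: algebra_simps)
qed

lemma L2_tendsto_cmult:
  assumes f: "L2_tendsto M fs f"
  shows "L2_tendsto M (\<lambda>k x. c * fs k x) (\<lambda>x. c * f x)"
proof -
  note F = L2_tendstoD[OF f]
  have "(\<lambda>k. c\<^sup>2 * (LINT x|M. (f x - fs k x)\<^sup>2)) \<longlonglongrightarrow> c\<^sup>2 * 0"
    by (intro tendsto_mult_left F)
  moreover have "(LINT x|M. (c * f x - c * fs k x)\<^sup>2) = c\<^sup>2 * (LINT x|M. (f x - fs k x)\<^sup>2)" for k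
  proof -
    have "(c * f x - c * fs k x)\<^sup>2 = c\<^sup>2 * (f x - fs k x)\<^sup>2" for x
      by (simp add: power_mult_distrib flip: right_diff_distrib)
    then show ?thesis by simp
  qed
  ultimately show ?thesis using F by (auto simp: L2_tendsto_def intro: square_integrable_cmult)
qed

lemma L2_tendsto_diff:
  assumes f: "L2_tendsto M fs f" and g: "L2_tendsto M gs g"
  shows "L2_tendsto M (\<lambda>k x. fs k x - gs k x) (\<lambda>x. f x - g x)"
  using L2_tendsto_add[OF f L2_tendsto_cmult[OF g, of "-1"]] by simp

lemma L2_tendsto_sum:
  assumes "\<And>i. i \<in> I \<Longrightarrow> L2_tendsto M (fs i) (f i)"
  shows "L2_tendsto M (\<lambda>k x. \<Sum>i\<in>I. fs i k x) (\<lambda>x. \<Sum>i\<in>I. f i x)"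
  using assms
  by (induction I rule: infinite_finite_induct)
     (auto intro: L2_tendsto_add L2_tendsto_const square_integrable_zero)

text \<open>Expanding both factors around their limits leaves three error terms, each with a factor
  whose norm tends to 0. The auxiliary fact \<open>null\<close> lets the other factor have any limit
  norm, so that it also covers a fixed function.\<close>

lemma L2_tendsto_inner:
  assumes f: "L2_tendsto M fs f" and g: "L2_tendsto M gs g"
  shows "(\<lambda>k. \<integral>x. fs k x * gs k x \<partial>M) \<longlonglongrightarrow> (LINT x|M. f x * g x)"
proof -
  note F = L2_tendstoD[OF f] and G = L2_tendstoD[OF g]
  define u v where "u k x = f x - fs k x" and "v k x = g x - gs k x" for k x
  have U: "square_integrable M (u k)" and V: "square_integrable M (v k)" for k
    unfolding u_def v_def using F G by (auto intro: square_integrable_diff)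
  have un: "(\<lambda>k. sqrt (LINT x|M. (u k x)\<^sup>2)) \<longlonglongrightarrow> 0" and vn: "(\<lambda>k. sqrt (LINT x|M. (v k x)\<^sup>2)) \<longlonglongrightarrow> 0"
    using tendsto_real_sqrt[OF F(3)] tendsto_real_sqrt[OF G(3)] by (simp_all add: u_def v_def)
  have null: "(\<lambda>k. \<integral>x. a k x * b k x \<partial>M) \<longlonglongrightarrow> 0"
    if "\<And>k. square_integrable M (a k)" "\<And>k. square_integrable M (b k)"
      "(\<lambda>k. sqrt (LINT x|M. (a k x)\<^sup>2)) \<longlonglongrightarrow> 0" "(\<lambda>k. sqrt (LINT x|M. (b k x)\<^sup>2)) \<longlonglongrightarrow> c" for a b c
  proof (rule tendsto_rabs_zero_cancel, rule tendsto_sandwich[OF _ _ tendsto_const])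
    show "(\<lambda>k. sqrt (LINT x|M. (a k x)\<^sup>2) * sqrt (LINT x|M. (b k x)\<^sup>2)) \<longlonglongrightarrow> 0"
      using tendsto_mult[OF that(3,4)] by simp
  qed (use Cauchy_Schwarz_integral[OF that(1,2)] in auto)
  have eq: "(LINT x|M. fs k x * gs k x) = (LINT x|M. f x * g x) - (LINT x|M. u k x * g x)
      - (LINT x|M. v k x * f x) + (LINT x|M. u k x * v k x)" for k
  proof -
    have "(LINT x|M. fs k x * gs k x) = (LINT x|M. f x * g x - u k x * g x - v k x * f x + u k x * v k x)"
      by (intro Bochner_Integration.integral_cong refl) (simp add: u_def v_def algebra_simps)
    also have "\<dots> = (LINT x|M. f x * g x) - (LINT x|M. u k x * g x)
      - (LINT x|M. v k x * f x) + (LINT x|M. u k x * v k x)"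
      using square_integrable_mult[OF F(2) G(2)] square_integrable_mult[OF U G(2), of k]
        square_integrable_mult[OF V F(2), of k] square_integrable_mult[OF U V, of k k] by simp
    finally show ?thesis .
  qed
  have "(\<lambda>k. (LINT x|M. f x * g x) - (LINT x|M. u k x * g x)
      - (LINT x|M. v k x * f x) + (LINT x|M. u k x * v k x)) \<longlonglongrightarrow> (LINT x|M. f x * g x) - 0 - 0 + 0"
    by (intro tendsto_intros null[OF U G(2) un] null[OF V F(2) vn] null[OF U V un vn]) auto
  then show ?thesis by (simp add: eq)
qed

lemma L2_tendsto_norm:
  assumes "L2_tendsto M fs f"
  shows "(\<lambda>k. \<integral>x. (fs k x)\<^sup>2 \<partial>M) \<longlonglongrightarrow> (LINT x|M. (f x)\<^sup>2)"
  using L2_tendsto_inner[OF assms assms] by (simp add: power2_eq_square)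

lemma (in prob_space) square_integrable_bounded:
  assumes "f \<in> borel_measurable M" "\<And>x. \<bar>f x\<bar> \<le> c"
  shows "square_integrable M f"
proof -
  have "(f x)\<^sup>2 \<le> c\<^sup>2" for x using assms(2)[of x] by (metis abs_ge_zero power2_abs power_mono)
  then show ?thesis unfolding square_integrable_def
    using assms(1) by (auto intro!: integrable_const_bound[where B="c\<^sup>2"])
qed

lemma (in prob_space) square_integrable_integrable:
  assumes "square_integrable M f"
  shows "integrable M f"
  using square_integrable_mult[OF assms square_integrable_bounded[of "\<lambda>_. 1" 1]] by simp

lemma (in prob_space) expectation_abs_le_sqrt:
  assumes "square_integrable M f"
  shows "expectation (\<lambda>x. \<bar>f x\<bar>) \<le> sqrt (expectation (\<lambda>x. (f x)\<^sup>2))"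
proof -
  have "square_integrable M (\<lambda>x. \<bar>f x\<bar>)" using assms by (auto simp: square_integrable_def)
  from Cauchy_Schwarz_integral[OF this square_integrable_bounded[of "\<lambda>_. 1" 1]]
  show ?thesis by (simp add: prob_space)
qed

lemma (in prob_space) L2_tendsto_L1:
  assumes "L2_tendsto M fs f"
  shows "(\<lambda>k. expectation (\<lambda>x. \<bar>f x - fs k x\<bar>)) \<longlonglongrightarrow> 0"
proof (rule tendsto_sandwich[OF _ _ tendsto_const])
  note F = L2_tendstoD[OF assms]
  show "(\<lambda>k. sqrt (LINT x|M. (f x - fs k x)\<^sup>2)) \<longlonglongrightarrow> 0"
    using tendsto_real_sqrt[OF F(3)] by simp
  show "eventually (\<lambda>k. expectation (\<lambda>x. \<bar>f x - fs k x\<bar>) \<le> sqrt (LINT x|M. (f x - fs k x)\<^sup>2)) sequentially"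
    using F by (intro always_eventually allI expectation_abs_le_sqrt square_integrable_diff)
qed auto

section \<open>Independence and conditioning\<close>

context prob_space
begin

text \<open>After division by its mean, \<open>V\<close> is a probability density. The factorisation
  says that \<open>X\<close> has the same characteristic function under the new measure as under
  \<open>M\<close>, so Levy's uniqueness theorem gives the same law.\<close>

lemma char_factor_indicator_nonneg:
  fixes X V :: "'a \<Rightarrow> real"
  assumes X[measurable]: "X \<in> borel_measurable M" and V[measurable]: "V \<in> borel_measurable M"
    and V0: "\<And>x. 0 \<le> V x" and Vc: "\<And>x. V x \<le> c"
    and fact: "\<And>t. (CLINT x|M. of_real (V x) * iexp (t * X x)) =
      of_real (expectation V) * (CLINT x|M. iexp (t * X x))"
    and C[measurable]: "C \<in> sets borel"
  shows "expectation (\<lambda>x. V x * indicator C (X x)) = expectation V * prob (X -` C \<inter> space M)"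
proof (cases "expectation V = 0")
  case True
  have int: "integrable M V" using V0 Vc by (intro integrable_const_bound[where B=c]) auto
  have "AE x in M. V x = 0"
    using integral_nonneg_eq_0_iff_AE[OF int] V0 True by simp
  then have "AE x in M. V x * indicator C (X x) = 0" by eventually_elim simp
  then show ?thesis using True by (simp add: integral_eq_zero_AE)
next
  case False
  define v where "v = expectation V"
  have int: "integrable M V" using V0 Vc by (intro integrable_const_bound[where B=c]) auto
  have v: "v > 0" using False V0 by (simp add: v_def less_le)
  define N where "N = density M (\<lambda>x. ennreal (V x / v))"
  have "emeasure N (space N) = (\<integral>\<^sup>+x. ennreal (V x / v) \<partial>M)"
    by (simp add: N_def emeasure_density)
  also have "\<dots> = ennreal (LINT x|M. V x / v)"
    using int v V0 by (intro nn_integral_eq_integral) auto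
  also have "\<dots> = 1" using v by (simp add: v_def)
  finally interpret N: prob_space N by (intro prob_spaceI)
  have XN[measurable]: "X \<in> borel_measurable N" by (simp add: N_def)
  have rd1: "real_distribution (distr N borel X)" by (rule N.real_distribution_distr) simp
  have rd2: "real_distribution (distr M borel X)" by (rule real_distribution_distr) simp
  have "char (distr N borel X) = char (distr M borel X)"
  proof
    fix t
    have "char (distr N borel X) t = (CLINT x|N. iexp (t * X x))"
      by (simp add: char_def integral_distr)
    also have "\<dots> = (CLINT x|M. (V x / v) *\<^sub>R iexp (t * X x))"
      unfolding N_def using v V0 by (subst integral_density) auto
    also have "\<dots> = (CLINT x|M. of_real (1 / v) * (of_real (V x) * iexp (t * X x)))"
      by (intro Bochner_Integration.integral_cong refl) (simp add: scaleR_conv_of_real)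
    also have "\<dots> = of_real (1 / v) * (CLINT x|M. of_real (V x) * iexp (t * X x))"
      by (rule integral_mult_right_zero)
    also have "\<dots> = (CLINT x|M. iexp (t * X x))"
      unfolding fact using v by (simp add: v_def)
    also have "\<dots> = char (distr M borel X) t"
      by (simp add: char_def integral_distr)
    finally show "char (distr N borel X) t = char (distr M borel X) t" .
  qed
  from Levy_uniqueness[OF rd1 rd2 this]
  have "measure (distr N borel X) C = measure (distr M borel X) C" by simp
  then have "measure N (X -` C \<inter> space M) = prob (X -` C \<inter> space M)"
    by (simp add: measure_distr) (simp add: N_def)
  moreover have "measure N (X -` C \<inter> space M) = (LINT x|M. V x * indicator C (X x)) / v"
  proof -
    have "measure N (X -` C \<inter> space M) = (LINT x|N. indicator (X -` C \<inter> space M) x)"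
      by (simp add: N_def)
    also have "\<dots> = (LINT x|M. (V x / v) *\<^sub>R indicator (X -` C \<inter> space M) x)"
      unfolding N_def using v V0 by (subst integral_density) auto
    also have "\<dots> = (LINT x|M. (V x * indicator C (X x)) / v)"
      by (intro Bochner_Integration.integral_cong refl) (simp add: indicator_def)
    finally show ?thesis by simp
  qed
  ultimately show ?thesis using v by (simp add: v_def field_simps)
qed

text \<open>\<open>Re V + c\<close> is nonnegative, which leads back to the previous case. The
  hypothesis at \<open>- t\<close>, conjugated, is the factorisation for \<open>cnj V\<close>, and
  the mean of \<open>V\<close> and \<open>cnj V\<close> is the real part.\<close>

lemma char_factor_indicator_Re:
  fixes X :: "'a \<Rightarrow> real" and V :: "'a \<Rightarrow> complex"
  assumes X[measurable]: "X \<in> borel_measurable M" and V[measurable]: "V \<in> borel_measurable M"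
    and Vc: "\<And>x. cmod (V x) \<le> c"
    and fact: "\<And>t. (CLINT x|M. V x * iexp (t * X x)) =
      (CLINT x|M. V x) * (CLINT x|M. iexp (t * X x))"
    and C[measurable]: "C \<in> sets borel"
  shows "expectation (\<lambda>x. Re (V x) * indicator C (X x)) =
    expectation (\<lambda>x. Re (V x)) * prob (X -` C \<inter> space M)"
proof -
  have Re_bound: "\<bar>Re (V x)\<bar> \<le> c" for x using abs_Re_le_cmod[of "V x"] Vc[of x] by linarith
  have intV: "integrable M V" using Vc by (intro integrable_const_bound[where B=c]) auto
  have cV[measurable]: "(\<lambda>x. cnj (V x)) \<in> borel_measurable M"
    by (rule borel_measurable_continuous_onI[THEN measurable_compose[rotated]])
       (auto intro!: continuous_intros)
  have intVe: "integrable M (\<lambda>x. V x * iexp (t * X x))" for t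
    using Vc by (intro integrable_const_bound[where B=c]) (auto simp: norm_mult)
  have intcVe: "integrable M (\<lambda>x. cnj (V x) * iexp (t * X x))" for t
    using Vc by (intro integrable_const_bound[where B=c]) (auto simp: norm_mult)
  have inte: "integrable M (\<lambda>x. iexp (t * X x))" for t
    by (intro integrable_const_bound[where B=1]) auto
  have intR: "integrable M (\<lambda>x. Re (V x))" using Re_bound by (intro integrable_const_bound[where B=c]) auto
  have cnjV: "(CLINT x|M. cnj (V x) * iexp (t * X x)) = cnj (CLINT x|M. V x) * (CLINT x|M. iexp (t * X x))" for t
  proof -
    have "(CLINT x|M. cnj (V x) * iexp (t * X x)) = (CLINT x|M. cnj (V x * iexp (- t * X x)))"
      by (intro Bochner_Integration.integral_cong refl) (simp add: exp_cnj)
    also have "\<dots> = cnj (CLINT x|M. V x * iexp (- t * X x))"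
      by (rule Bochner_Integration.integral_cnj)
    also have "\<dots> = cnj (CLINT x|M. V x) * cnj (CLINT x|M. iexp (- t * X x))"
      by (simp only: fact complex_cnj_mult)
    also have "cnj (CLINT x|M. iexp (- t * X x)) = (CLINT x|M. cnj (iexp (- t * X x)))"
      by (rule Bochner_Integration.integral_cnj[symmetric])
    also have "\<dots> = (CLINT x|M. iexp (t * X x))"
      by (intro Bochner_Integration.integral_cong refl) (simp add: exp_cnj)
    finally show ?thesis .
  qed
  define W where "W x = Re (V x) + c" for x
  have W: "(CLINT x|M. of_real (W x) * iexp (t * X x)) =
      of_real (expectation W) * (CLINT x|M. iexp (t * X x))" for t
  proof -
    have "(CLINT x|M. of_real (W x) * iexp (t * X x)) =
      (CLINT x|M. (1/2) * (V x * iexp (t * X x)) + (1/2) * (cnj (V x) * iexp (t * X x)) + of_real c * iexp (t * X x))"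
    proof (intro Bochner_Integration.integral_cong refl)
      fix x
      have "complex_of_real (Re (V x)) = (1/2) * V x + (1/2) * cnj (V x)"
        by (simp add: complex_eq_iff)
      then show "of_real (W x) * iexp (t * X x) = (1/2) * (V x * iexp (t * X x)) +
          (1/2) * (cnj (V x) * iexp (t * X x)) + of_real c * iexp (t * X x)"
        unfolding W_def by (simp add: algebra_simps)
    qed
    also have "\<dots> = (1/2) * (CLINT x|M. V x * iexp (t * X x)) + (1/2) * (CLINT x|M. cnj (V x) * iexp (t * X x))
        + of_real c * (CLINT x|M. iexp (t * X x))"
      using intVe[of t] intcVe[of t] inte[of t] by simp
    also have "\<dots> = ((1/2) * (CLINT x|M. V x) + (1/2) * cnj (CLINT x|M. V x) + of_real c) * (CLINT x|M. iexp (t * X x))"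
      unfolding fact cnjV by (simp add: algebra_simps)
    also have "(1/2) * (CLINT x|M. V x) + (1/2) * cnj (CLINT x|M. V x) + of_real c = of_real (expectation W)"
    proof -
      have "expectation W = Re (CLINT x|M. V x) + c"
        unfolding W_def using intR intV by (simp add: prob_space)
      then show ?thesis by (simp add: complex_eq_iff)
    qed
    finally show ?thesis .
  qed
  have ind: "integrable M (\<lambda>x. indicator C (X x) :: real)"
    by (intro integrable_const_bound[where B=1]) (auto simp: indicator_def)
  have indR: "integrable M (\<lambda>x. Re (V x) * indicator C (X x))"
    using Re_bound by (intro integrable_const_bound[where B=c]) (auto simp: indicator_def intro: order_trans[OF abs_ge_zero])
  have indE: "expectation (\<lambda>x. indicator C (X x) :: real) = prob (X -` C \<inter> space M)"
  proof -
    have "expectation (\<lambda>x. indicator C (X x) :: real) = expectation (indicator (X -` C \<inter> space M))"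
      by (intro Bochner_Integration.integral_cong refl) (simp add: indicator_def)
    then show ?thesis by simp
  qed
  have "expectation (\<lambda>x. W x * indicator C (X x)) = expectation W * prob (X -` C \<inter> space M)"
  proof (rule char_factor_indicator_nonneg[OF X _ _ _ W C, of "2 * c"])
    show "W \<in> borel_measurable M" unfolding W_def by simp
    show "0 \<le> W x" for x using Re_bound[of x] by (simp add: W_def)
    show "W x \<le> 2 * c" for x using Re_bound[of x] by (simp add: W_def)
  qed
  moreover have "expectation (\<lambda>x. W x * indicator C (X x)) =
     expectation (\<lambda>x. Re (V x) * indicator C (X x)) + c * prob (X -` C \<inter> space M)"
    unfolding W_def distrib_right using ind indR indE by simp
  moreover have "expectation W = expectation (\<lambda>x. Re (V x)) + c"
    unfolding W_def using intR by (simp add: prob_space)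
  ultimately show ?thesis by (simp add: algebra_simps)
qed

text \<open>\<open>Im V\<close> is the real part of \<open>- \<i> * V\<close>, so the real case
  applies twice. The point is to trade an exponential of \<open>X\<close> for an indicator of
  \<open>X\<close>; a complex \<open>V\<close> may still carry exponentials of other
  variables.\<close>

lemma char_factor_indicator:
  fixes X :: "'a \<Rightarrow> real" and V :: "'a \<Rightarrow> complex"
  assumes X[measurable]: "X \<in> borel_measurable M" and V[measurable]: "V \<in> borel_measurable M"
    and Vc: "\<And>x. cmod (V x) \<le> c"
    and fact: "\<And>t. (CLINT x|M. V x * iexp (t * X x)) =
      (CLINT x|M. V x) * (CLINT x|M. iexp (t * X x))"
    and C[measurable]: "C \<in> sets borel"
  shows "(CLINT x|M. V x * indicator C (X x)) = (CLINT x|M. V x) * prob (X -` C \<inter> space M)"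
proof -
  have intV: "integrable M V" using Vc by (intro integrable_const_bound[where B=c]) auto
  have intC: "integrable M (\<lambda>x. V x * indicator C (X x))"
    using Vc by (intro integrable_const_bound[where B=c])
      (auto simp: indicator_def intro: order_trans[OF norm_ge_zero])
  have "expectation (\<lambda>x. Re (V x) * indicator C (X x)) =
    expectation (\<lambda>x. Re (V x)) * prob (X -` C \<inter> space M)"
    by (rule char_factor_indicator_Re[OF X V Vc fact C])
  moreover have "expectation (\<lambda>x. Re (- \<i> * V x) * indicator C (X x)) =
    expectation (\<lambda>x. Re (- \<i> * V x)) * prob (X -` C \<inter> space M)"
  proof (rule char_factor_indicator_Re[OF X _ _ _ C])
    show "cmod (- \<i> * V x) \<le> c" for x using Vc[of x] by (simp add: norm_mult)
    show "(CLINT x|M. - \<i> * V x * iexp (t * X x)) =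
      (CLINT x|M. - \<i> * V x) * (CLINT x|M. iexp (t * X x))" for t
      using fact[of t] by (simp add: mult.assoc)
  qed simp
  moreover have "Re (V x * indicator C (X x)) = Re (V x) * indicator C (X x)"
    "Im (V x * indicator C (X x)) = Re (- \<i> * V x) * indicator C (X x)" for x
    by (auto simp: indicator_def)
  ultimately show ?thesis
    using integral_Re[OF intC] integral_Im[OF intC] integral_Re[OF intV] integral_Im[OF intV]
    by (simp add: complex_eq_iff)
qed

text \<open>Independence makes the law of the pair \<open>(x, X x)\<close> a product measure, so
  Fubini's theorem integrates out \<open>X\<close> with the \<open>G\<close>-variable held fixed. No
  regular conditional distribution has to be constructed.\<close>

lemma freezing:
  fixes X :: "'a \<Rightarrow> real" and \<Phi> :: "'a \<times> real \<Rightarrow> real"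
  assumes G: "subalgebra M G" and X: "distributed M lborel X (\<lambda>y. ennreal (p y))" and p: "\<And>y. 0 \<le> p y"
    and p_meas[measurable]: "p \<in> borel_measurable borel"
    and indep: "indep_set (sets G) {X -` A \<inter> space M |A. A \<in> sets borel}"
    and \<Phi>[measurable]: "\<Phi> \<in> borel_measurable (G \<Otimes>\<^sub>M borel)" and bound: "\<And>z. \<bar>\<Phi> z\<bar> \<le> c"
  shows "expectation (\<lambda>x. \<Phi> (x, X x)) = expectation (\<lambda>x. \<integral>y. p y * \<Phi> (x, y) \<partial>lborel)"
proof -
  have Xm[measurable]: "X \<in> borel_measurable M" using distributed_measurable[OF X] by simp
  have idm[measurable]: "(\<lambda>x. x) \<in> measurable M G" by (rule measurable_from_subalg[OF G]) simp
  have spG: "space G = space M" using G by (simp add: subalgebra_def)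
  interpret G: prob_space "distr M G (\<lambda>x. x)" by (rule prob_space_distr) simp
  interpret X: prob_space "distr M borel X" by (rule prob_space_distr) simp
  interpret GX: pair_prob_space "distr M G (\<lambda>x. x)" "distr M borel X" ..
  have D: "distr M G (\<lambda>x. x) \<Otimes>\<^sub>M distr M borel X = distr M (G \<Otimes>\<^sub>M borel) (\<lambda>x. (x, X x))"
  proof (rule pair_measure_eqI)
    fix A B assume A: "A \<in> sets (distr M G (\<lambda>x. x))" and B: "B \<in> sets (distr M borel X)"
    have [measurable]: "A \<in> sets G" "B \<in> sets borel" using A B by auto
    have [measurable]: "A \<in> events" using G \<open>A \<in> sets G\<close> by (auto simp: subalgebra_def)
    have sub: "A \<subseteq> space M" by (rule sets.sets_into_space) simp
    have "prob (A \<inter> (X -` B \<inter> space M)) = prob A * prob (X -` B \<inter> space M)"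
      by (rule indep_setD[OF indep]) auto
    moreover have "(\<lambda>x. (x, X x)) -` (A \<times> B) \<inter> space M = A \<inter> (X -` B \<inter> space M)"
      "(\<lambda>x. x) -` A \<inter> space M = A" using sub by auto
    ultimately show "emeasure (distr M G (\<lambda>x. x)) A * emeasure (distr M borel X) B =
        emeasure (distr M (G \<Otimes>\<^sub>M borel) (\<lambda>x. (x, X x))) (A \<times> B)"
      by (simp add: emeasure_distr emeasure_eq_measure ennreal_mult)
  qed (auto intro: G.sigma_finite_measure_axioms X.sigma_finite_measure_axioms)
  have "expectation (\<lambda>x. \<Phi> (x, X x)) = (\<integral>z. \<Phi> z \<partial>distr M (G \<Otimes>\<^sub>M borel) (\<lambda>x. (x, X x)))"
    by (subst integral_distr) auto
  also have "\<dots> = (\<integral>z. \<Phi> z \<partial>(distr M G (\<lambda>x. x) \<Otimes>\<^sub>M distr M borel X))" by (simp add: D)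
  also have "\<dots> = (\<integral>x. \<integral>y. \<Phi> (x, y) \<partial>distr M borel X \<partial>distr M G (\<lambda>x. x))"
    by (rule GX.integral_fst'[symmetric]) (use bound in \<open>auto intro!: GX.integrable_const_bound[where B=c]\<close>)
  also have "\<dots> = expectation (\<lambda>x. \<integral>y. \<Phi> (x, y) \<partial>distr M borel X)"
  proof (rule integral_distr)
    have "(\<lambda>x. \<integral>y. \<Phi> (x, y) \<partial>distr M borel X) \<in> borel_measurable (distr M G (\<lambda>x. x))"
      by (rule X.borel_measurable_lebesgue_integral) simp
    then show "(\<lambda>x. \<integral>y. \<Phi> (x, y) \<partial>distr M borel X) \<in> borel_measurable G" by simp
  qed simp
  also have "\<dots> = expectation (\<lambda>x. \<integral>y. p y * \<Phi> (x, y) \<partial>lborel)"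
  proof (rule Bochner_Integration.integral_cong[OF refl])
    fix x assume "x \<in> space M"
    then have [measurable]: "(\<lambda>y. \<Phi> (x, y)) \<in> borel_measurable borel"
      using spG by (intro measurable_compose[OF measurable_Pair1' \<Phi>]) simp
    have "(\<integral>y. \<Phi> (x, y) \<partial>distr M borel X) = expectation (\<lambda>w. \<Phi> (x, X w))"
      by (subst integral_distr) auto
    also have "\<dots> = (LINT y|lborel. p y * \<Phi> (x, y))"
      by (rule distributed_integral[OF X, symmetric]) (use p in auto)
    finally show "(\<integral>y. \<Phi> (x, y) \<partial>distr M borel X) = (LINT y|lborel. p y * \<Phi> (x, y))" .
  qed
  finally show ?thesis .
qed

end

section \<open>Total variation distance of normal densities\<close>

text \<open>\<open>\<bar>p - q\<bar>\<close> is twice the positive part of \<open>p - q\<close>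
  minus \<open>p - q\<close>, and the latter integrates to 0. For densities a one-sided pointwise
  bound thus controls the total variation.\<close>

lemma integral_abs_diff_le:
  fixes p q e :: "'a \<Rightarrow> real"
  assumes "integrable M p" "integrable M q" "integrable M e" "(LINT x|M. p x) = (LINT x|M. q x)"
    and "\<And>x. 0 \<le> e x" "\<And>x. p x - q x \<le> e x"
  shows "(LINT x|M. \<bar>p x - q x\<bar>) \<le> 2 * (LINT x|M. e x)"
proof -
  have "(LINT x|M. \<bar>p x - q x\<bar>) \<le> (LINT x|M. 2 * e x - (p x - q x))"
  proof (rule integral_mono)
    show "integrable M (\<lambda>x. \<bar>p x - q x\<bar>)" "integrable M (\<lambda>x. 2 * e x - (p x - q x))" using assms by auto
    fix x show "\<bar>p x - q x\<bar> \<le> 2 * e x - (p x - q x)" using assms(5,6)[of x] by linarith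
  qed
  also have "\<dots> = 2 * (LINT x|M. e x)" using assms by simp
  finally show ?thesis .
qed

text \<open>Widening the density increases the exponential factor; only the prefactor
  \<open>1 / \<sigma>\<close> is lost.\<close>

lemma normal_density_scale_ge:
  assumes "0 < \<sigma>'" "\<sigma>' \<le> \<sigma>"
  shows "\<sigma>' / \<sigma> * normal_density \<mu> \<sigma>' x \<le> normal_density \<mu> \<sigma> x"
proof -
  have s: "0 < \<sigma>" using assms by linarith
  have "\<sigma>'\<^sup>2 \<le> \<sigma>\<^sup>2" using assms by (intro power_mono) auto
  then have "(x - \<mu>)\<^sup>2 / (2 * \<sigma>\<^sup>2) \<le> (x - \<mu>)\<^sup>2 / (2 * \<sigma>'\<^sup>2)"
    using assms s by (intro divide_left_mono) auto
  then have "exp (- (x - \<mu>)\<^sup>2 / (2 * \<sigma>'\<^sup>2)) \<le> exp (- (x - \<mu>)\<^sup>2 / (2 * \<sigma>\<^sup>2))" by simp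
  then have "1 / (sqrt (2 * pi) * \<sigma>) * exp (- (x - \<mu>)\<^sup>2 / (2 * \<sigma>'\<^sup>2)) \<le>
    1 / (sqrt (2 * pi) * \<sigma>) * exp (- (x - \<mu>)\<^sup>2 / (2 * \<sigma>\<^sup>2))"
    using s by (intro mult_left_mono) auto
  moreover have "\<sigma>' / \<sigma> * (1 / (sqrt (2 * pi) * \<sigma>')) = 1 / (sqrt (2 * pi) * \<sigma>)"
    using assms s by (simp add: field_simps)
  ultimately show ?thesis
    using assms s unfolding normal_density_def by (simp add: real_sqrt_mult mult_ac)
qed

lemma normal_density_diff_scale:
  assumes "0 < \<sigma>" "0 < \<sigma>'"
  shows "(LINT x|lborel. \<bar>normal_density \<mu> \<sigma> x - normal_density \<mu> \<sigma>' x\<bar>) \<le> 2 * \<bar>\<sigma>\<^sup>2 - \<sigma>'\<^sup>2\<bar> / \<sigma>'\<^sup>2"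
proof -
  have base: "(LINT x|lborel. \<bar>normal_density \<mu> t x - normal_density \<mu> s x\<bar>) \<le> 2 * ((s\<^sup>2 - t\<^sup>2) / s\<^sup>2)"
    if "0 < t" "t \<le> s" for s t :: real
  proof -
    have ts: "t / s \<le> 1" "0 \<le> t / s" using that by auto
    have "(LINT x|lborel. \<bar>normal_density \<mu> t x - normal_density \<mu> s x\<bar>) \<le>
        2 * (LINT x|lborel. (1 - t / s) * normal_density \<mu> t x)"
    proof (rule integral_abs_diff_le)
      fix x
      show "normal_density \<mu> t x - normal_density \<mu> s x \<le> (1 - t / s) * normal_density \<mu> t x"
        using normal_density_scale_ge[OF that, of \<mu> x] by (simp add: algebra_simps)
      show "0 \<le> (1 - t / s) * normal_density \<mu> t x" using that by simp
    qed (use that in auto)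
    also have "\<dots> = 2 * (1 - t / s)" using that by simp
    \<comment> \<open>Passing to squares loses at most a factor 2 and expresses the bound through
      variances, the quantities known for the conditional laws.\<close>
    also have "\<dots> \<le> 2 * (1 - (t / s)\<^sup>2)"
      using mult_left_le[OF ts] by (simp add: power2_eq_square)
    also have "1 - (t / s)\<^sup>2 = (s\<^sup>2 - t\<^sup>2) / s\<^sup>2" using that by (simp add: field_simps)
    finally show ?thesis .
  qed
  show ?thesis
  proof (cases "\<sigma> \<le> \<sigma>'")
    case True
    then have "\<sigma>\<^sup>2 \<le> \<sigma>'\<^sup>2" using assms by (intro power_mono) auto
    then show ?thesis using base[OF assms(1) True] by simp
  next
    case False
    then have "\<sigma>'\<^sup>2 \<le> \<sigma>\<^sup>2" using assms by (intro power_mono) auto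
    have "(LINT x|lborel. \<bar>normal_density \<mu> \<sigma> x - normal_density \<mu> \<sigma>' x\<bar>) \<le> 2 * ((\<sigma>\<^sup>2 - \<sigma>'\<^sup>2) / \<sigma>\<^sup>2)"
      using base[of \<sigma>' \<sigma>] False assms by (simp add: abs_minus_commute)
    also have "(\<sigma>\<^sup>2 - \<sigma>'\<^sup>2) / \<sigma>\<^sup>2 \<le> (\<sigma>\<^sup>2 - \<sigma>'\<^sup>2) / \<sigma>'\<^sup>2"
      using \<open>\<sigma>'\<^sup>2 \<le> \<sigma>\<^sup>2\<close> assms by (intro divide_left_mono) auto
    finally show ?thesis using \<open>\<sigma>'\<^sup>2 \<le> \<sigma>\<^sup>2\<close> by simp
  qed
qed

text \<open>The ratio of the two densities is \<open>exp z\<close>, and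
  \<open>exp z \<ge> 1 + z\<close> bounds \<open>p - q\<close> from above by a first absolute
  moment. For a shift of at most \<open>\<sigma>\<close> this yields
  \<open>2 * (1/2 + 1) = 3\<close>; for a larger one the trivial bound 2 is enough.\<close>

lemma normal_density_diff_shift:
  assumes s: "0 < \<sigma>"
  shows "(LINT x|lborel. \<bar>normal_density \<mu> \<sigma> x - normal_density \<nu> \<sigma> x\<bar>) \<le> 3 * (\<bar>\<mu> - \<nu>\<bar> / \<sigma>)"
proof -
  let ?p = "normal_density \<nu> \<sigma>" and ?q = "normal_density \<mu> \<sigma>"
  define d where "d = \<mu> - \<nu>"
  have abs_moment: "has_bochner_integral lborel (\<lambda>x. ?p x * \<bar>x - \<nu>\<bar>) (\<sigma> * sqrt (2 / pi))"
    using normal_moment_abs_odd[OF s, of \<nu> 0] by simp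
  have "sqrt (2 / pi) \<le> 1" using pi_ge_two by simp
  define e where "e x = (d\<^sup>2 / (2 * \<sigma>\<^sup>2)) * ?p x + (\<bar>d\<bar> / \<sigma>\<^sup>2) * (?p x * \<bar>x - \<nu>\<bar>)" for x
  have int_e: "integrable lborel e" unfolding e_def
    using s integrable.intros[OF abs_moment] by auto
  have e0: "0 \<le> e x" for x unfolding e_def by (auto intro!: add_nonneg_nonneg mult_nonneg_nonneg)
  have pq: "?p x - ?q x \<le> e x" for x
  proof -
    define z where "z = ((x - \<nu>) * d - d\<^sup>2 / 2) / \<sigma>\<^sup>2"
    have "- (x - \<mu>)\<^sup>2 / (2 * \<sigma>\<^sup>2) = - (x - \<nu>)\<^sup>2 / (2 * \<sigma>\<^sup>2) + z"
      using s unfolding z_def d_def by (simp add: field_simps power2_eq_square)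
    then have q: "?q x = ?p x * exp z"
      unfolding normal_density_def by (simp only: exp_add mult.assoc)
    have "?p x * (1 + z) \<le> ?p x * exp z" by (intro mult_left_mono exp_ge_add_one_self) simp
    then have "?p x - ?q x \<le> ?p x * (- z)" unfolding q by (simp add: algebra_simps)
    also have "\<dots> \<le> ?p x * (d\<^sup>2 / (2 * \<sigma>\<^sup>2) + (\<bar>d\<bar> / \<sigma>\<^sup>2) * \<bar>x - \<nu>\<bar>)"
    proof (intro mult_left_mono)
      have "- ((x - \<nu>) * d) \<le> \<bar>d\<bar> * \<bar>x - \<nu>\<bar>"
        by (metis abs_ge_minus_self abs_mult mult.commute)
      then have "(- ((x - \<nu>) * d) + d\<^sup>2 / 2) / \<sigma>\<^sup>2 \<le> (\<bar>d\<bar> * \<bar>x - \<nu>\<bar> + d\<^sup>2 / 2) / \<sigma>\<^sup>2"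
        using s by (intro divide_right_mono) auto
      then show "- z \<le> d\<^sup>2 / (2 * \<sigma>\<^sup>2) + (\<bar>d\<bar> / \<sigma>\<^sup>2) * \<bar>x - \<nu>\<bar>"
        using s unfolding z_def by (simp add: field_simps)
    qed simp
    also have "\<dots> = e x" unfolding e_def by (simp add: algebra_simps)
    finally show ?thesis .
  qed
  have le: "(LINT x|lborel. \<bar>?p x - ?q x\<bar>) \<le> 2 * (LINT x|lborel. e x)"
    by (rule integral_abs_diff_le) (use s int_e e0 pq in auto)
  have int_e_eq: "(LINT x|lborel. e x) = d\<^sup>2 / (2 * \<sigma>\<^sup>2) + (\<bar>d\<bar> / \<sigma>\<^sup>2) * (\<sigma> * sqrt (2 / pi))"
    unfolding e_def using s integrable.intros[OF abs_moment] has_bochner_integral_integral_eq[OF abs_moment]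
    by simp
  show ?thesis
  proof (cases "\<bar>d\<bar> \<le> \<sigma>")
    case True
    have "d\<^sup>2 / (2 * \<sigma>\<^sup>2) \<le> \<bar>d\<bar> / (2 * \<sigma>)"
    proof -
      have "d\<^sup>2 / (2 * \<sigma>\<^sup>2) = \<bar>d\<bar> / (2 * \<sigma>) * (\<bar>d\<bar> / \<sigma>)" using s by (simp add: power2_eq_square)
      also have "\<dots> \<le> \<bar>d\<bar> / (2 * \<sigma>) * 1" using True s by (intro mult_left_mono) auto
      finally show ?thesis by simp
    qed
    moreover have "(\<bar>d\<bar> / \<sigma>\<^sup>2) * (\<sigma> * sqrt (2 / pi)) \<le> \<bar>d\<bar> / \<sigma>"
    proof -
      have "(\<bar>d\<bar> / \<sigma>\<^sup>2) * (\<sigma> * sqrt (2 / pi)) = \<bar>d\<bar> / \<sigma> * sqrt (2 / pi)" using s by (simp add: power2_eq_square)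
      also have "\<dots> \<le> \<bar>d\<bar> / \<sigma> * 1" using \<open>sqrt (2 / pi) \<le> 1\<close> s by (intro mult_left_mono) auto
      finally show ?thesis by simp
    qed
    ultimately have "2 * (LINT x|lborel. e x) \<le> 2 * (\<bar>d\<bar> / (2 * \<sigma>) + \<bar>d\<bar> / \<sigma>)" unfolding int_e_eq by (intro mult_left_mono add_mono) auto
    also have "\<dots> = 3 * (\<bar>d\<bar> / \<sigma>)" by simp
    finally show ?thesis using le by (simp add: d_def abs_minus_commute)
  next
    case False
    have "(LINT x|lborel. \<bar>?p x - ?q x\<bar>) \<le> (LINT x|lborel. ?p x + ?q x)"
      by (rule integral_mono) (use s in \<open>auto intro: order_trans[OF abs_triangle_ineq4]\<close>)
    also have "\<dots> = 2" using s by simp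
    also have "2 \<le> 3 * (\<bar>d\<bar> / \<sigma>)" using False s by (simp add: field_simps)
    finally show ?thesis by (simp add: d_def abs_minus_commute)
  qed
qed

lemma normal_density_diff_integrable:
  assumes "0 < \<sigma>" "0 < \<sigma>'"
  shows "integrable lborel (\<lambda>x. \<bar>normal_density \<mu> \<sigma> x - normal_density \<nu> \<sigma>' x\<bar>)"
  using assms by auto

text \<open>The intermediate density has the mean of the first and the deviation of the second, so
  that only \<open>\<sigma>'\<close> occurs in a denominator. In the application
  \<open>\<sigma>'\<close> belongs to the left end of a cell and is the same for all times in the
  cell.\<close>

lemma normal_density_diff:
  assumes "0 < \<sigma>" "0 < \<sigma>'"
  shows "(LINT x|lborel. \<bar>normal_density \<mu> \<sigma> x - normal_density \<nu> \<sigma>' x\<bar>) \<le>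
    3 * (\<bar>\<mu> - \<nu>\<bar> / \<sigma>') + 2 * \<bar>\<sigma>\<^sup>2 - \<sigma>'\<^sup>2\<bar> / \<sigma>'\<^sup>2"
proof -
  have "(LINT x|lborel. \<bar>normal_density \<mu> \<sigma> x - normal_density \<nu> \<sigma>' x\<bar>) \<le>
    (LINT x|lborel. \<bar>normal_density \<mu> \<sigma> x - normal_density \<mu> \<sigma>' x\<bar> + \<bar>normal_density \<mu> \<sigma>' x - normal_density \<nu> \<sigma>' x\<bar>)"
    using assms by (intro integral_mono) auto
  also have "\<dots> = (LINT x|lborel. \<bar>normal_density \<mu> \<sigma> x - normal_density \<mu> \<sigma>' x\<bar>)
     + (LINT x|lborel. \<bar>normal_density \<mu> \<sigma>' x - normal_density \<nu> \<sigma>' x\<bar>)"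
    using assms by (intro Bochner_Integration.integral_add) auto
  finally show ?thesis
    using normal_density_diff_scale[OF assms, of \<mu>] normal_density_diff_shift[OF assms(2), of \<mu> \<nu>] by linarith
qed

section \<open>Even moments and martingale differences\<close>

text \<open>Young's inequality with conjugate exponents \<open>p / (p - 1)\<close> and
  \<open>p\<close>. The weights on the right add up to 1, so two moments normalised to 1 bound the
  mixed moment by 1; this takes the place of Hoelder's inequality.\<close>

lemma young_power:
  fixes x y :: real
  assumes "0 \<le> x" "0 \<le> y" "1 \<le> p"
  shows "x ^ (p - 1) * y \<le> (1 - 1 / real p) * x ^ p + y ^ p / real p"
proof (cases "p = 1 \<or> x = 0")
  case True
  show ?thesis
  proof (cases "p = 1")
    case False
    then show ?thesis using True assms by (auto simp: power_0_left)
  qed (use assms in auto)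
next
  case False
  then have p: "1 < p" and x: "0 < x" using assms by auto
  define r where "r = real p / (real p - 1)"
  have r: "r > 1" "1 / r + 1 / real p = 1" using p by (auto simp: r_def field_simps)
  have "x ^ (p - 1) * y \<le> (x ^ (p - 1)) powr r / r + y powr real p / real p"
    using r p assms by (intro Youngs_inequality) auto
  also have "(x ^ (p - 1)) powr r = x ^ p"
  proof -
    have "(x ^ (p - 1)) powr r = x powr (real (p - 1) * r)"
      using x by (simp add: powr_powr flip: powr_realpow)
    also have "real (p - 1) * r = real p" using p by (simp add: r_def of_nat_diff)
    finally show ?thesis using x by (simp add: powr_realpow)
  qed
  also have "y powr real p = y ^ p" using assms p by (cases "y = 0") (auto simp: powr_realpow)
  also have "x ^ p / r = (1 - 1 / real p) * x ^ p" using p by (simp add: r_def field_simps)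
  finally show ?thesis .
qed

section \<open>Bounds for even moments\<close>

context prob_space
begin

text \<open>This is a bound of the norm in \<open>L^(2p)\<close>. Even integer exponents admit the
  binomial expansion behind the martingale estimate; the real exponent \<open>m\<close> is reached
  only at the end, by comparison of norms.\<close>

definition moment_le :: "nat \<Rightarrow> ('a \<Rightarrow> real) \<Rightarrow> real \<Rightarrow> bool" where
  "moment_le p X a \<longleftrightarrow> X \<in> borel_measurable M \<and> integrable M (\<lambda>x. X x ^ (2 * p)) \<and>
     0 \<le> a \<and> expectation (\<lambda>x. X x ^ (2 * p)) \<le> a ^ (2 * p)"

lemma moment_leD:
  assumes "moment_le p X a"
  shows "X \<in> borel_measurable M" "integrable M (\<lambda>x. X x ^ (2 * p))" "0 \<le> a"
    "expectation (\<lambda>x. X x ^ (2 * p)) \<le> a ^ (2 * p)"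
  using assms by (auto simp: moment_le_def)

lemma moment_le_mono: "moment_le p X a \<Longrightarrow> a \<le> b \<Longrightarrow> moment_le p X b"
  by (auto simp: moment_le_def intro: order_trans power_mono)

lemma moment_le_cong_AE:
  assumes X: "moment_le p X a" and Y[measurable]: "Y \<in> borel_measurable M" and eq: "AE x in M. X x = Y x"
  shows "moment_le p Y a"
proof -
  note [measurable] = moment_leD(1)[OF X]
  have ae: "AE x in M. X x ^ (2 * p) = Y x ^ (2 * p)" using eq by eventually_elim simp
  have "integrable M (\<lambda>x. Y x ^ (2 * p))"
    by (rule integrable_cong_AE_imp[OF moment_leD(2)[OF X] _ ae]) simp
  moreover have "expectation (\<lambda>x. X x ^ (2 * p)) = expectation (\<lambda>x. Y x ^ (2 * p))"
    by (rule integral_cong_AE[OF _ _ ae]) auto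
  ultimately show ?thesis using moment_leD[OF X] Y by (simp add: moment_le_def)
qed

lemma AE_bounded_integrable:
  fixes f :: "'a \<Rightarrow> real"
  assumes "f \<in> borel_measurable M" "AE x in M. \<bar>f x\<bar> \<le> c"
  shows "integrable M f"
  using assms by (intro integrable_const_bound[where B=c]) auto

lemma moment_le_bounded:
  assumes [measurable]: "X \<in> borel_measurable M" and ae: "AE x in M. \<bar>X x\<bar> \<le> c" and "0 \<le> c"
  shows "moment_le p X c"
proof -
  have ae': "AE x in M. X x ^ (2 * p) \<le> c ^ (2 * p)"
    using ae by eventually_elim (metis abs_ge_zero power_even_abs power_mono even_mult_iff even_numeral)
  have int: "integrable M (\<lambda>x. X x ^ (2 * p))"
  proof (rule AE_bounded_integrable[where c="c ^ (2 * p)"])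
    show "AE x in M. \<bar>X x ^ (2 * p)\<bar> \<le> c ^ (2 * p)"
      using ae' by eventually_elim (simp add: power_mult)
  qed simp
  have "expectation (\<lambda>x. X x ^ (2 * p)) \<le> expectation (\<lambda>x. c ^ (2 * p))"
    by (rule integral_mono_AE[OF int _ ae']) simp
  then show ?thesis using assms int by (simp add: moment_le_def prob_space)
qed

lemma moment_le_zero: "moment_le p (\<lambda>x. 0) 0"
  by (rule moment_le_bounded) auto

lemma moment_le_0_AE:
  assumes X: "moment_le p X 0" and p: "1 \<le> p"
  shows "AE x in M. X x = 0"
proof -
  have "expectation (\<lambda>x. X x ^ (2 * p)) = 0"
    using moment_leD(4)[OF X] p by (intro antisym) (auto simp: power_mult power_0_left)
  then have "AE x in M. X x ^ (2 * p) = 0"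
    using integral_nonneg_eq_0_iff_AE[OF moment_leD(2)[OF X]] by (simp add: power_mult)
  then show ?thesis by eventually_elim (use p in auto)
qed

lemma convex_even_power:
  fixes x y t :: real
  assumes "0 \<le> t" "t \<le> 1"
  shows "((1 - t) * x + t * y) ^ (2 * p) \<le> (1 - t) * x ^ (2 * p) + t * y ^ (2 * p)"
proof -
  have "convex_on UNIV (\<lambda>x::real. x ^ (2 * p))" by (rule convex_power_even) simp
  from convex_onD[OF this assms, of x y] show ?thesis by simp
qed

text \<open>Minkowski's inequality: \<open>X + Y\<close> is \<open>a + b\<close> times the convex
  combination of \<open>X / a\<close> and \<open>Y / b\<close> with weights
  \<open>a / (a + b)\<close> and \<open>b / (a + b)\<close>, and even powers are convex. If
  \<open>a\<close> or \<open>b\<close> is 0, that variable vanishes almost surely.\<close>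

lemma moment_le_add:
  assumes X: "moment_le p X a" and Y: "moment_le p Y b" and p: "1 \<le> p"
  shows "moment_le p (\<lambda>x. X x + Y x) (a + b)"
proof (cases "a = 0 \<or> b = 0")
  case True
  note [measurable] = moment_leD(1)[OF X] moment_leD(1)[OF Y]
  from True show ?thesis
  proof
    assume "a = 0"
    with moment_le_0_AE X p have "AE x in M. X x = 0" by simp
    then have "AE x in M. Y x = X x + Y x" by eventually_elim simp
    from moment_le_cong_AE[OF Y _ this] show ?thesis using \<open>a = 0\<close> by simp
  next
    assume "b = 0"
    with moment_le_0_AE Y p have "AE x in M. Y x = 0" by simp
    then have "AE x in M. X x = X x + Y x" by eventually_elim simp
    from moment_le_cong_AE[OF X _ this] show ?thesis using \<open>b = 0\<close> by simp
  qed
next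
  case False
  then have ab: "0 < a" "0 < b" using moment_leD(3)[OF X] moment_leD(3)[OF Y] by auto
  note [measurable] = moment_leD(1)[OF X] moment_leD(1)[OF Y]
  define t where "t = b / (a + b)"
  have t: "0 \<le> t" "t \<le> 1" "1 - t = a / (a + b)" using ab by (auto simp: t_def field_simps)
  define U where "U x = (a + b) ^ (2 * p) * ((1 - t) * (X x ^ (2 * p) / a ^ (2 * p)) + t * (Y x ^ (2 * p) / b ^ (2 * p)))" for x
  have le: "(X x + Y x) ^ (2 * p) \<le> U x" for x
  proof -
    have "X x + Y x = (a + b) * ((1 - t) * (X x / a) + t * (Y x / b))"
    proof -
      have "a + b \<noteq> 0" using ab by simp
      then show ?thesis using ab unfolding t(3) unfolding t_def by (simp add: distrib_left)
    qed
    then have "(X x + Y x) ^ (2 * p) = (a + b) ^ (2 * p) * ((1 - t) * (X x / a) + t * (Y x / b)) ^ (2 * p)"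
      by (simp only: power_mult_distrib)
    also have "\<dots> \<le> (a + b) ^ (2 * p) * ((1 - t) * (X x / a) ^ (2 * p) + t * (Y x / b) ^ (2 * p))"
      using ab t by (intro mult_left_mono convex_even_power) auto
    finally show ?thesis by (simp add: U_def power_divide)
  qed
  have intU: "integrable M U" unfolding U_def using moment_leD(2)[OF X] moment_leD(2)[OF Y] by auto
  have int: "integrable M (\<lambda>x. (X x + Y x) ^ (2 * p))"
    by (rule Bochner_Integration.integrable_bound[OF intU])
       (use le in \<open>auto simp: power_mult intro!: order_trans[OF _ abs_ge_self]\<close>)
  have "expectation (\<lambda>x. (X x + Y x) ^ (2 * p)) \<le> expectation U"
    by (intro integral_mono int intU le)
  also have "\<dots> = (a + b) ^ (2 * p) * ((1 - t) * (expectation (\<lambda>x. X x ^ (2 * p)) / a ^ (2 * p)) +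
      t * (expectation (\<lambda>x. Y x ^ (2 * p)) / b ^ (2 * p)))"
    unfolding U_def using moment_leD(2)[OF X] moment_leD(2)[OF Y] by simp
  also have "\<dots> \<le> (a + b) ^ (2 * p) * ((1 - t) * 1 + t * 1)"
    using moment_leD(4)[OF X] moment_leD(4)[OF Y] ab t
    by (intro mult_left_mono add_mono) auto
  finally show ?thesis using ab int by (simp add: moment_le_def)
qed

lemma moment_le_cmult:
  assumes X: "moment_le p X a"
  shows "moment_le p (\<lambda>x. c * X x) (\<bar>c\<bar> * a)"
proof -
  have "c ^ (2 * p) * expectation (\<lambda>x. X x ^ (2 * p)) \<le> c ^ (2 * p) * a ^ (2 * p)"
    using moment_leD[OF X] by (intro mult_left_mono) (auto simp: power_mult)
  then show ?thesis using moment_leD[OF X]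
    by (auto simp: moment_le_def power_mult_distrib power_even_abs)
qed

lemma moment_le_diff:
  assumes "moment_le p X a" "moment_le p Y b" "1 \<le> p"
  shows "moment_le p (\<lambda>x. X x - Y x) (a + b)"
  using moment_le_add[OF assms(1) moment_le_cmult[OF assms(2), of "-1"] assms(3)] by simp

lemma moment_le_sum:
  assumes "\<And>i. i \<in> I \<Longrightarrow> moment_le p (X i) (a i)" "1 \<le> p"
  shows "moment_le p (\<lambda>x. \<Sum>i\<in>I. X i x) (\<Sum>i\<in>I. a i)"
  using assms(1)
  by (induction I rule: infinite_finite_induct) (auto intro: moment_le_add moment_le_zero assms(2))

end

text \<open>Every binomial term of degree at least 2 in \<open>y\<close> is dominated by
  \<open>x ^ (2 * p - 2) * y\<^sup>2\<close> or by \<open>y ^ (2 * p)\<close>, depending on which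
  variable is larger, and the binomial coefficients add up to \<open>4 ^ p\<close>. The linear term
  is kept exactly because its expectation will vanish.\<close>

lemma power_sum_expansion_le:
  fixes x y :: real
  assumes p: "1 \<le> p"
  shows "(x + y) ^ (2 * p) \<le> x ^ (2 * p) + 2 * real p * x ^ (2 * p - 1) * y
    + 4 ^ p * (x ^ (2 * p - 2) * y\<^sup>2 + y ^ (2 * p))"
proof -
  define n where "n = 2 * p"
  have n: "2 \<le> n" "even n" "even (n - 2)" using p by (auto simp: n_def)
  define B where "B = x ^ (n - 2) * y\<^sup>2 + y ^ n"
  have B0: "0 \<le> B" using n by (auto simp: B_def zero_le_even_power intro!: add_nonneg_nonneg mult_nonneg_nonneg)
  have term_le: "y ^ k * x ^ (n - k) \<le> B" if "k \<in> {2..n}" for k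
  proof -
    have k: "2 \<le> k" "k \<le> n" using that by auto
    have "y ^ k * x ^ (n - k) \<le> \<bar>y\<bar> ^ k * \<bar>x\<bar> ^ (n - k)"
      by (metis abs_ge_self abs_mult power_abs)
    also have "\<dots> \<le> \<bar>x\<bar> ^ (n - 2) * \<bar>y\<bar>\<^sup>2 + \<bar>y\<bar> ^ n"
    proof (cases "\<bar>y\<bar> \<le> \<bar>x\<bar>")
      case True
      have "\<bar>y\<bar> ^ k * \<bar>x\<bar> ^ (n - k) = \<bar>y\<bar>\<^sup>2 * (\<bar>y\<bar> ^ (k - 2) * \<bar>x\<bar> ^ (n - k))"
      proof -
        have "\<bar>y\<bar> ^ k = \<bar>y\<bar>\<^sup>2 * \<bar>y\<bar> ^ (k - 2)" using k by (metis le_add_diff_inverse power_add)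
        then show ?thesis by (simp only: mult.assoc)
      qed
      also have "\<dots> \<le> \<bar>y\<bar>\<^sup>2 * (\<bar>x\<bar> ^ (k - 2) * \<bar>x\<bar> ^ (n - k))"
        using True by (intro mult_left_mono mult_right_mono power_mono) auto
      also have "\<bar>x\<bar> ^ (k - 2) * \<bar>x\<bar> ^ (n - k) = \<bar>x\<bar> ^ (n - 2)"
        using k by (simp flip: power_add)
      finally show ?thesis by (simp add: mult.commute add_increasing2)
    next
      case False
      have "\<bar>y\<bar> ^ k * \<bar>x\<bar> ^ (n - k) \<le> \<bar>y\<bar> ^ k * \<bar>y\<bar> ^ (n - k)"
        using False by (intro mult_left_mono power_mono) auto
      also have "\<dots> = \<bar>y\<bar> ^ n" using k by (simp flip: power_add)
      finally show ?thesis by (simp add: add_increasing)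
    qed
    finally show ?thesis using n by (simp add: B_def power_even_abs)
  qed
  have "(x + y) ^ n = (\<Sum>k\<le>n. real (n choose k) * y ^ k * x ^ (n - k))"
    using binomial_ring[of y x n] by (simp add: add.commute)
  also have "{..n} = insert 0 (insert 1 {2..n})" using n by auto
  also have "(\<Sum>k\<in>insert 0 (insert 1 {2..n}). real (n choose k) * y ^ k * x ^ (n - k)) =
     x ^ n + (real n * y * x ^ (n - 1) + (\<Sum>k\<in>{2..n}. real (n choose k) * y ^ k * x ^ (n - k)))"
    by (subst sum.insert; simp)+
  also have "(\<Sum>k\<in>{2..n}. real (n choose k) * y ^ k * x ^ (n - k)) \<le> (\<Sum>k\<in>{2..n}. real (n choose k) * B)"
    using term_le by (intro sum_mono) (simp add: mult.assoc mult_left_mono)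
  also have "\<dots> \<le> (\<Sum>k\<le>n. real (n choose k) * B)"
    using B0 by (intro sum_mono2) auto
  also have "\<dots> = 4 ^ p * B"
    using choose_row_sum[of n] by (simp flip: sum_distrib_right of_nat_sum) (simp add: n_def power_mult)
  finally show ?thesis by (simp add: n_def B_def mult_ac)
qed

text \<open>Shaped to close the induction over the number of summands: the increase of
  \<open>a ^ p\<close> to \<open>(a + x) ^ p\<close> absorbs the second-order terms of the
  expansion.\<close>

lemma power_add_lower:
  fixes a x :: real
  assumes "0 \<le> a" "0 \<le> x" "1 \<le> p"
  shows "a ^ p + x * (a ^ (p - 1) + x ^ (p - 1)) / 2 \<le> (a + x) ^ p"
proof -
  obtain n where n: "p = Suc n" using assms(3) by (cases p) auto
  have "a ^ n \<le> (a + x) ^ n" "x ^ n \<le> (a + x) ^ n" using assms by (auto intro!: power_mono)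
  moreover from this have "(a ^ n + x ^ n) / 2 \<le> (a + x) ^ n" by simp
  ultimately have "a ^ n \<le> (a + x) ^ n" "(a ^ n + x ^ n) / 2 \<le> (a + x) ^ n" by simp_all
  from mult_left_mono[OF this(1) assms(1)] mult_left_mono[OF this(2) assms(2)]
  have "a * a ^ n \<le> a * (a + x) ^ n" "x * ((a ^ n + x ^ n) / 2) \<le> x * (a + x) ^ n" .
  then have "a * a ^ n + x * ((a ^ n + x ^ n) / 2) \<le> (a + x) * (a + x) ^ n"
    unfolding distrib_right by (rule add_mono)
  then show ?thesis by (simp add: n)
qed

section \<open>Moments of sums of martingale differences\<close>

context prob_space
begin

text \<open>Hoelder's inequality with exponents \<open>p / (p - 1)\<close> and \<open>p\<close>,
  from the pointwise \<open>young_power\<close> applied to \<open>S\<^sup>2 / A\<close> and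
  \<open>d\<^sup>2 / B\<close>. The parameters \<open>A\<close> and \<open>B\<close> are on the
  scale of variances, hence the square roots.\<close>

lemma expectation_power_mult_le:
  assumes S: "moment_le p S (sqrt A)" and d: "moment_le p d (sqrt B)" and A: "0 < A" and B: "0 < B" and p: "1 \<le> p"
  shows "integrable M (\<lambda>x. S x ^ (2 * p - 2) * (d x)\<^sup>2)"
    "expectation (\<lambda>x. S x ^ (2 * p - 2) * (d x)\<^sup>2) \<le> A ^ (p - 1) * B"
proof -
  note [measurable] = moment_leD(1)[OF S] moment_leD(1)[OF d]
  define U where "U x = A ^ (p - 1) * B * ((1 - 1 / real p) * (S x ^ (2 * p) / A ^ p) + d x ^ (2 * p) / B ^ p / real p)" for x
  have le: "S x ^ (2 * p - 2) * (d x)\<^sup>2 \<le> U x" for x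
  proof -
    have "((S x)\<^sup>2 / A) ^ (p - 1) * ((d x)\<^sup>2 / B) \<le> (1 - 1 / real p) * ((S x)\<^sup>2 / A) ^ p + ((d x)\<^sup>2 / B) ^ p / real p"
      using A B p by (intro young_power) auto
    then have "A ^ (p - 1) * B * (((S x)\<^sup>2 / A) ^ (p - 1) * ((d x)\<^sup>2 / B)) \<le>
      A ^ (p - 1) * B * ((1 - 1 / real p) * ((S x)\<^sup>2 / A) ^ p + ((d x)\<^sup>2 / B) ^ p / real p)"
      using A B by (intro mult_left_mono) auto
    moreover have "A ^ (p - 1) * B * (((S x)\<^sup>2 / A) ^ (p - 1) * ((d x)\<^sup>2 / B)) = S x ^ (2 * p - 2) * (d x)\<^sup>2"
    proof -
      have "((S x)\<^sup>2) ^ (p - 1) = S x ^ (2 * p - 2)"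
        by (simp add: right_diff_distrib' flip: power_mult)
      then show ?thesis using A B by (simp add: power_divide)
    qed
    ultimately show ?thesis by (simp add: U_def power_divide power_mult)
  qed
  have intU: "integrable M U" unfolding U_def using moment_leD(2)[OF S] moment_leD(2)[OF d] by auto
  have ev: "even (2 * p - 2)" by simp
  show int: "integrable M (\<lambda>x. S x ^ (2 * p - 2) * (d x)\<^sup>2)"
  proof (rule Bochner_Integration.integrable_bound[OF intU])
    show "AE x in M. norm (S x ^ (2 * p - 2) * (d x)\<^sup>2) \<le> norm (U x)"
    proof (rule AE_I2)
      fix x
      have "0 \<le> S x ^ (2 * p - 2) * (d x)\<^sup>2" using ev by (intro mult_nonneg_nonneg zero_le_even_power) auto
      then show "norm (S x ^ (2 * p - 2) * (d x)\<^sup>2) \<le> norm (U x)" using le[of x] by simp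
    qed
  qed simp
  have "expectation (\<lambda>x. S x ^ (2 * p - 2) * (d x)\<^sup>2) \<le> expectation U"
    by (intro integral_mono int intU le)
  also have "\<dots> = A ^ (p - 1) * B * ((1 - 1 / real p) * (expectation (\<lambda>x. S x ^ (2 * p)) / A ^ p) +
      expectation (\<lambda>x. d x ^ (2 * p)) / B ^ p / real p)"
    unfolding U_def using moment_leD(2)[OF S] moment_leD(2)[OF d] by simp
  also have "\<dots> \<le> A ^ (p - 1) * B * ((1 - 1 / real p) * 1 + 1 / real p)"
  proof -
    have "expectation (\<lambda>x. S x ^ (2 * p)) / A ^ p \<le> 1" "expectation (\<lambda>x. d x ^ (2 * p)) / B ^ p \<le> 1"
      using moment_leD(4)[OF S] moment_leD(4)[OF d] A B by (simp_all add: power_mult)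
    then show ?thesis using A B p
      by (intro mult_left_mono add_mono divide_right_mono) auto
  qed
  finally show "expectation (\<lambda>x. S x ^ (2 * p - 2) * (d x)\<^sup>2) \<le> A ^ (p - 1) * B" by simp
qed

text \<open>An elementary Burkholder bound, by induction on \<open>n\<close>: orthogonality removes
  the linear term of the expansion, Hoelder's inequality bounds the mixed term, and
  \<open>power_add_lower\<close> absorbs the rest. The almost sure bound \<open>c\<close> makes the
  mixed products integrable.\<close>

lemma martingale_difference_moment:
  assumes p: "1 \<le> p" and b: "0 < b"
    and d: "\<And>k. k < n \<Longrightarrow> moment_le p (d k) b"
    and bd: "\<And>k. k < n \<Longrightarrow> AE x in M. \<bar>d k x\<bar> \<le> c"
    and orth: "\<And>k. k < n \<Longrightarrow> expectation (\<lambda>x. (\<Sum>i<k. d i x) ^ (2 * p - 1) * d k x) = 0"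
  shows "moment_le p (\<lambda>x. \<Sum>k<n. d k x) (sqrt (2 * 4 ^ p * real n * b\<^sup>2))"
  using d bd orth
proof (induction n)
  case 0
  show ?case using moment_le_zero by simp
next
  case (Suc n)
  define K :: real where "K = 2 * 4 ^ p"
  have K: "K \<ge> 1" using one_le_power[of "4::real" p] unfolding K_def by linarith
  define S where "S x = (\<Sum>k<n. d k x)" for x
  define A where "A = K * real n * b\<^sup>2"
  have S: "moment_le p S (sqrt A)" unfolding S_def A_def K_def using Suc by auto
  have dn: "moment_le p (d n) b" using Suc.prems(1) by simp
  note [measurable] = moment_leD(1)[OF S] moment_leD(1)[OF dn]
  have c: "AE x in M. \<bar>d k x\<bar> \<le> \<bar>c\<bar>" if "k < Suc n" for k
    using Suc.prems(2)[OF that] by eventually_elim linarith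
  have "AE x in M. \<forall>k\<in>{..n}. \<bar>d k x\<bar> \<le> \<bar>c\<bar>"
    using c by (subst AE_finite_all) (auto simp: less_Suc_eq_le)
  then have Sb: "AE x in M. \<bar>S x\<bar> \<le> real n * \<bar>c\<bar>"
  proof eventually_elim
    case (elim x)
    have "\<bar>S x\<bar> \<le> (\<Sum>k<n. \<bar>d k x\<bar>)" unfolding S_def by (rule sum_abs)
    also have "\<dots> \<le> (\<Sum>k<n. \<bar>c\<bar>)" using elim by (intro sum_mono) auto
    finally show ?case by simp
  qed
  have A0: "0 \<le> A" using K by (auto simp: A_def)
  have key: "expectation (\<lambda>x. S x ^ (2 * p - 2) * (d n x)\<^sup>2) \<le> A ^ (p - 1) * b\<^sup>2 \<and>
      integrable M (\<lambda>x. S x ^ (2 * p - 2) * (d n x)\<^sup>2)"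
  \<comment> \<open>For \<open>n = 0\<close> the variance \<open>A\<close> is 0, which the Hoelder
    bound excludes. The convention \<open>0 ^ 0 = 1\<close> makes \<open>p = 1\<close> a separate
    case.\<close>
  proof (cases "n = 0")
    case True
    show ?thesis
    proof (cases "p = 1")
      case True
      then show ?thesis using moment_leD[OF dn] \<open>n = 0\<close> by (simp add: S_def A_def)
    next
      case False
      then have "2 * p - 2 \<noteq> 0" "p - 1 \<noteq> 0" using p by auto
      then show ?thesis using True by (simp add: S_def A_def power_0_left)
    qed
  next
    case False
    then have "0 < A" using K b by (simp add: A_def)
    moreover have "moment_le p (d n) (sqrt (b\<^sup>2))" using dn b by simp
    ultimately show ?thesis using expectation_power_mult_le[OF S, of "d n" "b\<^sup>2"] b p by simp
  qed
  have int1: "integrable M (\<lambda>x. S x ^ (2 * p - 1) * d n x)"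
  proof (rule AE_bounded_integrable[where c="(real n * \<bar>c\<bar>) ^ (2 * p - 1) * \<bar>c\<bar>"])
    show "AE x in M. \<bar>S x ^ (2 * p - 1) * d n x\<bar> \<le> (real n * \<bar>c\<bar>) ^ (2 * p - 1) * \<bar>c\<bar>"
      using Sb c[of n, OF lessI]
      by eventually_elim (auto simp: abs_mult power_abs intro!: mult_mono power_mono)
  qed simp
  define U where "U x = S x ^ (2 * p) + 2 * real p * (S x ^ (2 * p - 1) * d n x)
      + 4 ^ p * (S x ^ (2 * p - 2) * (d n x)\<^sup>2 + d n x ^ (2 * p))" for x
  have intU: "integrable M U" unfolding U_def using int1 key moment_leD(2)[OF S] moment_leD(2)[OF dn] by auto
  have le: "(S x + d n x) ^ (2 * p) \<le> U x" for x
    using power_sum_expansion_le[OF p, of "S x" "d n x"] by (simp add: U_def mult.assoc)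
  have int: "integrable M (\<lambda>x. (S x + d n x) ^ (2 * p))"
    by (rule Bochner_Integration.integrable_bound[OF intU])
       (use le in \<open>auto simp: power_mult intro!: order_trans[OF _ abs_ge_self]\<close>)
  have "expectation (\<lambda>x. (S x + d n x) ^ (2 * p)) \<le> expectation U"
    by (intro integral_mono int intU le)
  also have "\<dots> = expectation (\<lambda>x. S x ^ (2 * p)) + 2 * real p * expectation (\<lambda>x. S x ^ (2 * p - 1) * d n x)
      + 4 ^ p * (expectation (\<lambda>x. S x ^ (2 * p - 2) * (d n x)\<^sup>2) + expectation (\<lambda>x. d n x ^ (2 * p)))"
    unfolding U_def using int1 key moment_leD(2)[OF S] moment_leD(2)[OF dn] by simp
  also have "\<dots> \<le> A ^ p + 2 * real p * 0 + 4 ^ p * (A ^ (p - 1) * b\<^sup>2 + b ^ (2 * p))"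
  proof (intro add_mono mult_left_mono)
    show "expectation (\<lambda>x. S x ^ (2 * p)) \<le> A ^ p" using moment_leD(4)[OF S] A0 by (simp add: power_mult)
    show "expectation (\<lambda>x. S x ^ (2 * p - 1) * d n x) \<le> 0"
      using Suc.prems(3)[of n] by (simp add: S_def)
    show "expectation (\<lambda>x. S x ^ (2 * p - 2) * (d n x)\<^sup>2) \<le> A ^ (p - 1) * b\<^sup>2" using key by simp
    show "expectation (\<lambda>x. d n x ^ (2 * p)) \<le> b ^ (2 * p)" by (rule moment_leD(4)[OF dn])
  qed auto
  \<comment> \<open>The factor 2 in \<open>K = 2 * 4 ^ p\<close> compensates the division by 2 in
    \<open>power_add_lower\<close>; \<open>K \<ge> 1\<close> lets \<open>b\<^sup>2\<close> grow to
    \<open>K * b\<^sup>2\<close> in the last power.\<close>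
  also have "\<dots> \<le> A ^ p + K * b\<^sup>2 * (A ^ (p - 1) + (K * b\<^sup>2) ^ (p - 1)) / 2"
  proof -
    have "(b\<^sup>2) ^ (p - 1) \<le> (K * b\<^sup>2) ^ (p - 1)" using K b by (intro power_mono) (auto simp: mult_le_cancel_right1)
    then have "b\<^sup>2 * (b\<^sup>2) ^ (p - 1) \<le> b\<^sup>2 * (K * b\<^sup>2) ^ (p - 1)" by (intro mult_left_mono) auto
    moreover have "b\<^sup>2 * (b\<^sup>2) ^ (p - 1) = b ^ (2 * p)"
    proof -
      obtain q where "p = Suc q" using p by (cases p) auto
      then show ?thesis by (simp add: power2_eq_square power_mult)
    qed
    ultimately have "4 ^ p * (A ^ (p - 1) * b\<^sup>2 + b ^ (2 * p)) \<le> 4 ^ p * (A ^ (p - 1) * b\<^sup>2 + b\<^sup>2 * (K * b\<^sup>2) ^ (p - 1))"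
      by (intro mult_left_mono) auto
    then show ?thesis by (simp add: K_def algebra_simps)
  qed
  also have "\<dots> \<le> (A + K * b\<^sup>2) ^ p" using A0 K p by (intro power_add_lower) auto
  also have "A + K * b\<^sup>2 = K * real (Suc n) * b\<^sup>2" by (simp add: A_def algebra_simps)
  finally have "expectation (\<lambda>x. (S x + d n x) ^ (2 * p)) \<le> (K * real (Suc n) * b\<^sup>2) ^ p" .
  also have "(K * real (Suc n) * b\<^sup>2) ^ p = sqrt (K * real (Suc n) * b\<^sup>2) ^ (2 * p)"
    using K by (simp add: power_mult del: of_nat_Suc)
  finally have "expectation (\<lambda>x. (S x + d n x) ^ (2 * p)) \<le> sqrt (K * real (Suc n) * b\<^sup>2) ^ (2 * p)" .
  moreover have "(\<lambda>x. \<Sum>k<n. d k x) \<in> borel_measurable M" using moment_leD(1)[OF S] by (simp add: S_def[abs_def])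
  ultimately show ?case using int K unfolding K_def[symmetric] by (simp add: moment_le_def S_def)
qed

lemma sigma_finite_subalgebraI: "subalgebra M G \<Longrightarrow> sigma_finite_subalgebra M G"
proof -
  assume "subalgebra M G"
  then interpret finite_measure_subalgebra M G by unfold_locales
  show ?thesis by (rule sigma_finite_subalgebra_axioms)
qed

lemma real_cond_exp_AE_bounded:
  assumes G: "subalgebra M G" and [measurable]: "f \<in> borel_measurable M" and ae: "AE x in M. \<bar>f x\<bar> \<le> c"
  shows "AE x in M. \<bar>real_cond_exp M G f x\<bar> \<le> c"
proof -
  interpret G: sigma_finite_subalgebra M G by (rule sigma_finite_subalgebraI[OF G])
  have int: "integrable M f" by (rule AE_bounded_integrable[OF _ ae]) simp
  have "AE x in M. real_cond_exp M G f x \<le> c"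
    by (rule G.real_cond_exp_le_c[OF int]) (use ae in eventually_elim, linarith)
  moreover have "AE x in M. real_cond_exp M G f x \<ge> - c"
    by (rule G.real_cond_exp_ge_c[OF int]) (use ae in eventually_elim, linarith)
  ultimately show ?thesis by eventually_elim linarith
qed

lemma expectation_mult_real_cond_exp:
  assumes G: "subalgebra M G" and T[measurable]: "T \<in> borel_measurable G" and f[measurable]: "f \<in> borel_measurable M"
    and Tb: "AE x in M. \<bar>T x\<bar> \<le> a" and fb: "AE x in M. \<bar>f x\<bar> \<le> c"
  shows "expectation (\<lambda>x. T x * real_cond_exp M G f x) = expectation (\<lambda>x. T x * f x)"
proof -
  interpret G: sigma_finite_subalgebra M G by (rule sigma_finite_subalgebraI[OF G])
  have [measurable]: "T \<in> borel_measurable M" by (rule measurable_from_subalg[OF G T])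
  have "integrable M (\<lambda>x. T x * f x)"
  proof (rule AE_bounded_integrable[where c="\<bar>a\<bar> * \<bar>c\<bar>"])
    show "AE x in M. \<bar>T x * f x\<bar> \<le> \<bar>a\<bar> * \<bar>c\<bar>"
      using Tb fb by eventually_elim (auto simp: abs_mult intro!: mult_mono)
  qed simp
  then show ?thesis by (rule G.real_cond_exp_intg(2)) simp_all
qed

text \<open>A test function that is measurable at time \<open>k\<close> has the same expectation
  against the conditional expectations at times \<open>k\<close> and \<open>k + 1\<close>.
  Orthogonality uses nothing else, so the variable \<open>z i\<close> may change with
  \<open>i\<close> and the summands need not come from one martingale.\<close>

lemma cond_exp_differences_moment:
  fixes G :: "nat \<Rightarrow> 'a measure" and z :: "nat \<Rightarrow> 'a \<Rightarrow> real"
  assumes p: "1 \<le> p" and b: "0 < b"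
    and G: "\<And>n. subalgebra M (G n)" and G_mono: "\<And>m n. m \<le> n \<Longrightarrow> sets (G m) \<subseteq> sets (G n)"
    and z[measurable]: "\<And>i. i < n \<Longrightarrow> z i \<in> borel_measurable M"
    and zb: "\<And>i. i < n \<Longrightarrow> AE x in M. \<bar>z i x\<bar> \<le> c"
    and mom: "\<And>i. i < n \<Longrightarrow> moment_le p (\<lambda>x. real_cond_exp M (G (Suc i)) (z i) x - real_cond_exp M (G i) (z i) x) b"
  shows "moment_le p (\<lambda>x. \<Sum>i<n. real_cond_exp M (G (Suc i)) (z i) x - real_cond_exp M (G i) (z i) x)
    (sqrt (2 * 4 ^ p * real n * b\<^sup>2))"
proof (rule martingale_difference_moment[OF p b mom, where c="2 * c"])
  define d where "d i x = real_cond_exp M (G (Suc i)) (z i) x - real_cond_exp M (G i) (z i) x" for i x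
  have db: "AE x in M. \<bar>d i x\<bar> \<le> 2 * c" if "i < n" for i
    using real_cond_exp_AE_bounded[OF G z[OF that] zb[OF that], of "Suc i"]
      real_cond_exp_AE_bounded[OF G z[OF that] zb[OF that], of i]
    unfolding d_def by eventually_elim linarith
  then show "AE x in M. \<bar>real_cond_exp M (G (Suc i)) (z i) x - real_cond_exp M (G i) (z i) x\<bar> \<le> 2 * c" if "i < n" for i
    using that by (simp add: d_def)
  fix k assume k: "k < n"
  note [measurable] = z[OF k]
  have sp: "space (G n) = space M" for n using G by (auto simp: subalgebra_def)
  have GG: "f \<in> borel_measurable (G m) \<Longrightarrow> m \<le> n \<Longrightarrow> f \<in> borel_measurable (G n)" for f :: "'a \<Rightarrow> real" and m n
    by (rule measurable_from_subalg[of _ "G m"]) (auto simp: subalgebra_def sp G_mono)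
  have dG: "d i \<in> borel_measurable (G k)" if "i < k" for i
    unfolding d_def
    by (rule borel_measurable_diff; rule GG[OF borel_measurable_cond_exp]) (use that in auto)
  define T where "T x = (\<Sum>i<k. d i x) ^ (2 * p - 1)" for x
  have TG[measurable]: "T \<in> borel_measurable (G k)" unfolding T_def using dG by (intro borel_measurable_power borel_measurable_sum) auto
  have TG'[measurable]: "T \<in> borel_measurable (G (Suc k))" by (rule GG[OF TG]) simp
  have [measurable]: "T \<in> borel_measurable M" by (rule measurable_from_subalg[OF G TG])
  have "AE x in M. \<forall>i\<in>{..<k}. \<bar>d i x\<bar> \<le> 2 * c"
    using db k by (subst AE_finite_all) auto
  then have Tb: "AE x in M. \<bar>T x\<bar> \<le> (real k * (2 * c)) ^ (2 * p - 1)"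
  proof eventually_elim
    case (elim x)
    have "\<bar>\<Sum>i<k. d i x\<bar> \<le> (\<Sum>i<k. \<bar>d i x\<bar>)" by (rule sum_abs)
    also have "\<dots> \<le> (\<Sum>i<k. 2 * c)" using elim by (intro sum_mono) auto
    finally show ?case unfolding T_def power_abs by (intro power_mono) auto
  qed
  have int: "integrable M (\<lambda>x. T x * real_cond_exp M (G m) (z k) x)" for m
  proof (rule AE_bounded_integrable[where c="\<bar>(real k * (2 * c)) ^ (2 * p - 1)\<bar> * \<bar>c\<bar>"])
    show "AE x in M. \<bar>T x * real_cond_exp M (G m) (z k) x\<bar> \<le> \<bar>(real k * (2 * c)) ^ (2 * p - 1)\<bar> * \<bar>c\<bar>"
      using Tb real_cond_exp_AE_bounded[OF G z[OF k] zb[OF k], of m]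
      unfolding abs_mult
    proof eventually_elim
      case (elim x)
      then have "\<bar>T x\<bar> \<le> \<bar>(real k * (2 * c)) ^ (2 * p - 1)\<bar>" "\<bar>real_cond_exp M (G m) (z k) x\<bar> \<le> \<bar>c\<bar>"
        by (auto intro: order_trans[OF _ abs_ge_self])
      then show ?case by (rule mult_mono) simp_all
    qed
  qed simp
  have "expectation (\<lambda>x. T x * d k x) =
      expectation (\<lambda>x. T x * real_cond_exp M (G (Suc k)) (z k) x) - expectation (\<lambda>x. T x * real_cond_exp M (G k) (z k) x)"
    unfolding d_def right_diff_distrib by (rule Bochner_Integration.integral_diff[OF int int])
  also have "\<dots> = 0"
    using expectation_mult_real_cond_exp[OF G TG z[OF k] Tb zb[OF k]]
      expectation_mult_real_cond_exp[OF G TG' z[OF k] Tb zb[OF k]] by simp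
  finally show "expectation (\<lambda>x. (\<Sum>i<k. real_cond_exp M (G (Suc i)) (z i) x - real_cond_exp M (G i) (z i) x) ^ (2 * p - 1) *
      (real_cond_exp M (G (Suc k)) (z k) x - real_cond_exp M (G k) (z k) x)) = 0"
    by (simp add: T_def d_def)
qed

end

section \<open>Telescoping conditional expectations\<close>

context prob_space
begin

text \<open>The telescoping replaces the stochastic sewing lemma: \<open>y k j\<close> is the contribution of the
  \<open>k\<close>-th grid cell with the drift frozen \<open>j\<close> grid points in the past. Moving from \<open>j\<close> to \<open>j + 1\<close>
  costs a frozen-drift error, controlled by \<open>e / j\<close>, and a difference of conditional expectations
  which for fixed \<open>j\<close> is a martingale difference in \<open>k\<close>.\<close>

lemma telescoped_moment:
  fixes G :: "nat \<Rightarrow> 'a measure" and y :: "nat \<Rightarrow> nat \<Rightarrow> 'a \<Rightarrow> real"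
  assumes p: "1 \<le> p" and c0: "0 < c" and b0: "0 < b" and e0: "0 \<le> e" and N: "1 \<le> N"
    and G: "\<And>n. subalgebra M (G n)" and G_mono: "\<And>m n. m \<le> n \<Longrightarrow> sets (G m) \<subseteq> sets (G n)"
    and y[measurable]: "\<And>k j. y k j \<in> borel_measurable M" and yb: "\<And>k j. AE x in M. \<bar>y k j x\<bar> \<le> c"
    and adapted: "\<And>k. 1 \<le> k \<Longrightarrow> k \<le> N \<Longrightarrow> AE x in M. real_cond_exp M (G (Suc k)) (y k 1) x = y k 1 x"
    and m1: "\<And>k j. 1 \<le> j \<Longrightarrow> j \<le> k \<Longrightarrow> k \<le> N \<Longrightarrow>
      moment_le p (real_cond_exp M (G (k - j)) (y k j)) (b / real j)"
    and m2: "\<And>k j. 1 \<le> j \<Longrightarrow> j < k \<Longrightarrow> k \<le> N \<Longrightarrow>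
      moment_le p (real_cond_exp M (G (k - j)) (y k (Suc j))) (b / real j)"
    and m3: "\<And>k j. 1 \<le> j \<Longrightarrow> j < k \<Longrightarrow> k \<le> N \<Longrightarrow>
      moment_le p (real_cond_exp M (G (k - j)) (\<lambda>x. y k j x - y k (Suc j) x)) (e / real j)"
  defines "h \<equiv> \<Sum>j=1..N. 1 / real j"
  shows "moment_le p (\<lambda>x. \<Sum>k=1..N. y k 1 x)
    (8 * sqrt (2 * 4 ^ p * real N) * (c + b) * h + e * real N * h)"
proof -
  define E where "E n f = real_cond_exp M (G n) f" for n and f :: "'a \<Rightarrow> real"
  define R where "R = sqrt (2 * 4 ^ p * real N)"
  have [measurable]: "E n f \<in> borel_measurable M" for n f unfolding E_def by simp
  have int: "integrable M (y k j)" for k j by (rule AE_bounded_integrable[OF y yb])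
  have root: "sqrt (2 * 4 ^ p * real n * a\<^sup>2) \<le> R * a" if "n \<le> N" "0 \<le> a" for n a
  proof -
    have "sqrt (2 * 4 ^ p * real n * a\<^sup>2) = sqrt (2 * 4 ^ p * real n) * a"
      using that by (simp add: real_sqrt_mult)
    also have "\<dots> \<le> R * a" unfolding R_def using that by (intro mult_right_mono real_sqrt_le_mono mult_left_mono) auto
    finally show ?thesis .
  qed
  have h1: "1 \<le> h"
  proof -
    have "(\<Sum>j\<in>{1}. 1 / real j) \<le> h" unfolding h_def using N by (intro sum_mono2) auto
    then show ?thesis by simp
  qed
  have R1: "real N \<le> R\<^sup>2" "1 \<le> R"
  proof -
    have "1 * real N \<le> 2 * 4 ^ p * real N" using one_le_power[of "4::real" p] by (intro mult_right_mono) linarith+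
    then show "real N \<le> R\<^sup>2" by (simp add: R_def)
    have "1 \<le> real N" using N by simp
    also have "\<dots> \<le> 2 * 4 ^ p * real N" using \<open>1 * real N \<le> 2 * 4 ^ p * real N\<close> by simp
    finally show "1 \<le> R" unfolding R_def by simp
  qed
  \<comment> \<open>\<open>y k 1\<close> is known only at time \<open>k + 1\<close>, while its drift
    is frozen at \<open>k - 1\<close>. \<open>D1\<close> and \<open>D2\<close> bridge these two
    steps, where only the bound \<open>c\<close> is at hand; \<open>D3\<close> carries the error of
    freezing one step earlier, and \<open>D4\<close> the step back of the conditioning.\<close>
  define D1 where "D1 k x = E (Suc k) (y k 1) x - E k (y k 1) x" for k x
  define D2 where "D2 k x = E k (y k 1) x - E (k - 1) (y k 1) x" for k x
  define D3 where "D3 k j x = E (k - j) (\<lambda>x. y k j x - y k (Suc j) x) x" for k j x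
  define D4 where "D4 k j x = E (k - j) (y k (Suc j)) x - E (k - Suc j) (y k (Suc j)) x" for k j x
  have Ey: "moment_le p (E n (y k j)) c" for n k j unfolding E_def
    by (rule moment_le_bounded) (use real_cond_exp_AE_bounded[OF G y yb] c0 in auto)
  have decomp: "AE x in M. y k 1 x = D1 k x + D2 k x + (\<Sum>j=1..<k. D3 k j x) + (\<Sum>j=1..<k. D4 k j x) + E 0 (y k k) x"
    if k: "1 \<le> k" "k \<le> N" for k
  proof -
    have "AE x in M. \<forall>j\<in>{1..<k}. D3 k j x = E (k - j) (y k j) x - E (k - j) (y k (Suc j)) x"
    proof (subst AE_finite_all, simp, intro ballI)
      fix j
      interpret S: sigma_finite_subalgebra M "G (k - j)" by (rule sigma_finite_subalgebraI[OF G])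
      show "AE x in M. D3 k j x = E (k - j) (y k j) x - E (k - j) (y k (Suc j)) x"
        unfolding D3_def E_def by (rule S.real_cond_exp_diff[OF int int])
    qed
    then show ?thesis using adapted[OF k]
    proof eventually_elim
      case (elim x)
      have "(\<Sum>j=1..<k. D3 k j x) + (\<Sum>j=1..<k. D4 k j x) = (\<Sum>j=1..<k. E (k - j) (y k j) x - E (k - Suc j) (y k (Suc j)) x)"
        using elim by (simp add: D4_def flip: sum.distrib)
      also have "\<dots> = E (k - 1) (y k 1) x - E (k - k) (y k k) x"
        using sum_Suc_diff'[OF k(1), of "\<lambda>j. - E (k - j) (y k j) x"] by simp
      finally show ?case using elim by (simp add: D1_def D2_def E_def)
    qed
  qed
  have s1: "moment_le p (\<lambda>x. \<Sum>k=1..N. D1 k x) (R * (2 * c))"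
  proof -
    have "moment_le p (\<lambda>x. \<Sum>i<N. E (Suc (Suc i)) (y (Suc i) 1) x - E (Suc i) (y (Suc i) 1) x)
        (sqrt (2 * 4 ^ p * real N * (2 * c)\<^sup>2))"
      unfolding E_def
    \<comment> \<open>\<open>D1 k\<close> compares times \<open>k\<close> and \<open>k + 1\<close>,
      and \<open>k\<close> starts at 1; the filtration is therefore shifted by one.\<close>
    proof (rule cond_exp_differences_moment[OF p, where G="\<lambda>n. G (Suc n)"])
      show "moment_le p (\<lambda>x. real_cond_exp M (G (Suc (Suc i))) (y (Suc i) 1) x -
          real_cond_exp M (G (Suc i)) (y (Suc i) 1) x) (2 * c)" for i
        unfolding mult_2 by (rule moment_le_diff[OF Ey[of "Suc (Suc i)" "Suc i" 1] Ey[of "Suc i" "Suc i" 1] p, unfolded E_def])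
      show "sets (G (Suc m)) \<subseteq> sets (G (Suc n))" if "m \<le> n" for m n
        by (rule G_mono) (use that in simp)
    qed (rule G y yb | use c0 in simp)+
    then have "moment_le p (\<lambda>x. \<Sum>k=1..N. D1 k x) (sqrt (2 * 4 ^ p * real N * (2 * c)\<^sup>2))"
      by (simp add: D1_def sum.atLeast1_atMost_eq)
    then show ?thesis by (rule moment_le_mono) (use root[of N "2 * c"] c0 in auto)
  qed
  have s2: "moment_le p (\<lambda>x. \<Sum>k=1..N. D2 k x) (R * (2 * c))"
  proof -
    have "moment_le p (\<lambda>x. \<Sum>i<N. E (Suc i) (y (Suc i) 1) x - E i (y (Suc i) 1) x)
        (sqrt (2 * 4 ^ p * real N * (2 * c)\<^sup>2))"
      unfolding E_def
    proof (rule cond_exp_differences_moment[OF p, where G=G])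
      show "moment_le p (\<lambda>x. real_cond_exp M (G (Suc i)) (y (Suc i) 1) x -
          real_cond_exp M (G i) (y (Suc i) 1) x) (2 * c)" for i
        unfolding mult_2 by (rule moment_le_diff[OF Ey[of "Suc i" "Suc i" 1] Ey[of i "Suc i" 1] p, unfolded E_def])
    qed (rule G y yb G_mono | assumption | use c0 in simp)+
    then have "moment_le p (\<lambda>x. \<Sum>k=1..N. D2 k x) (sqrt (2 * 4 ^ p * real N * (2 * c)\<^sup>2))"
      by (simp add: D2_def sum.atLeast1_atMost_eq)
    then show ?thesis by (rule moment_le_mono) (use root[of N "2 * c"] c0 in auto)
  qed
  have s4: "moment_le p (\<lambda>x. \<Sum>k=Suc j..N. D4 k j x) (R * (2 * b / real j))" if j: "1 \<le> j" "j < N" for j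
  proof -
    \<comment> \<open>For fixed \<open>j\<close> put \<open>i = k - j - 1\<close>. Then
      \<open>D4 k j\<close> is the difference between times \<open>i + 1\<close> and
      \<open>i\<close>, and each of its two parts is of size \<open>b / j\<close>.\<close>
    have "moment_le p (\<lambda>x. \<Sum>i<N - j. E (Suc i) (y (Suc j + i) (Suc j)) x - E i (y (Suc j + i) (Suc j)) x)
        (sqrt (2 * 4 ^ p * real (N - j) * (2 * b / real j)\<^sup>2))"
      unfolding E_def
    proof (rule cond_exp_differences_moment[OF p, where G=G])
      fix i assume i: "i < N - j"
      have "moment_le p (real_cond_exp M (G (Suc i)) (y (Suc j + i) (Suc j))) (b / real j)"
        using m2[of j "Suc j + i"] i j by simp
      moreover have "moment_le p (real_cond_exp M (G i) (y (Suc j + i) (Suc j))) (b / real (Suc j))"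
        using m1[of "Suc j" "Suc j + i"] i j by simp
      then have "moment_le p (real_cond_exp M (G i) (y (Suc j + i) (Suc j))) (b / real j)"
        by (rule moment_le_mono) (use b0 j in \<open>auto intro!: divide_left_mono\<close>)
      ultimately show "moment_le p (\<lambda>x. real_cond_exp M (G (Suc i)) (y (Suc j + i) (Suc j)) x -
          real_cond_exp M (G i) (y (Suc j + i) (Suc j)) x) (2 * b / real j)"
        unfolding mult_2 add_divide_distrib by (rule moment_le_diff[OF _ _ p])
    qed (rule G y yb G_mono | assumption | use b0 j in simp)+
    moreover have "(\<Sum>i<N - j. E (Suc i) (y (Suc j + i) (Suc j)) x - E i (y (Suc j + i) (Suc j)) x) = (\<Sum>k=Suc j..N. D4 k j x)" for x
      by (rule sum.reindex_bij_witness[where i="\<lambda>k. k - Suc j" and j="\<lambda>i. Suc j + i"])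
         (use j in \<open>auto simp: D4_def Suc_diff_le\<close>)
    ultimately have "moment_le p (\<lambda>x. \<Sum>k=Suc j..N. D4 k j x) (sqrt (2 * 4 ^ p * real (N - j) * (2 * b / real j)\<^sup>2))"
      by simp
    then show ?thesis by (rule moment_le_mono) (use root[of "N - j" "2 * b / real j"] b0 in auto)
  qed
  have h': "(\<Sum>j=1..<N. 1 / real j) \<le> h" unfolding h_def by (intro sum_mono2) auto
  \<comment> \<open>For fixed \<open>j\<close> the sum over \<open>k\<close> has gained the square
    root by orthogonality. Different \<open>j\<close> are only added by the triangle inequality,
    which costs the harmonic sum \<open>h\<close>.\<close>
  have S4: "moment_le p (\<lambda>x. \<Sum>k=1..N. \<Sum>j=1..<k. D4 k j x) (R * (2 * b) * h)"
  proof -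
    have "moment_le p (\<lambda>x. \<Sum>j=1..<N. \<Sum>k=Suc j..N. D4 k j x) (\<Sum>j=1..<N. R * (2 * b / real j))"
      by (rule moment_le_sum[OF s4 p]) auto
    moreover have "(\<Sum>j=1..<N. \<Sum>k=Suc j..N. D4 k j x) = (\<Sum>k=1..N. \<Sum>j=1..<k. D4 k j x)" for x
      unfolding sum.Sigma[OF finite_atLeastLessThan ballI[OF finite_atLeastAtMost]]
        sum.Sigma[OF finite_atLeastAtMost ballI[OF finite_atLeastLessThan]]
      by (rule sum.reindex_bij_witness[where i="\<lambda>(k, j). (j, k)" and j="\<lambda>(j, k). (k, j)"]) auto
    moreover have "(\<Sum>j=1..<N. R * (2 * b / real j)) = R * (2 * b) * (\<Sum>j=1..<N. 1 / real j)"
      by (simp add: sum_distrib_left)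
    ultimately have "moment_le p (\<lambda>x. \<Sum>k=1..N. \<Sum>j=1..<k. D4 k j x) (R * (2 * b) * (\<Sum>j=1..<N. 1 / real j))"
      by simp
    then show ?thesis by (rule moment_le_mono) (use h' R1 b0 in \<open>auto intro!: mult_left_mono\<close>)
  qed
  have S3: "moment_le p (\<lambda>x. \<Sum>k=1..N. \<Sum>j=1..<k. D3 k j x) (e * real N * h)"
  proof -
    have "moment_le p (\<lambda>x. \<Sum>k=1..N. \<Sum>j=1..<k. D3 k j x) (\<Sum>k=1..N. \<Sum>j=1..<k. e / real j)"
      unfolding D3_def E_def by (intro moment_le_sum p m3) auto
    moreover have "(\<Sum>k=1..N. \<Sum>j=1..<k. e / real j) \<le> (\<Sum>k=1..N. e * h)"
    proof (rule sum_mono)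
      fix k assume k: "k \<in> {1..N}"
      have "(\<Sum>j=1..<k. 1 / real j) \<le> h" unfolding h_def using k by (intro sum_mono2) auto
      then have "e * (\<Sum>j=1..<k. 1 / real j) \<le> e * h" using e0 by (rule mult_left_mono)
      then show "(\<Sum>j=1..<k. e / real j) \<le> e * h" by (simp add: sum_distrib_left)
    qed
    ultimately show ?thesis by (auto elim: moment_le_mono simp: mult_ac)
  qed
  have S5: "moment_le p (\<lambda>x. \<Sum>k=1..N. E 0 (y k k) x) (b * h)"
  proof -
    have "moment_le p (\<lambda>x. \<Sum>k=1..N. E 0 (y k k) x) (\<Sum>k=1..N. b / real k)"
      unfolding E_def using m1[of k k for k] by (intro moment_le_sum p) auto
    then show ?thesis by (simp add: h_def sum_distrib_left)
  qed
  have "AE x in M. \<forall>k\<in>{1..N}. y k 1 x = D1 k x + D2 k x + (\<Sum>j=1..<k. D3 k j x) + (\<Sum>j=1..<k. D4 k j x) + E 0 (y k k) x"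
    using decomp by (subst AE_finite_all) auto
  then have ae: "AE x in M. ((\<Sum>k=1..N. D1 k x) + (\<Sum>k=1..N. D2 k x)) + ((\<Sum>k=1..N. \<Sum>j=1..<k. D3 k j x)
      + (\<Sum>k=1..N. \<Sum>j=1..<k. D4 k j x)) + (\<Sum>k=1..N. E 0 (y k k) x) = (\<Sum>k=1..N. y k 1 x)"
    by eventually_elim (simp add: sum.distrib)
  have "moment_le p (\<lambda>x. \<Sum>k=1..N. y k 1 x) ((R * (2 * c) + R * (2 * c)) + (e * real N * h + R * (2 * b) * h) + b * h)"
    by (rule moment_le_cong_AE[OF moment_le_add[OF moment_le_add[OF moment_le_add[OF s1 s2 p] moment_le_add[OF S3 S4 p] p] S5 p] _ ae])
      simp
  moreover have "(R * (2 * c) + R * (2 * c)) + (e * real N * h + R * (2 * b) * h) + b * h \<le> 8 * R * (c + b) * h + e * real N * h"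
  proof -
    have "R * c \<le> R * c * h" using mult_left_mono[OF h1, of "R * c"] R1 c0 by simp
    moreover have "b * h \<le> R * b * h" using mult_right_mono[OF R1(2), of "b * h"] h1 b0 by simp
    moreover have "0 \<le> R * b * h" "0 \<le> R * c * h" using h1 R1 b0 c0 by auto
    ultimately show ?thesis by (simp add: algebra_simps)
  qed
  ultimately show ?thesis unfolding R_def by (rule moment_le_mono)
qed

end

section \<open>The Volterra kernel\<close>

lemma has_bochner_integral_Beta_interval:
  fixes v t a b :: real
  assumes "v < t" "0 < a" "0 < b"
  shows "has_bochner_integral lborel
    (\<lambda>x. indicator {v..t} x *\<^sub>R ((x - v) powr (a - 1) * (t - x) powr (b - 1)))
    ((t - v) powr (a + b - 1) * Beta a b)"
proof -
  let ?f = "\<lambda>y. indicator {0..1} y *\<^sub>R (y powr (a - 1) * (1 - y) powr (b - 1)) :: real"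
  have int: "integrable lborel ?f"
    using integrable_Beta[OF assms(2,3)] by (simp add: set_integrable_def)
  have "(LINT y:{0..1}|lborel. y powr (a - 1) * (1 - y) powr (b - 1)) = Beta a b"
    using set_borel_integral_eq_integral(2)[OF integrable_Beta[OF assms(2,3)]]
      integral_unique[OF has_integral_Beta_real[OF assms(2,3)]] by simp
  then have f: "has_bochner_integral lborel ?f (Beta a b)"
    using int by (simp add: has_bochner_integral_iff set_lebesgue_integral_def)
  have eq: "indicator {v..t} (v + (t - v) * y) *\<^sub>R
      ((v + (t - v) * y - v) powr (a - 1) * (t - (v + (t - v) * y)) powr (b - 1)) =
      (t - v) powr (a + b - 2) * ?f y" for y
  proof -
    have "v + (t - v) * y \<in> {v..t} \<longleftrightarrow> y \<in> {0..1}"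
    proof -
      have "v \<le> v + (t - v) * y \<longleftrightarrow> 0 \<le> y" using assms(1) by (simp add: zero_le_mult_iff)
      moreover have "v + (t - v) * y \<le> t \<longleftrightarrow> y \<le> 1"
        using mult_le_cancel_left_pos[of "t - v" y 1] assms(1) by (simp add: le_diff_eq add.commute)
      ultimately show ?thesis by simp
    qed
    moreover have "((t - v) * y) powr (a - 1) * ((t - v) * (1 - y)) powr (b - 1) =
        (t - v) powr (a + b - 2) * (y powr (a - 1) * (1 - y) powr (b - 1))" if "y \<in> {0..1}"
    proof -
      have "(t - v) powr (a + b - 2) = (t - v) powr (a - 1) * (t - v) powr (b - 1)"
        using assms(1) by (simp flip: powr_add)
      then show ?thesis using that assms(1) by (simp add: powr_mult)
    qed
    moreover have "t - (v + (t - v) * y) = (t - v) * (1 - y)" by (simp add: algebra_simps)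
    ultimately show ?thesis by (simp add: indicator_def)
  qed
  have "has_bochner_integral lborel (\<lambda>y. (t - v) powr (a + b - 2) * ?f y) ((t - v) powr (a + b - 2) * Beta a b)"
    by (rule has_bochner_integral_mult_right[OF f])
  then have "has_bochner_integral lborel (\<lambda>y. (t - v) powr (a + b - 2) * ?f y)
      ((t - v) powr (a + b - 1) * Beta a b /\<^sub>R \<bar>t - v\<bar>)"
  proof -
    have "(t - v) powr (a + b - 1) = (t - v) * (t - v) powr (a + b - 2)"
      using assms(1) powr_add[of "t - v" 1 "a + b - 2"] by simp
    then have "(t - v) powr (a + b - 1) * Beta a b /\<^sub>R \<bar>t - v\<bar> = (t - v) powr (a + b - 2) * Beta a b"
      using assms(1) by simp
    then show ?thesis using \<open>has_bochner_integral lborel _ ((t - v) powr (a + b - 2) * Beta a b)\<close> by (simp only:)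
  qed
  note scaled = this
  show ?thesis
  proof (subst lborel_has_bochner_integral_real_affine_iff[where c="t - v" and t=v])
    show "t - v \<noteq> 0" using assms(1) by simp
  qed (unfold eq, rule scaled)
qed

text \<open>The algebra of the derivative in \<open>inversion_identity\<close>, freed from powers:
  \<open>X\<close>, \<open>Y\<close>, \<open>V\<close> stand for the powers with exponent
  \<open>a\<close> of \<open>x\<close>, \<open>t - x\<close>, \<open>v\<close>; \<open>s\<close> and
  \<open>u\<close> for \<open>1 / x\<close> and \<open>1 / (t - x)\<close>; \<open>P\<close> for
  \<open>(x - v) powr - a\<close>; and \<open>I\<close> for the Volterra integral.\<close>

lemma inversion_algebra:
  fixes X :: real
  assumes "X \<noteq> 0"
  shows "- ((- a * (Y * u) * X + a * (X * s) * Y) * (V * I) + (V * (s / X * P)) * (Y * X)) =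
    ((Y * u) * X - (X * s) * Y) * (V * (1 / X * P + a * I)) - V * (P * (Y * u))"
  using assms by (simp add: field_simps)

definition volterra_integral :: "real \<Rightarrow> real \<Rightarrow> real \<Rightarrow> real" where
  "volterra_integral H t s = (LINT u:{s..t}|lborel. u powr (H - 3/2) * (u - s) powr (H - 1/2))"

section \<open>Shape of the kernel in its time variable, and its inversion\<close>

context
  fixes H :: real
  assumes H: "0 < H" "H < 1/2"
begin

lemma volterra_integrable:
  assumes s: "0 < s"
  shows "set_integrable lborel {s..t} (\<lambda>u. u powr (H - 3/2) * (u - s) powr (H - 1/2))"
proof (cases "s < t")
  case False
  then have "(\<lambda>u. indicator {s..t} u *\<^sub>R (u powr (H - 3/2) * (u - s) powr (H - 1/2))) = (\<lambda>_. 0)"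
    by (auto simp: indicator_def fun_eq_iff)
  then show ?thesis by (simp add: set_integrable_def)
next
  case True
  have B: "integrable lborel (\<lambda>x. s powr (H - 3/2) * (indicator {s..t} x *\<^sub>R ((x - s) powr ((H + 1/2) - 1) * (t - x) powr (1 - 1))))"
    using has_bochner_integral_Beta_interval[OF True, of "H + 1/2" 1] H
    by (intro integrable_mult_right) (auto dest: integrable.intros)
  have "AE u in lborel. u \<noteq> t" by (rule AE_lborel_singleton)
  then show ?thesis unfolding set_integrable_def
  proof (intro Bochner_Integration.integrable_bound[OF B])
    show "AE x in lborel. norm (indicator {s..t} x *\<^sub>R (x powr (H - 3/2) * (x - s) powr (H - 1/2)))
      \<le> norm (s powr (H - 3/2) * (indicator {s..t} x *\<^sub>R ((x - s) powr ((H + 1/2) - 1) * (t - x) powr (1 - 1))))"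
      using \<open>AE u in lborel. u \<noteq> t\<close>
    proof eventually_elim
      case (elim x)
      show ?case
      proof (cases "x \<in> {s..t}")
        case True
        have "x powr (H - 3/2) \<le> s powr (H - 3/2)" using True s H by (intro powr_mono2') auto
        then have "x powr (H - 3/2) * (x - s) powr (H - 1/2) \<le> s powr (H - 3/2) * (x - s) powr (H - 1/2)"
          by (rule mult_right_mono) simp
        then show ?thesis using True elim by (simp add: abs_mult)
      qed simp
    qed
  qed simp
qed

lemma volterra_integral_eq:
  assumes "0 < s"
  shows "volterra_integral H t s = integral {s..t} (\<lambda>u. u powr (H - 3/2) * (u - s) powr (H - 1/2))"
    "(\<lambda>u. u powr (H - 3/2) * (u - s) powr (H - 1/2)) integrable_on {s..t}"
  using set_borel_integral_eq_integral[OF volterra_integrable[OF assms, of t]]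
  by (auto simp: volterra_integral_def)

lemma volterra_integral_nonneg: "0 \<le> volterra_integral H t s"
  unfolding volterra_integral_def set_lebesgue_integral_def
  by (intro integral_nonneg_AE AE_I2) (auto simp: indicator_def)

lemma continuous_on_volterra_integral:
  assumes "0 < s"
  shows "continuous_on {s..t} (\<lambda>x. volterra_integral H x s)"
  unfolding volterra_integral_eq(1)[OF assms]
  by (intro indefinite_integral_continuous_1 volterra_integral_eq(2)[OF assms])

lemma volterra_integral_deriv:
  assumes s: "0 < s" "s < t"
  shows "((\<lambda>x. volterra_integral H x s) has_real_derivative t powr (H - 3/2) * (t - s) powr (H - 1/2)) (at t)"
proof -
  let ?f = "\<lambda>u. u powr (H - 3/2) * (u - s) powr (H - 1/2)"
  have "continuous (at t within {s..t + 1}) ?f"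
    using s by (intro continuous_intros) auto
  then have "((\<lambda>u. integral {s..u} ?f) has_vector_derivative ?f t) (at t within {s..t + 1} - {})"
    using s by (intro integral_has_vector_derivative_continuous_at volterra_integral_eq(2)) auto
  moreover have "at t within {s..t + 1} - {} = at t"
    using s by (simp add: at_within_Icc_at)
  ultimately show ?thesis
    unfolding volterra_integral_eq(1)[OF s(1)] by (simp add: has_real_derivative_iff_has_vector_derivative)
qed

lemma volterra_integral_mono:
  assumes s: "0 < s" "s < x" "x \<le> y"
  shows "volterra_integral H x s \<le> volterra_integral H y s"
  using assms by (intro DERIV_nonneg_imp_nondecreasing[of x y "\<lambda>x. volterra_integral H x s"])
    (auto intro!: exI volterra_integral_deriv)

lemma fbm_kernel_unnormalised_eq:
  assumes "0 < s" "s < t"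
  shows "fbm_kernel_unnormalised H t s = s powr (1/2 - H) *
    (t powr (H - 1/2) * (t - s) powr (H - 1/2) + (1/2 - H) * volterra_integral H t s)"
proof -
  have "(t / s) powr (H - 1/2) = t powr (H - 1/2) * s powr (1/2 - H)"
    using assms powr_minus_divide[of s "H - 1/2"] by (simp add: powr_divide)
  then show ?thesis
    unfolding fbm_kernel_unnormalised_def volterra_integral_def[symmetric] by (simp add: algebra_simps)
qed

lemma fbm_kernel_unnormalised_nonneg: "0 < s \<Longrightarrow> s < t \<Longrightarrow> 0 \<le> fbm_kernel_unnormalised H t s"
  using H volterra_integral_nonneg[of t s] by (subst fbm_kernel_unnormalised_eq) auto

text \<open>Differentiating the power of \<open>t\<close> and the Volterra integral produces
  opposite multiples of \<open>t powr (H - 3/2) * (t - s) powr (H - 1/2)\<close>. What is left has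
  one sign and a modulus decreasing in \<open>t\<close>, the source of monotonicity and
  convexity.\<close>

lemma fbm_kernel_unnormalised_deriv:
  assumes s: "0 < s" "s < t"
  shows "((\<lambda>x. fbm_kernel_unnormalised H x s) has_real_derivative
    - ((1/2 - H) * s powr (1/2 - H) * (t powr (H - 1/2) * (t - s) powr (H - 3/2)))) (at t)"
proof -
  have "((\<lambda>x. s powr (1/2 - H) * (x powr (H - 1/2) * (x - s) powr (H - 1/2) + (1/2 - H) * volterra_integral H x s))
     has_real_derivative
    s powr (1/2 - H) * ((H - 1/2) * t powr (H - 1/2 - 1) * (t - s) powr (H - 1/2)
      + (H - 1/2) * (t - s) powr (H - 1/2 - 1) * t powr (H - 1/2)
      + (1/2 - H) * (t powr (H - 3/2) * (t - s) powr (H - 1/2)))) (at t)"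
    using s by (auto intro!: derivative_eq_intros volterra_integral_deriv simp: algebra_simps)
  also have "s powr (1/2 - H) * ((H - 1/2) * t powr (H - 1/2 - 1) * (t - s) powr (H - 1/2)
      + (H - 1/2) * (t - s) powr (H - 1/2 - 1) * t powr (H - 1/2)
      + (1/2 - H) * (t powr (H - 3/2) * (t - s) powr (H - 1/2)))
    = - ((1/2 - H) * s powr (1/2 - H) * (t powr (H - 1/2) * (t - s) powr (H - 3/2)))"
    by (simp add: algebra_simps)
  finally have D: "((\<lambda>x. s powr (1/2 - H) * (x powr (H - 1/2) * (x - s) powr (H - 1/2) + (1/2 - H) * volterra_integral H x s))
     has_real_derivative - ((1/2 - H) * s powr (1/2 - H) * (t powr (H - 1/2) * (t - s) powr (H - 3/2)))) (at t)" .
  have "eventually (\<lambda>x. s < x) (nhds t)" using s eventually_nhds_in_open[of "{s<..}" t] by simp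
  then have "eventually (\<lambda>x. fbm_kernel_unnormalised H x s = s powr (1/2 - H) * (x powr (H - 1/2) * (x - s) powr (H - 1/2) + (1/2 - H) * volterra_integral H x s)) (nhds t)"
    by eventually_elim (rule fbm_kernel_unnormalised_eq[OF s(1)])
  then show ?thesis using D by (subst DERIV_cong_ev[OF refl _ refl]) auto
qed

lemma fbm_kernel_unnormalised_antimono:
  assumes "0 < s" "s < x" "x \<le> y"
  shows "fbm_kernel_unnormalised H y s \<le> fbm_kernel_unnormalised H x s"
proof (rule DERIV_nonpos_imp_nonincreasing[OF assms(3)])
  fix z assume "x \<le> z" "z \<le> y"
  then have "s < z" using assms by simp
  from fbm_kernel_unnormalised_deriv[OF assms(1) this] H
  show "\<exists>d. ((\<lambda>x. fbm_kernel_unnormalised H x s) has_real_derivative d) (at z) \<and> d \<le> 0"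
    by (intro exI conjI) (assumption, simp)
qed

text \<open>Comparison of two chord slopes, multiplied out, by the mean value theorem on each
  interval. In the application \<open>x\<close> is the conditioning time, so the change over
  \<open>[y, z]\<close> is at most \<open>(z - y) / (y - x)\<close> times the change over
  \<open>[x, y]\<close>.\<close>

lemma fbm_kernel_unnormalised_convex:
  assumes s: "0 < s" "s < x" and xyz: "x < y" "y \<le> z"
  shows "(fbm_kernel_unnormalised H y s - fbm_kernel_unnormalised H z s) * (y - x) \<le>
    (fbm_kernel_unnormalised H x s - fbm_kernel_unnormalised H y s) * (z - y)"
proof (cases "y = z")
  case False
  then have yz: "y < z" using xyz by simp
  let ?K = "\<lambda>t. fbm_kernel_unnormalised H t s"
  define D where "D t = (1/2 - H) * s powr (1/2 - H) * (t powr (H - 1/2) * (t - s) powr (H - 3/2))" for t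
  have "\<exists>u>x. u < y \<and> ?K y - ?K x = (y - x) * - D u"
    unfolding D_def by (rule MVT2[OF xyz(1)]) (use s in \<open>auto intro!: fbm_kernel_unnormalised_deriv\<close>)
  then obtain u where u: "x < u" "u < y" "?K y - ?K x = (y - x) * - D u" by auto
  have "\<exists>w>y. w < z \<and> ?K z - ?K y = (z - y) * - D w"
    unfolding D_def by (rule MVT2[OF yz]) (use s xyz in \<open>auto intro!: fbm_kernel_unnormalised_deriv\<close>)
  then obtain w where w: "y < w" "w < z" "?K z - ?K y = (z - y) * - D w" by auto
  have "D w \<le> D u"
    unfolding D_def using s u w H
    by (intro mult_left_mono mult_mono powr_mono2') auto
  then have "(z - y) * D w * (y - x) \<le> (y - x) * D u * (z - y)"
    using xyz yz mult_left_mono[of "D w" "D u" "(z - y) * (y - x)"] by (simp add: mult_ac)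
  moreover have "?K y - ?K z = (z - y) * D w" "?K x - ?K y = (y - x) * D u" using u(3) w(3) by auto
  ultimately show ?thesis by simp
qed simp

text \<open>Inversion of the kernel: with \<open>\<alpha> = 1/2 - H\<close> and \<open>w x = - ((x * (t - x)) powr \<alpha>)' / \<alpha>\<close>, the integral
  of \<open>w\<close> against the kernel is a multiple of \<open>v powr \<alpha>\<close>. The difference of \<open>w x * K x v\<close> and a Beta
  integrand is the derivative of \<open>- (x * (t - x) * v) powr \<alpha> * volterra_integral H x v\<close>, which vanishes at
  both ends of \<open>{v..t}\<close>.\<close>

definition inversion_weight :: "real \<Rightarrow> real \<Rightarrow> real" where
  "inversion_weight t x = (t - x) powr (-1/2 - H) * x powr (1/2 - H) - x powr (-1/2 - H) * (t - x) powr (1/2 - H)"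

lemma inversion_weight_abs_le:
  assumes "0 < x" "x < t"
  shows "\<bar>inversion_weight t x\<bar> \<le> t * (x powr (-1/2 - H) * (t - x) powr (-1/2 - H))"
proof -
  have "x powr (1/2 - H) = x * x powr (-1/2 - H)" "(t - x) powr (1/2 - H) = (t - x) * (t - x) powr (-1/2 - H)"
    using assms powr_add[of x 1 "-1/2 - H"] powr_add[of "t - x" 1 "-1/2 - H"] by (simp_all del: left_diff_distrib')
  then have "inversion_weight t x = (x - (t - x)) * (x powr (-1/2 - H) * (t - x) powr (-1/2 - H))"
    unfolding inversion_weight_def by (simp only: left_diff_distrib right_diff_distrib mult_ac)
  moreover have "\<bar>x - (t - x)\<bar> \<le> t" using assms by auto
  ultimately show ?thesis by (simp add: abs_mult mult_right_mono)
qed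

lemma inversion_weight_measurable[measurable]: "inversion_weight t \<in> borel_measurable borel"
  unfolding inversion_weight_def by measurable

lemma inversion_weight_integrable:
  assumes "0 < t"
  shows "set_integrable lborel {0<..<t} (inversion_weight t)"
proof -
  have "integrable lborel (\<lambda>x. t * (indicator {0..t} x *\<^sub>R ((x - 0) powr ((1/2 - H) - 1) * (t - x) powr ((1/2 - H) - 1))))"
    using has_bochner_integral_Beta_interval[OF assms, of "1/2 - H" "1/2 - H"] H
    by (intro integrable_mult_right) (auto dest: integrable.intros)
  then show ?thesis unfolding set_integrable_def
    by (rule Bochner_Integration.integrable_bound)
       (use inversion_weight_abs_le in \<open>auto simp: indicator_def abs_mult\<close>)
qed

lemma inversion_identity:
  assumes v: "0 < v" "v < t"
  shows "set_integrable lborel {v<..<t} (\<lambda>x. inversion_weight t x * fbm_kernel_unnormalised H x v)"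
    "(LINT x:{v<..<t}|lborel. inversion_weight t x * fbm_kernel_unnormalised H x v) =
      Beta (1/2 + H) (1/2 - H) * v powr (1/2 - H)"
proof -
  define a where "a = 1/2 - H"
  have a: "0 < a" "a < 1/2" "H = 1/2 - a" using H by (auto simp: a_def)
  let ?K = "\<lambda>x. fbm_kernel_unnormalised H x v" and ?w = "inversion_weight t"
  let ?b = "\<lambda>x. (x - v) powr ((1 - a) - 1) * (t - x) powr (a - 1)"
  define \<Psi> where "\<Psi> x = - ((t - x) powr a * x powr a * (v powr a * volterra_integral H x v))" for x
  have Psi_deriv: "(\<Psi> has_real_derivative ?w x * ?K x - v powr a * ?b x) (at x)" if x: "v < x" "x < t" for x
  proof -
    let ?I = "volterra_integral H x v"
    have "((\<lambda>x. - ((t - x) powr a * x powr a * (v powr a * volterra_integral H x v))) has_real_derivative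
       - ((- a * (t - x) powr (a - 1) * x powr a + a * x powr (a - 1) * (t - x) powr a) * (v powr a * ?I)
        + (v powr a * (x powr (H - 3/2) * (x - v) powr (H - 1/2))) * ((t - x) powr a * x powr a))) (at x)"
      using x v by (auto intro!: derivative_eq_intros volterra_integral_deriv simp: algebra_simps)
    moreover have "- ((- a * (t - x) powr (a - 1) * x powr a + a * x powr (a - 1) * (t - x) powr a) * (v powr a * ?I)
        + (v powr a * (x powr (H - 3/2) * (x - v) powr (H - 1/2))) * ((t - x) powr a * x powr a))
        = ?w x * ?K x - v powr a * ?b x"
    proof -
      define X Y where "X = x powr a" and "Y = (t - x) powr a"
      have e: "H - 3/2 = - 1 - a" "H - 1/2 = - a" "-1/2 - H = a - 1" "1/2 - H = a" by (auto simp: a(3))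
      have X: "X > 0" "x powr (a - 1) = X / x" "x powr (- 1 - a) = 1 / (x * X)" "x powr (- a) = 1 / X"
        using x v powr_diff[of x "- 1" a] powr_diff[of x a 1] powr_minus_divide[of x 1] powr_minus_divide[of x a]
        by (auto simp: X_def)
      have Y: "Y > 0" "(t - x) powr (a - 1) = Y / (t - x)"
        using x powr_diff[of "t - x" a 1] by (auto simp: Y_def)
      show ?thesis
        unfolding fbm_kernel_unnormalised_eq[OF v(1) x(1)] inversion_weight_def e X_def[symmetric] Y_def[symmetric]
          X(2-) Y(2-)
        using inversion_algebra[OF less_imp_neq[OF X(1), symmetric], of a Y "1 / (t - x)" "1 / x" "v powr a" "volterra_integral H x v" "(x - v) powr - a"]
        by simp
    qed
    ultimately show ?thesis by (simp add: \<Psi>_def[abs_def])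
  qed
  have "continuous_on {v..t} \<Psi>" unfolding \<Psi>_def
    using v a(1)
    by (intro continuous_intros continuous_on_powr' continuous_on_volterra_integral) auto
  then have "((\<lambda>x. ?w x * ?K x - v powr a * ?b x) has_integral (\<Psi> t - \<Psi> v)) {v..t}"
    using Psi_deriv v by (intro fundamental_theorem_of_calculus_interior)
      (auto simp: has_real_derivative_iff_has_vector_derivative)
  moreover have "\<Psi> t = 0" using a by (simp add: \<Psi>_def)
  moreover have "\<Psi> v = 0"
    using volterra_integral_eq(1)[OF v(1), of v] by (simp add: \<Psi>_def)
  ultimately have hk1: "((\<lambda>x. ?w x * ?K x - v powr a * ?b x) has_integral 0) {v..t}" by simp
  have B: "has_bochner_integral lborel (\<lambda>x. indicator {v..t} x *\<^sub>R ?b x) (Beta (1 - a) a)"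
    using has_bochner_integral_Beta_interval[OF v(2), of "1 - a" a] a v by simp
  have Bset: "set_integrable lborel {v..t} ?b" using B by (auto simp: set_integrable_def dest: integrable.intros)
  have Bhk: "(?b has_integral Beta (1 - a) a) {v..t}"
  proof -
    have "(LINT x:{v..t}|lborel. ?b x) = Beta (1 - a) a"
      using has_bochner_integral_integral_eq[OF B] by (simp add: set_lebesgue_integral_def)
    then show ?thesis using set_borel_integral_eq_integral[OF Bset] by (metis integrable_integral)
  qed
  have "((\<lambda>x. (?w x * ?K x - v powr a * ?b x) + v powr a * ?b x) has_integral (0 + v powr a * Beta (1 - a) a)) {v..t}"
    by (intro has_integral_add hk1 has_integral_mult_right Bhk)
  then have hk: "((\<lambda>x. ?w x * ?K x) has_integral (v powr a * Beta (1 - a) a)) {v..t}" by simp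
  \<comment> \<open>The fundamental theorem gives only a gauge integral; absolute integrability
    needs a majorant. \<open>?b\<close> carries both singularities, that of the kernel at
    \<open>v\<close> and that of the weight at \<open>t\<close>, and \<open>C\<close> collects the
    bounded factors.\<close>
  define C where "C = t * v powr (a - 1) * (1 + v powr a * a * volterra_integral H t v * (t - v) powr a)"
  have bound: "\<bar>?w x * ?K x\<bar> \<le> C * ?b x" if x: "v < x" "x < t" for x
  proof -
    have wle: "\<bar>?w x\<bar> \<le> t * (v powr (a - 1) * (t - x) powr (a - 1))"
    proof -
      have "\<bar>?w x\<bar> \<le> t * (x powr (a - 1) * (t - x) powr (a - 1))"
        using inversion_weight_abs_le[of x t] x v by (simp add: a(3))
      also have "\<dots> \<le> t * (v powr (a - 1) * (t - x) powr (a - 1))"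
        using x v a by (intro mult_left_mono mult_right_mono powr_mono2') auto
      finally show ?thesis .
    qed
    have "?K x = (v powr a * x powr (- a)) * (x - v) powr (- a) + v powr a * a * volterra_integral H x v"
      unfolding fbm_kernel_unnormalised_eq[OF v(1) x(1)] by (simp add: a(3) algebra_simps)
    also have "\<dots> \<le> 1 * (x - v) powr (- a) + v powr a * a * volterra_integral H t v"
    proof (intro add_mono mult_right_mono mult_left_mono)
      have "v powr a \<le> x powr a" using x v a by (intro powr_mono2) auto
      then have "v powr a * x powr (- a) \<le> x powr a * x powr (- a)" by (rule mult_right_mono) simp
      then show "v powr a * x powr (- a) \<le> 1" using x v by (simp flip: powr_add)
      show "volterra_integral H x v \<le> volterra_integral H t v" using x v by (intro volterra_integral_mono) auto
    qed (use a in auto)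
    also have "\<dots> \<le> (1 + v powr a * a * volterra_integral H t v * (t - v) powr a) * (x - v) powr (- a)"
    proof -
      have "(x - v) powr a \<le> (t - v) powr a" using x a by (intro powr_mono2) auto
      then have "(x - v) powr a * (x - v) powr (- a) \<le> (t - v) powr a * (x - v) powr (- a)" by (rule mult_right_mono) simp
      then have "1 \<le> (t - v) powr a * (x - v) powr (- a)" using x by (simp flip: powr_add)
      then have "v powr a * a * volterra_integral H t v * 1 \<le> v powr a * a * volterra_integral H t v * ((t - v) powr a * (x - v) powr (- a))"
        using a volterra_integral_nonneg by (intro mult_left_mono) auto
      then show ?thesis by (simp add: algebra_simps)
    qed
    finally have Kle: "?K x \<le> (1 + v powr a * a * volterra_integral H t v * (t - v) powr a) * (x - v) powr (- a)" .
    have "\<bar>?w x\<bar> * ?K x \<le> (t * (v powr (a - 1) * (t - x) powr (a - 1))) *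
       ((1 + v powr a * a * volterra_integral H t v * (t - v) powr a) * (x - v) powr (- a))"
      by (rule mult_mono[OF wle Kle]) (use v x fbm_kernel_unnormalised_nonneg in auto)
    then show ?thesis
      using fbm_kernel_unnormalised_nonneg[OF v(1) x(1)] by (simp add: C_def abs_mult mult_ac)
  qed
  have Kmeas: "set_borel_measurable lborel {v<..<t} (\<lambda>x. ?w x * ?K x)"
  proof -
    have "continuous_on {v<..<t} (\<lambda>x. ?w x * ?K x)"
      unfolding inversion_weight_def
      using v by (intro continuous_intros continuous_at_imp_continuous_on ballI DERIV_isCont[OF fbm_kernel_unnormalised_deriv]) auto
    from borel_measurable_continuous_on_indicator[OF _ this]
    show ?thesis by (simp add: set_borel_measurable_def)
  qed
  have int: "set_integrable lborel {v<..<t} (\<lambda>x. ?w x * ?K x)"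
    unfolding set_integrable_def
  proof (rule Bochner_Integration.integrable_bound)
    show "integrable lborel (\<lambda>x. C * (indicator {v..t} x *\<^sub>R ?b x))"
      using Bset by (auto simp: set_integrable_def)
    show "(\<lambda>x. indicator {v<..<t} x *\<^sub>R (?w x * ?K x)) \<in> borel_measurable lborel"
      using Kmeas by (simp add: set_borel_measurable_def)
    show "AE x in lborel. norm (indicator {v<..<t} x *\<^sub>R (?w x * ?K x)) \<le> norm (C * (indicator {v..t} x *\<^sub>R ?b x))"
    proof (rule AE_I2)
      fix x
      show "norm (indicator {v<..<t} x *\<^sub>R (?w x * ?K x)) \<le> norm (C * (indicator {v..t} x *\<^sub>R ?b x))"
      proof (cases "v < x \<and> x < t")
        case True
        then have "\<bar>?w x * ?K x\<bar> \<le> \<bar>C * ?b x\<bar>" using bound[of x] by linarith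
        then show ?thesis using True by simp
      qed simp
    qed
  qed
  then show "set_integrable lborel {v<..<t} (\<lambda>x. ?w x * ?K x)" .
  have "((\<lambda>x. ?w x * ?K x) has_integral (v powr a * Beta (1 - a) a)) {v<..<t}"
    using hk by (simp add: has_integral_Icc_iff_Ioo)
  then show "(LINT x:{v<..<t}|lborel. ?w x * ?K x) = Beta (1/2 + H) (1/2 - H) * v powr (1/2 - H)"
    using set_borel_integral_eq_integral(2)[OF int] by (simp add: integral_unique a(3) add.commute)
qed

end

lemma sum_Un_combine:
  fixes f :: "'a \<Rightarrow> real"
  assumes "finite Q" "finite R"
  shows "(\<Sum>q\<in>Q \<union> R. ((if q \<in> Q then a q else 0) + (if q \<in> R then b q else 0)) * f q) =
    (\<Sum>q\<in>Q. a q * f q) + (\<Sum>q\<in>R. b q * f q)"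
proof -
  have "(\<Sum>q\<in>Q \<union> R. ((if q \<in> Q then a q else 0) + (if q \<in> R then b q else 0)) * f q) =
      (\<Sum>q\<in>Q \<union> R. if q \<in> Q then a q * f q else 0) + (\<Sum>q\<in>Q \<union> R. if q \<in> R then b q * f q else 0)"
    unfolding sum.distrib[symmetric] by (intro sum.cong) (auto simp: algebra_simps)
  also have "\<dots> = (\<Sum>q\<in>Q. a q * f q) + (\<Sum>q\<in>R. b q * f q)"
    using assms by (simp add: sum.If_cases Int_absorb1 Int_absorb2 Un_Int_distrib)
  finally show ?thesis .
qed

section \<open>Closed linear spans in the space of square-integrable functions\<close>

definition L2_span :: "(real \<Rightarrow> real \<Rightarrow> real) \<Rightarrow> (real \<Rightarrow> real) \<Rightarrow> bool" where
  "L2_span k \<phi> \<longleftrightarrow> square_integrable lborel \<phi> \<and>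
     (\<forall>\<epsilon>>0. \<exists>Q a. finite Q \<and> Q \<subseteq> {0..1} \<and> (LINT v|lborel. (\<phi> v - (\<Sum>q\<in>Q. a q * k q v))\<^sup>2) < \<epsilon>)"

locale square_integrable_family =
  fixes k :: "real \<Rightarrow> real \<Rightarrow> real"
  assumes k_square_integrable: "q \<in> {0..1} \<Longrightarrow> square_integrable lborel (k q)"
begin

lemma combination_square_integrable:
  "Q \<subseteq> {0..1} \<Longrightarrow> square_integrable lborel (\<lambda>v. \<Sum>q\<in>Q. a q * k q v)"
  by (intro square_integrable_sum square_integrable_cmult k_square_integrable) auto

lemma L2_span_combination:
  assumes "finite Q" "Q \<subseteq> {0..1}"
  shows "L2_span k (\<lambda>v. \<Sum>q\<in>Q. a q * k q v)"
  unfolding L2_span_def using assms combination_square_integrable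
  by (auto intro!: exI[of _ Q] exI[of _ a])

lemma L2_span_limit:
  assumes \<phi>: "square_integrable lborel \<phi>"
    and lim: "\<And>\<epsilon>. 0 < \<epsilon> \<Longrightarrow> \<exists>g. L2_span k g \<and> (LINT v|lborel. (\<phi> v - g v)\<^sup>2) < \<epsilon>"
  shows "L2_span k \<phi>"
  unfolding L2_span_def
proof (intro conjI allI impI \<phi>)
  fix \<epsilon> :: real assume "0 < \<epsilon>"
  then obtain g where g: "L2_span k g" "(LINT v|lborel. (\<phi> v - g v)\<^sup>2) < \<epsilon> / 4"
    using lim[of "\<epsilon> / 4"] by auto
  from g(1) \<open>0 < \<epsilon>\<close> obtain Q a where Q: "finite Q" "Q \<subseteq> {0..1}"
      "(LINT v|lborel. (g v - (\<Sum>q\<in>Q. a q * k q v))\<^sup>2) < \<epsilon> / 4"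
    unfolding L2_span_def by (meson divide_pos_pos zero_less_numeral)
  have gs: "square_integrable lborel g" using g(1) by (simp add: L2_span_def)
  have "(LINT v|lborel. ((\<phi> v - g v) + (g v - (\<Sum>q\<in>Q. a q * k q v)))\<^sup>2) \<le>
      2 * (LINT v|lborel. (\<phi> v - g v)\<^sup>2) + 2 * (LINT v|lborel. (g v - (\<Sum>q\<in>Q. a q * k q v))\<^sup>2)"
    by (intro integral_power2_sum_le square_integrable_diff \<phi> gs combination_square_integrable Q)
  also have "\<dots> < \<epsilon>" using g(2) Q(3) by simp
  finally show "\<exists>Q a. finite Q \<and> Q \<subseteq> {0..1} \<and> (LINT v|lborel. (\<phi> v - (\<Sum>q\<in>Q. a q * k q v))\<^sup>2) < \<epsilon>"
    using Q(1,2) by (intro exI[of _ Q] exI[of _ a]) simp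
qed

lemma L2_span_add:
  assumes f: "L2_span k f" and g: "L2_span k g"
  shows "L2_span k (\<lambda>v. f v + g v)"
proof (rule L2_span_limit)
  have fs: "square_integrable lborel f" and gs: "square_integrable lborel g"
    using f g by (auto simp: L2_span_def)
  then show "square_integrable lborel (\<lambda>v. f v + g v)" by (rule square_integrable_add)
  fix \<epsilon> :: real assume "0 < \<epsilon>"
  then have e4: "0 < \<epsilon> / 4" by simp
  from f e4 obtain Q a where Q: "finite Q" "Q \<subseteq> {0..1}"
      "(LINT v|lborel. (f v - (\<Sum>q\<in>Q. a q * k q v))\<^sup>2) < \<epsilon> / 4"
    unfolding L2_span_def by meson
  from g e4 obtain R b where R: "finite R" "R \<subseteq> {0..1}"
      "(LINT v|lborel. (g v - (\<Sum>q\<in>R. b q * k q v))\<^sup>2) < \<epsilon> / 4"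
    unfolding L2_span_def by meson
  define c where "c q = (if q \<in> Q then a q else 0) + (if q \<in> R then b q else 0)" for q
  have c: "(\<Sum>q\<in>Q \<union> R. c q * k q v) = (\<Sum>q\<in>Q. a q * k q v) + (\<Sum>q\<in>R. b q * k q v)" for v
    unfolding c_def by (rule sum_Un_combine[OF Q(1) R(1)])
  have "(LINT v|lborel. ((f v - (\<Sum>q\<in>Q. a q * k q v)) + (g v - (\<Sum>q\<in>R. b q * k q v)))\<^sup>2) \<le>
      2 * (LINT v|lborel. (f v - (\<Sum>q\<in>Q. a q * k q v))\<^sup>2) + 2 * (LINT v|lborel. (g v - (\<Sum>q\<in>R. b q * k q v))\<^sup>2)"
    by (intro integral_power2_sum_le square_integrable_diff fs gs combination_square_integrable Q R)
  also have "\<dots> < \<epsilon>" using Q(3) R(3) by simp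
  finally have "(LINT v|lborel. (f v + g v - (\<Sum>q\<in>Q \<union> R. c q * k q v))\<^sup>2) < \<epsilon>"
    unfolding c by (simp add: algebra_simps)
  then show "\<exists>h. L2_span k h \<and> (LINT v|lborel. (f v + g v - h v)\<^sup>2) < \<epsilon>"
    using L2_span_combination[of "Q \<union> R" c] Q R by auto
qed

lemma L2_span_cmult:
  assumes f: "L2_span k f"
  shows "L2_span k (\<lambda>v. c * f v)"
proof (cases "c = 0")
  case True
  then show ?thesis using L2_span_combination[of "{}" "\<lambda>_. 0"] by simp
next
  case False
  have fs: "square_integrable lborel f" using f by (auto simp: L2_span_def)
  show ?thesis
  proof (rule L2_span_limit)
    show "square_integrable lborel (\<lambda>v. c * f v)" using fs by (rule square_integrable_cmult)
    fix \<epsilon> :: real assume "0 < \<epsilon>"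
    then have e: "0 < \<epsilon> / c\<^sup>2" using False by simp
    from f e obtain Q a where Q: "finite Q" "Q \<subseteq> {0..1}"
        "(LINT v|lborel. (f v - (\<Sum>q\<in>Q. a q * k q v))\<^sup>2) < \<epsilon> / c\<^sup>2"
      unfolding L2_span_def by meson
    have "(c * f v - (\<Sum>q\<in>Q. (c * a q) * k q v))\<^sup>2 = c\<^sup>2 * (f v - (\<Sum>q\<in>Q. a q * k q v))\<^sup>2" for v
    proof -
      have "c * f v - (\<Sum>q\<in>Q. (c * a q) * k q v) = c * (f v - (\<Sum>q\<in>Q. a q * k q v))"
        by (simp add: sum_distrib_left right_diff_distrib mult.assoc)
      then show ?thesis by (simp add: power_mult_distrib)
    qed
    then have "(LINT v|lborel. (c * f v - (\<Sum>q\<in>Q. (c * a q) * k q v))\<^sup>2) < \<epsilon>"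
      using Q(3) False by (simp add: field_simps)
    then show "\<exists>h. L2_span k h \<and> (LINT v|lborel. (c * f v - h v)\<^sup>2) < \<epsilon>"
      using L2_span_combination[OF Q(1,2), of "\<lambda>q. c * a q"] by auto
  qed
qed

lemma L2_span_diff:
  assumes "L2_span k f" "L2_span k g"
  shows "L2_span k (\<lambda>v. f v - g v)"
  using L2_span_add[OF assms(1) L2_span_cmult[OF assms(2), of "-1"]] by simp

lemma L2_span_sum:
  assumes "\<And>i. i \<in> I \<Longrightarrow> L2_span k (f i)"
  shows "L2_span k (\<lambda>v. \<Sum>i\<in>I. f i v)"
  using assms
proof (induction I rule: infinite_finite_induct)
  case (insert x F)
  then show ?case using L2_span_add[of "f x" "\<lambda>v. \<Sum>i\<in>F. f i v"] by simp
qed (use L2_span_combination[of "{}" "\<lambda>_. 0"] in auto)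

text \<open>Riemann sums of \<open>\<integral> w x * k x dx\<close> converge in \<open>L\<^sup>2\<close> when \<open>x \<mapsto> k x\<close> is Hoelder continuous into \<open>L\<^sup>2\<close>.\<close>

lemma L2_span_integral:
  assumes k_meas: "(\<lambda>(x, v). k x v) \<in> borel_measurable (borel \<Otimes>\<^sub>M borel)"
    and k_diff: "\<And>x y. x \<in> {0..1} \<Longrightarrow> y \<in> {0..1} \<Longrightarrow> (LINT v|lborel. (k x v - k y v)\<^sup>2) \<le> \<bar>x - y\<bar> powr r"
    and r: "0 < r" and t: "0 < t" "t \<le> 1"
    and w[measurable]: "w \<in> borel_measurable borel" and w_int: "set_integrable lborel {0<..<t} w"
    and int: "\<And>v. set_integrable lborel {0<..<t} (\<lambda>x. w x * k x v)"
    and \<phi>: "\<And>v. \<phi> v = (LINT x:{0<..<t}|lborel. w x * k x v)"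
    and \<phi>_meas[measurable]: "\<phi> \<in> borel_measurable borel"
  shows "L2_span k \<phi>"
proof -
  note [measurable] = k_meas[THEN measurable_Pair_compose_split]
  define u where "u x = \<bar>indicator {0<..<t} x * w x\<bar>" for x
  have u_meas[measurable]: "u \<in> borel_measurable borel" unfolding u_def by measurable
  have u_int: "integrable lborel u" unfolding u_def
    using w_int by (intro integrable_abs) (simp add: set_integrable_def)
  define W where "W = (LINT x|lborel. u x)"
  have W0: "0 \<le> W" unfolding W_def by (simp add: u_def)
  have nnW: "(\<integral>\<^sup>+x. ennreal (u x) \<partial>lborel) = ennreal W"
    unfolding W_def by (rule nn_integral_eq_integral[OF u_int]) (simp add: u_def)
  \<comment> \<open>Rounding up keeps the nodes \<open>i / n\<close> with
    \<open>1 \<le> i \<le> n\<close> in the unit interval, even if the last one lies beyond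
    \<open>t\<close>.\<close>
  define g :: "nat \<Rightarrow> real \<Rightarrow> real" where "g n x = of_int \<lceil>real n * x\<rceil> / real n" for n x
  define s where "s n v = (\<Sum>q\<in>(\<lambda>i. real i / real n) ` {1..n}. (LINT x:{0<..<t} \<inter> {x. g n x = q}|lborel. w x) * k q v)" for n v
  have g_meas[measurable]: "g n \<in> borel_measurable borel" for n unfolding g_def by measurable
  have g: "g n x \<in> (\<lambda>i. real i / real n) ` {1..n}" "\<bar>x - g n x\<bar> \<le> 1 / real n" if "x \<in> {0<..<t}" "1 \<le> n" for n x
  proof -
    have nx: "0 < real n * x" "real n * x \<le> real n" using that t by auto
    then have c: "1 \<le> \<lceil>real n * x\<rceil>" "\<lceil>real n * x\<rceil> \<le> int n" by (auto simp: ceiling_le_iff le_ceiling_iff)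
    have "g n x = real (nat \<lceil>real n * x\<rceil>) / real n" unfolding g_def using c by simp
    then show "g n x \<in> (\<lambda>i. real i / real n) ` {1..n}"
    proof (rule image_eqI)
      show "nat \<lceil>real n * x\<rceil> \<in> {1..n}" using c by (simp only: atLeastAtMost_iff) linarith
    qed
    have "\<bar>real n * x - of_int \<lceil>real n * x\<rceil>\<bar> \<le> 1" by linarith
    then have "\<bar>real n * x - of_int \<lceil>real n * x\<rceil>\<bar> / real n \<le> 1 / real n" by (intro divide_right_mono) auto
    moreover have "x - g n x = (real n * x - of_int \<lceil>real n * x\<rceil>) / real n" using that by (simp add: g_def field_simps)
    ultimately show "\<bar>x - g n x\<bar> \<le> 1 / real n" by (simp add: abs_divide)
  qed
  have g01: "g n x \<in> {0..1}" if "x \<in> {0<..<t}" "1 \<le> n" for n x using g(1)[OF that] by auto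
  have Q01: "(\<lambda>i. real i / real n) ` {1..n} \<subseteq> {0..1}" for n by auto
  have s_eq: "has_bochner_integral lborel (\<lambda>x. indicator {0<..<t} x * (w x * k (g n x) v)) (s n v)" if n: "1 \<le> n" for n v
  proof -
    have "has_bochner_integral lborel (\<lambda>x. \<Sum>q\<in>(\<lambda>i. real i / real n) ` {1..n}. (indicator ({0<..<t} \<inter> {x. g n x = q}) x * w x) * k q v) (s n v)"
      unfolding s_def
    proof (intro has_bochner_integral_sum has_bochner_integral_mult_left)
      fix q
      have "set_integrable lborel ({0<..<t} \<inter> {x. g n x = q}) w"
        by (rule set_integrable_subset[OF w_int]) auto
      then show "has_bochner_integral lborel (\<lambda>x. indicator ({0<..<t} \<inter> {x. g n x = q}) x * w x) (LINT x:{0<..<t} \<inter> {x. g n x = q}|lborel. w x)"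
        by (simp add: has_bochner_integral_iff set_integrable_def set_lebesgue_integral_def)
    qed
    moreover have "(\<Sum>q\<in>(\<lambda>i. real i / real n) ` {1..n}. (indicator ({0<..<t} \<inter> {x. g n x = q}) x * w x) * k q v) = indicator {0<..<t} x * (w x * k (g n x) v)" for x
    proof (cases "x \<in> {0<..<t}")
      case True
      have "(\<Sum>q\<in>(\<lambda>i. real i / real n) ` {1..n}. (indicator ({0<..<t} \<inter> {x. g n x = q}) x * w x) * k q v) =
          (\<Sum>q\<in>(\<lambda>i. real i / real n) ` {1..n}. if g n x = q then w x * k q v else 0)"
        using True by (intro sum.cong) (auto simp: indicator_def)
      also have "\<dots> = w x * k (g n x) v" using g(1)[OF True n] by (subst sum.delta') auto
      finally show ?thesis using True by simp
    qed (auto intro!: sum.neutral simp: indicator_def)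
    ultimately show ?thesis by simp
  qed
  have s_span: "L2_span k (s n)" for n unfolding s_def using Q01 by (intro L2_span_combination) auto
  have [measurable]: "s n \<in> borel_measurable borel" for n
    using s_span[of n] by (simp add: L2_span_def square_integrable_def)
  have pointwise: "ennreal ((\<phi> v - s n v)\<^sup>2) \<le> ennreal W * (\<integral>\<^sup>+x. ennreal (u x * (k x v - k (g n x) v)\<^sup>2) \<partial>lborel)"
    if n: "1 \<le> n" for n v
  proof -
    have "has_bochner_integral lborel (\<lambda>x. indicator {0<..<t} x * (w x * k x v)) (\<phi> v)"
      using int[of v] \<phi>[of v] by (simp add: has_bochner_integral_iff set_integrable_def set_lebesgue_integral_def)
    from has_bochner_integral_diff[OF this s_eq[OF n]]
    have D: "has_bochner_integral lborel (\<lambda>x. indicator {0<..<t} x * w x * (k x v - k (g n x) v)) (\<phi> v - s n v)"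
      by (simp add: algebra_simps)
    have "ennreal \<bar>\<phi> v - s n v\<bar> \<le> (\<integral>\<^sup>+x. ennreal (norm (indicator {0<..<t} x * w x * (k x v - k (g n x) v))) \<partial>lborel)"
      using integral_norm_bound_ennreal[OF integrable.intros[OF D]] has_bochner_integral_integral_eq[OF D] by simp
    \<comment> \<open>The weight is split into two square roots, that is, Cauchy-Schwarz is used for
      the finite measure with density \<open>u\<close>. The weight of the application is integrable
      but not square-integrable.\<close>
    also have "\<dots> = (\<integral>\<^sup>+x. ennreal (sqrt (u x)) * ennreal (sqrt (u x) * \<bar>k x v - k (g n x) v\<bar>) \<partial>lborel)"
    proof (intro nn_integral_cong)
      fix x
      have u0: "0 \<le> u x" by (simp add: u_def)
      then have "norm (indicator {0<..<t} x * w x * (k x v - k (g n x) v)) = sqrt (u x) * (sqrt (u x) * \<bar>k x v - k (g n x) v\<bar>)"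
        by (simp add: abs_mult u_def flip: mult.assoc)
      then show "ennreal (norm (indicator {0<..<t} x * w x * (k x v - k (g n x) v))) = ennreal (sqrt (u x)) * ennreal (sqrt (u x) * \<bar>k x v - k (g n x) v\<bar>)"
        using u0 by (simp add: ennreal_mult)
    qed
    finally have "(ennreal \<bar>\<phi> v - s n v\<bar>)\<^sup>2 \<le> (\<integral>\<^sup>+x. ennreal (sqrt (u x)) * ennreal (sqrt (u x) * \<bar>k x v - k (g n x) v\<bar>) \<partial>lborel)\<^sup>2"
      by (rule power_mono) simp
    also have "\<dots> \<le> (\<integral>\<^sup>+x. (ennreal (sqrt (u x)))\<^sup>2 \<partial>lborel) * (\<integral>\<^sup>+x. (ennreal (sqrt (u x) * \<bar>k x v - k (g n x) v\<bar>))\<^sup>2 \<partial>lborel)"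
      by (rule Cauchy_Schwarz_nn_integral) measurable
    also have "(\<integral>\<^sup>+x. (ennreal (sqrt (u x)))\<^sup>2 \<partial>lborel) = ennreal W"
      unfolding nnW[symmetric] by (intro nn_integral_cong) (simp add: ennreal_power u_def)
    also have "(\<integral>\<^sup>+x. (ennreal (sqrt (u x) * \<bar>k x v - k (g n x) v\<bar>))\<^sup>2 \<partial>lborel) = (\<integral>\<^sup>+x. ennreal (u x * (k x v - k (g n x) v)\<^sup>2) \<partial>lborel)"
      by (intro nn_integral_cong) (simp add: ennreal_power power_mult_distrib u_def)
    finally show ?thesis by (simp add: ennreal_power)
  qed
  have bound: "(\<integral>\<^sup>+v. ennreal ((\<phi> v - s n v)\<^sup>2) \<partial>lborel) \<le> ennreal (W * (W * (1 / real n) powr r))" if n: "1 \<le> n" for n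
  proof -
    have "(\<integral>\<^sup>+v. ennreal ((\<phi> v - s n v)\<^sup>2) \<partial>lborel) \<le> (\<integral>\<^sup>+v. ennreal W * (\<integral>\<^sup>+x. ennreal (u x * (k x v - k (g n x) v)\<^sup>2) \<partial>lborel) \<partial>lborel)"
      by (intro nn_integral_mono pointwise n)
    also have "\<dots> = ennreal W * (\<integral>\<^sup>+v. (\<integral>\<^sup>+x. ennreal (u x * (k x v - k (g n x) v)\<^sup>2) \<partial>lborel) \<partial>lborel)"
      by (rule nn_integral_cmult) measurable
    also have "(\<integral>\<^sup>+v. (\<integral>\<^sup>+x. ennreal (u x * (k x v - k (g n x) v)\<^sup>2) \<partial>lborel) \<partial>lborel) =
       (\<integral>\<^sup>+x. (\<integral>\<^sup>+v. ennreal (u x * (k x v - k (g n x) v)\<^sup>2) \<partial>lborel) \<partial>lborel)"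
      by (rule lborel_pair.Fubini') measurable
    also have "\<dots> \<le> (\<integral>\<^sup>+x. ennreal (u x) * ennreal ((1 / real n) powr r) \<partial>lborel)"
    proof (rule nn_integral_mono)
      fix x :: real
      show "(\<integral>\<^sup>+v. ennreal (u x * (k x v - k (g n x) v)\<^sup>2) \<partial>lborel) \<le> ennreal (u x) * ennreal ((1 / real n) powr r)"
      proof (cases "x \<in> {0<..<t}")
        case True
        then have x01: "x \<in> {0..1}" using t by auto
        have sq: "integrable lborel (\<lambda>v. (k x v - k (g n x) v)\<^sup>2)"
          using square_integrable_diff[OF k_square_integrable[OF x01] k_square_integrable[OF g01[OF True n]]]
          by (simp add: square_integrable_def)
        have "(\<integral>\<^sup>+v. ennreal (u x * (k x v - k (g n x) v)\<^sup>2) \<partial>lborel) = ennreal (u x) * (\<integral>\<^sup>+v. ennreal ((k x v - k (g n x) v)\<^sup>2) \<partial>lborel)"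
          using sq by (subst nn_integral_cmult[symmetric]) (auto simp: ennreal_mult u_def dest: borel_measurable_integrable)
        also have "(\<integral>\<^sup>+v. ennreal ((k x v - k (g n x) v)\<^sup>2) \<partial>lborel) = ennreal (LINT v|lborel. (k x v - k (g n x) v)\<^sup>2)"
          by (rule nn_integral_eq_integral[OF sq]) simp
        also have "(LINT v|lborel. (k x v - k (g n x) v)\<^sup>2) \<le> (1 / real n) powr r"
          using order_trans[OF k_diff[OF x01 g01[OF True n]] powr_mono2[OF _ _ g(2)[OF True n]]] r by simp
        finally show ?thesis by (simp add: mult_left_mono ennreal_leI)
      qed (simp add: u_def)
    qed
    also have "\<dots> = ennreal W * ennreal ((1 / real n) powr r)" by (simp add: nn_integral_multc nnW)
    finally show ?thesis using W0 by (simp add: ennreal_mult mult_left_mono)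
  qed
  have sq_diff: "square_integrable lborel (\<lambda>v. \<phi> v - s n v)" if "1 \<le> n" for n
  proof -
    have "integrable lborel (\<lambda>v. (\<phi> v - s n v)\<^sup>2)"
      using bound[OF that] by (intro integrableI_nonneg) (auto intro: le_less_trans)
    then show ?thesis by (simp add: square_integrable_def)
  qed
  show ?thesis
  proof (rule L2_span_limit)
    have "square_integrable lborel (s 1)" using s_span[of 1] by (simp add: L2_span_def)
    from square_integrable_add[OF sq_diff[of 1] this] show "square_integrable lborel \<phi>" by simp
    fix \<epsilon> :: real assume e: "0 < \<epsilon>"
    have "(\<lambda>n. W * (W * (1 / real n) powr r)) \<longlonglongrightarrow> W * (W * 0)"
    proof (intro tendsto_mult_left)
      have "(\<lambda>n. (1 / real n) powr r) \<longlonglongrightarrow> 0 powr r"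
        by (rule tendsto_powr2[OF lim_1_over_n tendsto_const]) (use r in auto)
      then show "(\<lambda>n. (1 / real n) powr r) \<longlonglongrightarrow> 0" by simp
    qed
    then have "eventually (\<lambda>n. W * (W * (1 / real n) powr r) < \<epsilon>) sequentially"
      using e by (intro order_tendstoD) auto
    then have "eventually (\<lambda>n. 1 \<le> n \<and> W * (W * (1 / real n) powr r) < \<epsilon>) sequentially"
      using eventually_ge_at_top[of 1] by eventually_elim simp
    then obtain n where n: "1 \<le> n" "W * (W * (1 / real n) powr r) < \<epsilon>"
      by (auto dest: eventually_happens)
    have "ennreal (LINT v|lborel. (\<phi> v - s n v)\<^sup>2) \<le> ennreal (W * (W * (1 / real n) powr r))"
      using bound[OF n(1)] sq_diff[OF n(1)] by (simp add: nn_integral_eq_integral square_integrable_def)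
    then have "(LINT v|lborel. (\<phi> v - s n v)\<^sup>2) < \<epsilon>" using n(2) W0 by simp
    then show "\<exists>h. L2_span k h \<and> (LINT v|lborel. (\<phi> v - h v)\<^sup>2) < \<epsilon>" using s_span by blast
  qed
qed

text \<open>Differences of the given functions are \<open>v powr a\<close> on short intervals. There
  the power is nearly constant and can be divided by its value at the right end; adding the pieces
  approximates the indicator of \<open>[b, t)\<close>. Staying above \<open>b > 0\<close> keeps the
  relative oscillation small, and \<open>b\<close> tends to 0 afterwards.\<close>

lemma L2_span_indicator:
  assumes a: "0 < a" "a < 1" and t: "0 < t" "t \<le> 1"
    and \<phi>: "\<And>t. 0 < t \<Longrightarrow> t \<le> 1 \<Longrightarrow> L2_span k (\<lambda>v. indicator {0<..<t} v * v powr a)"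
  shows "L2_span k (indicator {0<..<t})"
proof -
  have partial: "L2_span k (indicator {b..<t})" if b: "0 < b" "b < t" for b
  proof (rule L2_span_limit)
    have "integrable lborel (indicator {b..<t} :: real \<Rightarrow> real)"
      using b by (simp add: integrable_indicator_iff)
    moreover have "(indicator {b..<t} v :: real)\<^sup>2 = indicator {b..<t} v" for v :: real by (simp add: indicator_def)
    ultimately show sqi: "square_integrable lborel (indicator {b..<t})" by (simp add: square_integrable_def)
    fix \<epsilon> :: real assume e: "0 < \<epsilon>"
    have "(\<lambda>n. ((t - b) * (1 / real n) / b)\<^sup>2 * (t - b)) \<longlonglongrightarrow> ((t - b) * 0 / b)\<^sup>2 * (t - b)"
      using b by (intro tendsto_intros lim_1_over_n) auto
    then have "eventually (\<lambda>n. ((t - b) * (1 / real n) / b)\<^sup>2 * (t - b) < \<epsilon>) sequentially"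
      using e by (intro order_tendstoD) auto
    then have "eventually (\<lambda>n. 1 \<le> n \<and> ((t - b) * (1 / real n) / b)\<^sup>2 * (t - b) < \<epsilon>) sequentially"
      using eventually_ge_at_top[of 1] by eventually_elim simp
    then obtain n where n: "1 \<le> n" "((t - b) * (1 / real n) / b)\<^sup>2 * (t - b) < \<epsilon>"
      by (auto dest: eventually_happens)
    \<comment> \<open>The mesh divided by \<open>b\<close>. It bounds the relative oscillation on
      one interval because \<open>a < 1\<close> gives \<open>y \<le> y powr a\<close> for
      \<open>y\<close> in the unit interval.\<close>
    define d where "d = (t - b) * (1 / real n) / b"
    define x where "x i = b + (t - b) * (real i / real n)" for i
    define ch :: "nat \<Rightarrow> real \<Rightarrow> real" where "ch i = indicator {0<..<x i}" for i
    have x0: "x 0 = b" "x n = t" using n by (auto simp: x_def)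
    have xb: "b \<le> x i" "0 < x i" for i using b by (auto simp: x_def intro: add_pos_nonneg)
    have xt: "x i \<le> 1" if "i \<le> n" for i
    proof -
      have "(t - b) * (real i / real n) \<le> (t - b) * 1" using that b n by (intro mult_left_mono) auto
      then show ?thesis using t by (simp add: x_def)
    qed
    have xS: "x (Suc i) - x i = (t - b) * (1 / real n)" for i by (simp add: x_def field_simps add_divide_distrib)
    have x_less: "x i < x (Suc i)" for i
    proof -
      have "0 < (t - b) * (1 / real n)" using b n by simp
      then show ?thesis using xS[of i] by linarith
    qed
    define g where "g v = (\<Sum>i<n. x (Suc i) powr (- a) * (indicator {0<..<x (Suc i)} v * v powr a - indicator {0<..<x i} v * v powr a))" for v
    have "L2_span k g" unfolding g_def
      using xb xt by (intro L2_span_sum L2_span_cmult L2_span_diff \<phi>) (auto simp: Suc_le_eq less_imp_le)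
    have tele: "indicator {b..<t} v = (\<Sum>i<n. ch (Suc i) v - ch i v)" for v
    proof -
      have "indicator {b..<t} v = ch n v - ch 0 v" using b by (auto simp: ch_def x0 indicator_def)
      then show ?thesis using sum_lessThan_telescope[of "\<lambda>i. ch i v" n] by simp
    qed
    have diff0: "0 \<le> ch (Suc i) v - ch i v" for i v
      using x_less[of i] by (auto simp: ch_def indicator_def)
    have g': "indicator {b..<t} v - g v = (\<Sum>i<n. (1 - x (Suc i) powr (- a) * v powr a) * (ch (Suc i) v - ch i v))" for v
      unfolding tele g_def ch_def sum_subtractf[symmetric] by (intro sum.cong refl) (simp add: algebra_simps)
    have termle: "\<bar>(1 - x (Suc i) powr (- a) * v powr a) * (ch (Suc i) v - ch i v)\<bar> \<le> d * (ch (Suc i) v - ch i v)" for i v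
    proof (cases "x i \<le> v \<and> v < x (Suc i)")
      case True
      have v: "0 < v" "v \<le> x (Suc i)" using True xb[of i] by auto
      have "x (Suc i) powr (- a) * v powr a = (v / x (Suc i)) powr a"
        using v xb[of "Suc i"] by (simp add: powr_divide powr_minus field_simps)
      moreover have "(v / x (Suc i)) powr a \<le> 1" using v xb[of "Suc i"] a by (simp add: powr_le1)
      moreover have "v / x (Suc i) \<le> (v / x (Suc i)) powr a"
        using powr_mono'[of a 1 "v / x (Suc i)"] v xb[of "Suc i"] a by simp
      moreover have "1 - v / x (Suc i) \<le> d"
      proof -
        have "1 - v / x (Suc i) = (x (Suc i) - v) / x (Suc i)" using xb[of "Suc i"] by (simp add: field_simps)
        also have "\<dots> \<le> (x (Suc i) - x i) / b"
          using True xb[of "Suc i"] b by (intro frac_le) auto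
        finally show ?thesis by (simp add: xS d_def)
      qed
      ultimately have "\<bar>1 - x (Suc i) powr (- a) * v powr a\<bar> \<le> d" by linarith
      then show ?thesis using diff0[of i v] by (simp add: abs_mult mult_right_mono)
    next
      case False
      then have "ch (Suc i) v - ch i v = 0" using x_less[of i] xb[of i] by (auto simp: ch_def indicator_def)
      then show ?thesis by simp
    qed
    have "\<bar>indicator {b..<t} v - g v\<bar> \<le> d * indicator {b..<t} v" for v
    proof -
      have "\<bar>indicator {b..<t} v - g v\<bar> \<le> (\<Sum>i<n. d * (ch (Suc i) v - ch i v))"
        unfolding g' by (rule order_trans[OF sum_abs sum_mono[OF termle]])
      then show ?thesis by (simp add: tele sum_distrib_left)
    qed
    then have sq_le: "(indicator {b..<t} v - g v)\<^sup>2 \<le> d\<^sup>2 * indicator {b..<t} v" for v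
      using power_mono[of "\<bar>indicator {b..<t} v - g v\<bar>" "d * indicator {b..<t} v" 2]
      by (auto simp: power_mult_distrib indicator_def split: if_splits)
    have gs: "square_integrable lborel g" using \<open>L2_span k g\<close> by (simp add: L2_span_def)
    have "(LINT v|lborel. (indicator {b..<t} v - g v)\<^sup>2) \<le> (LINT v|lborel. d\<^sup>2 * indicator {b..<t} v)"
      using square_integrable_diff[OF sqi gs] sq_le b
      by (intro integral_mono) (auto simp: square_integrable_def integrable_indicator_iff)
    also have "\<dots> = d\<^sup>2 * (t - b)" using b by simp
    also have "\<dots> < \<epsilon>" using n(2) by (simp add: d_def)
    finally show "\<exists>h. L2_span k h \<and> (LINT v|lborel. (indicator {b..<t} v - h v)\<^sup>2) < \<epsilon>"
      using \<open>L2_span k g\<close> by blast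
  qed
  show ?thesis
  proof (rule L2_span_limit)
    have "integrable lborel (indicator {0<..<t} :: real \<Rightarrow> real)"
      using t by (simp add: integrable_indicator_iff)
    moreover have "(indicator {0<..<t} v :: real)\<^sup>2 = indicator {0<..<t} v" for v :: real by (simp add: indicator_def)
    ultimately show "square_integrable lborel (indicator {0<..<t})" by (simp add: square_integrable_def)
    fix \<epsilon> :: real assume e: "0 < \<epsilon>"
    define b where "b = min (\<epsilon> / 2) (t / 2)"
    have b: "0 < b" "b < t" "b < \<epsilon>" using e t by (auto simp: b_def)
    have "(indicator {0<..<t} v - indicator {b..<t} v)\<^sup>2 = (indicator {0<..<b} v :: real)" for v :: real
      using b by (auto simp: indicator_def)
    then have "(LINT v|lborel. (indicator {0<..<t} v - indicator {b..<t} v)\<^sup>2) < \<epsilon>" using b by simp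
    then show "\<exists>h. L2_span k h \<and> (LINT v|lborel. (indicator {0<..<t} v - h v)\<^sup>2) < \<epsilon>"
      using partial[OF b(1,2)] by blast
  qed
qed

end

section \<open>Brownian motion and Wiener integrals\<close>

lemma (in prob_space) indep_var_of_indep_set:
  fixes X Y :: "'a \<Rightarrow> real"
  assumes G: "subalgebra M G" and X: "X \<in> borel_measurable G" and Y[measurable]: "Y \<in> borel_measurable M"
    and indep: "indep_set (sets G) {Y -` A \<inter> space M |A. A \<in> sets borel}"
  shows "indep_var borel X borel Y"
proof -
  have [measurable]: "X \<in> borel_measurable M" by (rule measurable_from_subalg[OF G X])
  have sp: "space G = space M" using G by (simp add: subalgebra_def)
  have "{X -` A \<inter> space M |A. A \<in> sets borel} \<subseteq> sets G"
    using measurable_sets[OF X] sp by auto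
  then have "indep_set {X -` A \<inter> space M |A. A \<in> sets borel} {Y -` A \<inter> space M |A. A \<in> sets borel}"
    using indep_setD[OF indep] indep_setD_ev1[OF indep] indep_setD_ev2[OF indep] by (intro indep_setI) blast+
  then have "indep_set (sigma_sets (space M) {X -` A \<inter> space M |A. A \<in> sets borel})
      (sigma_sets (space M) {Y -` A \<inter> space M |A. A \<in> sets borel})"
  proof (rule indep_set_sigma_sets)
    have "Int_stable {Z -` A \<inter> space M |A. A \<in> sets borel}" for Z :: "'a \<Rightarrow> real"
    proof (rule Int_stableI)
      fix a b assume "a \<in> {Z -` A \<inter> space M |A. A \<in> sets borel}" "b \<in> {Z -` A \<inter> space M |A. A \<in> sets borel}"
      then obtain A B where AB: "a = Z -` A \<inter> space M" "b = Z -` B \<inter> space M" "A \<in> sets borel" "B \<in> sets borel" by auto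
      then have "a \<inter> b = Z -` (A \<inter> B) \<inter> space M" "A \<inter> B \<in> sets borel" by auto
      then show "a \<inter> b \<in> {Z -` A \<inter> space M |A. A \<in> sets borel}" by blast
    qed
    then show "Int_stable {X -` A \<inter> space M |A. A \<in> sets borel}" "Int_stable {Y -` A \<inter> space M |A. A \<in> sets borel}" by auto
  qed
  then show ?thesis by (simp add: indep_var_eq)
qed

lemma (in prob_space) indep_set_expectation_mult:
  fixes X Y :: "'a \<Rightarrow> real"
  assumes G: "subalgebra M G" and X: "X \<in> borel_measurable G" and Y[measurable]: "Y \<in> borel_measurable M"
    and indep: "indep_set (sets G) {Y -` A \<inter> space M |A. A \<in> sets borel}"
    and g[measurable]: "g \<in> borel_measurable borel"
    and int: "integrable M X" "integrable M (\<lambda>x. g (Y x))"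
  shows "expectation (\<lambda>x. X x * g (Y x)) = expectation X * expectation (\<lambda>x. g (Y x))"
    "integrable M (\<lambda>x. X x * g (Y x))"
proof -
  have "indep_var borel X borel (g \<circ> Y)"
    using indep_var_compose[OF indep_var_of_indep_set[OF G X Y indep], of "\<lambda>x. x" borel g borel] by (simp add: comp_def)
  then have iv: "indep_var borel X borel (\<lambda>x. g (Y x))" by (simp add: comp_def)
  show "expectation (\<lambda>x. X x * g (Y x)) = expectation X * expectation (\<lambda>x. g (Y x))"
    by (rule indep_var_lebesgue_integral[OF iv int])
  show "integrable M (\<lambda>x. X x * g (Y x))" by (rule indep_var_integrable[OF iv int])
qed

section \<open>Measurability with respect to the filtration\<close>

context filtered_prob_space
begin

lemma F_meas: "t \<in> {0..1} \<Longrightarrow> f \<in> measurable (F t) N \<Longrightarrow> f \<in> measurable M N"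
  by (rule measurable_from_subalg[OF subalgebra_F])

lemma space_F: "t \<in> {0..1} \<Longrightarrow> space (F t) = space M"
  using subalgebra_F[of t] by (simp add: subalgebra_def)

lemma F_meas_mono: "0 \<le> s \<Longrightarrow> s \<le> t \<Longrightarrow> t \<le> 1 \<Longrightarrow> f \<in> measurable (F s) N \<Longrightarrow> f \<in> measurable (F t) N"
  by (rule measurable_from_subalg[of _ "F s"]) (auto simp: subalgebra_def space_F F_mono)

text \<open>Two of the usual conditions are at work: by completeness the exceptional part is a null
  set, and all null sets already belong to \<open>F 0\<close>.\<close>

lemma F_meas_AE:
  fixes X Y :: "'a \<Rightarrow> real"
  assumes t: "t \<in> {0..1}" and Y[measurable]: "Y \<in> borel_measurable (F t)" and X: "X \<in> borel_measurable M"
    and ae: "AE x in M. X x = Y x"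
  shows "X \<in> borel_measurable (F t)"
proof -
  note [measurable] = F_meas[OF t Y] X
  define N where "N = {x \<in> space M. X x \<noteq> Y x}"
  have N: "N \<in> null_sets M" unfolding N_def using ae by (intro AE_iff_null[THEN iffD1]) auto
  have sub: "sets (F 0) \<subseteq> sets (F t)" using t by (intro F_mono) auto
  show ?thesis
  proof (rule measurableI)
    fix A :: "real set" assume A[measurable]: "A \<in> sets borel"
    have "X -` A \<inter> N \<in> null_sets M"
      by (rule complete2[OF _ N]) auto
    then have "X -` A \<inter> N \<in> sets (F t)" "N \<in> sets (F t)"
      using null_sets_F N sub by auto
    moreover have "Y -` A \<inter> space (F t) \<in> sets (F t)" by (rule measurable_sets[OF Y A])
    moreover have "X -` A \<inter> space (F t) = (Y -` A \<inter> space (F t) - N) \<union> (X -` A \<inter> N)"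
      using space_F[OF t] by (auto simp: N_def)
    ultimately show "X -` A \<inter> space (F t) \<in> sets (F t)" by auto
  qed simp
qed

end

section \<open>Moments and products of Brownian increments\<close>

locale F_brownian = filtered_prob_space M F for M :: "'a measure" and F +
  fixes W :: "real \<Rightarrow> 'a \<Rightarrow> real"
  assumes W: "F_brownian_motion M F W"
begin

lemma W_F_meas: "t \<in> {0..1} \<Longrightarrow> W t \<in> borel_measurable (F t)"
  using W by (simp add: F_brownian_motion_def adapted_process_def)

lemma W_meas: "t \<in> {0..1} \<Longrightarrow> W t \<in> borel_measurable M"
  by (rule F_meas[OF _ W_F_meas])

lemma increment_meas: "s \<in> {0..1} \<Longrightarrow> t \<in> {0..1} \<Longrightarrow> (\<lambda>w. W t w - W s w) \<in> borel_measurable M"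
  by (intro borel_measurable_diff W_meas)

lemma increment_F_meas:
  assumes "0 \<le> s" "s \<le> u" "0 \<le> t" "t \<le> u" "u \<le> 1"
  shows "(\<lambda>w. W t w - W s w) \<in> borel_measurable (F u)"
  using assms by (intro borel_measurable_diff F_meas_mono[OF _ _ _ W_F_meas]) auto

context
  fixes s t :: real
  assumes st: "0 \<le> s" "s < t" "t \<le> 1"
begin

lemma increment_distributed: "distributed M lborel (\<lambda>w. W t w - W s w) (\<lambda>x. ennreal (normal_density 0 (sqrt (t - s)) x))"
  and increment_indep: "indep_set (sets (F s)) {(\<lambda>w. W t w - W s w) -` A \<inter> space M |A. A \<in> sets borel}"
  using W st by (auto simp: F_brownian_motion_def)

lemma increment_even_moment:
  "integrable M (\<lambda>w. (W t w - W s w) ^ (2 * k))"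
  "expectation (\<lambda>w. (W t w - W s w) ^ (2 * k)) = fact (2 * k) / ((2 / (t - s)) ^ k * fact k)"
proof -
  have sd: "0 < sqrt (t - s)" "(sqrt (t - s))\<^sup>2 = t - s" using st by auto
  have m: "has_bochner_integral lborel (\<lambda>x. normal_density 0 (sqrt (t - s)) x * x ^ (2 * k)) (fact (2 * k) / ((2 / (t - s)) ^ k * fact k))"
    using normal_moment_even[OF sd(1), of 0 k] sd(2) by simp
  show "integrable M (\<lambda>w. (W t w - W s w) ^ (2 * k))"
    using distributed_integrable[OF increment_distributed, of "\<lambda>x. x ^ (2 * k)"] integrable.intros[OF m] by simp
  show "expectation (\<lambda>w. (W t w - W s w) ^ (2 * k)) = fact (2 * k) / ((2 / (t - s)) ^ k * fact k)"
    using distributed_integral[OF increment_distributed, of "\<lambda>x. x ^ (2 * k)"] has_bochner_integral_integral_eq[OF m] by simp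
qed

lemma increment_square_integrable: "square_integrable M (\<lambda>w. W t w - W s w)"
  using increment_even_moment(1)[of 1] increment_meas[of s t] st by (simp add: square_integrable_def)

lemma increment_mean: "expectation (\<lambda>w. W t w - W s w) = 0"
proof -
  have sd: "0 < sqrt (t - s)" using st by auto
  show ?thesis
    using distributed_integral[OF increment_distributed, of "\<lambda>x. x"] integral_normal_moment_nz_1[OF sd, of 0] by simp
qed

lemma increment_variance: "expectation (\<lambda>w. (W t w - W s w)\<^sup>2) = t - s"
  using increment_even_moment(2)[of 1] by (simp add: fact_numeral)

lemma increment_fourth: "expectation (\<lambda>w. (W t w - W s w) ^ 4) = 3 * (t - s)\<^sup>2"
  "integrable M (\<lambda>w. (W t w - W s w) ^ 4)"
  using increment_even_moment[of 2] by (simp_all add: fact_numeral power2_eq_square)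

text \<open>The inequality between arithmetic and geometric mean interpolates the third power
  between the second and the fourth. Balancing with the standard deviation \<open>d\<close> gives
  \<open>3/2 + 1/2 = 2\<close>.\<close>

lemma increment_third_le:
  "integrable M (\<lambda>w. \<bar>W t w - W s w\<bar> ^ 3)"
  "expectation (\<lambda>w. \<bar>W t w - W s w\<bar> ^ 3) \<le> 2 * sqrt (t - s) * (t - s)"
proof -
  define d where "d = sqrt (t - s)"
  have d: "0 < d" "d\<^sup>2 = t - s" using st by (auto simp: d_def)
  define Y where "Y w = W t w - W s w" for w
  note [measurable] = increment_meas[of s t, folded Y_def]
  have [measurable]: "Y \<in> borel_measurable M" using increment_meas[of s t] st by (simp add: Y_def[abs_def])
  have le: "\<bar>Y w\<bar> ^ 3 \<le> (1 / (2 * d)) * (Y w) ^ 4 + (d / 2) * (Y w)\<^sup>2" for w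
  proof -
    have "0 \<le> (1 / (2 * d)) * (Y w)\<^sup>2 * (\<bar>Y w\<bar> - d)\<^sup>2" using d by simp
    also have "\<dots> = (1 / (2 * d)) * (Y w) ^ 4 + (d / 2) * (Y w)\<^sup>2 - \<bar>Y w\<bar> ^ 3"
    proof -
      have "\<bar>Y w\<bar> ^ 3 = (Y w)\<^sup>2 * \<bar>Y w\<bar>" by (simp add: power2_eq_square power3_eq_cube flip: abs_mult)
      then show ?thesis using d(1) by (simp add: power2_diff field_simps power2_eq_square power4_eq_xxxx)
    qed
    finally show ?thesis by simp
  qed
  have I2: "integrable M (\<lambda>w. (Y w)\<^sup>2)" and I4: "integrable M (\<lambda>w. (Y w) ^ 4)"
    using increment_square_integrable increment_fourth(2) by (auto simp: Y_def square_integrable_def)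
  have int: "integrable M (\<lambda>w. \<bar>Y w\<bar> ^ 3)"
    by (rule Bochner_Integration.integrable_bound[where f="\<lambda>w. (1 / (2 * d)) * (Y w) ^ 4 + (d / 2) * (Y w)\<^sup>2"])
       (use I2 I4 le in \<open>auto simp: power_abs intro!: order_trans[OF _ abs_ge_self]\<close>)
  have "expectation (\<lambda>w. \<bar>Y w\<bar> ^ 3) \<le> expectation (\<lambda>w. (1 / (2 * d)) * (Y w) ^ 4 + (d / 2) * (Y w)\<^sup>2)"
    using I2 I4 by (intro integral_mono int le) auto
  also have "\<dots> = (1 / (2 * d)) * (3 * (d\<^sup>2)\<^sup>2) + (d / 2) * d\<^sup>2"
    using I2 I4 increment_fourth(1) increment_variance d(2) by (simp add: Y_def)
  also have "\<dots> = 2 * d * d\<^sup>2" using d(1) by (simp add: power2_eq_square)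
  finally show "expectation (\<lambda>w. \<bar>W t w - W s w\<bar> ^ 3) \<le> 2 * sqrt (t - s) * (t - s)"
    unfolding Y_def d(2) by (simp add: d_def)
  show "integrable M (\<lambda>w. \<bar>W t w - W s w\<bar> ^ 3)" using int by (simp add: Y_def)
qed

lemma increment_mult:
  assumes X: "X \<in> borel_measurable (F s)" "integrable M X"
  shows "expectation (\<lambda>w. X w * (W t w - W s w)) = 0" "integrable M (\<lambda>w. X w * (W t w - W s w))"
    "expectation (\<lambda>w. X w * (W t w - W s w)\<^sup>2) = expectation X * (t - s)" "integrable M (\<lambda>w. X w * (W t w - W s w)\<^sup>2)"
proof -
  have s01: "s \<in> {0..1}" and t01: "t \<in> {0..1}" using st by auto
  note * = indep_set_expectation_mult[OF subalgebra_F[OF s01] X(1) increment_meas[OF s01 t01] increment_indep _ X(2)]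
  have i: "integrable M (\<lambda>w. W t w - W s w)" by (rule square_integrable_integrable[OF increment_square_integrable])
  show "expectation (\<lambda>w. X w * (W t w - W s w)) = 0" "integrable M (\<lambda>w. X w * (W t w - W s w))"
    using *[of "\<lambda>x. x"] i increment_mean by auto
  have i2: "integrable M (\<lambda>w. (W t w - W s w)\<^sup>2)" using increment_square_integrable by (simp add: square_integrable_def)
  show "expectation (\<lambda>w. X w * (W t w - W s w)\<^sup>2) = expectation X * (t - s)" "integrable M (\<lambda>w. X w * (W t w - W s w)\<^sup>2)"
    using *[of "\<lambda>x. x\<^sup>2"] i2 increment_variance by auto
qed

end

lemma increment_sq_int: "0 \<le> s \<Longrightarrow> s \<le> t \<Longrightarrow> t \<le> 1 \<Longrightarrow> square_integrable M (\<lambda>w. W t w - W s w)"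
  using increment_square_integrable[of s t] square_integrable_zero by (cases "s = t") auto

lemma increment_cov:
  assumes "0 \<le> u" "u \<le> p" "u \<le> q" "p \<le> 1" "q \<le> 1"
  shows "expectation (\<lambda>w. (W p w - W u w) * (W q w - W u w)) = min p q - u"
proof -
  have *: "expectation (\<lambda>w. (W p w - W u w) * (W q w - W u w)) = p - u"
    if pq: "p \<le> q" "u \<le> p" "q \<le> 1" for p q
  proof -
    have sq: "square_integrable M (\<lambda>w. W p w - W u w)" using assms that by (intro increment_sq_int) auto
    have var: "expectation (\<lambda>w. (W p w - W u w)\<^sup>2) = p - u"
      using increment_variance[of u p] assms pq by (cases "u = p") auto
    show ?thesis
    proof (cases "p = q")
      case True
      then show ?thesis using var by (simp add: power2_eq_square)
    next
      case False
      then have pq': "0 \<le> p" "p < q" "q \<le> 1" using that assms by auto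
      have m: "(\<lambda>w. W p w - W u w) \<in> borel_measurable (F p)" using assms that by (intro increment_F_meas) auto
      note * = increment_mult[OF pq' m square_integrable_integrable[OF sq]]
      have "expectation (\<lambda>w. (W p w - W u w) * (W q w - W u w)) =
        expectation (\<lambda>w. (W p w - W u w)\<^sup>2 + (W p w - W u w) * (W q w - W p w))"
        by (intro Bochner_Integration.integral_cong refl) (simp add: power2_eq_square algebra_simps)
      also have "\<dots> = p - u" using *(1,2) var sq by (simp add: square_integrable_def)
      finally show ?thesis .
    qed
  qed
  show ?thesis
  proof (cases "p \<le> q")
    case False
    then show ?thesis using *[of q p] assms by (simp add: mult.commute)
  qed (use * assms in auto)
qed

end

definition step_fun :: "real \<Rightarrow> real set \<Rightarrow> (real \<Rightarrow> real) \<Rightarrow> real \<Rightarrow> real" where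
  "step_fun u P \<alpha> v = (\<Sum>p\<in>P. \<alpha> p * indicator {u<..p} v)"

definition step_integral :: "(real \<Rightarrow> 'a \<Rightarrow> real) \<Rightarrow> real \<Rightarrow> real set \<Rightarrow> (real \<Rightarrow> real) \<Rightarrow> 'a \<Rightarrow> real" where
  "step_integral W u P \<alpha> w = (\<Sum>p\<in>P. \<alpha> p * (W p w - W u w))"

lemma step_fun_square_integrable: "square_integrable lborel (step_fun u P \<alpha>)"
proof -
  have "square_integrable lborel (\<lambda>v. indicator {u<..p} v :: real)" for p
  proof -
    have "(indicator {u<..p} v :: real)\<^sup>2 = indicator {u<..p} v" for v :: real by (simp add: indicator_def)
    moreover have "integrable lborel (indicator {u<..p} :: real \<Rightarrow> real)"
      by (cases "u \<le> p") (auto simp: integrable_indicator_iff)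
    ultimately show ?thesis by (simp add: square_integrable_def)
  qed
  then show ?thesis unfolding step_fun_def[abs_def] by (intro square_integrable_sum square_integrable_cmult)
qed

text \<open>The integral runs over \<open>[u, 1]\<close>. Steps \<open>{u<..p}\<close> with a common left end suffice, and make step functions linear in their coefficients.\<close>

definition wiener_version :: "'a measure \<Rightarrow> (real \<Rightarrow> 'a \<Rightarrow> real) \<Rightarrow> real \<Rightarrow> (real \<Rightarrow> real) \<Rightarrow> ('a \<Rightarrow> real) \<Rightarrow> bool" where
  "wiener_version M W u \<phi> X \<longleftrightarrow> (\<exists>P \<alpha>. (\<forall>k. finite (P k) \<and> P k \<subseteq> {u..1}) \<and>
     L2_tendsto lborel (\<lambda>k. step_fun u (P k) (\<alpha> k)) \<phi> \<and>
     L2_tendsto M (\<lambda>k. step_integral W u (P k) (\<alpha> k)) X)"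

section \<open>Isometry and linearity of the Wiener integral\<close>

context F_brownian
begin

lemma step_integral_square_integrable:
  assumes "0 \<le> u" "P \<subseteq> {u..1}"
  shows "square_integrable M (step_integral W u P \<alpha>)"
  unfolding step_integral_def[abs_def]
  using assms by (intro square_integrable_sum square_integrable_cmult increment_sq_int) auto

text \<open>\<open>min p q - u\<close> is both the covariance of two increments starting at
  \<open>u\<close> and the inner product of the corresponding indicators.\<close>

lemma step_isometry:
  assumes u: "0 \<le> u" and P: "finite P" "P \<subseteq> {u..1}"
  shows "expectation (\<lambda>w. (step_integral W u P \<alpha> w)\<^sup>2) = (LINT v|lborel. (step_fun u P \<alpha> v)\<^sup>2)"
proof -
  have int: "integrable M (\<lambda>w. (W p w - W u w) * (W q w - W u w))" if "p \<in> P" "q \<in> P" for p q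
    using that P u by (intro square_integrable_mult increment_sq_int) auto
  have ind: "has_bochner_integral lborel (\<lambda>v. indicator {u<..p} v * indicator {u<..q} v :: real) (min p q - u)" if "p \<in> P" "q \<in> P" for p q
  proof -
    have "u \<le> min p q" using that P by auto
    then have "has_bochner_integral lborel (indicator {u<..min p q} :: real \<Rightarrow> real) (measure lborel {u<..min p q})"
      by (intro has_bochner_integral_real_indicator) auto
    moreover have "measure lborel {u<..min p q} = min p q - u" using that P by (subst measure_lborel_Ioc) auto
    moreover have "indicator {u<..p} v * indicator {u<..q} v = (indicator {u<..min p q} v :: real)" for v by (auto simp: indicator_def)
    ultimately show ?thesis by simp
  qed
  have "expectation (\<lambda>w. (step_integral W u P \<alpha> w)\<^sup>2) =
      expectation (\<lambda>w. \<Sum>p\<in>P. \<Sum>q\<in>P. (\<alpha> p * \<alpha> q) * ((W p w - W u w) * (W q w - W u w)))"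
    by (intro Bochner_Integration.integral_cong refl) (simp add: step_integral_def power2_eq_square sum_product mult_ac)
  also have "\<dots> = (\<Sum>p\<in>P. \<Sum>q\<in>P. (\<alpha> p * \<alpha> q) * expectation (\<lambda>w. (W p w - W u w) * (W q w - W u w)))"
    using int by simp
  also have "\<dots> = (\<Sum>p\<in>P. \<Sum>q\<in>P. (\<alpha> p * \<alpha> q) * (min p q - u))"
    using u P by (intro sum.cong refl arg_cong2[where f="(*)"] increment_cov) auto
  also have "\<dots> = (LINT v|lborel. (\<Sum>p\<in>P. \<Sum>q\<in>P. (\<alpha> p * \<alpha> q) * (indicator {u<..p} v * indicator {u<..q} v)))"
    using ind by (intro has_bochner_integral_integral_eq[symmetric] has_bochner_integral_sum has_bochner_integral_mult_right)
  also have "\<dots> = (LINT v|lborel. (step_fun u P \<alpha> v)\<^sup>2)"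
    by (intro Bochner_Integration.integral_cong refl) (simp add: step_fun_def power2_eq_square sum_product mult_ac)
  finally show ?thesis .
qed

lemma wiener_versionD:
  assumes "wiener_version M W u \<phi> X"
  shows "square_integrable lborel \<phi>" "square_integrable M X"
  using assms by (auto simp: wiener_version_def L2_tendsto_def)

lemma wiener_isometry:
  assumes u: "0 \<le> u" and X: "wiener_version M W u \<phi> X"
  shows "expectation (\<lambda>w. (X w)\<^sup>2) = (LINT v|lborel. (\<phi> v)\<^sup>2)"
proof -
  from X obtain P \<alpha> where P: "\<And>k. finite (P k)" "\<And>k. P k \<subseteq> {u..1}"
    and L: "L2_tendsto lborel (\<lambda>k. step_fun u (P k) (\<alpha> k)) \<phi>" "L2_tendsto M (\<lambda>k. step_integral W u (P k) (\<alpha> k)) X"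
    unfolding wiener_version_def by auto
  show ?thesis
    using LIMSEQ_unique[OF L2_tendsto_norm[OF L(2), unfolded step_isometry[OF u P]] L2_tendsto_norm[OF L(1)]] .
qed

lemma wiener_version_add:
  assumes X: "wiener_version M W u \<phi> X" and Y: "wiener_version M W u \<psi> Y"
  shows "wiener_version M W u (\<lambda>v. \<phi> v + \<psi> v) (\<lambda>w. X w + Y w)"
proof -
  from X obtain P \<alpha> where P: "\<And>k. finite (P k)" "\<And>k. P k \<subseteq> {u..1}"
    and L: "L2_tendsto lborel (\<lambda>k. step_fun u (P k) (\<alpha> k)) \<phi>" "L2_tendsto M (\<lambda>k. step_integral W u (P k) (\<alpha> k)) X"
    unfolding wiener_version_def by auto
  from Y obtain Q \<beta> where Q: "\<And>k. finite (Q k)" "\<And>k. Q k \<subseteq> {u..1}"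
    and L': "L2_tendsto lborel (\<lambda>k. step_fun u (Q k) (\<beta> k)) \<psi>" "L2_tendsto M (\<lambda>k. step_integral W u (Q k) (\<beta> k)) Y"
    unfolding wiener_version_def by auto
  define \<gamma> where "\<gamma> k q = (if q \<in> P k then \<alpha> k q else 0) + (if q \<in> Q k then \<beta> k q else 0)" for k q
  have "step_fun u (P k \<union> Q k) (\<gamma> k) v = step_fun u (P k) (\<alpha> k) v + step_fun u (Q k) (\<beta> k) v"
    "step_integral W u (P k \<union> Q k) (\<gamma> k) w = step_integral W u (P k) (\<alpha> k) w + step_integral W u (Q k) (\<beta> k) w" for k v w
    unfolding step_fun_def step_integral_def \<gamma>_def by (rule sum_Un_combine[OF P(1) Q(1)])+
  then have "step_fun u (P k \<union> Q k) (\<gamma> k) = (\<lambda>v. step_fun u (P k) (\<alpha> k) v + step_fun u (Q k) (\<beta> k) v)"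
    "step_integral W u (P k \<union> Q k) (\<gamma> k) = (\<lambda>w. step_integral W u (P k) (\<alpha> k) w + step_integral W u (Q k) (\<beta> k) w)" for k
    by (simp_all add: fun_eq_iff)
  then show ?thesis unfolding wiener_version_def
    using P Q L2_tendsto_add[OF L(1) L'(1)] L2_tendsto_add[OF L(2) L'(2)]
    by (intro exI[of _ "\<lambda>k. P k \<union> Q k"] exI[of _ \<gamma>]) simp
qed

lemma wiener_version_cmult:
  assumes X: "wiener_version M W u \<phi> X"
  shows "wiener_version M W u (\<lambda>v. c * \<phi> v) (\<lambda>w. c * X w)"
proof -
  from X obtain P \<alpha> where P: "\<And>k. finite (P k)" "\<And>k. P k \<subseteq> {u..1}"
    and L: "L2_tendsto lborel (\<lambda>k. step_fun u (P k) (\<alpha> k)) \<phi>" "L2_tendsto M (\<lambda>k. step_integral W u (P k) (\<alpha> k)) X"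
    unfolding wiener_version_def by auto
  have "step_fun u (P k) (\<lambda>q. c * \<alpha> k q) = (\<lambda>v. c * step_fun u (P k) (\<alpha> k) v)"
    "step_integral W u (P k) (\<lambda>q. c * \<alpha> k q) = (\<lambda>w. c * step_integral W u (P k) (\<alpha> k) w)" for k
    by (simp_all add: fun_eq_iff step_fun_def step_integral_def sum_distrib_left mult.assoc)
  then show ?thesis unfolding wiener_version_def
    using P L2_tendsto_cmult[OF L(1)] L2_tendsto_cmult[OF L(2)]
    by (intro exI[of _ P] exI[of _ "\<lambda>k q. c * \<alpha> k q"]) simp
qed

lemma wiener_version_diff:
  assumes "wiener_version M W u \<phi> X" "wiener_version M W u \<psi> Y"
  shows "wiener_version M W u (\<lambda>v. \<phi> v - \<psi> v) (\<lambda>w. X w - Y w)"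
  using wiener_version_add[OF assms(1) wiener_version_cmult[OF assms(2), of "-1"]] by simp

lemma wiener_version_increment:
  assumes "0 \<le> u" "u \<le> t" "t \<le> 1"
  shows "wiener_version M W u (indicator {u<..t}) (\<lambda>w. W t w - W u w)"
proof -
  have "step_fun u {t} (\<lambda>_. 1) = indicator {u<..t}" "step_integral W u {t} (\<lambda>_. 1) = (\<lambda>w. W t w - W u w)"
    by (auto simp: step_fun_def step_integral_def fun_eq_iff)
  then show ?thesis unfolding wiener_version_def
    using assms step_fun_square_integrable[of u "{t}" "\<lambda>_. 1"] increment_sq_int[of u t]
    by (intro exI[of _ "\<lambda>_. {t}"] exI[of _ "\<lambda>_ _. 1"]) (simp add: L2_tendsto_const)
qed

lemma wiener_version_zero: "0 \<le> u \<Longrightarrow> u \<le> 1 \<Longrightarrow> wiener_version M W u (\<lambda>_. 0) (\<lambda>_. 0)"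
  using wiener_version_cmult[OF wiener_version_increment[of u u], of 0] by simp

lemma wiener_version_sum:
  assumes u: "0 \<le> u" "u \<le> 1" and X: "\<And>i. i \<in> I \<Longrightarrow> wiener_version M W u (\<phi> i) (X i)"
  shows "wiener_version M W u (\<lambda>v. \<Sum>i\<in>I. \<phi> i v) (\<lambda>w. \<Sum>i\<in>I. X i w)"
  using X
proof (induction I rule: infinite_finite_induct)
  case (insert i I)
  then show ?case using wiener_version_add[of u "\<phi> i" "X i"] by simp
qed (auto intro: wiener_version_zero[OF u])

text \<open>Polarisation of the isometry.\<close>

lemma wiener_inner:
  assumes u: "0 \<le> u" and X: "wiener_version M W u \<phi> X" and Y: "wiener_version M W u \<psi> Y"
  shows "expectation (\<lambda>w. X w * Y w) = (LINT v|lborel. \<phi> v * \<psi> v)"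
proof -
  have a: "square_integrable N f \<Longrightarrow> square_integrable N g \<Longrightarrow>
    (LINT v|N. (f v + g v)\<^sup>2) = (LINT v|N. (f v)\<^sup>2) + (LINT v|N. (g v)\<^sup>2) + 2 * (LINT v|N. f v * g v)" for N :: "'b measure" and f g
    using square_integrable_mult[of N f g] unfolding power2_sum mult.assoc by (simp add: square_integrable_def)
  show ?thesis
    using wiener_isometry[OF u wiener_version_add[OF X Y]] wiener_isometry[OF u X] wiener_isometry[OF u Y]
      a[OF wiener_versionD(1)[OF X] wiener_versionD(1)[OF Y]] a[OF wiener_versionD(2)[OF X] wiener_versionD(2)[OF Y]]
    by simp
qed

end

lemma (in prob_space) L2_tendsto_bounded_mult:
  assumes f: "L2_tendsto M fs f" and S[measurable]: "S \<in> borel_measurable M" and Sb: "\<And>x. \<bar>S x\<bar> \<le> c"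
  shows "L2_tendsto M (\<lambda>k x. S x * fs k x) (\<lambda>x. S x * f x)"
proof -
  note F = L2_tendstoD[OF f]
  have le: "(S x * y)\<^sup>2 \<le> c\<^sup>2 * y\<^sup>2" for x y
    using power_mono[OF Sb[of x], of 2] by (simp add: power_mult_distrib mult_right_mono)
  have sq: "square_integrable M (\<lambda>x. S x * g x)" if "square_integrable M g" for g
  proof -
    note [measurable] = square_integrableD(1)[OF that]
    have "integrable M (\<lambda>x. (S x * g x)\<^sup>2)"
      by (rule Bochner_Integration.integrable_bound[OF integrable_mult_right[OF square_integrableD(2)[OF that], of "c\<^sup>2"]])
         (use le in auto)
    then show ?thesis by (simp add: square_integrable_def)
  qed
  show ?thesis
  proof (rule L2_tendsto_le[OF sq[OF F(1)] sq[OF F(2)]])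
    show "(\<lambda>k. c\<^sup>2 * expectation (\<lambda>x. (f x - fs k x)\<^sup>2)) \<longlonglongrightarrow> 0"
      using tendsto_mult_left[OF F(3), of "c\<^sup>2"] by simp
    fix k
    have d: "square_integrable M (\<lambda>x. f x - fs k x)" using F by (intro square_integrable_diff)
    have "expectation (\<lambda>x. (S x * f x - S x * fs k x)\<^sup>2) = expectation (\<lambda>x. (S x * (f x - fs k x))\<^sup>2)"
      by (simp add: right_diff_distrib)
    also have "\<dots> \<le> expectation (\<lambda>x. c\<^sup>2 * (f x - fs k x)\<^sup>2)"
      using sq[OF d] d le by (intro integral_mono) (auto simp: square_integrable_def)
    finally show "expectation (\<lambda>x. (S x * f x - S x * fs k x)\<^sup>2) \<le> c\<^sup>2 * expectation (\<lambda>x. (f x - fs k x)\<^sup>2)" by simp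
  qed
qed

lemma (in prob_space) real_cond_exp_L2:
  assumes G: "subalgebra M G" and X: "square_integrable M X"
  shows "square_integrable M (real_cond_exp M G X)"
    "expectation (\<lambda>x. (real_cond_exp M G X x)\<^sup>2) \<le> expectation (\<lambda>x. (X x)\<^sup>2)"
proof -
  interpret fs: finite_measure_subalgebra M G using G by unfold_locales
  have int: "integrable M X" by (rule square_integrable_integrable[OF X])
  have int2: "integrable M (\<lambda>x. (X x)\<^sup>2)" by (rule square_integrableD(2)[OF X])
  have "AE x in M. (real_cond_exp M G X x)\<^sup>2 \<le> real_cond_exp M G (\<lambda>x. (X x)\<^sup>2) x"
    by (rule fs.real_cond_exp_jensens_inequality(2)[OF int, where I=UNIV]) (auto intro: int2 convex_power2)
  moreover have i: "integrable M (real_cond_exp M G (\<lambda>x. (X x)\<^sup>2))" by (rule fs.real_cond_exp_int(1)[OF int2])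
  ultimately have sq: "integrable M (\<lambda>x. (real_cond_exp M G X x)\<^sup>2)"
    by (intro Bochner_Integration.integrable_bound[OF i]) (auto elim!: eventually_mono)
  then show "square_integrable M (real_cond_exp M G X)" by (simp add: square_integrable_def)
  have "expectation (\<lambda>x. (real_cond_exp M G X x)\<^sup>2) \<le> expectation (real_cond_exp M G (\<lambda>x. (X x)\<^sup>2))"
    by (rule integral_mono_AE[OF sq i]) fact
  also have "\<dots> = expectation (\<lambda>x. (X x)\<^sup>2)" by (rule fs.real_cond_exp_int(2)[OF int2])
  finally show "expectation (\<lambda>x. (real_cond_exp M G X x)\<^sup>2) \<le> expectation (\<lambda>x. (X x)\<^sup>2)" .
qed

text \<open>End points of different increments may coincide, so their coefficients are added up at
  each point. With \<open>f\<close> an indicator or a Brownian path, the same identity rewrites a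
  step function and its integral.\<close>

lemma sum_increments_eq:
  fixes f :: "real \<Rightarrow> real" and c a b :: "nat \<Rightarrow> real" and n :: nat
  defines "P \<equiv> a ` {..<n} \<union> b ` {..<n}"
  shows "(\<Sum>i<n. c i * (f (b i) - f (a i))) =
    (\<Sum>p\<in>P. (\<Sum>i<n. c i * (of_bool (b i = p) - of_bool (a i = p))) * f p)"
proof -
  have "(\<Sum>p\<in>P. (\<Sum>i<n. c i * (of_bool (b i = p) - of_bool (a i = p))) * f p) =
      (\<Sum>i<n. \<Sum>p\<in>P. c i * (of_bool (b i = p) - of_bool (a i = p)) * f p)"
    unfolding sum_distrib_right by (rule sum.swap)
  also have "\<dots> = (\<Sum>i<n. c i * (f (b i) - f (a i)))"
  proof (rule sum.cong[OF refl])
    fix i assume i: "i \<in> {..<n}"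
    have fin: "finite P" by (simp add: P_def)
    have "(\<Sum>p\<in>P. c i * (of_bool (b i = p) - of_bool (a i = p)) * f p) =
        c i * ((\<Sum>p\<in>P. if p = b i then f p else 0) - (\<Sum>p\<in>P. if p = a i then f p else 0))"
      unfolding sum_subtractf[symmetric] sum_distrib_left by (intro sum.cong refl) auto
    also have "\<dots> = c i * (f (b i) - f (a i))" using i fin by (simp add: P_def)
    finally show "(\<Sum>p\<in>P. c i * (of_bool (b i = p) - of_bool (a i = p)) * f p) = c i * (f (b i) - f (a i))" .
  qed
  finally show ?thesis by simp
qed

lemma sum_image_combine:
  fixes f :: "'b \<Rightarrow> real"
  assumes "finite P"
  shows "(\<Sum>p\<in>P. \<alpha> p * f (g p)) = (\<Sum>q\<in>g ` P. (\<Sum>p\<in>{p\<in>P. g p = q}. \<alpha> p) * f q)"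
proof -
  have "(\<Sum>p\<in>P. \<alpha> p * f (g p)) = (\<Sum>q\<in>g ` P. \<Sum>p\<in>{p\<in>P. g p = q}. \<alpha> p * f (g p))"
    by (rule sum.image_gen[OF assms])
  also have "\<dots> = (\<Sum>q\<in>g ` P. (\<Sum>p\<in>{p\<in>P. g p = q}. \<alpha> p) * f q)"
    by (intro sum.cong refl) (simp add: sum_distrib_right)
  finally show ?thesis .
qed

section \<open>Splitting a Wiener integral into past and future\<close>

context F_brownian
begin

text \<open>A step on \<open>{a<..b}\<close> is the difference of the steps on
  \<open>{0<..b}\<close> and \<open>{0<..a}\<close>. All end points are at most \<open>t\<close>, so
  the step functions vanish off \<open>[0, t]\<close> and converge to the integrand cut off
  there.\<close>

lemma wiener_version_of_is_wiener_integral: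
  assumes t: "t \<in> {0..1}" and X: "is_wiener_integral M W t \<phi> X"
  shows "wiener_version M W 0 (\<lambda>v. indicator {0..t} v * \<phi> v) X"
proof -
  from X obtain n :: "nat \<Rightarrow> nat" and c a b :: "nat \<Rightarrow> nat \<Rightarrow> real" where
    Xm: "X \<in> borel_measurable M" and phim: "set_borel_measurable lborel {0..t} \<phi>"
    and ab: "\<And>k i. i < n k \<Longrightarrow> 0 \<le> a k i \<and> a k i \<le> b k i \<and> b k i \<le> t"
    and L1: "(\<lambda>k. \<integral>\<^sup>+u\<in>{0..t}. ennreal ((\<phi> u - (\<Sum>i<n k. c k i * indicator {a k i<..b k i} u))\<^sup>2) \<partial>lborel) \<longlonglongrightarrow> 0"
    and L2: "(\<lambda>k. \<integral>\<^sup>+w. ennreal ((X w - (\<Sum>i<n k. c k i * (W (b k i) w - W (a k i) w)))\<^sup>2) \<partial>M) \<longlonglongrightarrow> 0"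
    unfolding is_wiener_integral_def by blast
  define P where "P k = a k ` {..<n k} \<union> b k ` {..<n k}" for k
  define \<alpha> where "\<alpha> k p = (\<Sum>i<n k. c k i * (of_bool (b k i = p) - of_bool (a k i = p)))" for k p
  have P: "finite (P k)" "P k \<subseteq> {0..1}" for k
  proof -
    show "P k \<subseteq> {0..1}"
    proof
      fix p assume "p \<in> P k"
      then obtain i where "i < n k" "p = a k i \<or> p = b k i" by (auto simp: P_def)
      then show "p \<in> {0..1}" using ab[of i k] t by auto
    qed
  qed (simp add: P_def)
  have I: "step_integral W 0 (P k) (\<alpha> k) w = (\<Sum>i<n k. c k i * (W (b k i) w - W (a k i) w))" for k w
    unfolding step_integral_def P_def \<alpha>_def
    using sum_increments_eq[where f="\<lambda>p. W p w - W 0 w" and n="n k" and c="c k" and a="a k" and b="b k"] by simp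
  have S: "step_fun 0 (P k) (\<alpha> k) v = (\<Sum>i<n k. c k i * indicator {a k i<..b k i} v)" for k v
  proof -
    have "(\<Sum>i<n k. c k i * indicator {a k i<..b k i} v) =
        (\<Sum>i<n k. c k i * (indicator {0<..b k i} v - indicator {0<..a k i} v))"
      using ab[of _ k] by (intro sum.cong refl) (fastforce simp: indicator_def)
    then show ?thesis
      unfolding step_fun_def P_def \<alpha>_def
      using sum_increments_eq[where f="\<lambda>p. indicator {0<..p} v" and n="n k" and c="c k" and a="a k" and b="b k"] by simp
  qed
  have S0: "step_fun 0 (P k) (\<alpha> k) v = 0" if "v \<notin> {0..t}" for k v
    unfolding S using that ab[of _ k] by (intro sum.neutral) (fastforce simp: indicator_def)
  have "L2_tendsto M (\<lambda>k. step_integral W 0 (P k) (\<alpha> k)) X"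
    using L2 P by (intro L2_tendstoI_nn Xm step_integral_square_integrable) (auto simp: I)
  moreover have "L2_tendsto lborel (\<lambda>k. step_fun 0 (P k) (\<alpha> k)) (\<lambda>v. indicator {0..t} v * \<phi> v)"
  proof (rule L2_tendstoI_nn)
    show "(\<lambda>v. indicator {0..t} v * \<phi> v) \<in> borel_measurable lborel"
      using phim by (simp add: set_borel_measurable_def)
    have "(\<integral>\<^sup>+v. ennreal ((indicator {0..t} v * \<phi> v - step_fun 0 (P k) (\<alpha> k) v)\<^sup>2) \<partial>lborel) =
        (\<integral>\<^sup>+u\<in>{0..t}. ennreal ((\<phi> u - (\<Sum>i<n k. c k i * indicator {a k i<..b k i} u))\<^sup>2) \<partial>lborel)" for k
    proof (rule nn_integral_cong)
      fix v
      show "ennreal ((indicator {0..t} v * \<phi> v - step_fun 0 (P k) (\<alpha> k) v)\<^sup>2) =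
          ennreal ((\<phi> v - (\<Sum>i<n k. c k i * indicator {a k i<..b k i} v))\<^sup>2) * indicator {0..t} v"
        using S[of k v] S0[of v k] by (cases "v \<in> {0..t}") auto
    qed
    then show "(\<lambda>k. \<integral>\<^sup>+v. ennreal ((indicator {0..t} v * \<phi> v - step_fun 0 (P k) (\<alpha> k) v)\<^sup>2) \<partial>lborel) \<longlonglongrightarrow> 0"
      using L1 by simp
  qed (rule step_fun_square_integrable)
  ultimately show ?thesis unfolding wiener_version_def using P by blast
qed

text \<open>Conditioning on \<open>F u\<close> stops a step integral at \<open>u\<close>, because
  later increments have mean 0 over every set of \<open>F u\<close>. The conditional expectation
  contracts the L2 distance, which carries the splitting over to the limit.\<close>

lemma wiener_version_split:
  assumes u: "u \<in> {0..1}" and X: "wiener_version M W 0 \<phi> X"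
  defines "A \<equiv> real_cond_exp M (F u) X"
  shows "wiener_version M W 0 (\<lambda>v. indicator {..u} v * \<phi> v) A"
    "wiener_version M W u (\<lambda>v. indicator {u<..} v * \<phi> v) (\<lambda>w. X w - A w)"
proof -
  interpret fs: finite_measure_subalgebra M "F u" using subalgebra_F[OF u] by unfold_locales
  from X obtain P \<alpha> where P: "\<And>k. finite (P k)" "\<And>k. P k \<subseteq> {0..1}"
    and L: "L2_tendsto lborel (\<lambda>k. step_fun 0 (P k) (\<alpha> k)) \<phi>" "L2_tendsto M (\<lambda>k. step_integral W 0 (P k) (\<alpha> k)) X"
    unfolding wiener_version_def by auto
  note Xs = L2_tendstoD[OF L(2)] and ps = L2_tendstoD[OF L(1)]
  \<comment> \<open>Stopping maps all end points beyond \<open>u\<close> to \<open>u\<close>;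
    \<open>\<beta>\<close> adds up the coefficients of the merged points.\<close>
  define Q where "Q k = (\<lambda>p. min p u) ` P k" for k
  define \<beta> where "\<beta> k q = (\<Sum>p\<in>{p\<in>P k. min p u = q}. \<alpha> k p)" for k q
  define R where "R k = P k \<inter> {u..}" for k
  have Q: "finite (Q k)" "Q k \<subseteq> {0..1}" and R: "finite (R k)" "R k \<subseteq> {u..1}" for k
    using P[of k] u by (auto simp: Q_def R_def min_def)
  have stepQ: "step_fun 0 (Q k) (\<beta> k) v = indicator {..u} v * step_fun 0 (P k) (\<alpha> k) v" for k v
  proof -
    have "step_fun 0 (Q k) (\<beta> k) v = (\<Sum>p\<in>P k. \<alpha> k p * indicator {0<..min p u} v)"
      unfolding step_fun_def Q_def \<beta>_def by (rule sum_image_combine[OF P(1), symmetric])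
    then show ?thesis
      by (simp add: step_fun_def sum_distrib_left) (intro sum.cong refl, auto simp: indicator_def)
  qed
  have intQ: "step_integral W 0 (Q k) (\<beta> k) w = (\<Sum>p\<in>P k. \<alpha> k p * (W (min p u) w - W 0 w))" for k w
    unfolding step_integral_def Q_def \<beta>_def by (rule sum_image_combine[OF P(1), symmetric])
  have stepR: "step_fun u (R k) (\<alpha> k) v = indicator {u<..} v * step_fun 0 (P k) (\<alpha> k) v" for k v
  proof -
    have "step_fun u (R k) (\<alpha> k) v = (\<Sum>p\<in>P k. \<alpha> k p * indicator {u<..p} v)"
      unfolding step_fun_def R_def using P(1) by (intro sum.mono_neutral_left) (auto simp: indicator_def)
    also have "\<dots> = indicator {u<..} v * step_fun 0 (P k) (\<alpha> k) v"
      unfolding step_fun_def sum_distrib_left using u by (intro sum.cong refl) (auto simp: indicator_def)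
    finally show ?thesis .
  qed
  have intR: "step_integral W u (R k) (\<alpha> k) w = step_integral W 0 (P k) (\<alpha> k) w - step_integral W 0 (Q k) (\<beta> k) w" for k w
  proof -
    have "step_integral W u (R k) (\<alpha> k) w = (\<Sum>p\<in>P k. \<alpha> k p * (W p w - W (min p u) w))"
      unfolding step_integral_def R_def using P(1) by (intro sum.mono_neutral_cong_left) (auto simp: min_def)
    also have "\<dots> = step_integral W 0 (P k) (\<alpha> k) w - step_integral W 0 (Q k) (\<beta> k) w"
      unfolding intQ unfolding step_integral_def sum_subtractf[symmetric] by (intro sum.cong refl) (simp add: algebra_simps)
    finally show ?thesis .
  qed
  have Qm: "step_integral W 0 (Q k) (\<beta> k) \<in> borel_measurable (F u)" for k
    unfolding step_integral_def[abs_def]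
    using P[of k] u by (intro borel_measurable_sum borel_measurable_times borel_measurable_const increment_F_meas) (auto simp: Q_def)
  have sqQ: "square_integrable M (step_integral W 0 (Q k) (\<beta> k))" for k
    using Q by (intro step_integral_square_integrable) auto
  have cond: "AE w in M. real_cond_exp M (F u) (step_integral W 0 (P k) (\<alpha> k)) w = step_integral W 0 (Q k) (\<beta> k) w" for k
  proof (rule fs.real_cond_exp_charact)
    fix B assume B[measurable]: "B \<in> sets (F u)"
    have "B \<in> events" using B subalgebra_F[OF u] by (auto simp: subalgebra_def)
    have i: "integrable M (indicator B :: 'a \<Rightarrow> real)" using \<open>B \<in> events\<close> by (simp add: integrable_indicator_iff emeasure_eq_measure)
    have zero: "has_bochner_integral M (\<lambda>w. indicator B w * (W p w - W u w)) 0" if "p \<in> R k" for p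
    proof (cases "p = u")
      case False
      then have up: "0 \<le> u" "u < p" "p \<le> 1" using that R(2)[of k] u by auto
      have "indicator B \<in> borel_measurable (F u)" by simp
      from increment_mult(1,2)[OF up this i] show ?thesis by (simp add: has_bochner_integral_iff)
    qed (simp add: has_bochner_integral_zero)
    have z: "has_bochner_integral M (\<lambda>w. \<Sum>p\<in>R k. \<alpha> k p * (indicator B w * (W p w - W u w))) (\<Sum>p\<in>R k. \<alpha> k p * 0)"
      by (intro has_bochner_integral_sum has_bochner_integral_mult_right zero)
    have "(\<lambda>w. \<Sum>p\<in>R k. \<alpha> k p * (indicator B w * (W p w - W u w))) =
        (\<lambda>w. indicator B w * step_integral W 0 (P k) (\<alpha> k) w - indicator B w * step_integral W 0 (Q k) (\<beta> k) w)"
      unfolding right_diff_distrib[symmetric] intR[symmetric]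
      by (simp add: step_integral_def sum_distrib_left mult_ac)
    with z have "has_bochner_integral M (\<lambda>w. indicator B w * step_integral W 0 (P k) (\<alpha> k) w - indicator B w * step_integral W 0 (Q k) (\<beta> k) w) 0"
      by simp
    moreover have "integrable M (\<lambda>w. indicator B w * step_integral W 0 (P k) (\<alpha> k) w)"
      "integrable M (\<lambda>w. indicator B w * step_integral W 0 (Q k) (\<beta> k) w)"
      using integrable_mult_indicator[OF \<open>B \<in> events\<close> square_integrable_integrable[OF Xs(1)]]
        integrable_mult_indicator[OF \<open>B \<in> events\<close> square_integrable_integrable[OF sqQ]] by auto
    ultimately show "(\<integral>w\<in>B. step_integral W 0 (P k) (\<alpha> k) w \<partial>M) = (\<integral>w\<in>B. step_integral W 0 (Q k) (\<beta> k) w \<partial>M)"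
      by (simp add: set_lebesgue_integral_def has_bochner_integral_iff)
  qed (use Qm square_integrable_integrable[OF Xs(1)] square_integrable_integrable[OF sqQ] in auto)
  have A: "L2_tendsto M (\<lambda>k. step_integral W 0 (Q k) (\<beta> k)) A"
  proof (rule L2_tendsto_le[OF sqQ _ _ Xs(3)])
    show "square_integrable M A" unfolding A_def by (rule real_cond_exp_L2[OF subalgebra_F[OF u] Xs(2)])
    fix k
    note d = square_integrable_diff[OF Xs(2) Xs(1)[of k]]
    have "AE w in M. real_cond_exp M (F u) (\<lambda>w. X w - step_integral W 0 (P k) (\<alpha> k) w) w =
        A w - real_cond_exp M (F u) (step_integral W 0 (P k) (\<alpha> k)) w"
      unfolding A_def by (intro fs.real_cond_exp_diff square_integrable_integrable Xs)
    then have ae: "AE w in M. (A w - step_integral W 0 (Q k) (\<beta> k) w)\<^sup>2 =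
        (real_cond_exp M (F u) (\<lambda>w. X w - step_integral W 0 (P k) (\<alpha> k) w) w)\<^sup>2"
      using cond[of k] by eventually_elim simp
    have "expectation (\<lambda>w. (A w - step_integral W 0 (Q k) (\<beta> k) w)\<^sup>2) =
       expectation (\<lambda>w. (real_cond_exp M (F u) (\<lambda>w. X w - step_integral W 0 (P k) (\<alpha> k) w) w)\<^sup>2)"
      by (rule integral_cong_AE[OF _ _ ae]) (use square_integrableD(1)[OF sqQ] in \<open>auto simp: A_def\<close>)
    also have "\<dots> \<le> expectation (\<lambda>w. (X w - step_integral W 0 (P k) (\<alpha> k) w)\<^sup>2)"
      by (rule real_cond_exp_L2(2)[OF subalgebra_F[OF u] d])
    finally show "expectation (\<lambda>w. (A w - step_integral W 0 (Q k) (\<beta> k) w)\<^sup>2) \<le>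
       expectation (\<lambda>w. (X w - step_integral W 0 (P k) (\<alpha> k) w)\<^sup>2)" .
  qed
  have ind: "L2_tendsto lborel (\<lambda>k v. indicator B v * step_fun 0 (P k) (\<alpha> k) v) (\<lambda>v. indicator B v * \<phi> v)"
    if [measurable]: "B \<in> sets borel" for B :: "real set"
  proof -
    have sq: "square_integrable lborel (\<lambda>v. indicator B v * g v)" if "square_integrable lborel g" for g
    proof -
      note [measurable] = square_integrableD(1)[OF that]
      have "integrable lborel (\<lambda>v. (indicator B v * g v)\<^sup>2)"
        by (rule Bochner_Integration.integrable_bound[OF square_integrableD(2)[OF that]]) (auto simp: indicator_def)
      then show ?thesis by (simp add: square_integrable_def)
    qed
    show ?thesis
    proof (rule L2_tendsto_le[OF sq[OF ps(1)] sq[OF ps(2)] _ ps(3)])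
      fix k
      note d = square_integrable_diff[OF ps(2) ps(1)[of k]]
      show "(LINT v|lborel. (indicator B v * \<phi> v - indicator B v * step_fun 0 (P k) (\<alpha> k) v)\<^sup>2) \<le>
          (LINT v|lborel. (\<phi> v - step_fun 0 (P k) (\<alpha> k) v)\<^sup>2)"
        using square_integrableD(2)[OF sq[OF d]] square_integrableD(2)[OF d]
        by (intro integral_mono) (auto simp: indicator_def algebra_simps)
    qed
  qed
  show "wiener_version M W 0 (\<lambda>v. indicator {..u} v * \<phi> v) A"
    unfolding wiener_version_def using Q A ind[of "{..u}"] by (intro exI[of _ Q] exI[of _ \<beta>]) (simp add: stepQ[abs_def])
  show "wiener_version M W u (\<lambda>v. indicator {u<..} v * \<phi> v) (\<lambda>w. X w - A w)"
    unfolding wiener_version_def using R L2_tendsto_diff[OF L(2) A] ind[of "{u<..}"]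
    by (intro exI[of _ R] exI[of _ \<alpha>]) (simp add: stepR[abs_def] intR[abs_def])
qed

end

section \<open>Joint law of independent Brownian motions\<close>

text \<open>Two \<open>F\<close>-Brownian motions that are independent as processes have independent increments jointly
  with respect to \<open>F\<close>. This is not part of the definition; it is Levy's theorem. Conditional
  orthogonality of the increments comes from a subdivision of the interval: the off-diagonal products
  vanish by the martingale property, and the diagonal ones are small by independence.\<close>

lemma (in filtered_prob_space) increments_uncorrelated:
  fixes W1 W2 :: "real \<Rightarrow> 'a \<Rightarrow> real" and C1 C2 :: "('a \<Rightarrow> real) set"
  assumes W1: "F_brownian_motion M F W1" and W2: "F_brownian_motion M F W2"
    and ap1: "\<And>a b. 0 \<le> a \<Longrightarrow> a \<le> b \<Longrightarrow> b \<le> 1 \<Longrightarrow> \<exists>X. (\<forall>n. X n \<in> C1) \<and> L2_tendsto M X (\<lambda>w. W1 b w - W1 a w)"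
    and ap2: "\<And>a b. 0 \<le> a \<Longrightarrow> a \<le> b \<Longrightarrow> b \<le> 1 \<Longrightarrow> \<exists>X. (\<forall>n. X n \<in> C2) \<and> L2_tendsto M X (\<lambda>w. W2 b w - W2 a w)"
    and prod: "\<And>X X' Y Y'. X \<in> C1 \<Longrightarrow> X' \<in> C1 \<Longrightarrow> Y \<in> C2 \<Longrightarrow> Y' \<in> C2 \<Longrightarrow>
      has_bochner_integral M (\<lambda>w. (X w * X' w) * (Y w * Y' w)) (expectation (\<lambda>w. X w * X' w) * expectation (\<lambda>w. Y w * Y' w))"
    and st: "0 \<le> s" "s < t" "t \<le> 1" and S: "S \<in> borel_measurable (F s)" and Sb: "\<And>w. \<bar>S w\<bar> \<le> c"
  shows "expectation (\<lambda>w. S w * ((W1 t w - W1 s w) * (W2 t w - W2 s w))) = 0"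
proof -
  interpret A: F_brownian M F W1 by unfold_locales (rule W1)
  interpret B: F_brownian M F W2 by unfold_locales (rule W2)
  have s01: "s \<in> {0..1}" using st by auto
  have Sm[measurable]: "S \<in> borel_measurable M" by (rule F_meas[OF s01 S])
  have c0: "0 \<le> c" using Sb[of undefined] by linarith
  define E where "E = expectation (\<lambda>w. S w * ((W1 t w - W1 s w) * (W2 t w - W2 s w)))"
  have bound: "\<bar>E\<bar> \<le> c * sqrt ((t - s)\<^sup>2 / real n)" if n: "0 < n" for n
  proof -
    define \<tau> where "\<tau> k = s + real k * ((t - s) / real n)" for k
    define d where "d = (t - s) / real n"
    have d: "0 < d" using st n by (simp add: d_def)
    have \<tau>0: "\<tau> 0 = s" "\<tau> n = t" using n by (auto simp: \<tau>_def)
    have \<tau>S: "\<tau> (Suc k) = \<tau> k + d" for k unfolding \<tau>_def d_def[symmetric] by (simp add: algebra_simps)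
    have \<tau>mono: "\<tau> j \<le> \<tau> k" if "j \<le> k" for j k using that d unfolding \<tau>_def d_def[symmetric] by (simp add: mult_right_mono)
    have \<tau>01: "0 \<le> \<tau> k" "s \<le> \<tau> k" for k using \<tau>mono[of 0 k] \<tau>0 st by auto
    have \<tau>1: "\<tau> k \<le> 1" if "k \<le> n" for k using \<tau>mono[OF that] \<tau>0 st by auto
    define U where "U k w = W1 (\<tau> (Suc k)) w - W1 (\<tau> k) w" for k w
    define V where "V k w = W2 (\<tau> (Suc k)) w - W2 (\<tau> k) w" for k w
    have Usum: "W1 t w - W1 s w = (\<Sum>k<n. U k w)" and Vsum: "W2 t w - W2 s w = (\<Sum>k<n. V k w)" for w
      using sum_lessThan_telescope[of "\<lambda>k. W1 (\<tau> k) w" n] sum_lessThan_telescope[of "\<lambda>k. W2 (\<tau> k) w" n]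
      by (simp_all add: U_def V_def \<tau>0)
    have Usq: "square_integrable M (U k)" and Vsq: "square_integrable M (V k)" if "k < n" for k
      unfolding U_def[abs_def] V_def[abs_def] using that \<tau>01 \<tau>1[of "Suc k"] \<tau>mono[of k "Suc k"]
      by (auto intro!: A.increment_sq_int B.increment_sq_int)
    have off: "has_bochner_integral M (\<lambda>w. S w * (U k w * V l w)) 0" if kl: "k < n" "l < n" "k \<noteq> l" for k l
    proof -
      have st': "0 \<le> \<tau> m" "\<tau> m < \<tau> (Suc m)" "\<tau> (Suc m) \<le> 1" if "m < n" for m
        using \<tau>01[of m] \<tau>S[of m] d \<tau>1[of "Suc m"] that by auto
      have SF: "S \<in> borel_measurable (F (\<tau> m))" if "m < n" for m
        using st \<tau>01[of m] \<tau>1[of m] that by (intro F_meas_mono[OF _ _ _ S]) auto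
      have sqint: "integrable M (\<lambda>w. S w * X w)" if "square_integrable M X" for X
        using square_integrable_mult[OF square_integrable_bounded[OF Sm Sb] that] .
      show ?thesis
      proof (cases "k < l")
        case True
        have "U k \<in> borel_measurable (F (\<tau> l))"
          unfolding U_def[abs_def] using \<tau>01 \<tau>1[of l] \<tau>mono[of "Suc k" l] \<tau>mono[of k l] True kl by (intro A.increment_F_meas) auto
        then have "(\<lambda>w. S w * U k w) \<in> borel_measurable (F (\<tau> l))" using SF[OF kl(2)] by simp
        from B.increment_mult(1,2)[OF st'[OF kl(2)] this sqint[OF Usq[OF kl(1)]]]
        show ?thesis by (simp add: has_bochner_integral_iff V_def mult.assoc)
      next
        case False
        then have "l < k" using kl by simp
        then have "V l \<in> borel_measurable (F (\<tau> k))"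
          unfolding V_def[abs_def] using \<tau>01 \<tau>1[of k] \<tau>mono[of "Suc l" k] \<tau>mono[of l k] kl by (intro B.increment_F_meas) auto
        then have "(\<lambda>w. S w * V l w) \<in> borel_measurable (F (\<tau> k))" using SF[OF kl(1)] by simp
        from A.increment_mult(1,2)[OF st'[OF kl(1)] this sqint[OF Vsq[OF kl(2)]]]
        show ?thesis by (simp add: has_bochner_integral_iff U_def mult_ac)
      qed
    qed
    have SUVint: "integrable M (\<lambda>w. S w * (U k w * V l w))" if "k < n" "l < n" for k l
      using square_integrable_mult[OF L2_tendstoD(2)[OF L2_tendsto_bounded_mult[OF L2_tendsto_const[OF Usq[OF that(1)]] Sm Sb]] Vsq[OF that(2)]]
      by (simp add: mult.assoc)
    have "S w * ((\<Sum>k<n. U k w) * (\<Sum>l<n. V l w)) = (\<Sum>k<n. \<Sum>l<n. S w * (U k w * V l w))" for w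
      unfolding sum_product by (simp only: sum_distrib_left)
    then have "E = expectation (\<lambda>w. \<Sum>k<n. \<Sum>l<n. S w * (U k w * V l w))"
      unfolding E_def Usum Vsum by simp
    also have "\<dots> = (\<Sum>k<n. expectation (\<lambda>w. \<Sum>l<n. S w * (U k w * V l w)))"
      by (intro Bochner_Integration.integral_sum Bochner_Integration.integrable_sum SUVint) auto
    also have "\<dots> = (\<Sum>k<n. \<Sum>l<n. expectation (\<lambda>w. S w * (U k w * V l w)))"
      by (intro sum.cong refl Bochner_Integration.integral_sum SUVint) auto
    finally have "E = (\<Sum>k<n. \<Sum>l<n. expectation (\<lambda>w. S w * (U k w * V l w)))" .
    also have "\<dots> = (\<Sum>k<n. \<Sum>l<n. if k = l then expectation (\<lambda>w. S w * (U k w * V k w)) else 0)"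
      using off by (intro sum.cong refl) (auto dest: has_bochner_integral_integral_eq)
    also have "\<dots> = (\<Sum>k<n. expectation (\<lambda>w. S w * (U k w * V k w)))" by (simp add: sum.delta)
    finally have E: "E = (\<Sum>k<n. expectation (\<lambda>w. S w * (U k w * V k w)))" .
    \<comment> \<open>Fourth-order products factor only for elements of \<open>C1\<close> and
      \<open>C2\<close>. The diagonal sum is therefore estimated for the approximants, as
      \<open>T\<close>, and \<open>m\<close> tends to infinity with the subdivision fixed. In the
      limit its second moment consists of \<open>n\<close> terms \<open>d * d\<close>, which makes
      \<open>E\<close> of order \<open>n^(-1/2)\<close>.\<close>
    have "\<exists>X. (\<forall>m. X m \<in> C1) \<and> L2_tendsto M X (U k)" if "k < n" for k
      unfolding U_def[abs_def] using that \<tau>01 \<tau>1[of "Suc k"] \<tau>mono[of k "Suc k"] by (intro ap1) auto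
    then obtain X where X: "\<And>k m. k < n \<Longrightarrow> X k m \<in> C1" "\<And>k. k < n \<Longrightarrow> L2_tendsto M (X k) (U k)" by metis
    have "\<exists>X. (\<forall>m. X m \<in> C2) \<and> L2_tendsto M X (V k)" if "k < n" for k
      unfolding V_def[abs_def] using that \<tau>01 \<tau>1[of "Suc k"] \<tau>mono[of k "Suc k"] by (intro ap2) auto
    then obtain Y where Y: "\<And>k m. k < n \<Longrightarrow> Y k m \<in> C2" "\<And>k. k < n \<Longrightarrow> L2_tendsto M (Y k) (V k)" by metis
    define T where "T m w = (\<Sum>k<n. X k m w * Y k m w)" for m w
    have Tint: "integrable M (\<lambda>w. (X k m w * Y k m w) * (X l m w * Y l m w))" if "k < n" "l < n" for k l m
      using integrable.intros[OF prod[OF X(1)[OF that(1)] X(1)[OF that(2)] Y(1)[OF that(1)] Y(1)[OF that(2)]]] by (simp add: mult_ac)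
    have XYm: "X k m \<in> borel_measurable M" "Y k m \<in> borel_measurable M" if "k < n" for k m
      using square_integrableD(1)[OF L2_tendstoD(1)[OF X(2)[OF that], of m]] square_integrableD(1)[OF L2_tendstoD(1)[OF Y(2)[OF that], of m]] by auto
    have T2: "(T m w)\<^sup>2 = (\<Sum>k<n. \<Sum>l<n. (X k m w * Y k m w) * (X l m w * Y l m w))" for m w
      unfolding T_def power2_eq_square by (rule sum_product)
    have Tsq: "square_integrable M (T m)" for m
      unfolding square_integrable_def T2
    proof
      show "T m \<in> borel_measurable M" unfolding T_def[abs_def]
        by (intro borel_measurable_sum borel_measurable_times XYm) auto
    qed (intro Bochner_Integration.integrable_sum Tint; simp)
    have ET2: "expectation (\<lambda>w. (T m w)\<^sup>2) = (\<Sum>k<n. \<Sum>l<n. expectation (\<lambda>w. X k m w * X l m w) * expectation (\<lambda>w. Y k m w * Y l m w))" for m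
    proof -
      have "expectation (\<lambda>w. (T m w)\<^sup>2) = (\<Sum>k<n. \<Sum>l<n. expectation (\<lambda>w. (X k m w * Y k m w) * (X l m w * Y l m w)))"
        unfolding T2 by (subst Bochner_Integration.integral_sum;
          (intro sum.cong refl Bochner_Integration.integral_sum Bochner_Integration.integrable_sum Tint)?; simp)
      also have "\<dots> = (\<Sum>k<n. \<Sum>l<n. expectation (\<lambda>w. X k m w * X l m w) * expectation (\<lambda>w. Y k m w * Y l m w))"
        using has_bochner_integral_integral_eq[OF prod[OF X(1) X(1) Y(1) Y(1)]] by (intro sum.cong refl) (simp add: mult_ac)
      finally show ?thesis .
    qed
    have covU: "expectation (\<lambda>w. U k w * U l w) = (if k = l then d else 0)" and covV: "expectation (\<lambda>w. V k w * V l w) = (if k = l then d else 0)" if kl: "k < n" "l < n" for k l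
    proof -
      have gen: "expectation (\<lambda>w. (W (\<tau> (Suc k)) w - W (\<tau> k) w) * (W (\<tau> (Suc l)) w - W (\<tau> l) w)) = (if k = l then d else 0)"
        if "F_brownian_motion M F W" for W
      proof -
        interpret F_brownian M F W by unfold_locales (rule that)
        have *: "expectation (\<lambda>w. (W (\<tau> (Suc k)) w - W (\<tau> k) w) * (W (\<tau> (Suc l)) w - W (\<tau> l) w)) = 0" if kl: "k < l" "l < n" for k l
        proof -
          have m: "(\<lambda>w. W (\<tau> (Suc k)) w - W (\<tau> k) w) \<in> borel_measurable (F (\<tau> l))"
            using \<tau>01 \<tau>1[of l] \<tau>mono[of "Suc k" l] \<tau>mono[of k l] kl by (intro increment_F_meas) auto
          have i: "integrable M (\<lambda>w. W (\<tau> (Suc k)) w - W (\<tau> k) w)"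
            using \<tau>01 \<tau>1[of "Suc k"] \<tau>mono[of k "Suc k"] kl by (intro square_integrable_integrable increment_sq_int) auto
          show ?thesis using \<tau>01[of l] \<tau>S[of l] d \<tau>1[of "Suc l"] kl by (intro increment_mult(1)[OF _ _ _ m i]) auto
        qed
        have "expectation (\<lambda>w. (W (\<tau> (Suc k)) w - W (\<tau> k) w)\<^sup>2) = d"
          using increment_variance[of "\<tau> k" "\<tau> (Suc k)"] \<tau>01[of k] \<tau>S[of k] d \<tau>1[of "Suc k"] kl by simp
        then show ?thesis using *[of k l] *[of l k] kl
          by (cases k l rule: linorder_cases) (auto simp: power2_eq_square mult.commute)
      qed
      show "expectation (\<lambda>w. U k w * U l w) = (if k = l then d else 0)" unfolding U_def by (rule gen[OF W1])
      show "expectation (\<lambda>w. V k w * V l w) = (if k = l then d else 0)" unfolding V_def by (rule gen[OF W2])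
    qed
    have "(\<lambda>m. expectation (\<lambda>w. (T m w)\<^sup>2)) \<longlonglongrightarrow> (\<Sum>k<n. \<Sum>l<n. expectation (\<lambda>w. U k w * U l w) * expectation (\<lambda>w. V k w * V l w))"
      unfolding ET2 by (intro tendsto_sum tendsto_mult L2_tendsto_inner X Y) auto
    also have "(\<Sum>k<n. \<Sum>l<n. expectation (\<lambda>w. U k w * U l w) * expectation (\<lambda>w. V k w * V l w)) = (\<Sum>k<n. \<Sum>l<n. if k = l then d * d else 0)"
      using covU covV by (intro sum.cong refl) auto
    also have "\<dots> = (t - s)\<^sup>2 / real n" using n by (simp add: sum.delta d_def power2_eq_square)
    finally have limT: "(\<lambda>m. expectation (\<lambda>w. (T m w)\<^sup>2)) \<longlonglongrightarrow> (t - s)\<^sup>2 / real n" .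
    have limE: "(\<lambda>m. \<Sum>k<n. expectation (\<lambda>w. (S w * X k m w) * Y k m w)) \<longlonglongrightarrow> (\<Sum>k<n. expectation (\<lambda>w. (S w * U k w) * V k w))"
      by (intro tendsto_sum L2_tendsto_inner L2_tendsto_bounded_mult[OF _ Sm Sb] X Y) auto
    have le: "\<bar>\<Sum>k<n. expectation (\<lambda>w. (S w * X k m w) * Y k m w)\<bar> \<le> c * sqrt (expectation (\<lambda>w. (T m w)\<^sup>2))" for m
    proof -
      have "(\<Sum>k<n. expectation (\<lambda>w. (S w * X k m w) * Y k m w)) = expectation (\<lambda>w. \<Sum>k<n. (S w * X k m w) * Y k m w)"
        by (rule Bochner_Integration.integral_sum[symmetric])
           (intro square_integrable_mult L2_tendstoD(1)[OF L2_tendsto_bounded_mult[OF X(2) Sm Sb]] L2_tendstoD(1)[OF Y(2)], auto)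
      also have "(\<lambda>w. \<Sum>k<n. (S w * X k m w) * Y k m w) = (\<lambda>w. S w * T m w)"
        by (simp add: T_def sum_distrib_left mult.assoc)
      also have "\<bar>expectation (\<lambda>w. S w * T m w)\<bar> \<le> sqrt (expectation (\<lambda>w. (S w)\<^sup>2)) * sqrt (expectation (\<lambda>w. (T m w)\<^sup>2))"
        by (rule Cauchy_Schwarz_integral[OF square_integrable_bounded[OF Sm Sb] Tsq])
      also have "\<dots> \<le> c * sqrt (expectation (\<lambda>w. (T m w)\<^sup>2))"
      proof (rule mult_right_mono)
        have "expectation (\<lambda>w. (S w)\<^sup>2) \<le> expectation (\<lambda>w. c\<^sup>2)"
          using square_integrable_bounded[OF Sm Sb] power_mono[OF Sb, where n=2] by (intro integral_mono) (auto simp: square_integrable_def)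
        then show "sqrt (expectation (\<lambda>w. (S w)\<^sup>2)) \<le> c" using c0 by (simp add: prob_space real_le_lsqrt)
      qed simp
      finally show ?thesis .
    qed
    have "\<bar>\<Sum>k<n. expectation (\<lambda>w. (S w * U k w) * V k w)\<bar> \<le> c * sqrt ((t - s)\<^sup>2 / real n)"
      by (rule LIMSEQ_le[OF tendsto_rabs[OF limE] tendsto_mult_left[OF tendsto_real_sqrt[OF limT]]]) (use le in auto)
    then show ?thesis unfolding E by (simp add: mult.assoc)
  qed
  have "(\<lambda>n. c * sqrt ((t - s)\<^sup>2 * (1 / real n))) \<longlonglongrightarrow> c * sqrt ((t - s)\<^sup>2 * 0)"
    by (intro tendsto_intros lim_1_over_n)
  then have "\<bar>E\<bar> \<le> c * sqrt ((t - s)\<^sup>2 * 0)"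
    by (rule tendsto_lowerbound) (use bound in \<open>auto intro!: eventually_sequentiallyI[of 1]\<close>)
  then show ?thesis by (simp add: E_def)
qed

section \<open>Joint characteristic functions of increments and Wiener integrals\<close>

lemma (in prob_space) integrable_complex_mult:
  fixes V :: "'a \<Rightarrow> complex" and Y :: "'a \<Rightarrow> real"
  assumes [measurable]: "V \<in> borel_measurable M" and Vc: "\<And>x. cmod (V x) \<le> c" and Y: "integrable M Y"
  shows "integrable M (\<lambda>x. V x * of_real (Y x))"
proof (rule Bochner_Integration.integrable_bound[OF integrable_mult_right[OF integrable_abs[OF Y], of c]])
  show "AE x in M. norm (V x * of_real (Y x)) \<le> norm (c * \<bar>Y x\<bar>)"
  proof (rule AE_I2)
    fix x
    have "0 \<le> c" using Vc[of x] norm_ge_zero order_trans by blast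
    then show "norm (V x * of_real (Y x)) \<le> norm (c * \<bar>Y x\<bar>)"
      using mult_right_mono[OF Vc[of x], of "\<bar>Y x\<bar>"] by (simp add: norm_mult)
  qed
qed (use Y in measurable)

lemma (in prob_space) complex_expectation_mult:
  fixes V :: "'a \<Rightarrow> complex" and Y :: "'a \<Rightarrow> real"
  assumes V: "V \<in> borel_measurable G" and G: "subalgebra M G" and Vc: "\<And>x. cmod (V x) \<le> c" and Y: "integrable M Y"
    and real_case: "\<And>S. S \<in> borel_measurable G \<Longrightarrow> (\<And>x. \<bar>S x\<bar> \<le> c) \<Longrightarrow> expectation (\<lambda>x. S x * Y x) = expectation S * r"
  shows "(CLINT x|M. V x * of_real (Y x)) = (CLINT x|M. V x) * of_real r"
proof -
  have [measurable]: "V \<in> borel_measurable M" by (rule measurable_from_subalg[OF G V])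
  have intV: "integrable M V" using Vc by (intro integrable_const_bound[where B=c]) auto
  have intVY: "integrable M (\<lambda>x. V x * of_real (Y x))" by (rule integrable_complex_mult[OF _ Vc Y]) simp
  have "expectation (\<lambda>x. Re (V x) * Y x) = expectation (\<lambda>x. Re (V x)) * r"
    by (rule real_case) (use V order_trans[OF abs_Re_le_cmod Vc] in auto)
  moreover have "expectation (\<lambda>x. Im (V x) * Y x) = expectation (\<lambda>x. Im (V x)) * r"
    by (rule real_case) (use V order_trans[OF abs_Im_le_cmod Vc] in auto)
  ultimately show ?thesis
    using integral_Re[OF intVY] integral_Im[OF intVY] integral_Re[OF intV] integral_Im[OF intV]
    by (simp add: complex_eq_iff)
qed

lemma sum_abs_cube_le:
  fixes a :: "'d::finite \<Rightarrow> real"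
  shows "\<bar>\<Sum>l\<in>UNIV. a l\<bar> ^ 3 \<le> real CARD('d) ^ 3 * (\<Sum>l\<in>UNIV. \<bar>a l\<bar> ^ 3)"
proof -
  define m where "m = Max (range (\<lambda>l. \<bar>a l\<bar>))"
  have "m \<in> range (\<lambda>l. \<bar>a l\<bar>)" unfolding m_def by (intro Max_in) auto
  then obtain l where l: "m = \<bar>a l\<bar>" by auto
  have "\<bar>\<Sum>l\<in>UNIV. a l\<bar> \<le> (\<Sum>l\<in>UNIV. \<bar>a l\<bar>)" by (rule sum_abs)
  also have "\<dots> \<le> (\<Sum>l\<in>(UNIV :: 'd set). m)" unfolding m_def by (intro sum_mono Max_ge) auto
  finally have "\<bar>\<Sum>l\<in>UNIV. a l\<bar> \<le> real CARD('d) * \<bar>a l\<bar>" by (simp add: l)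
  then have "\<bar>\<Sum>l\<in>UNIV. a l\<bar> ^ 3 \<le> (real CARD('d) * \<bar>a l\<bar>) ^ 3" by (rule power_mono) simp
  also have "\<dots> = real CARD('d) ^ 3 * \<bar>a l\<bar> ^ 3" by (rule power_mult_distrib)
  also have "\<bar>a l\<bar> ^ 3 \<le> (\<Sum>l\<in>UNIV. \<bar>a l\<bar> ^ 3)"
    by (rule member_le_sum) auto
  finally show ?thesis by (simp add: mult_left_mono)
qed

text \<open>Since \<open>cmod q \<le> 1\<close>, the one-step errors add up without
  amplification.\<close>

lemma norm_iterates_le:
  fixes a :: "nat \<Rightarrow> complex"
  assumes q: "cmod q \<le> 1" and step: "\<And>k. k < n \<Longrightarrow> cmod (a (Suc k) - q * a k) \<le> \<eta>" and "k \<le> n"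
  shows "cmod (a k - q ^ k * a 0) \<le> real k * \<eta>"
  using \<open>k \<le> n\<close>
proof (induction k)
  case (Suc k)
  have "a (Suc k) - q ^ Suc k * a 0 = (a (Suc k) - q * a k) + q * (a k - q ^ k * a 0)" by (simp add: algebra_simps)
  then have "cmod (a (Suc k) - q ^ Suc k * a 0) \<le> cmod (a (Suc k) - q * a k) + cmod q * cmod (a k - q ^ k * a 0)"
    by (metis norm_mult norm_triangle_ineq)
  also have "\<dots> \<le> \<eta> + 1 * (real k * \<eta>)"
    using step[of k] Suc q by (intro add_mono mult_mono) auto
  finally show ?case by (simp add: algebra_simps)
qed simp

text \<open>Conditional orthogonality, expressed with bounded test functions of the past, is the
  only joint assumption on the components. It is the bracket condition of Levy's theorem, and the
  joint laws below are derived from it.\<close>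

locale F_brownian_family = filtered_prob_space M F for M :: "'a measure" and F +
  fixes W :: "'d::finite \<Rightarrow> real \<Rightarrow> 'a \<Rightarrow> real"
  assumes W_brownian: "F_brownian_motion M F (W l)"
    and W_uncorrelated: "l \<noteq> m \<Longrightarrow> 0 \<le> s \<Longrightarrow> s < t \<Longrightarrow> t \<le> 1 \<Longrightarrow> S \<in> borel_measurable (F s) \<Longrightarrow>
      (\<And>w. \<bar>S w\<bar> \<le> c) \<Longrightarrow> expectation (\<lambda>w. S w * ((W l t w - W l s w) * (W m t w - W m s w))) = 0"
begin

sublocale W: F_brownian M F "W l" for l by unfold_locales (rule W_brownian)

definition increment :: "('d \<Rightarrow> real) \<Rightarrow> real \<Rightarrow> real \<Rightarrow> 'a \<Rightarrow> real" where
  "increment lam s t w = (\<Sum>l\<in>UNIV. lam l * (W l t w - W l s w))"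

lemma increment_add: "increment lam s t w + increment lam t u w = increment lam s u w"
  unfolding increment_def sum.distrib[symmetric] by (simp add: algebra_simps)

lemma increment_F_measurable:
  assumes "0 \<le> s" "s \<le> t" "t \<le> u" "u \<le> 1"
  shows "increment lam s t \<in> borel_measurable (F u)"
  unfolding increment_def[abs_def]
  using assms by (intro borel_measurable_sum borel_measurable_times borel_measurable_const W.increment_F_meas) auto

text \<open>Taylor expansion of the exponential to second order: the linear term has conditional
  mean 0, the quadratic one is deterministic because the mixed products vanish, and the third
  moments make the remainder of order \<open>(t - s)^(3/2)\<close>.\<close>

lemma increment_char_step:
  fixes V :: "'a \<Rightarrow> complex"
  assumes st: "0 \<le> s" "s < t" "t \<le> 1" and V: "V \<in> borel_measurable (F s)" and Vc: "\<And>w. cmod (V w) \<le> c"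
  shows "cmod ((CLINT w|M. V w * iexp (increment lam s t w)) -
      of_real (1 - (\<Sum>l\<in>UNIV. (lam l)\<^sup>2) * (t - s) / 2) * (CLINT w|M. V w)) \<le>
    c * (real CARD('d) ^ 3 * (\<Sum>l\<in>UNIV. \<bar>lam l\<bar> ^ 3 * (2 * sqrt (t - s) * (t - s))))"
proof -
  define x where "x = increment lam s t"
  define \<Lambda> where "\<Lambda> = (\<Sum>l\<in>UNIV. (lam l)\<^sup>2)"
  have s01: "s \<in> {0..1}" using st by auto
  have Vm[measurable]: "V \<in> borel_measurable M" by (rule F_meas[OF s01 V])
  have xm[measurable]: "x \<in> borel_measurable M"
    using F_meas[OF _ increment_F_measurable[of s t t lam]] st by (simp add: x_def)
  have c0: "0 \<le> c" using Vc[of undefined] norm_ge_zero order_trans by blast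
  have sq: "square_integrable M (\<lambda>w. W l t w - W l s w)" for l using st by (intro W.increment_sq_int) auto
  have xsq: "square_integrable M x" unfolding x_def increment_def[abs_def]
    by (intro square_integrable_sum square_integrable_cmult sq)
  have xint: "integrable M x" by (rule square_integrable_integrable[OF xsq])
  have x2int: "integrable M (\<lambda>w. (x w)\<^sup>2)" using xsq by (simp add: square_integrable_def)
  have S1: "expectation (\<lambda>w. S w * x w) = expectation S * 0"
    and S2: "expectation (\<lambda>w. S w * (x w)\<^sup>2) = expectation S * (\<Lambda> * (t - s))"
    if S: "S \<in> borel_measurable (F s)" and Sb: "\<And>w. \<bar>S w\<bar> \<le> c" for S
  proof -
    have Sm: "S \<in> borel_measurable M" by (rule F_meas[OF s01 S])
    have Sint: "integrable M S" using square_integrable_integrable[OF square_integrable_bounded[OF Sm Sb]] .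
    note m = W.increment_mult[OF st S Sint]
    have "expectation (\<lambda>w. S w * x w) = expectation (\<lambda>w. \<Sum>l\<in>UNIV. lam l * (S w * (W l t w - W l s w)))"
      by (simp add: x_def increment_def sum_distrib_left mult_ac)
    also have "\<dots> = 0" using m(1,2) by simp
    finally show "expectation (\<lambda>w. S w * x w) = expectation S * 0" by simp
    have pint: "integrable M (\<lambda>w. S w * ((W l t w - W l s w) * (W k t w - W k s w)))" for l k
      using square_integrable_mult[OF L2_tendstoD(2)[OF L2_tendsto_bounded_mult[OF L2_tendsto_const[OF sq[of l]] Sm Sb]] sq[of k]]
      by (simp add: mult.assoc)
    have "S w * (x w)\<^sup>2 = (\<Sum>l\<in>UNIV. \<Sum>k\<in>UNIV. (lam l * lam k) * (S w * ((W l t w - W l s w) * (W k t w - W k s w))))" for w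
      unfolding x_def increment_def power2_eq_square sum_product
      by (simp only: sum_distrib_left) (intro sum.cong refl, simp add: mult_ac)
    then have "expectation (\<lambda>w. S w * (x w)\<^sup>2) =
      expectation (\<lambda>w. \<Sum>l\<in>UNIV. \<Sum>k\<in>UNIV. (lam l * lam k) * (S w * ((W l t w - W l s w) * (W k t w - W k s w))))"
      by simp
    also have "\<dots> = (\<Sum>l\<in>UNIV. \<Sum>k\<in>UNIV. (lam l * lam k) * expectation (\<lambda>w. S w * ((W l t w - W l s w) * (W k t w - W k s w))))"
      using pint by simp
    also have "\<dots> = (\<Sum>l\<in>UNIV. \<Sum>k\<in>UNIV. if l = k then (lam l)\<^sup>2 * (expectation S * (t - s)) else 0)"
    proof (intro sum.cong refl)
      fix l k :: 'd
      show "(lam l * lam k) * expectation (\<lambda>w. S w * ((W l t w - W l s w) * (W k t w - W k s w))) =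
          (if l = k then (lam l)\<^sup>2 * (expectation S * (t - s)) else 0)"
        using W_uncorrelated[OF _ st S Sb, of l k] m(3)[of k] by (cases "l = k") (simp_all add: power2_eq_square)
    qed
    also have "\<dots> = expectation S * (\<Lambda> * (t - s))"
      by (simp add: sum.delta \<Lambda>_def sum_distrib_left sum_distrib_right mult_ac)
    finally show "expectation (\<lambda>w. S w * (x w)\<^sup>2) = expectation S * (\<Lambda> * (t - s))" .
  qed
  have G: "subalgebra M (F s)" by (rule subalgebra_F[OF s01])
  have V1: "(CLINT w|M. V w * of_real (x w)) = (CLINT w|M. V w) * of_real 0"
    by (rule complex_expectation_mult[OF V G Vc xint S1]) auto
  have V2: "(CLINT w|M. V w * of_real ((x w)\<^sup>2)) = (CLINT w|M. V w) * of_real (\<Lambda> * (t - s))"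
    by (rule complex_expectation_mult[OF V G Vc x2int S2]) auto
  have Vint: "integrable M V" using Vc by (intro integrable_const_bound[where B=c]) auto
  have VYint: "integrable M (\<lambda>w. V w * of_real (Y w))" if "integrable M Y" for Y
    by (rule integrable_complex_mult[OF Vm Vc that])
  have Veint: "integrable M (\<lambda>w. V w * iexp (x w))"
    using Vc by (intro integrable_const_bound[where B=c]) (auto simp: norm_mult)
  define R where "R w = iexp (x w) - (1 + \<i> * of_real (x w) - of_real ((x w)\<^sup>2) / 2)" for w
  have R: "cmod (R w) \<le> \<bar>x w\<bar> ^ 3" for w
  proof -
    have "(\<Sum>k\<le>2. (\<i> * of_real (x w)) ^ k / fact k) = 1 + \<i> * of_real (x w) - of_real ((x w)\<^sup>2) / 2"
      by (simp add: numeral_2_eq_2 power2_eq_square mult_ac)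
    then have "cmod (R w) \<le> \<bar>x w\<bar> ^ Suc 2 / fact (Suc 2)"
      using iexp_approx1[of "x w" 2] by (simp add: R_def)
    also have "\<bar>x w\<bar> ^ Suc 2 / fact (Suc 2) = \<bar>x w\<bar> ^ 3 / 6" by (simp add: eval_nat_numeral)
    also have "\<dots> \<le> \<bar>x w\<bar> ^ 3" using zero_le_power[of "\<bar>x w\<bar>" 3] by linarith
    finally show ?thesis .
  qed
  define C where "C w = real CARD('d) ^ 3 * (\<Sum>l\<in>UNIV. \<bar>lam l\<bar> ^ 3 * \<bar>W l t w - W l s w\<bar> ^ 3)" for w
  have RC: "cmod (R w) \<le> C w" for w
    using R[of w] sum_abs_cube_le[of "\<lambda>l. lam l * (W l t w - W l s w)"]
    by (simp add: x_def increment_def C_def abs_mult power_mult_distrib)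
  have Cint: "integrable M C" unfolding C_def[abs_def] using W.increment_third_le(1)[OF st] by auto
  have EC: "expectation C \<le> real CARD('d) ^ 3 * (\<Sum>l\<in>UNIV. \<bar>lam l\<bar> ^ 3 * (2 * sqrt (t - s) * (t - s)))"
  proof -
    have "expectation C = real CARD('d) ^ 3 * (\<Sum>l\<in>UNIV. \<bar>lam l\<bar> ^ 3 * expectation (\<lambda>w. \<bar>W l t w - W l s w\<bar> ^ 3))"
      unfolding C_def[abs_def] using W.increment_third_le(1)[OF st] by simp
    also have "\<dots> \<le> real CARD('d) ^ 3 * (\<Sum>l\<in>UNIV. \<bar>lam l\<bar> ^ 3 * (2 * sqrt (t - s) * (t - s)))"
      by (intro mult_left_mono sum_mono W.increment_third_le(2)[OF st]) auto
    finally show ?thesis .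
  qed
  have "(CLINT w|M. V w * iexp (x w)) - of_real (1 - \<Lambda> * (t - s) / 2) * (CLINT w|M. V w) = (CLINT w|M. V w * R w)"
  proof -
    have "(CLINT w|M. V w * R w) = (CLINT w|M. V w * iexp (x w) - (V w + \<i> * (V w * of_real (x w)) - (1/2) * (V w * of_real ((x w)\<^sup>2))))"
      by (intro Bochner_Integration.integral_cong refl) (simp add: R_def algebra_simps)
    also have "\<dots> = (CLINT w|M. V w * iexp (x w)) - ((CLINT w|M. V w) + \<i> * (CLINT w|M. V w * of_real (x w)) - (1/2) * (CLINT w|M. V w * of_real ((x w)\<^sup>2)))"
      using Veint Vint VYint[OF xint] VYint[OF x2int] by simp
    finally show ?thesis unfolding V1 V2 by (simp add: algebra_simps diff_divide_distrib)
  qed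
  also have "cmod (CLINT w|M. V w * R w) \<le> expectation (\<lambda>w. c * C w)"
  proof (rule order_trans[OF integral_norm_bound integral_mono])
    show VRle: "norm (V w * R w) \<le> c * C w" for w
      unfolding norm_mult using Vc RC c0 by (intro mult_mono) auto
    show "integrable M (\<lambda>w. c * C w)" using Cint by simp
    then show "integrable M (\<lambda>w. norm (V w * R w))"
      by (rule Bochner_Integration.integrable_bound)
         (use VRle in \<open>auto simp: R_def intro!: order_trans[OF _ abs_ge_self]\<close>)
  qed
  also have "\<dots> \<le> c * (real CARD('d) ^ 3 * (\<Sum>l\<in>UNIV. \<bar>lam l\<bar> ^ 3 * (2 * sqrt (t - s) * (t - s))))"
    using EC c0 by (simp add: mult_left_mono)
  finally show ?thesis by (simp add: x_def \<Lambda>_def)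
qed

text \<open>Over \<open>n\<close> equal subintervals the one-step errors are of order
  \<open>n^(-3/2)\<close> and add up to \<open>n^(-1/2)\<close>, while the \<open>n\<close>-th
  powers of the one-step factors converge to the exponential. For \<open>n\<close> at least
  \<open>\<Lambda> * (t - s)\<close> these factors have modulus at most 1.\<close>

lemma increment_char:
  fixes V :: "'a \<Rightarrow> complex"
  assumes st: "0 \<le> s" "s \<le> t" "t \<le> 1" and V: "V \<in> borel_measurable (F s)" and Vc: "\<And>w. cmod (V w) \<le> c"
  shows "(CLINT w|M. V w * iexp (increment lam s t w)) =
    of_real (exp (- ((\<Sum>l\<in>UNIV. (lam l)\<^sup>2) * (t - s) / 2))) * (CLINT w|M. V w)"
proof (cases "s = t")
  case True
  then show ?thesis by (simp add: increment_def)
next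
  case False
  then have s_t: "s < t" using st by simp
  define \<Lambda> where "\<Lambda> = (\<Sum>l\<in>UNIV. (lam l)\<^sup>2)"
  define K where "K = c * (real CARD('d) ^ 3 * (\<Sum>l\<in>UNIV. \<bar>lam l\<bar> ^ 3 * 2))"
  define a where "a = (CLINT w|M. V w * iexp (increment lam s t w))"
  define b where "b = (CLINT w|M. V w)"
  define q where "q n = 1 + (- (\<Lambda> * (t - s) / 2)) / real n" for n
  have Lam0: "0 \<le> \<Lambda>" unfolding \<Lambda>_def by (intro sum_nonneg) auto
  have bound: "cmod (a - of_real (q n ^ n) * b) \<le> K * (t - s) * sqrt ((t - s) * (1 / real n))"
    if n: "0 < n" "\<Lambda> * (t - s) \<le> real n" for n
  proof -
    define \<tau> where "\<tau> k = s + real k * ((t - s) / real n)" for k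
    define d where "d = (t - s) / real n"
    have d: "0 < d" using s_t n by (simp add: d_def)
    have \<tau>0: "\<tau> 0 = s" "\<tau> n = t" using n by (auto simp: \<tau>_def)
    have \<tau>S: "\<tau> (Suc k) = \<tau> k + d" for k unfolding \<tau>_def d_def[symmetric] by (simp add: algebra_simps)
    have \<tau>mono: "\<tau> j \<le> \<tau> k" if "j \<le> k" for j k using that d unfolding \<tau>_def d_def[symmetric] by (simp add: mult_right_mono)
    have \<tau>01: "0 \<le> \<tau> k" "s \<le> \<tau> k" for k using \<tau>mono[of 0 k] \<tau>0 st by auto
    have \<tau>1: "\<tau> k \<le> 1" if "k \<le> n" for k using \<tau>mono[OF that] \<tau>0 st by auto
    define A where "A k = (CLINT w|M. V w * iexp (increment lam s (\<tau> k) w))" for k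
    have "cmod (A n - of_real (q n) ^ n * A 0) \<le> real n * (K * (sqrt d * d))"
    proof (rule norm_iterates_le[of _ n])
      have "\<bar>q n\<bar> \<le> 1"
      proof -
        define z where "z = \<Lambda> * (t - s) / 2 / real n"
        have "0 \<le> z" using Lam0 st by (simp add: z_def)
        moreover have "z \<le> 1 / 2"
          using divide_right_mono[OF n(2), of "2 * real n"] n(1) by (simp add: z_def)
        ultimately have "\<bar>1 - z\<bar> \<le> 1" by simp
        then show ?thesis by (simp add: q_def z_def)
      qed
      then show "cmod (of_real (q n)) \<le> 1" by simp
      fix k assume k: "k < n"
      define Vk where "Vk w = V w * iexp (increment lam s (\<tau> k) w)" for w
      have st': "0 \<le> \<tau> k" "\<tau> k < \<tau> (Suc k)" "\<tau> (Suc k) \<le> 1" "\<tau> k \<le> 1"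
        using \<tau>01[of k] \<tau>S[of k] d \<tau>1[of "Suc k"] \<tau>1[of k] k by auto
      have [measurable]: "V \<in> borel_measurable (F (\<tau> k))" using st st' \<tau>01[of k] by (intro F_meas_mono[OF _ _ _ V]) auto
      have [measurable]: "increment lam s (\<tau> k) \<in> borel_measurable (F (\<tau> k))"
        using st st' \<tau>01[of k] by (intro increment_F_measurable) auto
      have Vk: "Vk \<in> borel_measurable (F (\<tau> k))" unfolding Vk_def[abs_def] by measurable
      have Vkc: "cmod (Vk w) \<le> c" for w using Vc by (simp add: Vk_def norm_mult)
      have "Vk w * iexp (increment lam (\<tau> k) (\<tau> (Suc k)) w) = V w * iexp (increment lam s (\<tau> (Suc k)) w)" for w
        unfolding Vk_def using increment_add[of lam s "\<tau> k" w "\<tau> (Suc k)", symmetric]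
        by (simp add: algebra_simps exp_add)
      then have A1: "(CLINT w|M. Vk w * iexp (increment lam (\<tau> k) (\<tau> (Suc k)) w)) = A (Suc k)"
        by (simp only: A_def)
      have A0: "(CLINT w|M. Vk w) = A k" by (simp only: A_def Vk_def)
      have "cmod (A (Suc k) - of_real (1 - \<Lambda> * (\<tau> (Suc k) - \<tau> k) / 2) * A k) \<le>
          c * (real CARD('d) ^ 3 * (\<Sum>l\<in>UNIV. \<bar>lam l\<bar> ^ 3 * (2 * sqrt (\<tau> (Suc k) - \<tau> k) * (\<tau> (Suc k) - \<tau> k))))"
        using increment_char_step[OF st'(1-3) Vk Vkc, of lam] unfolding A1 A0 \<Lambda>_def[symmetric] .
      also have "\<tau> (Suc k) - \<tau> k = d" using \<tau>S by simp
      also have "c * (real CARD('d) ^ 3 * (\<Sum>l\<in>UNIV. \<bar>lam l\<bar> ^ 3 * (2 * sqrt d * d))) = K * (sqrt d * d)"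
        by (simp add: K_def sum_distrib_left sum_distrib_right mult_ac)
      also have "1 - \<Lambda> * d / 2 = q n" by (simp add: q_def d_def)
      finally show "cmod (A (Suc k) - of_real (q n) * A k) \<le> K * (sqrt d * d)" .
    qed simp
    moreover have "A n = a" "A 0 = b" by (simp_all add: A_def a_def b_def \<tau>0 increment_def)
    moreover have "real n * (K * (sqrt d * d)) = K * (t - s) * sqrt ((t - s) * (1 / real n))"
      using n by (simp add: d_def)
    ultimately show ?thesis by simp
  qed
  have "(\<lambda>n. K * (t - s) * sqrt ((t - s) * (1 / real n))) \<longlonglongrightarrow> K * (t - s) * sqrt ((t - s) * 0)"
    by (intro tendsto_intros lim_1_over_n)
  moreover have "(\<lambda>n. cmod (a - of_real (q n ^ n) * b)) \<longlonglongrightarrow> cmod (a - of_real (exp (- (\<Lambda> * (t - s) / 2))) * b)"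
    unfolding q_def by (intro tendsto_intros tendsto_exp_limit_sequentially)
  moreover have "eventually (\<lambda>n. cmod (a - of_real (q n ^ n) * b) \<le> K * (t - s) * sqrt ((t - s) * (1 / real n))) sequentially"
    using eventually_gt_at_top[of 0] eventually_ge_at_top[of "nat \<lceil>\<Lambda> * (t - s)\<rceil>"]
    by eventually_elim (rule bound, auto simp: nat_ceiling_le_eq)
  ultimately have "cmod (a - of_real (exp (- (\<Lambda> * (t - s) / 2))) * b) \<le> K * (t - s) * sqrt ((t - s) * 0)"
    by (intro tendsto_le[OF sequentially_bot])
  then show ?thesis by (simp add: a_def b_def \<Lambda>_def)
qed

text \<open>Induction from the earliest end point \<open>p\<close>. All steps start at
  \<open>u\<close>, so on \<open>{u<..p}\<close> they have the common height \<open>\<beta>\<close>,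
  the sum of all coefficients. The exponential of this first increment joins \<open>V\<close>, and
  the remaining steps restart at \<open>p\<close>.\<close>

lemma step_char:
  fixes V :: "'a \<Rightarrow> complex" and \<alpha> :: "'d \<Rightarrow> real \<Rightarrow> real"
  assumes "finite P" "0 \<le> u" "u \<le> 1" "P \<subseteq> {u..1}" "V \<in> borel_measurable (F u)" "\<And>w. cmod (V w) \<le> c"
  shows "(CLINT w|M. V w * iexp (\<Sum>l\<in>UNIV. step_integral (W l) u P (\<alpha> l) w)) =
    of_real (exp (- ((\<Sum>l\<in>UNIV. \<integral>v. (step_fun u P (\<alpha> l) v)\<^sup>2 \<partial>lborel) / 2))) * (CLINT w|M. V w)"
  using assms
proof (induction P arbitrary: u V rule: finite_linorder_min_induct)
  case empty
  then show ?case by (simp add: step_integral_def step_fun_def)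
next
  case (insert p A)
  define \<beta> where "\<beta> l = (\<Sum>q\<in>insert p A. \<alpha> l q)" for l
  have p: "u \<le> p" "p \<le> 1" "p \<notin> A" "A \<subseteq> {p..1}" using insert by fastforce+
  have p0: "0 \<le> p" using p insert by simp
  have intg: "step_integral (W l) u (insert p A) (\<alpha> l) w = \<beta> l * (W l p w - W l u w) + step_integral (W l) p A (\<alpha> l) w" for l w
    unfolding step_integral_def \<beta>_def sum_distrib_right using p(3) insert(1)
    by (simp add: algebra_simps sum.distrib[symmetric] sum_subtractf[symmetric])
  have stp: "step_fun u (insert p A) (\<alpha> l) v = \<beta> l * indicator {u<..p} v + step_fun p A (\<alpha> l) v" for l v
  proof -
    have "(\<Sum>q\<in>A. \<alpha> l q * indicator {u<..q} v) = (\<Sum>q\<in>A. \<alpha> l q * indicator {u<..p} v + \<alpha> l q * indicator {p<..q} v)"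
      using p by (intro sum.cong refl) (force simp: indicator_def)
    moreover have "step_fun u (insert p A) (\<alpha> l) v = \<alpha> l p * indicator {u<..p} v + (\<Sum>q\<in>A. \<alpha> l q * indicator {u<..q} v)"
      unfolding step_fun_def by (rule sum.insert[OF insert(1) p(3)])
    moreover have "\<beta> l = \<alpha> l p + sum (\<alpha> l) A" unfolding \<beta>_def by (rule sum.insert[OF insert(1) p(3)])
    ultimately show ?thesis
      unfolding step_fun_def[of p] by (simp only: sum.distrib sum_distrib_right distrib_right add.assoc)
  qed
  have norm: "(LINT v|lborel. (step_fun u (insert p A) (\<alpha> l) v)\<^sup>2) = (\<beta> l)\<^sup>2 * (p - u) + (LINT v|lborel. (step_fun p A (\<alpha> l) v)\<^sup>2)" for l
  proof -
    have "(step_fun u (insert p A) (\<alpha> l) v)\<^sup>2 = (\<beta> l)\<^sup>2 * indicator {u<..p} v + (step_fun p A (\<alpha> l) v)\<^sup>2" for v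
    proof (cases "v \<in> {u<..p}")
      case True
      then have "step_fun p A (\<alpha> l) v = 0" unfolding step_fun_def by (intro sum.neutral) (auto simp: indicator_def)
      then show ?thesis using True by (simp add: stp)
    qed (simp add: stp)
    moreover have "integrable lborel (indicator {u<..p} :: real \<Rightarrow> real)" using p by (simp add: integrable_indicator_iff)
    ultimately show ?thesis using p square_integrableD(2)[OF step_fun_square_integrable[of p A "\<alpha> l"]] by simp
  qed
  define V' where "V' w = V w * iexp (increment \<beta> u p w)" for w
  have [measurable]: "V \<in> borel_measurable (F p)" using insert p by (intro F_meas_mono[OF _ _ _ \<open>V \<in> borel_measurable (F u)\<close>]) auto
  have [measurable]: "increment \<beta> u p \<in> borel_measurable (F p)" using insert p by (intro increment_F_measurable) auto
  have V': "V' \<in> borel_measurable (F p)" unfolding V'_def[abs_def] by measurable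
  have V'c: "cmod (V' w) \<le> c" for w using insert.prems(5) by (simp add: V'_def norm_mult)
  have "(\<Sum>l\<in>UNIV. step_integral (W l) u (insert p A) (\<alpha> l) w) = increment \<beta> u p w + (\<Sum>l\<in>UNIV. step_integral (W l) p A (\<alpha> l) w)" for w
    by (simp add: intg sum.distrib increment_def)
  then have "(CLINT w|M. V w * iexp (\<Sum>l\<in>UNIV. step_integral (W l) u (insert p A) (\<alpha> l) w)) =
     (CLINT w|M. V' w * iexp (\<Sum>l\<in>UNIV. step_integral (W l) p A (\<alpha> l) w))"
    by (simp add: V'_def distrib_left exp_add mult.assoc)
  also have "\<dots> = of_real (exp (- ((\<Sum>l\<in>UNIV. \<integral>v. (step_fun p A (\<alpha> l) v)\<^sup>2 \<partial>lborel) / 2))) * (CLINT w|M. V' w)"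
    by (rule insert.IH[OF p0 p(2) p(4) V' V'c])
  also have "(CLINT w|M. V' w) = of_real (exp (- ((\<Sum>l\<in>UNIV. (\<beta> l)\<^sup>2) * (p - u) / 2))) * (CLINT w|M. V w)"
    unfolding V'_def by (rule increment_char[OF insert.prems(1) p(1,2) insert.prems(4,5)])
  finally have fin: "(CLINT w|M. V w * iexp (\<Sum>l\<in>UNIV. step_integral (W l) u (insert p A) (\<alpha> l) w)) =
    of_real (exp (- ((\<Sum>l\<in>UNIV. \<integral>v. (step_fun p A (\<alpha> l) v)\<^sup>2 \<partial>lborel) / 2))) *
    (of_real (exp (- ((\<Sum>l\<in>UNIV. (\<beta> l)\<^sup>2) * (p - u) / 2))) * (CLINT w|M. V w))" .
  show ?case
  proof -
    have e: "exp (- ((a + b) / 2)) = exp (- (b / 2)) * exp (- (a / 2))" for a b :: real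
      by (simp add: add_divide_distrib flip: exp_add)
    show ?thesis using fin
      unfolding norm sum.distrib sum_distrib_right[symmetric] e of_real_mult mult.assoc .
  qed
qed

text \<open>Limit of \<open>step_char\<close>, using that \<open>x \<mapsto> iexp x\<close> is
  Lipschitz with constant 1. The components come with different sets of end points; their union with
  zero coefficients gives the common set that \<open>step_char\<close> asks for.\<close>

lemma wiener_char:
  fixes V :: "'a \<Rightarrow> complex"
  assumes u: "0 \<le> u" "u \<le> 1" and V: "V \<in> borel_measurable (F u)" and Vc: "\<And>w. cmod (V w) \<le> c"
    and X: "\<And>l. wiener_version M (W l) u (\<phi> l) (X l)"
  shows "(CLINT w|M. V w * iexp (\<Sum>l\<in>UNIV. X l w)) =
    of_real (exp (- ((\<Sum>l\<in>UNIV. \<integral>v. (\<phi> l v)\<^sup>2 \<partial>lborel) / 2))) * (CLINT w|M. V w)"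
proof -
  have "\<forall>l. \<exists>P \<alpha>. (\<forall>k. finite (P k) \<and> P k \<subseteq> {u..1}) \<and> L2_tendsto lborel (\<lambda>k. step_fun u (P k) (\<alpha> k)) (\<phi> l) \<and>
     L2_tendsto M (\<lambda>k. step_integral (W l) u (P k) (\<alpha> k)) (X l)"
    using X unfolding wiener_version_def by blast
  from choice[OF this] obtain P where "\<forall>l. \<exists>\<alpha>. (\<forall>k. finite (P l k) \<and> P l k \<subseteq> {u..1}) \<and>
      L2_tendsto lborel (\<lambda>k. step_fun u (P l k) (\<alpha> k)) (\<phi> l) \<and> L2_tendsto M (\<lambda>k. step_integral (W l) u (P l k) (\<alpha> k)) (X l)"
    by blast
  from choice[OF this] obtain \<alpha> where P: "\<And>l k. finite (P l k)" "\<And>l k. P l k \<subseteq> {u..1}"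
    and L: "\<And>l. L2_tendsto lborel (\<lambda>k. step_fun u (P l k) (\<alpha> l k)) (\<phi> l)"
      "\<And>l. L2_tendsto M (\<lambda>k. step_integral (W l) u (P l k) (\<alpha> l k)) (X l)"
    by blast
  define Q where "Q k = (\<Union>l. P l k)" for k
  define \<beta> where "\<beta> k l p = (if p \<in> P l k then \<alpha> l k p else 0)" for k l p
  have Q: "finite (Q k)" "Q k \<subseteq> {u..1}" for k
    using P(1) P(2) unfolding Q_def by (simp, blast)
  have sum_ext: "(\<Sum>p\<in>Q k. \<beta> k l p * f p) = (\<Sum>p\<in>P l k. \<alpha> l k p * f p)" for k l and f :: "real \<Rightarrow> real"
    by (rule sum.mono_neutral_cong_right[OF Q(1)]) (auto simp: \<beta>_def Q_def)
  have ext: "step_fun u (Q k) (\<beta> k l) = step_fun u (P l k) (\<alpha> l k)"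
    "step_integral (W l) u (Q k) (\<beta> k l) = step_integral (W l) u (P l k) (\<alpha> l k)" for k l
    unfolding step_fun_def[abs_def] step_integral_def[abs_def] sum_ext by (rule refl)+
  have eq: "(CLINT w|M. V w * iexp (\<Sum>l\<in>UNIV. step_integral (W l) u (P l k) (\<alpha> l k) w)) =
    of_real (exp (- ((\<Sum>l\<in>UNIV. \<integral>v. (step_fun u (P l k) (\<alpha> l k) v)\<^sup>2 \<partial>lborel) / 2))) * (CLINT w|M. V w)" for k
    using step_char[OF Q(1) u Q(2) V Vc, of k "\<beta> k"] unfolding ext .
  have Vm[measurable]: "V \<in> borel_measurable M" using u by (intro F_meas[OF _ V]) auto
  have c0: "0 \<le> c" using Vc[of undefined] norm_ge_zero order_trans by blast
  define Y where "Y k w = (\<Sum>l\<in>UNIV. step_integral (W l) u (P l k) (\<alpha> l k) w)" for k w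
  define Z where "Z w = (\<Sum>l\<in>UNIV. X l w)" for w
  have YZ: "L2_tendsto M Y Z" unfolding Y_def[abs_def] Z_def[abs_def] by (intro L2_tendsto_sum L)
  note YZ' = L2_tendstoD[OF YZ]
  have [measurable]: "Y k \<in> borel_measurable M" "Z \<in> borel_measurable M" for k
    using YZ' by (auto simp: square_integrable_def)
  have "(\<lambda>k. CLINT w|M. V w * iexp (Y k w)) \<longlonglongrightarrow> (CLINT w|M. V w * iexp (Z w))"
  proof (rule Lim_transform2[OF tendsto_const], rule tendsto_norm_zero_cancel, rule tendsto_sandwich[OF _ _ tendsto_const])
    have int: "integrable M (\<lambda>w. V w * iexp (T w))" if [measurable]: "T \<in> borel_measurable M" for T
      using Vc by (intro integrable_const_bound[where B=c]) (auto simp: norm_mult)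
    have "cmod ((CLINT w|M. V w * iexp (Z w)) - (CLINT w|M. V w * iexp (Y k w))) \<le> c * expectation (\<lambda>w. \<bar>Z w - Y k w\<bar>)" for k
    proof -
      have "(CLINT w|M. V w * iexp (Z w)) - (CLINT w|M. V w * iexp (Y k w)) = (CLINT w|M. V w * iexp (Z w) - V w * iexp (Y k w))"
        by (rule Bochner_Integration.integral_diff[symmetric]) (auto intro: int)
      also have "cmod \<dots> \<le> expectation (\<lambda>w. c * \<bar>Z w - Y k w\<bar>)"
      proof (rule order_trans[OF integral_norm_bound integral_mono])
        show "integrable M (\<lambda>w. norm (V w * iexp (Z w) - V w * iexp (Y k w)))"
          by (intro integrable_norm Bochner_Integration.integrable_diff int) auto
        show "integrable M (\<lambda>w. c * \<bar>Z w - Y k w\<bar>)"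
          using square_integrable_integrable[OF square_integrable_diff[OF YZ'(2) YZ'(1)[of k]]] by auto
        fix w
        have "V w * iexp (Z w) - V w * iexp (Y k w) = V w * iexp (Y k w) * (iexp (Z w - Y k w) - 1)"
          by (simp add: exp_diff right_diff_distrib)
        moreover have "cmod (iexp (Z w - Y k w) - 1) \<le> \<bar>Z w - Y k w\<bar>"
          using iexp_approx1[of "Z w - Y k w" 0] by simp
        ultimately show "norm (V w * iexp (Z w) - V w * iexp (Y k w)) \<le> c * \<bar>Z w - Y k w\<bar>"
          using Vc[of w] c0 by (simp add: norm_mult mult_mono)
      qed
      finally show ?thesis by simp
    qed
    then show "eventually (\<lambda>k. cmod ((CLINT w|M. V w * iexp (Z w)) - (CLINT w|M. V w * iexp (Y k w))) \<le> c * expectation (\<lambda>w. \<bar>Z w - Y k w\<bar>)) sequentially"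
      by simp
    show "(\<lambda>k. c * expectation (\<lambda>w. \<bar>Z w - Y k w\<bar>)) \<longlonglongrightarrow> 0"
      using tendsto_mult_left[OF L2_tendsto_L1[OF YZ], of c] by simp
  qed simp
  moreover have "(\<lambda>k. CLINT w|M. V w * iexp (Y k w)) \<longlonglongrightarrow>
      of_real (exp (- ((\<Sum>l\<in>UNIV. \<integral>v. (\<phi> l v)\<^sup>2 \<partial>lborel) / 2))) * (CLINT w|M. V w)"
    unfolding Y_def eq by (intro tendsto_intros L2_tendsto_norm L) simp
  ultimately show ?thesis unfolding Z_def by (rule LIMSEQ_unique)
qed

end

section \<open>Normal laws and their moments from characteristic functions\<close>

lemma (in prob_space) normal_of_char:
  fixes X :: "'a \<Rightarrow> real"
  assumes X[measurable]: "X \<in> borel_measurable M" and v: "0 < v"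
    and char: "\<And>t. (CLINT w|M. iexp (t * X w)) = of_real (exp (- (v * t\<^sup>2 / 2)))"
  shows "distributed M lborel X (\<lambda>x. ennreal (normal_density 0 (sqrt v) x))"
proof -
  have s: "0 < sqrt v" using v by simp
  define Y where "Y w = X w / sqrt v" for w
  have [measurable]: "Y \<in> borel_measurable M" unfolding Y_def[abs_def] by simp
  have "char (distr M borel Y) = char std_normal_distribution"
  proof
    fix t
    have "char (distr M borel Y) t = (CLINT w|M. iexp (t * Y w))" by (simp add: char_def integral_distr)
    also have "\<dots> = (CLINT w|M. iexp ((t / sqrt v) * X w))" by (simp add: Y_def)
    also have "\<dots> = of_real (exp (- (v * (t / sqrt v)\<^sup>2 / 2)))" by (rule char)
    also have "v * (t / sqrt v)\<^sup>2 = t\<^sup>2" using v by (simp add: power_divide)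
    finally show "char (distr M borel Y) t = char std_normal_distribution t"
      by (simp add: char_std_normal_distribution)
  qed
  then have "distr M borel Y = std_normal_distribution"
    by (intro Levy_uniqueness real_distribution_distr real_dist_normal_dist) auto
  moreover have "distr M lborel Y = distr M borel Y" by (intro distr_cong) auto
  ultimately have "distributed M lborel Y (\<lambda>x. ennreal (std_normal_density x))"
    by (simp add: distributed_def)
  then show ?thesis
    using normal_standard_normal_convert[OF s, of X 0] by (simp add: Y_def[abs_def])
qed

text \<open>The fraction \<open>c\<close> is the moment of order \<open>2 * p\<close> of a standard
  normal variable. Since \<open>c \<le> (1 + c) ^ (2 * p)\<close>, the number \<open>1 + c\<close>
  bounds the norm without taking a root.\<close>

definition gaussian_moment_const :: "nat \<Rightarrow> real" where
  "gaussian_moment_const p = 1 + fact (2 * p) / (2 ^ p * fact p)"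

lemma gaussian_moment_const_pos: "0 < gaussian_moment_const p"
  by (simp add: gaussian_moment_const_def add_pos_nonneg)

text \<open>For \<open>v > 0\<close> the law is normal and its moments are explicit. The case
  \<open>v = 0\<close> has no density and is treated apart; differences of conditional means at
  equal times are of this kind.\<close>

lemma (in prob_space) gaussian_moment_le:
  fixes X :: "'a \<Rightarrow> real"
  assumes X: "square_integrable M X" and var: "expectation (\<lambda>w. (X w)\<^sup>2) = v" and p: "1 \<le> p"
    and char: "\<And>t. (CLINT w|M. iexp (t * X w)) = of_real (exp (- (v * t\<^sup>2 / 2)))"
  shows "moment_le p X (gaussian_moment_const p * sqrt v)"
proof (cases "v = 0")
  case True
  note [measurable] = square_integrableD(1)[OF X]
  have "AE w in M. (X w)\<^sup>2 = 0"
    using integral_nonneg_eq_0_iff_AE[OF square_integrableD(2)[OF X]] var True by simp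
  then have "AE w in M. 0 = X w" by eventually_elim simp
  from moment_le_cong_AE[OF moment_le_zero _ this] show ?thesis using True by simp
next
  case False
  have "0 \<le> v" unfolding var[symmetric] by simp
  then have v: "0 < v" using False by simp
  then have s: "0 < sqrt v" by simp
  note D = normal_of_char[OF square_integrableD(1)[OF X] v char]
  have m: "has_bochner_integral lborel (\<lambda>x. normal_density 0 (sqrt v) x * x ^ (2 * p)) (fact (2 * p) / ((2 / v) ^ p * fact p))"
    using normal_moment_even[OF s, of 0 p] v by simp
  have int: "integrable M (\<lambda>w. X w ^ (2 * p))"
    using distributed_integrable[OF D, of "\<lambda>x. x ^ (2 * p)"] integrable.intros[OF m] by simp
  define c :: real where "c = fact (2 * p) / (2 ^ p * fact p)"
  have c: "0 \<le> c" by (simp add: c_def)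
  have "expectation (\<lambda>w. X w ^ (2 * p)) = c * v ^ p"
    using distributed_integral[OF D, of "\<lambda>x. x ^ (2 * p)"] has_bochner_integral_integral_eq[OF m] v
    by (simp add: c_def power_divide)
  also have "c * v ^ p \<le> (1 + c) ^ (2 * p) * v ^ p"
  proof (rule mult_right_mono)
    have "c \<le> (1 + c) ^ 1" by simp
    also have "\<dots> \<le> (1 + c) ^ (2 * p)" using c p by (intro power_increasing) auto
    finally show "c \<le> (1 + c) ^ (2 * p)" .
  qed (use v in simp)
  also have "\<dots> = ((1 + c) * sqrt v) ^ (2 * p)"
    using v by (simp add: power_mult_distrib power_mult[of "sqrt v"])
  finally show ?thesis using int square_integrableD(1)[OF X] c v
    by (simp add: moment_le_def gaussian_moment_const_def c_def)
qed

section \<open>Joint independence of the past and of the future parts of all components\<close>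

context F_brownian_family
begin

context
  fixes u :: real and \<phi> :: "'d \<Rightarrow> real \<Rightarrow> real" and X :: "'d \<Rightarrow> 'a \<Rightarrow> real"
  assumes u: "0 \<le> u" "u \<le> 1" and X: "\<And>l. wiener_version M (W l) u (\<phi> l) (X l)"
begin

private lemma X_meas[measurable]: "X l \<in> borel_measurable M"
  using W.wiener_versionD(2)[OF X] by (simp add: square_integrable_def)

lemma wiener_char_linear:
  fixes V :: "'a \<Rightarrow> complex"
  assumes V: "V \<in> borel_measurable (F u)" and Vc: "\<And>w. cmod (V w) \<le> c"
  shows "(CLINT w|M. V w * iexp (\<Sum>l\<in>UNIV. lam l * X l w)) =
    of_real (exp (- ((\<Sum>l\<in>UNIV. (lam l)\<^sup>2 * (LINT v|lborel. (\<phi> l v)\<^sup>2)) / 2))) * (CLINT w|M. V w)"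
proof -
  have "wiener_version M (W l) u (\<lambda>v. lam l * \<phi> l v) (\<lambda>w. lam l * X l w)" for l
    by (rule W.wiener_version_cmult[OF X])
  from wiener_char[OF u V Vc this] show ?thesis by (simp add: power_mult_distrib)
qed

lemma wiener_char_single:
  "(CLINT w|M. iexp (t * X i w)) = of_real (exp (- ((LINT v|lborel. (\<phi> i v)\<^sup>2) * t\<^sup>2 / 2)))"
proof -
  have "(\<Sum>l\<in>UNIV. (if l = i then t else 0) * X l w) = t * X i w" for w
  proof -
    have "(\<Sum>l\<in>UNIV. (if l = i then t else 0) * X l w) = (\<Sum>l\<in>UNIV. if l = i then t * X l w else 0)"
      by (intro sum.cong) auto
    then show ?thesis by simp
  qed
  moreover have "(\<Sum>l\<in>UNIV. (if l = i then t else 0)\<^sup>2 * (LINT v|lborel. (\<phi> l v)\<^sup>2)) = t\<^sup>2 * (LINT v|lborel. (\<phi> i v)\<^sup>2)"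
  proof -
    have "(\<Sum>l\<in>UNIV. (if l = i then t else 0)\<^sup>2 * (LINT v|lborel. (\<phi> l v)\<^sup>2)) = (\<Sum>l\<in>UNIV. if l = i then t\<^sup>2 * (LINT v|lborel. (\<phi> l v)\<^sup>2) else 0)"
      by (intro sum.cong) auto
    then show ?thesis by simp
  qed
  ultimately show ?thesis
    using wiener_char_linear[of "\<lambda>_. 1" 1 "\<lambda>l. if l = i then t else 0"] by (simp add: prob_space mult.commute)
qed

text \<open>Components in \<open>I\<close> have been turned from exponentials into indicators. In
  the induction step all factors except component \<open>j\<close> form a bounded \<open>V\<close>;
  letting the coefficient of component \<open>j\<close> vary gives the factorisation that
  \<open>char_factor_indicator\<close> asks for.\<close>

lemma wiener_joint_char:
  assumes A: "A \<in> sets (F u)" and C[measurable]: "\<And>l. C l \<in> sets borel"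
  shows "(CLINT w|M. indicator A w * (\<Prod>l\<in>I. indicator (C l) (X l w)) * iexp (\<Sum>l\<in>-I. lam l * X l w)) =
    of_real (prob A) * (\<Prod>l\<in>I. of_real (prob (X l -` C l \<inter> space M))) *
    of_real (exp (- ((\<Sum>l\<in>-I. (lam l)\<^sup>2 * (LINT v|lborel. (\<phi> l v)\<^sup>2)) / 2)))"
proof -
  have u01: "u \<in> {0..1}" using u by simp
  have Am[measurable]: "A \<in> events" using A subalgebra_F[OF u01] by (auto simp: subalgebra_def)
  have "finite I" by simp
  then show ?thesis
  proof (induction I arbitrary: lam rule: finite_induct)
    case empty
    have "(CLINT w|M. indicator A w) = (of_real (prob A) :: complex)"
    proof -
      have "(CLINT w|M. indicator A w) = (CLINT w|M. of_real (indicator A w))"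
        by (intro Bochner_Integration.integral_cong refl) (simp add: indicator_def)
      also have "\<dots> = of_real (expectation (indicator A))" by (rule integral_complex_of_real)
      finally show ?thesis by simp
    qed
    then show ?case
      using wiener_char_linear[of "indicator A" 1 lam] A by (simp add: indicator_def mult.commute)
  next
    case (insert j I)
    define V where "V w = indicator A w * (\<Prod>l\<in>I. indicator (C l) (X l w)) * iexp (\<Sum>l\<in>-insert j I. lam l * X l w)" for w
    have [measurable]: "V \<in> borel_measurable M" unfolding V_def[abs_def] by measurable
    have Vc: "cmod (V w) \<le> 1" for w
    proof -
      have "(\<Prod>l\<in>I. cmod (indicator (C l) (X l w))) \<le> 1"
        by (intro prod_le_1) (auto simp: indicator_def)
      then show ?thesis unfolding V_def norm_mult prod_norm[symmetric] by (simp add: indicator_def)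
    qed
    have split: "(\<Sum>l\<in>-I. f l) = f j + (\<Sum>l\<in>-insert j I. f l)" for f :: "'d \<Rightarrow> real"
    proof -
      have "-I = insert j (-insert j I)" using insert by auto
      then have "(\<Sum>l\<in>-I. f l) = (\<Sum>l\<in>insert j (-insert j I). f l)" by simp
      also have "\<dots> = f j + (\<Sum>l\<in>-insert j I. f l)" by (rule sum.insert) auto
      finally show ?thesis .
    qed
    define R where "R = of_real (prob A) * (\<Prod>l\<in>I. complex_of_real (prob (X l -` C l \<inter> space M))) *
      of_real (exp (- ((\<Sum>l\<in>-insert j I. (lam l)\<^sup>2 * (LINT v|lborel. (\<phi> l v)\<^sup>2)) / 2)))"
    have VX: "(CLINT w|M. V w * iexp (t * X j w)) = R * of_real (exp (- ((LINT v|lborel. (\<phi> j v)\<^sup>2) * t\<^sup>2 / 2)))" for t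
    proof -
      have s1: "(\<Sum>l\<in>-I. (lam(j := t)) l * X l w) = t * X j w + (\<Sum>l\<in>-insert j I. lam l * X l w)" for w
        unfolding split by (intro arg_cong2[where f="(+)"] sum.cong) auto
      have s2: "(\<Sum>l\<in>-I. ((lam(j := t)) l)\<^sup>2 * (LINT v|lborel. (\<phi> l v)\<^sup>2)) =
          t\<^sup>2 * (LINT v|lborel. (\<phi> j v)\<^sup>2) + (\<Sum>l\<in>-insert j I. (lam l)\<^sup>2 * (LINT v|lborel. (\<phi> l v)\<^sup>2))"
        unfolding split by (intro arg_cong2[where f="(+)"] sum.cong) auto
      have "(CLINT w|M. V w * iexp (t * X j w)) =
        (CLINT w|M. indicator A w * (\<Prod>l\<in>I. indicator (C l) (X l w)) * iexp (\<Sum>l\<in>-I. (lam(j := t)) l * X l w))"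
        unfolding s1 by (intro Bochner_Integration.integral_cong refl) (simp add: V_def distrib_left exp_add mult_ac)
      also have "\<dots> = of_real (prob A) * (\<Prod>l\<in>I. of_real (prob (X l -` C l \<inter> space M))) *
        of_real (exp (- ((t\<^sup>2 * (LINT v|lborel. (\<phi> j v)\<^sup>2) + (\<Sum>l\<in>-insert j I. (lam l)\<^sup>2 * (LINT v|lborel. (\<phi> l v)\<^sup>2))) / 2)))"
        unfolding insert.IH s2 ..
      also have "exp (- ((t\<^sup>2 * (LINT v|lborel. (\<phi> j v)\<^sup>2) + (\<Sum>l\<in>-insert j I. (lam l)\<^sup>2 * (LINT v|lborel. (\<phi> l v)\<^sup>2))) / 2)) =
        exp (- ((\<Sum>l\<in>-insert j I. (lam l)\<^sup>2 * (LINT v|lborel. (\<phi> l v)\<^sup>2)) / 2)) * exp (- ((LINT v|lborel. (\<phi> j v)\<^sup>2) * t\<^sup>2 / 2))"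
        unfolding exp_add[symmetric] by (intro arg_cong[where f=exp]) (simp add: field_simps)
      finally show ?thesis by (simp only: R_def of_real_mult mult.assoc)
    qed
    have V0: "(CLINT w|M. V w) = R" using VX[of 0] by simp
    have "(CLINT w|M. V w * indicator (C j) (X j w)) = (CLINT w|M. V w) * prob (X j -` C j \<inter> space M)"
    proof (rule char_factor_indicator[OF X_meas _ Vc _ C])
      show "(CLINT w|M. V w * iexp (t * X j w)) = (CLINT w|M. V w) * (CLINT w|M. iexp (t * X j w))" for t
        unfolding V0 VX wiener_char_single ..
    qed simp
    moreover have "V w * indicator (C j) (X j w) = indicator A w * (\<Prod>l\<in>insert j I. indicator (C l) (X l w)) * iexp (\<Sum>l\<in>-insert j I. lam l * X l w)" for w
      using insert by (simp add: V_def mult_ac)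
    ultimately show ?case unfolding V0 R_def using insert by (simp add: mult_ac)
  qed
qed

lemma wiener_joint_prob:
  assumes A: "A \<in> sets (F u)" and C[measurable]: "\<And>l. C l \<in> sets borel"
  shows "prob (A \<inter> (\<Inter>l. X l -` C l \<inter> space M)) = prob A * (\<Prod>l\<in>UNIV. prob (X l -` C l \<inter> space M))"
proof -
  have u01: "u \<in> {0..1}" using u by simp
  have [measurable]: "A \<in> events" using A subalgebra_F[OF u01] by (auto simp: subalgebra_def)
  have ind: "indicator A w * (\<Prod>l\<in>UNIV. indicator (C l) (X l w)) = (of_real (indicator (A \<inter> (\<Inter>l. X l -` C l \<inter> space M)) w) :: complex)" if "w \<in> space M" for w
  proof (cases "\<forall>l. X l w \<in> C l")
    case True
    then show ?thesis using that by (simp add: indicator_def)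
  next
    case False
    then obtain l where "X l w \<notin> C l" by auto
    then have "(\<Prod>l\<in>UNIV. indicator (C l) (X l w)) = (0 :: complex)" by (intro prod_zero bexI[of _ l]) auto
    then show ?thesis using \<open>X l w \<notin> C l\<close> by (auto simp: indicator_def)
  qed
  have "complex_of_real (prob (A \<inter> (\<Inter>l. X l -` C l \<inter> space M))) = of_real (expectation (indicator (A \<inter> (\<Inter>l. X l -` C l \<inter> space M))))"
    by simp
  also have "\<dots> = (CLINT w|M. of_real (indicator (A \<inter> (\<Inter>l. X l -` C l \<inter> space M)) w))"
    by (rule integral_complex_of_real[symmetric])
  also have "\<dots> = (CLINT w|M. indicator A w * (\<Prod>l\<in>UNIV. indicator (C l) (X l w)) * iexp (\<Sum>l\<in>-UNIV. 0 * X l w))"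
    using ind by (intro Bochner_Integration.integral_cong refl) simp
  also have "\<dots> = of_real (prob A * (\<Prod>l\<in>UNIV. prob (X l -` C l \<inter> space M)))"
    unfolding wiener_joint_char[OF A C] by simp
  finally show ?thesis by (simp only: of_real_eq_iff)
qed

text \<open>\<open>G\<close> is generated by the past \<open>F u\<close> together with every
  component except \<open>i\<close>, and independence is checked on an intersection-stable
  generator. This is the sigma-algebra for \<open>freezing\<close>: it contains all that stays fixed
  while coordinate \<open>i\<close> is integrated out.\<close>

lemma wiener_independent:
  obtains G where "subalgebra M G" "subalgebra G (F u)" "\<And>l. l \<noteq> i \<Longrightarrow> X l \<in> borel_measurable G"
    "indep_set (sets G) {X i -` A \<inter> space M |A. A \<in> sets borel}"
proof -
  have u01: "u \<in> {0..1}" using u by simp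
  have FM: "sets (F u) \<subseteq> events" and sp: "space (F u) = space M" using subalgebra_F[OF u01] by (auto simp: subalgebra_def)
  \<comment> \<open>The condition \<open>C i = UNIV\<close> keeps \<open>X i\<close> out of the
    generating sets.\<close>
  define \<E> where "\<E> = {A \<inter> (\<Inter>l. X l -` C l \<inter> space M) |A C. A \<in> sets (F u) \<and> (\<forall>l. C l \<in> sets borel) \<and> C i = UNIV}"
  have EM: "\<E> \<subseteq> events"
  proof
    fix E assume "E \<in> \<E>"
    then obtain A C where AC: "E = A \<inter> (\<Inter>l. X l -` C l \<inter> space M)" "A \<in> sets (F u)" "\<And>l. C l \<in> sets borel" by (auto simp: \<E>_def)
    have [measurable]: "A \<in> events" "\<And>l. C l \<in> sets borel" using AC FM by auto
    show "E \<in> events" unfolding AC(1) by measurable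
  qed
  have "Int_stable \<E>"
  proof (rule Int_stableI)
    fix a b assume "a \<in> \<E>" "b \<in> \<E>"
    then obtain A C A' C' where *: "a = A \<inter> (\<Inter>l. X l -` C l \<inter> space M)" "A \<in> sets (F u)" "\<And>l. C l \<in> sets borel" "C i = UNIV"
      "b = A' \<inter> (\<Inter>l. X l -` C' l \<inter> space M)" "A' \<in> sets (F u)" "\<And>l. C' l \<in> sets borel" "C' i = UNIV"
      unfolding \<E>_def by blast
    have "a \<inter> b = (A \<inter> A') \<inter> (\<Inter>l. X l -` (C l \<inter> C' l) \<inter> space M)" unfolding * by auto
    moreover have "A \<inter> A' \<in> sets (F u)" "\<And>l. C l \<inter> C' l \<in> sets borel" "C i \<inter> C' i = UNIV" using * by auto
    ultimately show "a \<inter> b \<in> \<E>" unfolding \<E>_def by (intro CollectI exI[of _ "A \<inter> A'"] exI[of _ "\<lambda>l. C l \<inter> C' l"]) auto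
  qed
  have "Int_stable {X i -` A \<inter> space M |A. A \<in> sets borel}"
  proof (rule Int_stableI)
    fix a b assume "a \<in> {X i -` A \<inter> space M |A. A \<in> sets borel}" "b \<in> {X i -` A \<inter> space M |A. A \<in> sets borel}"
    then obtain A B where AB: "a = X i -` A \<inter> space M" "b = X i -` B \<inter> space M" "A \<in> sets borel" "B \<in> sets borel" by auto
    then have "a \<inter> b = X i -` (A \<inter> B) \<inter> space M" "A \<inter> B \<in> sets borel" by auto
    then show "a \<inter> b \<in> {X i -` A \<inter> space M |A. A \<in> sets borel}" by blast
  qed
  have "indep_set \<E> {X i -` A \<inter> space M |A. A \<in> sets borel}"
  proof (rule indep_setI[OF EM])
    show "{X i -` A \<inter> space M |A. A \<in> sets borel} \<subseteq> events" by auto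
    fix a b assume "a \<in> \<E>" "b \<in> {X i -` A \<inter> space M |A. A \<in> sets borel}"
    then obtain A C B where *: "a = A \<inter> (\<Inter>l. X l -` C l \<inter> space M)" "A \<in> sets (F u)" "\<And>l. C l \<in> sets borel" "C i = UNIV"
      "b = X i -` B \<inter> space M" "B \<in> sets borel"
      unfolding \<E>_def by blast
    define C' where "C' = C(i := B)"
    have C': "C' l \<in> sets borel" for l using * by (simp add: C'_def)
    have "a \<inter> b = A \<inter> (\<Inter>l. X l -` C' l \<inter> space M)" unfolding * C'_def using *(4) by (auto split: if_splits)
    then have "prob (a \<inter> b) = prob A * (\<Prod>l\<in>UNIV. prob (X l -` C' l \<inter> space M))" using wiener_joint_prob[OF *(2) C'] by simp
    also have "(\<Prod>l\<in>UNIV. prob (X l -` C' l \<inter> space M)) = prob (X i -` C' i \<inter> space M) * (\<Prod>l\<in>UNIV - {i}. prob (X l -` C' l \<inter> space M))"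
      by (rule prod.remove) auto
    also have "(\<Prod>l\<in>UNIV - {i}. prob (X l -` C' l \<inter> space M)) = (\<Prod>l\<in>UNIV - {i}. prob (X l -` C l \<inter> space M))"
      by (intro prod.cong) (auto simp: C'_def)
    also have "\<dots> = (\<Prod>l\<in>UNIV. prob (X l -` C l \<inter> space M))"
      using prod.remove[of UNIV i "\<lambda>l. prob (X l -` C l \<inter> space M)"] *(4) by (simp add: prob_space)
    also have "prob A * (prob (X i -` C' i \<inter> space M) * (\<Prod>l\<in>UNIV. prob (X l -` C l \<inter> space M))) = prob a * prob b"
      unfolding *(1) wiener_joint_prob[OF *(2,3)] by (simp add: C'_def *)
    finally show "prob (a \<inter> b) = prob a * prob b" .
  qed
  from indep_set_sigma_sets[OF this \<open>Int_stable \<E>\<close> \<open>Int_stable {X i -` A \<inter> space M |A. A \<in> sets borel}\<close>]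
  have ind: "indep_set (sigma_sets (space M) \<E>) (sigma_sets (space M) {X i -` A \<inter> space M |A. A \<in> sets borel})" .
  define G where "G = sigma (space M) \<E>"
  have EP: "\<E> \<subseteq> Pow (space M)" using EM sets.sets_into_space by blast
  have G: "sets G = sigma_sets (space M) \<E>" "space G = space M" unfolding G_def using EP by auto
  show ?thesis
  proof (rule that[of G])
    show "subalgebra M G" unfolding subalgebra_def G using sets.sigma_sets_subset[OF EM] by simp
    show "subalgebra G (F u)" unfolding subalgebra_def G
    proof (intro conjI sp subsetI)
      fix A assume A: "A \<in> sets (F u)"
      then have "A \<subseteq> space M" using sets.sets_into_space[OF A] sp by simp
      then have "A = A \<inter> (\<Inter>l. X l -` UNIV \<inter> space M)" by auto
      then have "A \<in> \<E>" unfolding \<E>_def using A by (intro CollectI exI[of _ A] exI[of _ "\<lambda>_. UNIV"]) auto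
      then show "A \<in> sigma_sets (space M) \<E>" by auto
    qed
    show "X l \<in> borel_measurable G" if "l \<noteq> i" for l
    proof (rule measurableI)
      fix B :: "real set" assume B: "B \<in> sets borel"
      have "X l -` B \<inter> space M = space M \<inter> (\<Inter>k. X k -` (if k = l then B else UNIV) \<inter> space M)"
        by (auto split: if_splits)
      moreover have "space M \<in> sets (F u)" using sp sets.top[of "F u"] by simp
      ultimately have "X l -` B \<inter> space M \<in> \<E>" unfolding \<E>_def using B that
        by (intro CollectI exI[of _ "space M"] exI[of _ "\<lambda>k. if k = l then B else UNIV"]) auto
      then show "X l -` B \<inter> space G \<in> sets G" unfolding G by auto
    qed simp
    show "indep_set (sets G) {X i -` A \<inter> space M |A. A \<in> sets borel}"
      unfolding G
    proof (rule indep_setI)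
      show "sigma_sets (space M) \<E> \<subseteq> events" by (rule sets.sigma_sets_subset[OF EM])
      show "{X i -` A \<inter> space M |A. A \<in> sets borel} \<subseteq> events" by auto
      show "prob (a \<inter> b) = prob a * prob b" if "a \<in> sigma_sets (space M) \<E>" "b \<in> {X i -` A \<inter> space M |A. A \<in> sets borel}" for a b
        using indep_setD[OF ind that(1) sigma_sets.Basic[OF that(2)]] .
    qed
  qed
qed

end

end

section \<open>Fractional Brownian motion\<close>

text \<open>The indicator discards the junk values of \<open>fbm_kernel\<close> outside \<open>0 < v < t\<close>.\<close>

definition fbm_kern :: "real \<Rightarrow> real \<Rightarrow> real \<Rightarrow> real" where
  "fbm_kern H t v = indicator {0<..<t} v * fbm_kernel H t v"

lemma fbm_kern_pair_measurable: "(\<lambda>(t, v). fbm_kern H t v) \<in> borel_measurable (borel \<Otimes>\<^sub>M borel)"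
proof -
  have [measurable]: "(\<lambda>x. LINT u:{snd x..fst x}|lborel. u powr (H - 3/2) * (u - snd x) powr (H - 1/2)) \<in> borel_measurable (borel \<Otimes>\<^sub>M borel)"
  proof -
    have "(\<lambda>x. LINT u:{snd x..fst x}|lborel. u powr (H - 3/2) * (u - snd x) powr (H - 1/2)) =
      (\<lambda>x. LINT u|lborel. (if snd x \<le> u \<and> u \<le> fst x then u powr (H - 3/2) * (u - snd x) powr (H - 1/2) else 0))"
      unfolding set_lebesgue_integral_def by (intro ext Bochner_Integration.integral_cong refl) (auto simp: indicator_def)
    moreover have "\<dots> \<in> borel_measurable (borel \<Otimes>\<^sub>M borel)"
      by (rule lborel.borel_measurable_lebesgue_integral) measurable
    ultimately show ?thesis by simp
  qed
  have eq: "(\<lambda>(t, v). fbm_kern H t v) = (\<lambda>x. (if 0 < snd x \<and> snd x < fst x then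
     fbm_const H * ((fst x / snd x) powr (H - 1/2) * (fst x - snd x) powr (H - 1/2)
     - (H - 1/2) * snd x powr (1/2 - H) * (LINT u:{snd x..fst x}|lborel. u powr (H - 3/2) * (u - snd x) powr (H - 1/2))) else 0))"
    by (auto simp: fun_eq_iff fbm_kern_def fbm_kernel_def fbm_kernel_unnormalised_def indicator_def)
  show ?thesis unfolding eq by measurable
qed

lemma fbm_kern_measurable[measurable]: "fbm_kern H t \<in> borel_measurable borel"
proof -
  have "(\<lambda>v. (t, v)) \<in> measurable borel (borel \<Otimes>\<^sub>M borel)" by simp
  from measurable_compose[OF this fbm_kern_pair_measurable] show ?thesis by simp
qed

lemma fbm_const_nonneg: "0 \<le> fbm_const H"
  by (simp add: fbm_const_def set_lebesgue_integral_def)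

context
  fixes H :: real
  assumes H: "0 < H" "H < 1/2"
begin

lemma fbm_kern_nonneg: "0 \<le> fbm_kern H t v"
  using fbm_kernel_unnormalised_nonneg[OF H, of v t] fbm_const_nonneg[of H]
  by (simp add: fbm_kern_def fbm_kernel_def indicator_def)

lemma fbm_kern_antimono:
  assumes "v < x" "x \<le> y"
  shows "fbm_kern H y v \<le> fbm_kern H x v"
  using fbm_kernel_unnormalised_antimono[OF H, of v x y] fbm_const_nonneg[of H] assms
  by (auto simp: fbm_kern_def fbm_kernel_def indicator_def intro!: mult_left_mono)

lemma fbm_kern_convex:
  assumes "v < x" "x < y" "y \<le> z"
  shows "(fbm_kern H y v - fbm_kern H z v) * (y - x) \<le> (fbm_kern H x v - fbm_kern H y v) * (z - y)"
proof (cases "0 < v")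
  case True
  have "fbm_const H * ((fbm_kernel_unnormalised H y v - fbm_kernel_unnormalised H z v) * (y - x)) \<le>
    fbm_const H * ((fbm_kernel_unnormalised H x v - fbm_kernel_unnormalised H y v) * (z - y))"
    using fbm_kernel_unnormalised_convex[OF H True assms] fbm_const_nonneg[of H] by (rule mult_left_mono)
  then show ?thesis using True assms by (simp add: fbm_kern_def fbm_kernel_def algebra_simps)
qed (simp add: fbm_kern_def)

end

text \<open>A tangent bound for the concave power, in the form
  \<open>(x / y) powr r \<le> x / y\<close> multiplied by \<open>y powr r\<close>.\<close>

lemma powr_diff_le:
  fixes x y r :: real
  assumes "0 < y" "y \<le> x" "0 \<le> r" "r \<le> 1"
  shows "x powr r - y powr r \<le> (x - y) * y powr (r - 1)"
proof -
  have "(x / y) powr r \<le> (x / y) powr 1" using assms by (intro powr_mono) auto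
  then have "y powr r * (x / y) powr r \<le> y powr r * (x / y)" using assms by (intro mult_left_mono) auto
  moreover have "y powr r * (x / y) powr r = x powr r" using assms by (simp add: powr_divide)
  moreover have y: "y powr r = y * y powr (r - 1)" using assms powr_add[of y 1 "r - 1"] by simp
  moreover have "y powr r * (x / y) = x * y powr (r - 1)" unfolding y using assms(1) by simp
  ultimately show ?thesis unfolding left_diff_distrib by linarith
qed

lemma (in F_brownian) wiener_version_cong_AE:
  assumes X: "wiener_version M W u \<phi> X" and \<psi>: "\<psi> \<in> borel_measurable lborel" and ae: "AE v in lborel. \<phi> v = \<psi> v"
  shows "wiener_version M W u \<psi> X"
proof -
  from X obtain P \<alpha> where P: "\<And>k. finite (P k)" "\<And>k. P k \<subseteq> {u..1}"
    and L: "L2_tendsto lborel (\<lambda>k. step_fun u (P k) (\<alpha> k)) \<phi>" "L2_tendsto M (\<lambda>k. step_integral W u (P k) (\<alpha> k)) X"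
    unfolding wiener_version_def by auto
  note ps = L2_tendstoD[OF L(1)]
  have sq: "square_integrable lborel \<psi>" by (rule square_integrable_cong_AE[OF ps(2) \<psi> ae])
  have "(LINT v|lborel. (\<psi> v - step_fun u (P k) (\<alpha> k) v)\<^sup>2) = (LINT v|lborel. (\<phi> v - step_fun u (P k) (\<alpha> k) v)\<^sup>2)" for k
  proof (rule integral_cong_AE)
    show "AE v in lborel. (\<psi> v - step_fun u (P k) (\<alpha> k) v)\<^sup>2 = (\<phi> v - step_fun u (P k) (\<alpha> k) v)\<^sup>2"
      using ae by eventually_elim simp
  qed (use square_integrableD(1)[OF ps(1)] square_integrableD(1)[OF ps(2)] \<psi> in auto)
  then have "L2_tendsto lborel (\<lambda>k. step_fun u (P k) (\<alpha> k)) \<psi>"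
    using ps sq by (simp add: L2_tendsto_def)
  then show ?thesis unfolding wiener_version_def using P L(2) by blast
qed

section \<open>From the driving Brownian motions to the components of \<open>B\<close> and
  back\<close>

locale F_fbm_process = filtered_prob_space M F for M :: "'a measure" and F +
  fixes B :: "real \<Rightarrow> 'a \<Rightarrow> real ^ 'd" and H :: real
  assumes H: "0 < H" "H < 1/2" and B: "F_fbm M F H B"
begin

text \<open>The definition of \<open>F_fbm\<close> only asserts the existence of a driving process;
  one is fixed for each component.\<close>

definition W :: "'d \<Rightarrow> real \<Rightarrow> 'a \<Rightarrow> real" where
  "W l = (SOME W. F_brownian_motion M F W \<and>
     (\<forall>t\<in>{0..1}. is_wiener_integral M W t (fbm_kernel H t) (\<lambda>w. B t w $ l)))"

lemma W_spec: "F_brownian_motion M F (W l)"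
  "t \<in> {0..1} \<Longrightarrow> is_wiener_integral M (W l) t (fbm_kernel H t) (\<lambda>w. B t w $ l)"
proof -
  have "\<exists>W. F_brownian_motion M F W \<and> (\<forall>t\<in>{0..1}. is_wiener_integral M W t (fbm_kernel H t) (\<lambda>w. B t w $ l))"
    using B by (auto simp: F_fbm_def F_fbm_real_def)
  from someI_ex[OF this] show "F_brownian_motion M F (W l)"
    "t \<in> {0..1} \<Longrightarrow> is_wiener_integral M (W l) t (fbm_kernel H t) (\<lambda>w. B t w $ l)"
    unfolding W_def by auto
qed

sublocale BM: F_brownian M F "W l" for l by unfold_locales (rule W_spec)

lemma B_wiener:
  assumes t: "t \<in> {0..1}"
  shows "wiener_version M (W l) 0 (fbm_kern H t) (\<lambda>w. B t w $ l)"
proof (rule BM.wiener_version_cong_AE[OF BM.wiener_version_of_is_wiener_integral[OF t W_spec(2)[OF t]]])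
  have "AE v in lborel. v \<noteq> 0" "AE v in lborel. v \<noteq> t" by (rule AE_lborel_singleton)+
  then show "AE v in lborel. indicator {0..t} v * fbm_kernel H t v = fbm_kern H t v"
    by eventually_elim (auto simp: fbm_kern_def indicator_def)
qed simp

lemma B_square_integrable: "t \<in> {0..1} \<Longrightarrow> square_integrable M (\<lambda>w. B t w $ l)"
  by (rule BM.wiener_versionD(2)[OF B_wiener])

lemma B_covariance:
  "s \<in> {0..1} \<Longrightarrow> t \<in> {0..1} \<Longrightarrow> expectation (\<lambda>w. B s w $ l * B t w $ l) =
    (s powr (2 * H) + t powr (2 * H) - \<bar>t - s\<bar> powr (2 * H)) / 2"
  using B by (simp add: F_fbm_def F_fbm_real_def fractional_brownian_motion_def)

lemma kern_square_integrable: "t \<in> {0..1} \<Longrightarrow> square_integrable lborel (fbm_kern H t)"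
  by (rule BM.wiener_versionD(1)[OF B_wiener])

text \<open>The covariance of \<open>B\<close> is given with its definition, and the isometry
  transports it to the kernels. Their L2 geometry is therefore known exactly, without evaluating an
  integral of the kernel.\<close>

lemma kern_inner:
  "s \<in> {0..1} \<Longrightarrow> t \<in> {0..1} \<Longrightarrow> (LINT v|lborel. fbm_kern H s v * fbm_kern H t v) =
    (s powr (2 * H) + t powr (2 * H) - \<bar>t - s\<bar> powr (2 * H)) / 2"
  using BM.wiener_inner[OF _ B_wiener B_wiener, of s t undefined] B_covariance[of s t undefined] by simp

lemma kern_norm: "t \<in> {0..1} \<Longrightarrow> (LINT v|lborel. (fbm_kern H t v)\<^sup>2) = t powr (2 * H)"
  using kern_inner[of t t] by (simp add: power2_eq_square)

lemma kern_diff: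
  assumes st: "s \<in> {0..1}" "t \<in> {0..1}"
  shows "(LINT v|lborel. (fbm_kern H s v - fbm_kern H t v)\<^sup>2) = \<bar>s - t\<bar> powr (2 * H)"
proof -
  note sq = kern_square_integrable[OF st(1)] kern_square_integrable[OF st(2)]
  have "(LINT v|lborel. (fbm_kern H s v - fbm_kern H t v)\<^sup>2) =
    (LINT v|lborel. (fbm_kern H s v)\<^sup>2 + (fbm_kern H t v)\<^sup>2 - 2 * (fbm_kern H s v * fbm_kern H t v))"
    by (intro Bochner_Integration.integral_cong refl) (simp add: power2_diff)
  also have "\<dots> = s powr (2 * H) + t powr (2 * H) - 2 * ((s powr (2 * H) + t powr (2 * H) - \<bar>t - s\<bar> powr (2 * H)) / 2)"
    using sq square_integrable_mult[OF sq] kern_norm[OF st(1)] kern_norm[OF st(2)] kern_inner[OF st]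
    by (simp add: square_integrable_def)
  finally show ?thesis by (simp add: abs_minus_commute field_simps)
qed

text \<open>The default value of a division by 0 has to be excluded. The existence of
  \<open>B\<close> does so: the kernel at time 1 has norm 1.\<close>

lemma fbm_const_pos: "0 < fbm_const H"
proof -
  have "fbm_const H \<noteq> 0"
  proof
    assume "fbm_const H = 0"
    then have "fbm_kern H 1 = (\<lambda>_. 0)" by (simp add: fun_eq_iff fbm_kern_def fbm_kernel_def)
    then show False using kern_norm[of 1] by simp
  qed
  then show ?thesis using fbm_const_nonneg[of H] by simp
qed

sublocale kern: square_integrable_family "fbm_kern H" by unfold_locales (rule kern_square_integrable)

text \<open>\<open>inversion_identity\<close> exhibits \<open>v powr (1/2 - H)\<close> on
  \<open>(0, t)\<close> as a superposition of kernels, a limit of Riemann sums, and the indicators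
  follow from these powers. Dividing the weight by \<open>fbm_const H * \<beta>\<close> removes the
  two constants of that identity.\<close>

lemma kern_total:
  assumes t: "0 \<le> t" "t \<le> 1"
  shows "L2_span (fbm_kern H) (indicator {0<..<t})"
proof (cases "t = 0")
  case True
  then have "indicator {0<..<t} = (\<lambda>_. 0 :: real)" by auto
  then show ?thesis using kern.L2_span_combination[of "{}" "\<lambda>_. 0"] by simp
next
  case False
  define \<beta> where "\<beta> = Beta (1/2 + H) (1/2 - H)"
  have \<beta>: "0 < \<beta>" unfolding \<beta>_def Beta_def using H by (intro divide_pos_pos mult_pos_pos Gamma_real_pos) auto
  show ?thesis
  proof (rule kern.L2_span_indicator[where a="1/2 - H"])
    fix t :: real assume t: "0 < t" "t \<le> 1"
    define w where "w x = inversion_weight H t x / (fbm_const H * \<beta>)" for x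
    have [measurable]: "inversion_weight H t \<in> borel_measurable borel" by (rule inversion_weight_measurable[OF H])
    have int: "has_bochner_integral lborel (\<lambda>x. indicator {0<..<t} x *\<^sub>R (w x * fbm_kern H x v)) (indicator {0<..<t} v * v powr (1/2 - H))" for v
    proof (cases "v \<in> {0<..<t}")
      case True
      then have v: "0 < v" "v < t" by auto
      have "has_bochner_integral lborel (\<lambda>x. (1 / \<beta>) * (indicator {v<..<t} x *\<^sub>R (inversion_weight H t x * fbm_kernel_unnormalised H x v))) ((1 / \<beta>) * (\<beta> * v powr (1/2 - H)))"
        using inversion_identity[OF H v] unfolding \<beta>_def[symmetric]
        by (intro has_bochner_integral_mult_right) (simp add: has_bochner_integral_iff set_integrable_def set_lebesgue_integral_def)
      moreover have "(1 / \<beta>) * (indicator {v<..<t} x *\<^sub>R (inversion_weight H t x * fbm_kernel_unnormalised H x v)) =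
          indicator {0<..<t} x *\<^sub>R (w x * fbm_kern H x v)" for x
        using v fbm_const_pos \<beta> by (auto simp: w_def fbm_kern_def fbm_kernel_def indicator_def field_simps)
      ultimately show ?thesis using True \<beta> by simp
    next
      case False
      then have z: "(\<lambda>x. indicator {0<..<t} x *\<^sub>R (w x * fbm_kern H x v)) = (\<lambda>x. 0)"
        by (auto simp: fbm_kern_def indicator_def fun_eq_iff)
      show ?thesis unfolding z using False by (simp add: has_bochner_integral_zero)
    qed
    show "L2_span (fbm_kern H) (\<lambda>v. indicator {0<..<t} v * v powr (1/2 - H))"
    proof (rule kern.L2_span_integral[OF fbm_kern_pair_measurable _ _ t, where w=w and r="2 * H"])
      show "(LINT v|lborel. (fbm_kern H x v - fbm_kern H y v)\<^sup>2) \<le> \<bar>x - y\<bar> powr (2 * H)" if "x \<in> {0..1}" "y \<in> {0..1}" for x y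
        using kern_diff[OF that] by simp
      show "w \<in> borel_measurable borel" unfolding w_def[abs_def] by simp
      show "set_integrable lborel {0<..<t} w"
        unfolding w_def[abs_def] using inversion_weight_integrable[OF H t(1)] by (rule set_integrable_divide)
      show "set_integrable lborel {0<..<t} (\<lambda>x. w x * fbm_kern H x v)" for v
        using int[of v] by (auto simp: set_integrable_def dest: integrable.intros)
      show "indicator {0<..<t} v * v powr (1/2 - H) = (LINT x:{0<..<t}|lborel. w x * fbm_kern H x v)" for v
        using has_bochner_integral_integral_eq[OF int[of v]] by (simp add: set_lebesgue_integral_def)
    qed (use H in auto)
  qed (use False t H in auto)
qed

text \<open>The isometry turns an approximation of indicators by kernels into one of increments of
  \<open>W l\<close> by values of \<open>B\<close>. This is the channel through which independence
  of the components of \<open>B\<close> reaches the driving processes.\<close>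

lemma W_increment_approx:
  assumes ab: "0 \<le> a" "a \<le> b" "b \<le> 1"
  shows "\<exists>X. (\<forall>n. X n \<in> {\<lambda>w. \<Sum>q\<in>Q. c q * B q w $ l |Q c. finite Q \<and> Q \<subseteq> {0..1}}) \<and> L2_tendsto M X (\<lambda>w. W l b w - W l a w)"
proof -
  define \<phi> :: "real \<Rightarrow> real" where "\<phi> v = indicator {0<..<b} v - indicator {0<..<a} v" for v
  have span: "L2_span (fbm_kern H) \<phi>" unfolding \<phi>_def[abs_def] using ab by (intro kern.L2_span_diff kern_total) auto
  have "\<exists>Q c. finite Q \<and> Q \<subseteq> {0..1} \<and> (LINT v|lborel. (\<phi> v - (\<Sum>q\<in>Q. c q * fbm_kern H q v))\<^sup>2) < 1 / real (Suc n)" for n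
    using span unfolding L2_span_def by simp
  then have "\<forall>n. \<exists>Q c. finite Q \<and> Q \<subseteq> {0..1} \<and> (LINT v|lborel. (\<phi> v - (\<Sum>q\<in>Q. c q * fbm_kern H q v))\<^sup>2) < 1 / real (Suc n)" ..
  from choice[OF this] obtain Q where "\<forall>n. \<exists>c. finite (Q n) \<and> Q n \<subseteq> {0..1} \<and>
    (LINT v|lborel. (\<phi> v - (\<Sum>q\<in>Q n. c q * fbm_kern H q v))\<^sup>2) < 1 / real (Suc n)" by blast
  from choice[OF this] obtain c where Qc: "\<And>n. finite (Q n)" "\<And>n. Q n \<subseteq> {0..1}"
    "\<And>n. (LINT v|lborel. (\<phi> v - (\<Sum>q\<in>Q n. c n q * fbm_kern H q v))\<^sup>2) < 1 / real (Suc n)" by blast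
  define X where "X n w = (\<Sum>q\<in>Q n. c n q * B q w $ l)" for n w
  have Xw: "wiener_version M (W l) 0 (\<lambda>v. \<Sum>q\<in>Q n. c n q * fbm_kern H q v) (X n)" for n
    unfolding X_def[abs_def] using Qc(2)[of n] by (intro BM.wiener_version_sum BM.wiener_version_cmult B_wiener) auto
  have "wiener_version M (W l) 0 (\<lambda>v. indicator {0<..b} v - indicator {0<..a} v) (\<lambda>w. (W l b w - W l 0 w) - (W l a w - W l 0 w))"
    using ab by (intro BM.wiener_version_diff BM.wiener_version_increment) auto
  then have "wiener_version M (W l) 0 (\<lambda>v. indicator {0<..b} v - indicator {0<..a} v) (\<lambda>w. W l b w - W l a w)" by simp
  then have Ww: "wiener_version M (W l) 0 \<phi> (\<lambda>w. W l b w - W l a w)"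
  proof (rule BM.wiener_version_cong_AE)
    have "AE v in lborel. v \<noteq> a" "AE v in lborel. v \<noteq> b" by (rule AE_lborel_singleton)+
    then show "AE v in lborel. indicator {0<..b} v - indicator {0<..a} v = \<phi> v"
      by eventually_elim (auto simp: \<phi>_def indicator_def)
  qed (simp add: \<phi>_def[abs_def])
  have "L2_tendsto M X (\<lambda>w. W l b w - W l a w)"
  proof (rule L2_tendsto_le)
    show "square_integrable M (X n)" for n by (rule BM.wiener_versionD(2)[OF Xw])
    show "square_integrable M (\<lambda>w. W l b w - W l a w)" by (rule BM.wiener_versionD(2)[OF Ww])
    show "expectation (\<lambda>w. (W l b w - W l a w - X n w)\<^sup>2) \<le> 1 / real (Suc n)" for n
      using BM.wiener_isometry[OF _ BM.wiener_version_diff[OF Ww Xw[of n]]] Qc(3)[of n] by simp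
    show "(\<lambda>n. 1 / real (Suc n)) \<longlonglongrightarrow> 0" by (rule LIMSEQ_Suc[OF lim_1_over_n])
  qed
  then show ?thesis using Qc(1,2) by (intro exI[of _ X]) (auto simp: X_def[abs_def])
qed

text \<open>A product of two linear combinations is a measurable function of the path of one
  component. Independence of the paths of components \<open>l\<close> and \<open>m\<close> then
  factors the expectation.\<close>

lemma B_combination_products:
  assumes lm: "l \<noteq> m"
    and X: "X \<in> {\<lambda>w. \<Sum>q\<in>Q. c q * B q w $ l |Q c. finite Q \<and> Q \<subseteq> {0..1}}" "X' \<in> {\<lambda>w. \<Sum>q\<in>Q. c q * B q w $ l |Q c. finite Q \<and> Q \<subseteq> {0..1}}"
    and Y: "Y \<in> {\<lambda>w. \<Sum>q\<in>Q. c q * B q w $ m |Q c. finite Q \<and> Q \<subseteq> {0..1}}" "Y' \<in> {\<lambda>w. \<Sum>q\<in>Q. c q * B q w $ m |Q c. finite Q \<and> Q \<subseteq> {0..1}}"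
  shows "has_bochner_integral M (\<lambda>w. (X w * X' w) * (Y w * Y' w)) (expectation (\<lambda>w. X w * X' w) * expectation (\<lambda>w. Y w * Y' w))"
proof -
  from X(1) obtain Q1 c1 where X1: "X = (\<lambda>w. \<Sum>q\<in>Q1. c1 q * B q w $ l)" "Q1 \<subseteq> {0..1}" by blast
  from X(2) obtain Q2 c2 where X2: "X' = (\<lambda>w. \<Sum>q\<in>Q2. c2 q * B q w $ l)" "Q2 \<subseteq> {0..1}" by blast
  from Y(1) obtain Q3 c3 where Y1: "Y = (\<lambda>w. \<Sum>q\<in>Q3. c3 q * B q w $ m)" "Q3 \<subseteq> {0..1}" by blast
  from Y(2) obtain Q4 c4 where Y2: "Y' = (\<lambda>w. \<Sum>q\<in>Q4. c4 q * B q w $ m)" "Q4 \<subseteq> {0..1}" by blast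
  define g where "g i f = (if i = l then (\<Sum>q\<in>Q1. c1 q * f q) * (\<Sum>q\<in>Q2. c2 q * f q) else (\<Sum>q\<in>Q3. c3 q * f q) * (\<Sum>q\<in>Q4. c4 q * f q))"
    for i and f :: "real \<Rightarrow> real"
  define Z where "Z i w = g i (\<lambda>t\<in>{0..1}. B t w $ i)" for i w
  have iv: "indep_vars (\<lambda>i. Pi\<^sub>M {0..1} (\<lambda>t. borel)) (\<lambda>i w. \<lambda>t\<in>{0..1}. B t w $ i) UNIV" using B by (simp add: F_fbm_def)
  have comb: "(\<lambda>f. \<Sum>q\<in>Q. c q * f q) \<in> borel_measurable (Pi\<^sub>M {0..1} (\<lambda>t. borel))" if "Q \<subseteq> {0..1}" for Q and c :: "real \<Rightarrow> real"
    using that by (intro borel_measurable_sum borel_measurable_times borel_measurable_const measurable_component_singleton) auto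
  have "g i \<in> borel_measurable (Pi\<^sub>M {0..1} (\<lambda>t. borel))" for i
    unfolding g_def[abs_def] using comb X1 X2 Y1 Y2 by (cases "i = l") (auto intro!: borel_measurable_times)
  from indep_vars_compose2[OF indep_vars_subset[OF iv, of "{l, m}"], of g "\<lambda>_. borel"] this
  have ivZ: "indep_vars (\<lambda>_. borel) Z {l, m}" by (simp add: Z_def[abs_def])
  have restr: "(\<Sum>q\<in>Q. c q * (\<lambda>t\<in>{0..1}. B t w $ i) q) = (\<Sum>q\<in>Q. c q * B q w $ i)" if "Q \<subseteq> {0..1}" for Q and c :: "real \<Rightarrow> real" and i w
    using that by (intro sum.cong refl) auto
  have Zl: "Z l = (\<lambda>w. X w * X' w)" unfolding Z_def g_def X1 X2 using restr X1 X2 by (simp add: fun_eq_iff)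
  have Zm: "Z m = (\<lambda>w. Y w * Y' w)" unfolding Z_def g_def Y1 Y2 using restr Y1 Y2 lm by (simp add: fun_eq_iff)
  have sq: "square_integrable M (\<lambda>w. \<Sum>q\<in>Q. c q * B q w $ i)" if "Q \<subseteq> {0..1}" for Q c i
    using that by (intro square_integrable_sum square_integrable_cmult B_square_integrable) auto
  have int: "integrable M (Z i)" if "i \<in> {l, m}" for i
    using that square_integrable_mult[OF sq sq] X1 X2 Y1 Y2 unfolding Zl Zm by (auto simp: Zl Zm)
  have "integrable M (\<lambda>w. \<Prod>i\<in>{l, m}. Z i w)" "expectation (\<lambda>w. \<Prod>i\<in>{l, m}. Z i w) = (\<Prod>i\<in>{l, m}. expectation (Z i))"
    using ivZ int by (auto intro!: indep_vars_integrable indep_vars_lebesgue_integral)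
  then show ?thesis using lm by (simp add: has_bochner_integral_iff Zl Zm)
qed

text \<open>Linear combinations of values of \<open>B\<close> serve as the approximating classes of
  \<open>increments_uncorrelated\<close>. From here on the joint laws hold for the driving
  processes.\<close>

sublocale BMs: F_brownian_family M F W
proof
  show "F_brownian_motion M F (W l)" for l by (rule W_spec)
  fix l m :: 'd and s t c :: real and S :: "'a \<Rightarrow> real"
  assume "l \<noteq> m" "0 \<le> s" "s < t" "t \<le> 1" "S \<in> borel_measurable (F s)" "\<And>w. \<bar>S w\<bar> \<le> c"
  then show "expectation (\<lambda>w. S w * ((W l t w - W l s w) * (W m t w - W m s w))) = 0"
    by (intro increments_uncorrelated[OF W_spec(1) W_spec(1) W_increment_approx[of _ _ l] W_increment_approx[of _ _ m] B_combination_products[of l m]])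
qed

end

section \<open>Smoothing by the conditional law\<close>

lemma borel_measurable_vecI:
  fixes f :: "'a \<Rightarrow> real ^ 'd"
  assumes "\<And>l. (\<lambda>x. f x $ l) \<in> borel_measurable N"
  shows "f \<in> borel_measurable N"
  unfolding borel_measurable_euclidean_space[of f]
  using assms by (auto simp: Basis_vec_def inner_axis)

lemma (in prob_space) moment_le_abs: "moment_le p X a \<Longrightarrow> moment_le p (\<lambda>x. \<bar>X x\<bar>) a"
  by (auto simp: moment_le_def power_even_abs)

section \<open>Conditional mean and variance given the past\<close>

context F_fbm_process
begin

definition past :: "real \<Rightarrow> real \<Rightarrow> 'd \<Rightarrow> 'a \<Rightarrow> real" where
  "past u r l = real_cond_exp M (F u) (\<lambda>w. B r w $ l)"

definition future :: "real \<Rightarrow> real \<Rightarrow> 'd \<Rightarrow> 'a \<Rightarrow> real" where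
  "future u r l w = B r w $ l - past u r l w"

text \<open>This is the conditional variance of each component of \<open>B r\<close> given
  \<open>F u\<close>; it is deterministic.\<close>

definition future_var :: "real \<Rightarrow> real \<Rightarrow> real" where
  "future_var u r = (LINT v|lborel. (indicator {u<..} v * fbm_kern H r v)\<^sup>2)"

lemma past_F_measurable: "past u r l \<in> borel_measurable (F u)"
  by (simp add: past_def)

lemma past_measurable[measurable]: "past u r l \<in> borel_measurable M"
  by (simp add: past_def)

lemma past_wiener: "u \<in> {0..1} \<Longrightarrow> r \<in> {0..1} \<Longrightarrow>
    wiener_version M (W l) 0 (\<lambda>v. indicator {..u} v * fbm_kern H r v) (past u r l)"
  unfolding past_def by (rule BM.wiener_version_split(1)[OF _ B_wiener])

lemma future_wiener: "u \<in> {0..1} \<Longrightarrow> r \<in> {0..1} \<Longrightarrow>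
    wiener_version M (W l) u (\<lambda>v. indicator {u<..} v * fbm_kern H r v) (future u r l)"
  unfolding past_def future_def[abs_def] by (rule BM.wiener_version_split(2)[OF _ B_wiener])

lemma B_component_measurable: "t \<in> {0..1} \<Longrightarrow> (\<lambda>w. B t w $ l) \<in> borel_measurable M"
  using B_square_integrable by (simp add: square_integrable_def)

text \<open>The kernel at time \<open>t\<close> vanishes beyond \<open>t\<close>, so the future part
  of \<open>B t\<close> at time \<open>t\<close> has norm 0. Hence \<open>B t\<close> equals its
  conditional expectation almost surely, and the null sets belong to \<open>F t\<close>.\<close>

lemma B_adapted:
  assumes t: "t \<in> {0..1}"
  shows "B t \<in> borel_measurable (F t)"
proof (rule borel_measurable_vecI)
  fix l
  have z: "indicator {t<..} v * fbm_kern H t v = 0" for v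
    by (auto simp: fbm_kern_def indicator_def)
  note fw = future_wiener[OF t t, of l]
  have "expectation (\<lambda>w. (future t t l w)\<^sup>2) = 0"
    using BM.wiener_isometry[OF _ fw] t by (simp only: z) simp
  then have "AE w in M. (future t t l w)\<^sup>2 = 0"
    using integral_nonneg_eq_0_iff_AE[OF square_integrableD(2)[OF BM.wiener_versionD(2)[OF fw]]] by simp
  then have "AE w in M. B t w $ l = past t t l w" by eventually_elim (simp add: future_def)
  then show "(\<lambda>w. B t w $ l) \<in> borel_measurable (F t)"
    by (intro F_meas_AE[OF t past_F_measurable B_component_measurable[OF t]])
qed

lemma B_measurable: "t \<in> {0..1} \<Longrightarrow> B t \<in> borel_measurable M"
  by (rule F_meas[OF _ B_adapted])

lemma kern_part_square_integrable:
  assumes t: "t \<in> {0..1}" and A[measurable]: "A \<in> sets borel"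
  shows "integrable lborel (\<lambda>v. (indicator A v * fbm_kern H t v)\<^sup>2)"
  by (rule Bochner_Integration.integrable_bound[OF square_integrableD(2)[OF kern_square_integrable[OF t]]])
     (auto simp: indicator_def)

lemma future_var_eq:
  assumes "r \<in> {0..1}"
  shows "future_var u r = r powr (2 * H) - (LINT v|lborel. (indicator {..u} v * fbm_kern H r v)\<^sup>2)"
proof -
  have "r powr (2 * H) = (LINT v|lborel. (indicator {u<..} v * fbm_kern H r v)\<^sup>2 + (indicator {..u} v * fbm_kern H r v)\<^sup>2)"
    unfolding kern_norm[OF assms, symmetric] by (intro Bochner_Integration.integral_cong refl) (auto simp: indicator_def)
  also have "\<dots> = future_var u r + (LINT v|lborel. (indicator {..u} v * fbm_kern H r v)\<^sup>2)"
    unfolding future_var_def using kern_part_square_integrable[OF assms] by (intro Bochner_Integration.integral_add) auto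
  finally show ?thesis by simp
qed

text \<open>The kernel decreases in time. Replacing one factor at time \<open>r\<close> by the
  larger one at time \<open>u\<close> bounds the variance of the past part by the covariance of
  \<open>B u\<close> and \<open>B r\<close>, and subtraction from \<open>r powr (2 * H)\<close>
  leaves half of \<open>(r - u) powr (2 * H)\<close> and a nonnegative term.\<close>

lemma future_var_lower:
  assumes "0 \<le> u" "u < r" "r \<le> 1"
  shows "(r - u) powr (2 * H) / 2 \<le> future_var u r"
proof -
  have u: "u \<in> {0..1}" and r: "r \<in> {0..1}" using assms by auto
  have "(LINT v|lborel. (indicator {..u} v * fbm_kern H r v)\<^sup>2) \<le> (LINT v|lborel. fbm_kern H u v * fbm_kern H r v)"
  proof (rule integral_mono_AE)
    show "integrable lborel (\<lambda>v. (indicator {..u} v * fbm_kern H r v)\<^sup>2)" by (rule kern_part_square_integrable[OF r]) simp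
    show "integrable lborel (\<lambda>v. fbm_kern H u v * fbm_kern H r v)"
      by (rule square_integrable_mult[OF kern_square_integrable[OF u] kern_square_integrable[OF r]])
    have "AE v in lborel. v \<noteq> u" by (rule AE_lborel_singleton)
    then show "AE v in lborel. (indicator {..u} v * fbm_kern H r v)\<^sup>2 \<le> fbm_kern H u v * fbm_kern H r v"
    proof eventually_elim
      case (elim v)
      have "0 \<le> fbm_kern H u v * fbm_kern H r v" by (intro mult_nonneg_nonneg fbm_kern_nonneg H)
      moreover have "fbm_kern H r v * fbm_kern H r v \<le> fbm_kern H u v * fbm_kern H r v" if "v < u"
        using that assms by (intro mult_right_mono fbm_kern_antimono[OF H] fbm_kern_nonneg H) auto
      ultimately show ?case using elim by (cases "v < u") (auto simp: indicator_def power2_eq_square)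
    qed
  qed
  also have "\<dots> = (u powr (2 * H) + r powr (2 * H) - (r - u) powr (2 * H)) / 2"
    using kern_inner[OF u r] assms by simp
  finally have "(r powr (2 * H) - u powr (2 * H)) / 2 + (r - u) powr (2 * H) / 2 \<le> future_var u r"
    unfolding future_var_eq[OF r] by (simp add: field_simps)
  moreover have "u powr (2 * H) \<le> r powr (2 * H)" using assms H by (intro powr_mono2) auto
  ultimately show ?thesis unfolding diff_divide_distrib by linarith
qed

text \<open>\<open>D\<close> is the loss of variance of the past part between \<open>r'\<close> and
  \<open>r\<close>. Monotonicity bounds it by a difference of two covariances with
  \<open>B u\<close>; in the total change the powers of \<open>r\<close> and \<open>r'\<close>
  themselves cancel and only powers of the distances to \<open>u\<close> remain.\<close>

lemma future_var_diff:
  assumes "0 \<le> u" "u < r'" "r' \<le> r" "r \<le> 1"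
  shows "\<bar>future_var u r - future_var u r'\<bar> \<le> (r - r') * (r' - u) powr (2 * H - 1)"
proof -
  have u: "u \<in> {0..1}" and r: "r \<in> {0..1}" and r': "r' \<in> {0..1}" using assms by auto
  define D where "D = (LINT v|lborel. (indicator {..u} v * fbm_kern H r' v)\<^sup>2) - (LINT v|lborel. (indicator {..u} v * fbm_kern H r v)\<^sup>2)"
  have ints: "integrable lborel (\<lambda>v. (indicator {..u} v * fbm_kern H x v)\<^sup>2)" if "x \<in> {0..1}" for x
    by (rule kern_part_square_integrable[OF that]) simp
  have inti: "integrable lborel (\<lambda>v. fbm_kern H x v * fbm_kern H u v)" if "x \<in> {0..1}" for x
    by (rule square_integrable_mult[OF kern_square_integrable[OF that] kern_square_integrable[OF u]])
  have D: "D = (LINT v|lborel. (indicator {..u} v * fbm_kern H r' v)\<^sup>2 - (indicator {..u} v * fbm_kern H r v)\<^sup>2)"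
    unfolding D_def by (rule Bochner_Integration.integral_diff[symmetric]) (intro ints r r')+
  have AEu: "AE v in lborel. v \<noteq> u" by (rule AE_lborel_singleton)
  have D0: "0 \<le> D" unfolding D
  proof (rule integral_nonneg_AE)
    show "AE v in lborel. 0 \<le> (indicator {..u} v * fbm_kern H r' v)\<^sup>2 - (indicator {..u} v * fbm_kern H r v)\<^sup>2"
    proof (rule AE_I2)
      fix v
      have "fbm_kern H r v \<le> fbm_kern H r' v" if "v \<le> u" using that assms by (intro fbm_kern_antimono[OF H]) auto
      then show "0 \<le> (indicator {..u} v * fbm_kern H r' v)\<^sup>2 - (indicator {..u} v * fbm_kern H r v)\<^sup>2"
        using fbm_kern_nonneg[OF H, of r v] by (auto simp: indicator_def intro!: power_mono)
    qed
  qed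
  have "D \<le> (LINT v|lborel. 2 * (fbm_kern H r' v * fbm_kern H u v) - 2 * (fbm_kern H r v * fbm_kern H u v))"
    unfolding D
  proof (rule integral_mono_AE)
    show "AE v in lborel. (indicator {..u} v * fbm_kern H r' v)\<^sup>2 - (indicator {..u} v * fbm_kern H r v)\<^sup>2 \<le>
        2 * (fbm_kern H r' v * fbm_kern H u v) - 2 * (fbm_kern H r v * fbm_kern H u v)"
      using AEu
    proof eventually_elim
      case (elim v)
      show ?case
      proof (cases "v < u")
        case True
        have le: "fbm_kern H r v \<le> fbm_kern H r' v" "fbm_kern H r' v \<le> fbm_kern H u v"
          using True assms by (auto intro!: fbm_kern_antimono[OF H])
        have "(fbm_kern H r' v)\<^sup>2 - (fbm_kern H r v)\<^sup>2 = (fbm_kern H r' v - fbm_kern H r v) * (fbm_kern H r' v + fbm_kern H r v)"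
          by (simp add: power2_eq_square algebra_simps)
        also have "\<dots> \<le> (fbm_kern H r' v - fbm_kern H r v) * (2 * fbm_kern H u v)"
          using le by (intro mult_left_mono) auto
        finally show ?thesis using True by (simp add: algebra_simps)
      next
        case False
        then show ?thesis using elim by (simp add: fbm_kern_def[of H u])
      qed
    qed
  qed (use ints[OF r] ints[OF r'] inti[OF r] inti[OF r'] in auto)
  also have "\<dots> = 2 * (LINT v|lborel. fbm_kern H r' v * fbm_kern H u v) - 2 * (LINT v|lborel. fbm_kern H r v * fbm_kern H u v)"
    using inti[OF r] inti[OF r'] by simp
  also have "\<dots> = (r' powr (2 * H) - (r' - u) powr (2 * H)) - (r powr (2 * H) - (r - u) powr (2 * H))"
    using kern_inner[OF r u] kern_inner[OF r' u] assms by (simp add: abs_minus_commute)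
  finally have D1: "D \<le> (r' powr (2 * H) - (r' - u) powr (2 * H)) - (r powr (2 * H) - (r - u) powr (2 * H))" .
  have "future_var u r - future_var u r' = r powr (2 * H) - r' powr (2 * H) + D"
    unfolding future_var_eq[OF r] future_var_eq[OF r'] D_def by simp
  moreover have "r' powr (2 * H) \<le> r powr (2 * H)" using assms H by (intro powr_mono2) auto
  moreover have "(r - u) powr (2 * H) - (r' - u) powr (2 * H) \<le> ((r - u) - (r' - u)) * (r' - u) powr (2 * H - 1)"
    using assms H by (intro powr_diff_le) auto
  ultimately show ?thesis using D0 D1 by simp
qed

text \<open>By convexity in time the kernel changes from \<open>r'\<close> to \<open>r\<close> by at
  most \<open>(r - r') / (r' - u)\<close> times its change from \<open>u\<close> to
  \<open>r'\<close>. The L2 norm of the latter is that of an increment of fractional Brownian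
  motion.\<close>

lemma past_diff_var:
  assumes "0 \<le> u" "u < r'" "r' \<le> r" "r \<le> 1"
  shows "(LINT v|lborel. (indicator {..u} v * fbm_kern H r v - indicator {..u} v * fbm_kern H r' v)\<^sup>2) \<le>
    ((r - r') / (r' - u))\<^sup>2 * (r' - u) powr (2 * H)"
proof -
  have u: "u \<in> {0..1}" and r: "r \<in> {0..1}" and r': "r' \<in> {0..1}" using assms by auto
  define c where "c = (r - r') / (r' - u)"
  have sqd: "square_integrable lborel (\<lambda>v. fbm_kern H u v - fbm_kern H r' v)"
    by (intro square_integrable_diff kern_square_integrable u r')
  have sqp: "square_integrable lborel (\<lambda>v. indicator {..u} v * fbm_kern H x v)" if "x \<in> {0..1}" for x
    using kern_part_square_integrable[OF that, of "{..u}"] by (simp add: square_integrable_def)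
  have "(LINT v|lborel. (indicator {..u} v * fbm_kern H r v - indicator {..u} v * fbm_kern H r' v)\<^sup>2) \<le>
      (LINT v|lborel. c\<^sup>2 * (fbm_kern H u v - fbm_kern H r' v)\<^sup>2)"
  proof (rule integral_mono_AE)
    show "integrable lborel (\<lambda>v. (indicator {..u} v * fbm_kern H r v - indicator {..u} v * fbm_kern H r' v)\<^sup>2)"
      using square_integrable_diff[OF sqp[OF r] sqp[OF r']] by (simp add: square_integrable_def)
    show "integrable lborel (\<lambda>v. c\<^sup>2 * (fbm_kern H u v - fbm_kern H r' v)\<^sup>2)"
      using sqd by (simp add: square_integrable_def)
    have "AE v in lborel. v \<noteq> u" by (rule AE_lborel_singleton)
    then show "AE v in lborel. (indicator {..u} v * fbm_kern H r v - indicator {..u} v * fbm_kern H r' v)\<^sup>2 \<le>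
        c\<^sup>2 * (fbm_kern H u v - fbm_kern H r' v)\<^sup>2"
    proof eventually_elim
      case (elim v)
      show ?case
      proof (cases "v < u")
        case True
        have "0 \<le> fbm_kern H r' v - fbm_kern H r v" using fbm_kern_antimono[OF H, of v r' r] True assms by simp
        moreover have "fbm_kern H r' v - fbm_kern H r v \<le> c * (fbm_kern H u v - fbm_kern H r' v)"
          using fbm_kern_convex[OF H, of v u r' r] True assms by (simp add: c_def field_simps)
        ultimately have "(fbm_kern H r' v - fbm_kern H r v)\<^sup>2 \<le> (c * (fbm_kern H u v - fbm_kern H r' v))\<^sup>2"
          by (intro power_mono) auto
        then show ?thesis using True by (simp add: power_mult_distrib power2_commute)
      next
        case False
        then show ?thesis using elim by simp
      qed
    qed
  qed
  also have "\<dots> = c\<^sup>2 * (r' - u) powr (2 * H)"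
    using kern_diff[OF u r'] assms by (simp add: abs_minus_commute)
  finally show ?thesis by (simp add: c_def)
qed

lemma future_var_pos: "0 \<le> u \<Longrightarrow> u < r \<Longrightarrow> r \<le> 1 \<Longrightarrow> 0 < future_var u r"
  using future_var_lower[of u r] by (auto intro: less_le_trans[of 0 "(r - u) powr (2 * H) / 2"])

text \<open>The right side of \<open>normal_density_diff\<close> for the conditional laws of one
  component at times \<open>r\<close> and \<open>r'\<close>. It is random only through the
  conditional means.\<close>

definition smoothing_factor :: "real \<Rightarrow> real \<Rightarrow> real \<Rightarrow> 'd \<Rightarrow> 'a \<Rightarrow> real" where
  "smoothing_factor u r r' l w = 3 * (\<bar>past u r l w - past u r' l w\<bar> / sqrt (future_var u r')) +
     2 * \<bar>future_var u r - future_var u r'\<bar> / future_var u r'"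

text \<open>With \<open>b = (r' - u) powr H\<close>, the conditional mean moves by a centred normal
  variable of deviation at most \<open>\<rho> * b\<close>, and the conditional deviation at
  \<open>r'\<close> is at least \<open>b / sqrt 2\<close>; the scale \<open>b\<close> cancels. The
  relative change of the variance is at most \<open>2 * \<rho>\<close>, which explains the summand
  4.\<close>

lemma smoothing_factor_moment:
  assumes ur: "0 \<le> u" "u < r'" "r' \<le> r" "r \<le> 1" and p: "1 \<le> p"
  shows "moment_le p (smoothing_factor u r r' l) ((5 * gaussian_moment_const p + 4) * ((r - r') / (r' - u)))"
proof -
  have u: "u \<in> {0..1}" and r: "r \<in> {0..1}" and r': "r' \<in> {0..1}" using assms by auto
  define \<rho> where "\<rho> = (r - r') / (r' - u)"
  define b where "b = (r' - u) powr H"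
  define f where "f = future_var u r'"
  have rho: "0 \<le> \<rho>" using ur by (simp add: \<rho>_def)
  have b: "0 < b" "b\<^sup>2 = (r' - u) powr (2 * H)"
    using ur by (auto simp: b_def powr_powr mult.commute simp flip: powr_numeral powr_mult)
  have f: "b\<^sup>2 / 2 \<le> f" "0 < f" using future_var_lower[of u r'] future_var_pos[of u r'] ur by (auto simp: f_def b)
  have "b / 2 \<le> b / sqrt 2" using b by (intro divide_left_mono) (auto intro: real_le_lsqrt)
  \<comment> \<open>\<open>3 / 5\<close> is a rational lower bound for \<open>1 / sqrt 2\<close>; it
    turns the factor 3 of the smoothing factor into 5.\<close>
  have sqf: "3 / 5 * b \<le> sqrt f"
  proof (rule real_le_rsqrt)
    have "(3 / 5 * b)\<^sup>2 \<le> b\<^sup>2 / 2" by (simp add: power_mult_distrib power_divide)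
    then show "(3 / 5 * b)\<^sup>2 \<le> f" using f by simp
  qed
  define X where "X l w = past u r l w - past u r' l w" for l w
  define \<phi> where "\<phi> v = indicator {..u} v * fbm_kern H r v - indicator {..u} v * fbm_kern H r' v" for v
  have Xw: "wiener_version M (W l) 0 \<phi> (X l)" for l
    unfolding X_def[abs_def] \<phi>_def[abs_def] by (intro BM.wiener_version_diff past_wiener u r r')
  have "moment_le p (X l) (gaussian_moment_const p * sqrt (LINT v|lborel. (\<phi> v)\<^sup>2))"
  proof (rule gaussian_moment_le[OF BM.wiener_versionD(2)[OF Xw] BM.wiener_isometry[OF _ Xw] p])
    show "(CLINT w|M. iexp (t * X l w)) = of_real (exp (- ((LINT v|lborel. (\<phi> v)\<^sup>2) * t\<^sup>2 / 2)))" for t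
      by (rule BMs.wiener_char_single[OF _ _ Xw]) auto
  qed simp
  moreover have "sqrt (LINT v|lborel. (\<phi> v)\<^sup>2) \<le> \<rho> * b"
  proof -
    have "sqrt (LINT v|lborel. (\<phi> v)\<^sup>2) \<le> sqrt ((\<rho> * b)\<^sup>2)"
      using past_diff_var[OF ur] by (simp only: \<phi>_def \<rho>_def power_mult_distrib b) (simp add: real_sqrt_le_iff)
    then show ?thesis using rho b by simp
  qed
  ultimately have "moment_le p (X l) (gaussian_moment_const p * (\<rho> * b))"
    using gaussian_moment_const_pos[of p] by (elim moment_le_mono mult_left_mono) simp
  from moment_le_cmult[OF moment_le_abs[OF this], of "3 / sqrt f"]
  have "moment_le p (\<lambda>w. 3 / sqrt f * \<bar>X l w\<bar>) (3 / sqrt f * (gaussian_moment_const p * (\<rho> * b)))"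
    using f by simp
  moreover have "3 / sqrt f * (gaussian_moment_const p * (\<rho> * b)) \<le> 5 * gaussian_moment_const p * \<rho>"
  proof -
    have "3 / sqrt f * b \<le> 5" using sqf f by (simp add: field_simps)
    then have "(3 / sqrt f * b) * (gaussian_moment_const p * \<rho>) \<le> 5 * (gaussian_moment_const p * \<rho>)"
      using gaussian_moment_const_pos[of p] rho by (intro mult_right_mono) auto
    then show ?thesis by (simp add: mult_ac)
  qed
  ultimately have m1: "moment_le p (\<lambda>w. 3 / sqrt f * \<bar>X l w\<bar>) (5 * gaussian_moment_const p * \<rho>)" by (rule moment_le_mono)
  have "2 * \<bar>future_var u r - f\<bar> / f \<le> 4 * \<rho>"
  proof -
    have e: "(r' - u) powr (2 * H - 1) = b\<^sup>2 / (r' - u)" using ur b powr_diff[of "r' - u" "2 * H" 1] by simp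
    have "\<bar>future_var u r - f\<bar> \<le> \<rho> * b\<^sup>2" using future_var_diff[OF ur] unfolding f_def e by (simp add: \<rho>_def)
    also have "\<dots> \<le> \<rho> * (2 * f)" using f rho by (intro mult_left_mono) auto
    finally show ?thesis using f by (simp add: field_simps)
  qed
  then have m2: "moment_le p (\<lambda>w. 2 * \<bar>future_var u r - f\<bar> / f) (4 * \<rho>)"
    using f by (intro moment_le_mono[OF moment_le_bounded[of _ "2 * \<bar>future_var u r - f\<bar> / f"]]) auto
  have "smoothing_factor u r r' l = (\<lambda>w. 3 / sqrt f * \<bar>X l w\<bar> + 2 * \<bar>future_var u r - f\<bar> / f)"
    by (simp add: fun_eq_iff smoothing_factor_def f_def X_def)
  then show ?thesis using moment_le_add[OF m1 m2 p] by (simp add: \<rho>_def algebra_simps)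
qed

section \<open>Change of the conditional law in time, one coordinate after another\<close>

context
  fixes u :: real and S :: "'a \<Rightarrow> real" and g :: "'a \<Rightarrow> real ^ 'd \<Rightarrow> real" and s0 g0 c :: real
  assumes u: "0 \<le> u" "u \<le> 1"
    and S: "S \<in> borel_measurable (F u)" and Sb: "\<And>w. \<bar>S w\<bar> \<le> s0"
    and g: "(\<lambda>(w, x). g w x) \<in> borel_measurable (F u \<Otimes>\<^sub>M borel)" and gb: "\<And>w x. \<bar>g w x\<bar> \<le> g0"
begin

lemma integrand_measurable:
  assumes Gu: "subalgebra N (F u)" and [measurable]: "X \<in> borel_measurable N"
  shows "(\<lambda>w. S w * g w (X w)) \<in> borel_measurable N"
proof -
  have [measurable]: "S \<in> borel_measurable N" by (rule measurable_from_subalg[OF Gu S])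
  have [measurable]: "(\<lambda>x. x) \<in> measurable N (F u)" by (rule measurable_from_subalg[OF Gu]) simp
  have "(\<lambda>w. (w, X w)) \<in> measurable N (F u \<Otimes>\<^sub>M borel)" by measurable
  from measurable_compose[OF this g] show ?thesis by simp
qed

text \<open>Only coordinate \<open>i\<close> is integrated out. The others may sit at any times
  \<open>\<tau> l\<close> after \<open>u\<close>, since their past and future parts are measurable
  with respect to the \<open>G\<close> of \<open>wiener_independent\<close>. \<open>freezing\<close>
  applies to the centred future part; a translation moves the density to the conditional
  mean.\<close>

lemma conditional_law:
  fixes i :: 'd
  assumes q: "u < q" "q \<le> 1" and \<tau>: "\<And>l. u < \<tau> l" "\<And>l. \<tau> l \<le> 1"
  defines "upd w y \<equiv> \<chi> l. if l = i then y else B (\<tau> l) w $ l"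
  shows "expectation (\<lambda>w. S w * g w (upd w (B q w $ i))) =
      expectation (\<lambda>w. \<integral>y. normal_density (past u q i w) (sqrt (future_var u q)) y * (S w * g w (upd w y)) \<partial>lborel)"
    and "(\<lambda>(w, y). S w * g w (upd w y)) \<in> borel_measurable (M \<Otimes>\<^sub>M borel)"
proof -
  have u01: "u \<in> {0..1}" using u by simp
  have q01: "q \<in> {0..1}" and \<tau>01: "\<And>l. \<tau> l \<in> {0..1}" using q \<tau> u by (auto intro: less_imp_le less_le_trans le_less_trans)
  define \<sigma> where "\<sigma> = sqrt (future_var u q)"
  have \<sigma>: "0 < \<sigma>" using future_var_pos[of u q] u q by (simp add: \<sigma>_def)
  define X where "X l = future u (if l = i then q else \<tau> l) l" for l
  have Xw: "wiener_version M (W l) u (\<lambda>v. indicator {u<..} v * fbm_kern H (if l = i then q else \<tau> l) v) (X l)" for l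
    unfolding X_def using q01 \<tau>01 by (intro future_wiener u01) auto
  obtain G where G: "subalgebra M G" "subalgebra G (F u)" "\<And>l. l \<noteq> i \<Longrightarrow> X l \<in> borel_measurable G"
    "indep_set (sets G) {X i -` A \<inter> space M |A. A \<in> sets borel}"
    using BMs.wiener_independent[OF u Xw, of i] by blast
  have Xm: "X i \<in> borel_measurable M" using BM.wiener_versionD(2)[OF Xw] by (simp add: square_integrable_def)
  have D: "distributed M lborel (X i) (\<lambda>x. ennreal (normal_density 0 \<sigma> x))"
    unfolding \<sigma>_def
  proof (rule normal_of_char[OF Xm])
    show "0 < future_var u q" using future_var_pos[of u q] u q by simp
    show "(CLINT w|M. iexp (t * X i w)) = of_real (exp (- (future_var u q * t\<^sup>2 / 2)))" for t
      using BMs.wiener_char_single[OF u Xw, of t i] by (simp add: future_var_def)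
  qed
  have BG: "(\<lambda>w. B (\<tau> l) w $ l) \<in> borel_measurable G" if "l \<noteq> i" for l
  proof -
    have "past u (\<tau> l) l \<in> borel_measurable G" by (rule measurable_from_subalg[OF G(2) past_F_measurable])
    from borel_measurable_add[OF this G(3)[OF that]] show ?thesis using that by (simp add: X_def future_def)
  qed
  have upd_meas: "(\<lambda>z. upd (fst z) (Y z)) \<in> borel_measurable (N \<Otimes>\<^sub>M borel)"
    if Y: "Y \<in> borel_measurable (N \<Otimes>\<^sub>M borel)" and BN: "\<And>l. l \<noteq> i \<Longrightarrow> (\<lambda>w. B (\<tau> l) w $ l) \<in> borel_measurable N"
    for N and Y :: "'a \<times> real \<Rightarrow> real"
  proof (rule borel_measurable_vecI)
    fix l
    have "(\<lambda>z. B (\<tau> l) (fst z) $ l) \<in> borel_measurable (N \<Otimes>\<^sub>M borel)" if "l \<noteq> i"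
      by (rule measurable_compose[OF measurable_fst BN[OF that]])
    then show "(\<lambda>z. upd (fst z) (Y z) $ l) \<in> borel_measurable (N \<Otimes>\<^sub>M borel)"
      using Y by (cases "l = i") (simp_all add: upd_def)
  qed
  have comp_meas: "(\<lambda>z. S (fst z) * g (fst z) (upd (fst z) (Y z))) \<in> borel_measurable (N \<Otimes>\<^sub>M borel)"
    if Y: "Y \<in> borel_measurable (N \<Otimes>\<^sub>M borel)" and BN: "\<And>l. l \<noteq> i \<Longrightarrow> (\<lambda>w. B (\<tau> l) w $ l) \<in> borel_measurable N"
      and NF: "subalgebra N (F u)"
    for N and Y :: "'a \<times> real \<Rightarrow> real"
  proof -
    have 1: "fst \<in> measurable (N \<Otimes>\<^sub>M borel) (F u)"
      by (rule measurable_compose[OF measurable_fst]) (rule measurable_from_subalg[OF NF], simp)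
    have "(\<lambda>z. (fst z, upd (fst z) (Y z))) \<in> measurable (N \<Otimes>\<^sub>M borel) (F u \<Otimes>\<^sub>M borel)"
      by (rule measurable_Pair[OF 1 upd_meas[OF Y BN]])
    from borel_measurable_times[OF measurable_compose[OF 1 S] measurable_compose[OF this g]]
    show ?thesis by simp
  qed
  have "(\<lambda>z. S (fst z) * g (fst z) (upd (fst z) (snd z))) \<in> borel_measurable (M \<Otimes>\<^sub>M borel)"
    by (rule comp_meas) (auto intro: B_component_measurable[OF \<tau>01] subalgebra_F[OF u01])
  then show "(\<lambda>(w, y). S w * g w (upd w y)) \<in> borel_measurable (M \<Otimes>\<^sub>M borel)"
    by (simp add: case_prod_beta')
  define \<Phi> where "\<Phi> z = S (fst z) * g (fst z) (upd (fst z) (past u q i (fst z) + snd z))" for z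
  have \<Phi>: "\<Phi> \<in> borel_measurable (G \<Otimes>\<^sub>M borel)"
    unfolding \<Phi>_def[abs_def]
  proof (rule comp_meas[OF _ BG G(2)])
    have [measurable]: "past u q i \<in> borel_measurable G" by (rule measurable_from_subalg[OF G(2) past_F_measurable])
    show "(\<lambda>z. past u q i (fst z) + snd z) \<in> borel_measurable (G \<Otimes>\<^sub>M borel)" by measurable
  qed
  have \<Phi>b: "\<bar>\<Phi> z\<bar> \<le> s0 * g0" for z
    unfolding \<Phi>_def abs_mult by (intro mult_mono Sb gb order_trans[OF abs_ge_zero Sb]) auto
  have "expectation (\<lambda>w. S w * g w (upd w (B q w $ i))) = expectation (\<lambda>w. \<Phi> (w, X i w))"
    by (simp add: \<Phi>_def X_def future_def)
  also have "\<dots> = expectation (\<lambda>w. \<integral>y. normal_density 0 \<sigma> y * \<Phi> (w, y) \<partial>lborel)"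
    by (rule freezing[OF G(1) D _ _ G(4) \<Phi> \<Phi>b]) auto
  also have "\<dots> = expectation (\<lambda>w. \<integral>y. normal_density (past u q i w) \<sigma> y * (S w * g w (upd w y)) \<partial>lborel)"
  proof (rule Bochner_Integration.integral_cong[OF refl])
    fix w
    have "(LINT y|lborel. normal_density (past u q i w) \<sigma> y * (S w * g w (upd w y))) =
      (LINT y|lborel. normal_density (past u q i w) \<sigma> (past u q i w + y) * (S w * g w (upd w (past u q i w + y))))"
      by (subst lborel_integral_real_affine[where c=1 and t="past u q i w"]) auto
    also have "\<dots> = (LINT y|lborel. normal_density 0 \<sigma> y * \<Phi> (w, y))"
      by (simp add: normal_density_def \<Phi>_def)
    finally show "(LINT y|lborel. normal_density 0 \<sigma> y * \<Phi> (w, y)) = (LINT y|lborel. normal_density (past u q i w) \<sigma> y * (S w * g w (upd w y)))" ..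
  qed
  finally show "expectation (\<lambda>w. S w * g w (upd w (B q w $ i))) =
      expectation (\<lambda>w. \<integral>y. normal_density (past u q i w) (sqrt (future_var u q)) y * (S w * g w (upd w y)) \<partial>lborel)"
    by (simp add: \<sigma>_def)
qed

text \<open>The same bounded function is integrated against two normal densities, so the difference
  is at most its bound times the total variation. There are two bounds on \<open>g\<close>: the sure
  bound \<open>g0\<close> secures integrability, while the sharper \<open>c\<close> may hold only
  almost surely, as the Lipschitz bound of the drift does.\<close>

lemma gaussian_smoothing_coordinate:
  fixes i :: 'd
  assumes r: "u < r'" "r' \<le> r" "r \<le> 1" and \<tau>: "\<And>l. u < \<tau> l" "\<And>l. \<tau> l \<le> 1"
    and c: "0 \<le> c" and gc: "AE w in M. \<forall>x. \<bar>g w x\<bar> \<le> c"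
  defines "upd w y \<equiv> \<chi> l. if l = i then y else B (\<tau> l) w $ l"
  shows "\<bar>expectation (\<lambda>w. S w * g w (upd w (B r w $ i))) - expectation (\<lambda>w. S w * g w (upd w (B r' w $ i)))\<bar> \<le>
    c * expectation (\<lambda>w. \<bar>S w\<bar> * smoothing_factor u r r' i w)"
proof -
  have u01: "u \<in> {0..1}" using u by simp
  have Sm[measurable]: "S \<in> borel_measurable M" by (rule F_meas[OF u01 S])
  define \<Psi> where "\<Psi> = (\<lambda>(w, y). S w * g w (upd w y))"
  have \<Psi>[measurable]: "\<Psi> \<in> borel_measurable (M \<Otimes>\<^sub>M borel)"
    unfolding \<Psi>_def upd_def using r \<tau> by (intro conditional_law(2)[of r]) auto
  have s0: "0 \<le> s0" using order_trans[OF abs_ge_zero Sb] .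
  have g0: "0 \<le> g0" using order_trans[OF abs_ge_zero gb] .
  have \<Psi>b: "\<bar>\<Psi> (w, y)\<bar> \<le> \<bar>S w\<bar> * g0" for w y by (simp add: \<Psi>_def abs_mult mult_left_mono gb)
  define \<sigma> where "\<sigma> q = sqrt (future_var u q)" for q
  have \<sigma>: "0 < \<sigma> r" "0 < \<sigma> r'" using future_var_pos[of u] u r by (auto simp: \<sigma>_def)
  have \<sigma>2: "(\<sigma> r)\<^sup>2 = future_var u r" "(\<sigma> r')\<^sup>2 = future_var u r'" using future_var_pos[of u r] future_var_pos[of u r'] u r by (auto simp: \<sigma>_def)
  define h where "h q w = (LINT y|lborel. normal_density (past u q i w) (\<sigma> q) y * \<Psi> (w, y))" for q w
  have hm[measurable]: "h q \<in> borel_measurable M" for q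
    unfolding h_def[abs_def]
  proof (rule lborel.borel_measurable_lebesgue_integral)
    show "(\<lambda>(w, y). normal_density (past u q i w) (\<sigma> q) y * \<Psi> (w, y)) \<in> borel_measurable (M \<Otimes>\<^sub>M lborel)"
      unfolding normal_density_def by measurable
  qed
  have int_y: "integrable lborel (\<lambda>y. normal_density a s y * \<Psi> (w, y))" if "w \<in> space M" "0 < s" for a s w
  proof -
    have [measurable]: "(\<lambda>y. \<Psi> (w, y)) \<in> borel_measurable borel"
      using that by (intro measurable_compose[OF measurable_Pair1' \<Psi>]) simp
    show ?thesis
    proof (rule Bochner_Integration.integrable_bound)
      show "integrable lborel (\<lambda>y. (\<bar>S w\<bar> * g0) * normal_density a s y)" using that by simp
      have "normal_density a s y * \<bar>\<Psi> (w, y)\<bar> \<le> normal_density a s y * (\<bar>S w\<bar> * g0)" for y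
        by (rule mult_left_mono[OF \<Psi>b]) simp
      then show "AE y in lborel. norm (normal_density a s y * \<Psi> (w, y)) \<le> norm ((\<bar>S w\<bar> * g0) * normal_density a s y)"
        using g0 by (intro AE_I2) (simp add: abs_mult mult_ac)
    qed simp
  qed
  have hb: "\<bar>h q w\<bar> \<le> s0 * \<bar>g0\<bar>" if "w \<in> space M" "0 < \<sigma> q" for q w
  proof -
    have "norm (h q w) \<le> (LINT y|lborel. (s0 * \<bar>g0\<bar>) * normal_density (past u q i w) (\<sigma> q) y)"
      unfolding h_def
    proof (rule order_trans[OF integral_norm_bound integral_mono])
      show "integrable lborel (\<lambda>y. norm (normal_density (past u q i w) (\<sigma> q) y * \<Psi> (w, y)))"
        by (rule integrable_norm[OF int_y[OF that]])
      have "\<bar>\<Psi> (w, y)\<bar> \<le> s0 * \<bar>g0\<bar>" for y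
      proof -
        have "\<bar>S w\<bar> * g0 \<le> s0 * \<bar>g0\<bar>" using Sb[of w] s0 g0 by (intro mult_mono') auto
        then show ?thesis using \<Psi>b[of w y] by linarith
      qed
      then show "norm (normal_density (past u q i w) (\<sigma> q) y * \<Psi> (w, y)) \<le> s0 * \<bar>g0\<bar> * normal_density (past u q i w) (\<sigma> q) y" for y
        by (simp add: abs_mult mult.commute mult_right_mono)
    qed (use that in simp)
    then show ?thesis using that by simp
  qed
  have hint: "integrable M (h q)" if "0 < \<sigma> q" for q
    by (rule AE_bounded_integrable[OF hm AE_I2[OF hb[OF _ that]]])
  have E: "expectation (\<lambda>w. S w * g w (upd w (B q w $ i))) = expectation (h q)" if "u < q" "q \<le> 1" for q
    using conditional_law(1)[OF that \<tau>, of i] by (simp add: h_def[abs_def] \<sigma>_def \<Psi>_def upd_def)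
  have le: "AE w in M. \<bar>h r w - h r' w\<bar> \<le> c * (\<bar>S w\<bar> * smoothing_factor u r r' i w)"
    using gc AE_space
  proof eventually_elim
    case (elim w)
    define a where "a = past u r i w"
    define a' where "a' = past u r' i w"
    have "h r w - h r' w = (LINT y|lborel. normal_density a (\<sigma> r) y * \<Psi> (w, y) - normal_density a' (\<sigma> r') y * \<Psi> (w, y))"
      unfolding h_def a_def a'_def by (rule Bochner_Integration.integral_diff[symmetric]) (intro int_y elim \<sigma>)+
    note diff = this
    have le1: "norm (LINT y|lborel. normal_density a (\<sigma> r) y * \<Psi> (w, y) - normal_density a' (\<sigma> r') y * \<Psi> (w, y)) \<le> (LINT y|lborel. (c * \<bar>S w\<bar>) * \<bar>normal_density a (\<sigma> r) y - normal_density a' (\<sigma> r') y\<bar>)"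
    proof (rule order_trans[OF integral_norm_bound integral_mono])
      show "integrable lborel (\<lambda>y. norm (normal_density a (\<sigma> r) y * \<Psi> (w, y) - normal_density a' (\<sigma> r') y * \<Psi> (w, y)))"
        by (intro integrable_norm Bochner_Integration.integrable_diff int_y elim \<sigma>)
      show "integrable lborel (\<lambda>y. (c * \<bar>S w\<bar>) * \<bar>normal_density a (\<sigma> r) y - normal_density a' (\<sigma> r') y\<bar>)"
        using normal_density_diff_integrable[OF \<sigma>] by (rule integrable_mult_right)
      fix y
      have "\<bar>\<Psi> (w, y)\<bar> \<le> c * \<bar>S w\<bar>"
        using mult_left_mono[of "\<bar>g w (upd w y)\<bar>" c "\<bar>S w\<bar>"] elim(1)
        by (simp add: \<Psi>_def abs_mult mult.commute)
      then have "\<bar>\<Psi> (w, y)\<bar> * \<bar>normal_density a (\<sigma> r) y - normal_density a' (\<sigma> r') y\<bar> \<le> (c * \<bar>S w\<bar>) * \<bar>normal_density a (\<sigma> r) y - normal_density a' (\<sigma> r') y\<bar>"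
        by (rule mult_right_mono) simp
      then show "norm (normal_density a (\<sigma> r) y * \<Psi> (w, y) - normal_density a' (\<sigma> r') y * \<Psi> (w, y)) \<le>
         (c * \<bar>S w\<bar>) * \<bar>normal_density a (\<sigma> r) y - normal_density a' (\<sigma> r') y\<bar>"
        by (simp add: abs_mult mult.commute flip: right_diff_distrib)
    qed
    have le2: "(c * \<bar>S w\<bar>) * (LINT y|lborel. \<bar>normal_density a (\<sigma> r) y - normal_density a' (\<sigma> r') y\<bar>) \<le> (c * \<bar>S w\<bar>) * smoothing_factor u r r' i w"
      using normal_density_diff[OF \<sigma>, of a a'] c unfolding smoothing_factor_def \<sigma>2 a_def a'_def
      by (intro mult_left_mono) (auto simp: \<sigma>_def)
    show ?case using le1 le2 unfolding diff integral_mult_right_zero by (simp add: mult.assoc)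
  qed
  have sf_int: "integrable M (\<lambda>w. \<bar>S w\<bar> * smoothing_factor u r r' i w)"
  proof -
    have "square_integrable M (smoothing_factor u r r' i)"
      using smoothing_factor_moment[of u r' r 1 i] u r by (auto simp: moment_le_def square_integrable_def)
    moreover have "square_integrable M (\<lambda>w. \<bar>S w\<bar>)" using Sb by (intro square_integrable_bounded[where c=s0]) auto
    ultimately show ?thesis by (intro square_integrable_mult)
  qed
  have "\<bar>expectation (h r) - expectation (h r')\<bar> = norm (expectation (\<lambda>w. h r w - h r' w))"
    using hint[OF \<sigma>(1)] hint[OF \<sigma>(2)] by simp
  also have "\<dots> \<le> expectation (\<lambda>w. c * (\<bar>S w\<bar> * smoothing_factor u r r' i w))"
  proof (rule order_trans[OF integral_norm_bound integral_mono_AE])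
    show "integrable M (\<lambda>w. norm (h r w - h r' w))"
      by (intro integrable_norm Bochner_Integration.integrable_diff hint \<sigma>)
    show "integrable M (\<lambda>w. c * (\<bar>S w\<bar> * smoothing_factor u r r' i w))" by (rule integrable_mult_right[OF sf_int])
    show "AE w in M. norm (h r w - h r' w) \<le> c * (\<bar>S w\<bar> * smoothing_factor u r r' i w)" using le by simp
  qed
  finally show ?thesis using E[of r] E[of r'] r by simp
qed

text \<open>The coordinates are moved from \<open>r'\<close> to \<open>r\<close> one at a time; in
  \<open>mix I\<close> those in \<open>I\<close> have been moved. Each move leaves the other
  coordinates at times after \<open>u\<close>, as \<open>gaussian_smoothing_coordinate\<close>
  requires.\<close>

lemma gaussian_smoothing:
  assumes r: "u < r'" "r' \<le> r" "r \<le> 1"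
    and c: "0 \<le> c" and gc: "AE w in M. \<forall>x. \<bar>g w x\<bar> \<le> c"
  shows "\<bar>expectation (\<lambda>w. S w * g w (B r w)) - expectation (\<lambda>w. S w * g w (B r' w))\<bar> \<le>
    (\<Sum>i\<in>UNIV. c * expectation (\<lambda>w. \<bar>S w\<bar> * smoothing_factor u r r' i w))"
proof -
  define mix where "mix I w = (\<chi> l. if l \<in> I then B r w $ l else B r' w $ l)" for I :: "'d set" and w
  have "finite I" for I :: "'d set" by simp
  then have "\<bar>expectation (\<lambda>w. S w * g w (mix I w)) - expectation (\<lambda>w. S w * g w (mix {} w))\<bar> \<le>
      (\<Sum>i\<in>I. c * expectation (\<lambda>w. \<bar>S w\<bar> * smoothing_factor u r r' i w))" for I
  proof (induction I rule: finite_induct)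
    case (insert i I)
    define \<tau> where "\<tau> l = (if l \<in> I then r else r')" for l
    have 1: "mix (insert i I) w = (\<chi> l. if l = i then B r w $ i else B (\<tau> l) w $ l)" for w
      by (auto simp: mix_def \<tau>_def vec_eq_iff)
    have 2: "mix I w = (\<chi> l. if l = i then B r' w $ i else B (\<tau> l) w $ l)" for w
      using insert by (auto simp: mix_def \<tau>_def vec_eq_iff)
    have "\<bar>expectation (\<lambda>w. S w * g w (mix (insert i I) w)) - expectation (\<lambda>w. S w * g w (mix I w))\<bar> \<le>
        c * expectation (\<lambda>w. \<bar>S w\<bar> * smoothing_factor u r r' i w)"
      unfolding 1 2 by (rule gaussian_smoothing_coordinate[OF r _ _ c gc]) (use r in \<open>auto simp: \<tau>_def\<close>)
    then show ?case using insert by simp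
  qed simp
  from this[of UNIV] show ?thesis by (simp add: mix_def vec_lambda_eta)
qed

end

end

section \<open>Time integrals\<close>

lemma set_integral_abs_le:
  fixes f :: "real \<Rightarrow> real"
  assumes [measurable]: "f \<in> borel_measurable borel" and ab: "a \<le> b"
    and le: "AE r in lborel. r \<in> {a..b} \<longrightarrow> \<bar>f r\<bar> \<le> c" and c: "0 \<le> c"
  shows "\<bar>LINT r:{a..b}|lborel. f r\<bar> \<le> c * (b - a)"
proof -
  have "norm (LINT r|lborel. indicator {a..b} r *\<^sub>R f r) \<le> (LINT r|lborel. indicator {a..b} r * c)"
  proof (rule order_trans[OF integral_norm_bound integral_mono_AE])
    show "integrable lborel (\<lambda>r. norm (indicator {a..b} r *\<^sub>R f r))"
      by (intro integrable_norm integrableI_bounded_set[where A="{a..b}" and B=c])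
         (use le c in \<open>auto simp: emeasure_lborel_Icc_eq elim!: eventually_mono\<close>)
    show "AE r in lborel. norm (indicator {a..b} r *\<^sub>R f r) \<le> indicator {a..b} r * c"
      using le by eventually_elim (auto simp: indicator_def)
  qed (simp add: emeasure_lborel_Icc_eq)
  then show ?thesis using ab by (simp add: set_lebesgue_integral_def mult.commute)
qed

context prob_space
begin

context
  fixes Y :: "real \<Rightarrow> 'a \<Rightarrow> real" and y0 a b :: real
  assumes Y: "(\<lambda>(r, w). Y r w) \<in> borel_measurable (borel \<Otimes>\<^sub>M M)"
    and Yb: "\<And>r w. \<bar>Y r w\<bar> \<le> y0" and ab: "a \<le> b"
begin

lemma time_slice_measurable: "Y r \<in> borel_measurable M"
  using measurable_compose[OF measurable_Pair1'[of r borel M] Y] by simp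

lemma time_path_measurable: "w \<in> space M \<Longrightarrow> (\<lambda>r. Y r w) \<in> borel_measurable borel"
  using measurable_compose[OF measurable_Pair2'[of w M borel] Y] by simp

lemma time_integral_measurable: "(\<lambda>w. LINT r:{a..b}|lborel. Y r w) \<in> borel_measurable M"
  unfolding set_lebesgue_integral_def
proof (rule lborel.borel_measurable_lebesgue_integral)
  have [measurable]: "(\<lambda>x. Y (snd x) (fst x)) \<in> borel_measurable (M \<Otimes>\<^sub>M lborel)"
    using measurable_compose[OF _ Y, of "\<lambda>x. (snd x, fst x)" "M \<Otimes>\<^sub>M lborel"] by simp
  show "(\<lambda>(w, r). indicator {a..b} r *\<^sub>R Y r w) \<in> borel_measurable (M \<Otimes>\<^sub>M lborel)"
    by (simp add: split_beta')
qed

lemma time_integral_abs_le: "w \<in> space M \<Longrightarrow> \<bar>LINT r:{a..b}|lborel. Y r w\<bar> \<le> y0 * (b - a)"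
  by (intro set_integral_abs_le time_path_measurable ab AE_I2) (auto simp: Yb intro: order_trans[OF abs_ge_zero Yb])

lemma time_integral_expectation:
  assumes T[measurable]: "T \<in> borel_measurable M" and Tb: "\<And>w. \<bar>T w\<bar> \<le> c"
  shows "expectation (\<lambda>w. T w * (LINT r:{a..b}|lborel. Y r w)) =
      (LINT r:{a..b}|lborel. expectation (\<lambda>w. T w * Y r w))"
    and "integrable lborel (\<lambda>r. indicator {a..b} r * expectation (\<lambda>w. T w * Y r w))"
proof -
  interpret P: pair_sigma_finite lborel M ..
  define f where "f r w = indicator {a..b} r * (T w * Y r w)" for r w
  have [measurable]: "(\<lambda>(r, w). Y r w) \<in> borel_measurable (lborel \<Otimes>\<^sub>M M)"
    using Y by (simp cong: measurable_cong_sets sets_pair_measure_cong)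
  have f: "integrable (lborel \<Otimes>\<^sub>M M) (case_prod f)"
  proof (rule integrableI_bounded_set[where A="{a..b} \<times> space M" and B="c * y0"])
    show "case_prod f \<in> borel_measurable (lborel \<Otimes>\<^sub>M M)" unfolding f_def[abs_def] by measurable
    show "emeasure (lborel \<Otimes>\<^sub>M M) ({a..b} \<times> space M) < \<infinity>"
      by (simp add: emeasure_pair_measure_Times emeasure_space_1 emeasure_lborel_Icc_eq)
    have "norm (f r w) \<le> c * y0" for r w
    proof -
      have "\<bar>T w\<bar> * \<bar>Y r w\<bar> \<le> c * y0"
        using Tb[of w] by (intro mult_mono Tb Yb) auto
      moreover have "norm (f r w) \<le> \<bar>T w\<bar> * \<bar>Y r w\<bar>" by (auto simp: f_def indicator_def abs_mult)
      ultimately show ?thesis by linarith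
    qed
    then show "AE x in lborel \<Otimes>\<^sub>M M. x \<in> {a..b} \<times> space M \<longrightarrow> norm (case_prod f x) \<le> c * y0" by auto
    show "AE x in lborel \<Otimes>\<^sub>M M. x \<notin> {a..b} \<times> space M \<longrightarrow> case_prod f x = 0"
      by (rule AE_I2) (auto simp: f_def space_pair_measure indicator_def)
  qed measurable
  have "expectation (\<lambda>w. T w * (LINT r:{a..b}|lborel. Y r w)) = expectation (\<lambda>w. LINT r|lborel. f r w)"
    unfolding set_lebesgue_integral_def f_def
    by (intro Bochner_Integration.integral_cong refl) (simp flip: integral_mult_right_zero add: mult_ac)
  also have "\<dots> = (LINT r|lborel. expectation (\<lambda>w. f r w))" by (rule P.Fubini_integral[OF f])
  also have "\<dots> = (LINT r:{a..b}|lborel. expectation (\<lambda>w. T w * Y r w))"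
    unfolding set_lebesgue_integral_def f_def by simp
  finally show "expectation (\<lambda>w. T w * (LINT r:{a..b}|lborel. Y r w)) =
      (LINT r:{a..b}|lborel. expectation (\<lambda>w. T w * Y r w))" .
  show "integrable lborel (\<lambda>r. indicator {a..b} r * expectation (\<lambda>w. T w * Y r w))"
    using P.integrable_fst'[OF f] by (simp add: f_def)
qed

text \<open>Truncation turns the almost sure bound of the conditional expectation into a bound at
  every point, the form in which it can serve as a test function.\<close>

lemma bounded_cond_exp_version:
  assumes G: "subalgebra M G"
  obtains D where "D \<in> borel_measurable G" "\<And>w. \<bar>D w\<bar> \<le> y0 * (b - a)"
    "AE w in M. real_cond_exp M G (\<lambda>w. LINT r:{a..b}|lborel. Y r w) w = D w"
proof -
  define Z where "Z w = (LINT r:{a..b}|lborel. Y r w)" for w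
  have "AE w in M. \<bar>Z w\<bar> \<le> y0 * (b - a)" unfolding Z_def by (rule AE_I2) (rule time_integral_abs_le)
  from real_cond_exp_AE_bounded[OF G _ this]
  have "AE w in M. \<bar>real_cond_exp M G Z w\<bar> \<le> y0 * (b - a)"
    using time_integral_measurable by (simp add: Z_def[abs_def])
  then have "AE w in M. real_cond_exp M G Z w = max (- (y0 * (b - a))) (min (y0 * (b - a)) (real_cond_exp M G Z w))"
    by eventually_elim auto
  moreover have "0 \<le> y0 * (b - a)" using Yb[of 0 undefined] ab by (intro mult_nonneg_nonneg) auto
  ultimately show ?thesis
    by (intro that[of "\<lambda>w. max (- (y0 * (b - a))) (min (y0 * (b - a)) (real_cond_exp M G Z w))"]) (auto simp: Z_def[abs_def])
qed

text \<open>Joint measurability is known for \<open>M\<close>, not for \<open>G\<close>, so the time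
  integral is not directly \<open>G\<close>-measurable. Instead the residual \<open>T\<close> is
  orthogonal to all bounded \<open>G\<close>-measurable functions, hence to each \<open>Y r\<close>
  and by Fubini's theorem to \<open>Z\<close>; being also orthogonal to \<open>D\<close>, it is
  orthogonal to itself.\<close>

lemma time_integral_cond_exp_adapted:
  assumes G: "subalgebra M G" and YG: "\<And>r. r \<in> {a..b} \<Longrightarrow> Y r \<in> borel_measurable G"
  shows "AE w in M. real_cond_exp M G (\<lambda>w. LINT r:{a..b}|lborel. Y r w) w = (LINT r:{a..b}|lborel. Y r w)"
proof -
  define Z where "Z w = (LINT r:{a..b}|lborel. Y r w)" for w
  obtain D where D: "D \<in> borel_measurable G" "\<And>w. \<bar>D w\<bar> \<le> y0 * (b - a)" "AE w in M. real_cond_exp M G Z w = D w"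
    unfolding Z_def by (rule bounded_cond_exp_version[OF G]) metis
  have Zm[measurable]: "Z \<in> borel_measurable M" using time_integral_measurable by (simp add: Z_def[abs_def])
  have [measurable]: "D \<in> borel_measurable M" by (rule measurable_from_subalg[OF G D(1)])
  note Ym[measurable] = time_slice_measurable
  have Zb: "AE w in M. \<bar>Z w\<bar> \<le> y0 * (b - a)" unfolding Z_def by (rule AE_I2) (rule time_integral_abs_le)
  have eq: "expectation (\<lambda>w. V w * D w) = expectation (\<lambda>w. V w * Z w)"
    if V: "V \<in> borel_measurable G" "\<And>w. \<bar>V w\<bar> \<le> c" for V c
  proof -
    have [measurable]: "V \<in> borel_measurable M" by (rule measurable_from_subalg[OF G V(1)])
    have "expectation (\<lambda>w. V w * D w) = expectation (\<lambda>w. V w * real_cond_exp M G Z w)"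
      by (rule integral_cong_AE) (use D(3) in \<open>auto elim!: eventually_mono\<close>)
    also have "\<dots> = expectation (\<lambda>w. V w * Z w)"
      by (rule expectation_mult_real_cond_exp[OF G V(1) Zm _ Zb]) (use V(2) in auto)
    finally show ?thesis .
  qed
  define T where "T w = max (- (y0 * (b - a))) (min (y0 * (b - a)) (Z w)) - D w" for w
  have [measurable]: "T \<in> borel_measurable M" unfolding T_def[abs_def] by measurable
  have TZ: "AE w in M. T w = Z w - D w" using Zb by eventually_elim (auto simp: T_def)
  have Tb: "\<bar>T w\<bar> \<le> 2 * (y0 * (b - a))" for w using D(2)[of w] by (auto simp: T_def)
  have int2: "integrable M (\<lambda>w. V w * V' w)" if "V \<in> borel_measurable M" "V' \<in> borel_measurable M"
    "AE w in M. \<bar>V w\<bar> \<le> x" "AE w in M. \<bar>V' w\<bar> \<le> y" for V V' and x y :: real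
  proof (rule AE_bounded_integrable[where c="\<bar>x\<bar> * \<bar>y\<bar>"])
    show "AE w in M. \<bar>V w * V' w\<bar> \<le> \<bar>x\<bar> * \<bar>y\<bar>"
      using that(3,4) by eventually_elim (auto simp: abs_mult intro!: mult_mono)
  qed (use that in simp)
  have orth: "expectation (\<lambda>w. V w * T w) = 0" if V: "V \<in> borel_measurable G" "\<And>w. \<bar>V w\<bar> \<le> c" for V c
  proof -
    have [measurable]: "V \<in> borel_measurable M" by (rule measurable_from_subalg[OF G V(1)])
    have "expectation (\<lambda>w. V w * T w) = expectation (\<lambda>w. V w * Z w - V w * D w)"
      by (rule integral_cong_AE) (use TZ in \<open>auto simp: right_diff_distrib elim!: eventually_mono\<close>)
    also have "\<dots> = expectation (\<lambda>w. V w * Z w) - expectation (\<lambda>w. V w * D w)"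
      by (intro Bochner_Integration.integral_diff int2[OF _ _ AE_I2[OF V(2)] Zb] int2[OF _ _ AE_I2[OF V(2)] AE_I2[OF D(2)]]) simp_all
    finally show ?thesis using eq[OF V] by simp
  qed
  have "expectation (\<lambda>w. T w * Z w) = (LINT r:{a..b}|lborel. expectation (\<lambda>w. T w * Y r w))"
    unfolding Z_def by (rule time_integral_expectation[OF _ Tb]) measurable
  also have "\<dots> = (LINT r:{a..b}|lborel. 0)"
    by (rule set_lebesgue_integral_cong) (use orth[OF YG Yb] in \<open>auto simp: mult.commute\<close>)
  finally have "expectation (\<lambda>w. T w * Z w) = 0" by (simp add: set_lebesgue_integral_def)
  moreover have "expectation (\<lambda>w. T w * D w) = 0" using orth[OF D(1,2)] by (simp add: mult.commute)
  moreover have "expectation (\<lambda>w. (T w)\<^sup>2) = expectation (\<lambda>w. T w * Z w - T w * D w)"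
    by (rule integral_cong_AE) (use TZ in \<open>auto simp: power2_eq_square simp flip: right_diff_distrib elim!: eventually_mono\<close>)
  moreover have "\<dots> = expectation (\<lambda>w. T w * Z w) - expectation (\<lambda>w. T w * D w)"
    by (intro Bochner_Integration.integral_diff int2[OF _ _ AE_I2[OF Tb] Zb] int2[OF _ _ AE_I2[OF Tb] AE_I2[OF D(2)]]) simp_all
  ultimately have "expectation (\<lambda>w. (T w)\<^sup>2) = 0" by simp
  moreover have "integrable M (\<lambda>w. (T w)\<^sup>2)"
    unfolding power2_eq_square by (rule int2[OF _ _ AE_I2[OF Tb] AE_I2[OF Tb]]) simp_all
  ultimately have "AE w in M. (T w)\<^sup>2 = 0" using integral_nonneg_eq_0_iff_AE[of M "\<lambda>w. (T w)\<^sup>2"] by simp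
  then have "AE w in M. real_cond_exp M G Z w = Z w" using TZ D(3) by eventually_elim simp
  then show ?thesis by (simp add: Z_def[abs_def])
qed

text \<open>Testing against \<open>D ^ (2 * p - 1)\<close>, where \<open>D\<close> is the conditional expectation, turns the weak
  bound into a moment bound.\<close>

lemma time_integral_cond_exp_moment:
  assumes G: "subalgebra M G" and p: "1 \<le> p" and \<rho>: "0 \<le> \<rho>"
    and weak: "\<And>S s0 r. S \<in> borel_measurable G \<Longrightarrow> (\<And>w. \<bar>S w\<bar> \<le> s0) \<Longrightarrow> r \<in> {a..b} \<Longrightarrow>
      \<bar>expectation (\<lambda>w. S w * Y r w)\<bar> \<le> expectation (\<lambda>w. \<bar>S w\<bar> * R r w)"
    and R: "\<And>r. r \<in> {a..b} \<Longrightarrow> moment_le p (R r) \<rho>"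
  shows "moment_le p (real_cond_exp M G (\<lambda>w. LINT r:{a..b}|lborel. Y r w)) (\<rho> * (b - a))"
proof -
  define Z where "Z w = (LINT r:{a..b}|lborel. Y r w)" for w
  obtain D where D: "D \<in> borel_measurable G" "\<And>w. \<bar>D w\<bar> \<le> y0 * (b - a)" "AE w in M. real_cond_exp M G Z w = D w"
    unfolding Z_def by (rule bounded_cond_exp_version[OF G]) metis
  have Zm[measurable]: "Z \<in> borel_measurable M" using time_integral_measurable by (simp add: Z_def[abs_def])
  have Dm[measurable]: "D \<in> borel_measurable M" by (rule measurable_from_subalg[OF G D(1)])
  have Zb: "AE w in M. \<bar>Z w\<bar> \<le> y0 * (b - a)" unfolding Z_def by (rule AE_I2) (rule time_integral_abs_le)
  have "moment_le p D (\<rho> * (b - a))"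
  proof (cases "a = b")
    case True
    then show ?thesis using D(2) by (intro moment_le_bounded AE_I2) auto
  next
    case False
    then have ab: "a < b" using ab by simp
    define q where "q = 2 * p"
    define m where "m = expectation (\<lambda>w. D w ^ q)"
    define S where "S w = D w ^ (q - 1)" for w
    have qn: "1 \<le> q" "q = Suc (q - 1)" "even q" using p by (auto simp: q_def)
    have Dint: "integrable M (\<lambda>w. D w ^ q)"
      by (rule AE_bounded_integrable[where c="(y0 * (b - a)) ^ q"]) (use D(2) in \<open>auto simp: power_abs intro!: power_mono\<close>)
    have SG: "S \<in> borel_measurable G" unfolding S_def[abs_def] using D(1) by measurable
    have Sb: "\<bar>S w\<bar> \<le> (y0 * (b - a)) ^ (q - 1)" for w unfolding S_def power_abs by (intro power_mono D(2)) auto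
    have "m = expectation (\<lambda>w. S w * real_cond_exp M G Z w)" unfolding m_def
    proof (rule integral_cong_AE)
      have "D w ^ q = S w * D w" for w unfolding S_def using qn(2) by (metis power_Suc2)
      then show "AE w in M. D w ^ q = S w * real_cond_exp M G Z w" using D(3) by (auto elim!: eventually_mono)
    qed (use measurable_from_subalg[OF G SG] in auto)
    also have "\<dots> = expectation (\<lambda>w. S w * Z w)"
      by (rule expectation_mult_real_cond_exp[OF G SG Zm AE_I2 Zb]) (rule Sb)
    also have "\<dots> = (LINT r:{a..b}|lborel. expectation (\<lambda>w. S w * Y r w))"
      unfolding Z_def by (rule time_integral_expectation[OF measurable_from_subalg[OF G SG] Sb])
    finally have m: "m = (LINT r:{a..b}|lborel. expectation (\<lambda>w. S w * Y r w))" .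
    \<comment> \<open>Young's bound divided by the length of the interval. Its part
      \<open>(1 - 1 / q) * m\<close> is finally absorbed by the left side, which leaves the factor
      \<open>1 / q\<close> on both sides.\<close>
    define k where "k = ((1 - 1 / real q) * m + ((b - a) * \<rho>) ^ q / real q) / (b - a)"
    have le: "expectation (\<lambda>w. S w * Y r w) \<le> k" if r: "r \<in> {a..b}" for r
    proof -
      note Rm = moment_leD[OF R[OF r]]
      have Rint: "integrable M (\<lambda>w. ((b - a) * \<bar>R r w\<bar>) ^ q)"
        using Rm(2)[folded q_def] by (simp add: power_mult_distrib power_even_abs[OF qn(3)])
      have "(b - a) * expectation (\<lambda>w. S w * Y r w) \<le> (b - a) * expectation (\<lambda>w. \<bar>S w\<bar> * R r w)"
        using weak[OF SG Sb r] ab by (intro mult_left_mono) auto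
      also have "\<dots> = expectation (\<lambda>w. (b - a) * (\<bar>S w\<bar> * R r w))" by simp
      also have "\<dots> \<le> expectation (\<lambda>w. (1 - 1 / real q) * D w ^ q + ((b - a) * \<bar>R r w\<bar>) ^ q / real q)"
      proof (rule integral_mono)
        show "integrable M (\<lambda>w. (1 - 1 / real q) * D w ^ q + ((b - a) * \<bar>R r w\<bar>) ^ q / real q)"
          using Dint Rint by auto
        have pt: "(b - a) * (\<bar>S w\<bar> * \<bar>R r w\<bar>) \<le> (1 - 1 / real q) * D w ^ q + ((b - a) * \<bar>R r w\<bar>) ^ q / real q" for w
          using young_power[of "\<bar>D w\<bar>" "(b - a) * \<bar>R r w\<bar>" q] ab qn(1)
          by (simp add: S_def power_abs power_even_abs[OF qn(3)] mult_ac)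
        show "(b - a) * (\<bar>S w\<bar> * R r w) \<le> (1 - 1 / real q) * D w ^ q + ((b - a) * \<bar>R r w\<bar>) ^ q / real q" for w
          by (rule order_trans[OF _ pt]) (use ab in \<open>auto intro!: mult_left_mono\<close>)
        show "integrable M (\<lambda>w. (b - a) * (\<bar>S w\<bar> * R r w))"
        proof (rule Bochner_Integration.integrable_bound)
          show "integrable M (\<lambda>w. (1 - 1 / real q) * D w ^ q + ((b - a) * \<bar>R r w\<bar>) ^ q / real q)"
            using Dint Rint by auto
          show "AE w in M. norm ((b - a) * (\<bar>S w\<bar> * R r w)) \<le> norm ((1 - 1 / real q) * D w ^ q + ((b - a) * \<bar>R r w\<bar>) ^ q / real q)"
          proof (rule AE_I2)
            fix w
            have "norm ((b - a) * (\<bar>S w\<bar> * R r w)) = (b - a) * (\<bar>S w\<bar> * \<bar>R r w\<bar>)" using ab by (simp add: abs_mult)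
            then show "norm ((b - a) * (\<bar>S w\<bar> * R r w)) \<le> norm ((1 - 1 / real q) * D w ^ q + ((b - a) * \<bar>R r w\<bar>) ^ q / real q)"
              using pt[of w] by simp
          qed
        qed (use measurable_from_subalg[OF G SG] Rm(1) in measurable)
      qed
      also have "\<dots> = (1 - 1 / real q) * m + expectation (\<lambda>w. ((b - a) * \<bar>R r w\<bar>) ^ q) / real q"
        using Dint Rint by (simp add: m_def)
      also have "expectation (\<lambda>w. ((b - a) * \<bar>R r w\<bar>) ^ q) \<le> ((b - a) * \<rho>) ^ q"
        using Rm(4)[folded q_def] ab by (simp add: power_mult_distrib power_even_abs[OF qn(3)])
      finally show ?thesis using ab qn(1) by (simp add: k_def field_simps divide_right_mono)
    qed
    have "integrable lborel (indicator {a..b} :: real \<Rightarrow> real)" by (simp add: emeasure_lborel_Icc_eq)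
    then have "m \<le> (LINT r|lborel. indicator {a..b} r * k)" unfolding m set_lebesgue_integral_def real_scaleR_def
      by (intro integral_mono[OF time_integral_expectation(2)[OF measurable_from_subalg[OF G SG] Sb]] integrable_mult_left)
         (use le in \<open>auto split: split_indicator\<close>)
    also have "\<dots> = (1 - 1 / real q) * m + ((b - a) * \<rho>) ^ q / real q" using ab by (simp add: k_def)
    finally have "m \<le> ((b - a) * \<rho>) ^ q" using qn(1) by (simp add: field_simps)
    then show ?thesis using Dint \<rho> ab by (simp add: moment_le_def m_def q_def mult.commute)
  qed
  then show ?thesis unfolding Z_def[symmetric, abs_def]
    by (rule moment_le_cong_AE) (use D(3) in \<open>auto elim!: eventually_mono\<close>)
qed

end

end

section \<open>Frozen cells\<close>

context F_fbm_process
begin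

text \<open>Off the null set of discontinuous paths, which are replaced by 0, the process is the
  limit of its values at grid points of mesh \<open>1 / (n + 1)\<close>. Clamping time to
  \<open>[0, 1]\<close> extends it to the whole line, so that Fubini's theorem applies with the
  Borel sets.\<close>

lemma measurable_version:
  obtains Bm where "(\<lambda>(r, w). Bm r w) \<in> borel_measurable (borel \<Otimes>\<^sub>M M)"
    "AE w in M. \<forall>r\<in>{0..1}. Bm r w = B r w"
proof -
  have "AE w in M. \<forall>i. continuous_on {0..1} (\<lambda>t. B t w $ i)"
    using B by (subst AE_all_countable) (simp add: F_fbm_def F_fbm_real_def fractional_brownian_motion_def)
  then obtain N where N: "{w\<in>space M. \<not> (\<forall>i. continuous_on {0..1} (\<lambda>t. B t w $ i))} \<subseteq> N"
    "emeasure M N = 0" "N \<in> sets M" by (rule AE_E)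
  define cl where "cl r = max 0 (min 1 r)" for r :: real
  have cl: "cl r \<in> {0..1}" for r by (auto simp: cl_def)
  define Bm where "Bm r w = (if w \<in> N then 0 else B (cl r) w)" for r w
  define Bn where "Bn n k w = (if w \<in> N then 0 else B (cl (of_int k / real (Suc n))) w)" for n and k :: int and w
  have [measurable]: "Bn n k \<in> borel_measurable M" for n k
    unfolding Bn_def[abs_def] using N(3) B_measurable[OF cl] by measurable
  have "(\<lambda>x. Bm (fst x) (snd x)) \<in> borel_measurable (borel \<Otimes>\<^sub>M M)"
  proof (rule borel_measurable_LIMSEQ_metric)
    show "(\<lambda>x. Bn n \<lfloor>real (Suc n) * fst x\<rfloor> (snd x)) \<in> borel_measurable (borel \<Otimes>\<^sub>M M)" for n
      by (rule measurable_compose_countable[where f="\<lambda>k x. Bn n k (snd x)"]) measurable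
    fix x :: "real \<times> 'a" assume "x \<in> space (borel \<Otimes>\<^sub>M M)"
    then have w: "snd x \<in> space M" by (auto simp: space_pair_measure)
    define r where "r = fst x"
    show "(\<lambda>n. Bn n \<lfloor>real (Suc n) * fst x\<rfloor> (snd x)) \<longlonglongrightarrow> Bm (fst x) (snd x)"
    proof (cases "snd x \<in> N")
      case False
      have "(\<lambda>n. of_int \<lfloor>real (Suc n) * r\<rfloor> / real (Suc n)) \<longlonglongrightarrow> r"
      proof (rule tendsto_sandwich)
        show "\<forall>\<^sub>F n in sequentially. r - 1 / real (Suc n) \<le> of_int \<lfloor>real (Suc n) * r\<rfloor> / real (Suc n)"
        proof (intro always_eventually allI)
          fix n
          have "real (Suc n) * r - 1 \<le> of_int \<lfloor>real (Suc n) * r\<rfloor>" by linarith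
          then have "(real (Suc n) * r - 1) / real (Suc n) \<le> of_int \<lfloor>real (Suc n) * r\<rfloor> / real (Suc n)"
            by (rule divide_right_mono) simp
          then show "r - 1 / real (Suc n) \<le> of_int \<lfloor>real (Suc n) * r\<rfloor> / real (Suc n)"
            by (simp add: diff_divide_distrib del: of_nat_Suc)
        qed
        show "\<forall>\<^sub>F n in sequentially. of_int \<lfloor>real (Suc n) * r\<rfloor> / real (Suc n) \<le> r"
          by (intro always_eventually allI) (simp add: field_simps del: of_nat_Suc)
        show "(\<lambda>n. r - 1 / real (Suc n)) \<longlonglongrightarrow> r"
          using tendsto_diff[OF tendsto_const LIMSEQ_inverse_real_of_nat, of r] by (simp add: inverse_eq_divide)
      qed simp
      then have lim: "(\<lambda>n. cl (of_int \<lfloor>real (Suc n) * r\<rfloor> / real (Suc n))) \<longlonglongrightarrow> cl r"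
        unfolding cl_def by (intro tendsto_intros)
      have "(\<lambda>n. B (cl (of_int \<lfloor>real (Suc n) * r\<rfloor> / real (Suc n))) (snd x)) \<longlonglongrightarrow> B (cl r) (snd x)"
      proof (rule vec_tendstoI)
        fix i
        have "continuous_on {0..1} (\<lambda>t. B t (snd x) $ i)" using False w N(1) by auto
        then show "(\<lambda>n. B (cl (of_int \<lfloor>real (Suc n) * r\<rfloor> / real (Suc n))) (snd x) $ i) \<longlonglongrightarrow> B (cl r) (snd x) $ i"
          by (rule continuous_on_tendsto_compose[OF _ lim]) (use cl in auto)
      qed
      then show ?thesis using False by (simp add: Bn_def Bm_def r_def)
    qed (simp add: Bn_def Bm_def)
  qed
  moreover have "AE w in M. w \<notin> N" using N by (intro AE_not_in) auto
  then have "AE w in M. \<forall>r\<in>{0..1}. Bm r w = B r w"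
    by eventually_elim (auto simp: Bm_def cl_def)
  ultimately show ?thesis by (intro that[of Bm]) (simp_all add: split_beta')
qed

definition cell_const :: "nat \<Rightarrow> real" where
  "cell_const p = real CARD('d) * (5 * gaussian_moment_const p + 4)"

lemma cell_const_pos: "0 < cell_const p"
  using gaussian_moment_const_pos[of p] by (simp add: cell_const_def)

context
  fixes Bm :: "real \<Rightarrow> 'a \<Rightarrow> real ^ 'd"
  assumes Bm: "(\<lambda>(r, w). Bm r w) \<in> borel_measurable (borel \<Otimes>\<^sub>M M)"
    and Bm_eq: "AE w in M. \<forall>r\<in>{0..1}. Bm r w = B r w"
begin

lemma version_measurable: "Bm r \<in> borel_measurable M"
  using measurable_compose[OF measurable_Pair1'[of r borel M] Bm] by simp

lemma version_adapted:
  assumes t: "t \<in> {0..1}"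
  shows "Bm t \<in> borel_measurable (F t)"
proof (rule borel_measurable_vecI)
  fix l
  show "(\<lambda>w. Bm t w $ l) \<in> borel_measurable (F t)"
  proof (rule F_meas_AE[OF t])
    show "(\<lambda>w. B t w $ l) \<in> borel_measurable (F t)"
      by (rule measurable_compose[OF B_adapted[OF t]]) simp
    show "(\<lambda>w. Bm t w $ l) \<in> borel_measurable M"
      by (rule measurable_compose[OF version_measurable]) simp
    show "AE w in M. Bm t w $ l = B t w $ l" using Bm_eq by eventually_elim (use t in simp)
  qed
qed

context
  fixes u :: real and g :: "'a \<Rightarrow> real ^ 'd \<Rightarrow> real" and g0 a b :: real
  assumes u: "0 \<le> u" "u < a" and ab: "a \<le> b" "b \<le> 1"
    and g: "(\<lambda>(w, x). g w x) \<in> borel_measurable (F u \<Otimes>\<^sub>M borel)" and gb: "\<And>w x. \<bar>g w x\<bar> \<le> g0"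
begin

lemma frozen_measurable:
  assumes "subalgebra N (F u)" "X \<in> borel_measurable N"
  shows "(\<lambda>w. g w (X w)) \<in> borel_measurable N"
  using integrand_measurable[of u "\<lambda>_. 1" 1 g g0 N X] assms u ab g gb by simp

lemma cell_integrand_measurable:
  "(\<lambda>(r, w). g w (Bm r w) - g w (Bm a w)) \<in> borel_measurable (borel \<Otimes>\<^sub>M M)"
proof -
  have 1: "(\<lambda>x. x) \<in> measurable M (F u)" using subalgebra_F[of u] u ab by (intro measurable_from_subalg[of M "F u"]) auto
  have [measurable]: "(\<lambda>x. Bm (fst x) (snd x)) \<in> borel_measurable (borel \<Otimes>\<^sub>M M)" using Bm by (simp add: split_beta')
  note [measurable] = version_measurable
  have [measurable]: "(\<lambda>x. snd x) \<in> measurable (borel \<Otimes>\<^sub>M M) (F u)" by (rule measurable_compose[OF _ 1]) simp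
  have "(\<lambda>x. g (snd x) (Bm (fst x) (snd x))) \<in> borel_measurable (borel \<Otimes>\<^sub>M M)"
    using measurable_compose[OF _ g, of "\<lambda>x. (snd x, Bm (fst x) (snd x))" "borel \<Otimes>\<^sub>M M"] by simp
  moreover have "(\<lambda>x. g (snd x) (Bm a (snd x))) \<in> borel_measurable (borel \<Otimes>\<^sub>M M)"
    using measurable_compose[OF _ g, of "\<lambda>x. (snd x, Bm a (snd x))" "borel \<Otimes>\<^sub>M M"] by simp
  ultimately show ?thesis unfolding split_beta' by (rule borel_measurable_diff)
qed

lemma cell_integrand_bounded: "\<bar>g w (Bm r w) - g w (Bm a w)\<bar> \<le> 2 * g0"
  using gb[of w "Bm r w"] gb[of w "Bm a w"] by linarith

lemmas cell_measurable = time_integral_measurable[OF cell_integrand_measurable cell_integrand_bounded ab(1)]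
lemmas cell_abs_le = time_integral_abs_le[OF cell_integrand_measurable cell_integrand_bounded ab(1)]
lemmas cell_path_measurable = time_path_measurable[OF cell_integrand_measurable cell_integrand_bounded ab(1)]

lemma cell_adapted:
  assumes v: "b \<le> v" "v \<le> 1"
  shows "AE w in M. real_cond_exp M (F v) (\<lambda>w. LINT r:{a..b}|lborel. g w (Bm r w) - g w (Bm a w)) w =
    (LINT r:{a..b}|lborel. g w (Bm r w) - g w (Bm a w))"
proof (rule time_integral_cond_exp_adapted[OF cell_integrand_measurable cell_integrand_bounded ab(1) subalgebra_F])
  fix r assume r: "r \<in> {a..b}"
  have "u \<in> {0..1}" "v \<in> {0..1}" "sets (F u) \<subseteq> sets (F v)" using u ab v F_mono[of u v] by auto
  then have sub: "subalgebra (F v) (F u)" by (simp add: subalgebra_def space_F)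
  have m: "Bm x \<in> borel_measurable (F v)" if "a \<le> x" "x \<le> b" for x
    by (rule F_meas_mono[OF _ _ _ version_adapted]) (use that u ab v in auto)
  show "(\<lambda>w. g w (Bm r w) - g w (Bm a w)) \<in> borel_measurable (F v)"
    by (intro borel_measurable_diff frozen_measurable[OF sub] m) (use r ab in auto)
qed (use v ab u in auto)

text \<open>\<open>gaussian_smoothing\<close> with earlier time \<open>a\<close> bounds the
  integrand tested against functions of the past, and \<open>time_integral_cond_exp_moment\<close>
  turns this into a moment bound. Compared with a bound of order \<open>c * h\<close> the gain is
  the factor \<open>h / (a - u)\<close>.\<close>

lemma cell_moment:
  assumes p: "1 \<le> p" and h: "b - a \<le> h" and c: "0 \<le> c" and gc: "AE w in M. \<forall>x. \<bar>g w x\<bar> \<le> c"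
  shows "moment_le p (real_cond_exp M (F u) (\<lambda>w. LINT r:{a..b}|lborel. g w (Bm r w) - g w (Bm a w)))
    (cell_const p * c * (h / (a - u)) * h)"
proof -
  define R where "R r w = (\<Sum>i\<in>UNIV. c * smoothing_factor u r a i w)" for r w
  define \<rho> where "\<rho> = cell_const p * c * (h / (a - u))"
  have h0: "0 \<le> h" using h ab by linarith
  have \<rho>0: "0 \<le> \<rho>" using cell_const_pos[of p] c h0 u by (simp add: \<rho>_def)
  have u01: "u \<in> {0..1}" using u ab by simp
  have sf: "moment_le q (smoothing_factor u r a i) ((5 * gaussian_moment_const q + 4) * (h / (a - u)))"
    if r: "r \<in> {a..b}" and q: "1 \<le> q" for r i q
  proof (rule moment_le_mono)
    show "moment_le q (smoothing_factor u r a i) ((5 * gaussian_moment_const q + 4) * ((r - a) / (a - u)))"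
      using r q u ab by (intro smoothing_factor_moment) auto
    show "(5 * gaussian_moment_const q + 4) * ((r - a) / (a - u)) \<le> (5 * gaussian_moment_const q + 4) * (h / (a - u))"
      using r h u gaussian_moment_const_pos[of q] by (intro mult_left_mono divide_right_mono) auto
  qed
  have "moment_le p (real_cond_exp M (F u) (\<lambda>w. LINT r:{a..b}|lborel. g w (Bm r w) - g w (Bm a w))) (\<rho> * (b - a))"
  proof (rule time_integral_cond_exp_moment[OF cell_integrand_measurable cell_integrand_bounded ab(1) subalgebra_F[OF u01] p \<rho>0])
    fix r assume r: "r \<in> {a..b}"
    have "moment_le p (R r) (\<Sum>i::'d\<in>UNIV. \<bar>c\<bar> * ((5 * gaussian_moment_const p + 4) * (h / (a - u))))"
      unfolding R_def[abs_def] by (intro moment_le_sum moment_le_cmult sf r p)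
    then show "moment_le p (R r) \<rho>" using c by (simp add: \<rho>_def cell_const_def mult_ac)
  next
    fix S :: "'a \<Rightarrow> real" and s0 r assume S: "S \<in> borel_measurable (F u)" and Sb: "\<And>w. \<bar>S w\<bar> \<le> s0" and r: "r \<in> {a..b}"
    have [measurable]: "S \<in> borel_measurable M" by (rule F_meas[OF u01 S])
    have gm[measurable]: "X \<in> borel_measurable M \<Longrightarrow> (\<lambda>w. g w (X w)) \<in> borel_measurable M" for X
      by (rule frozen_measurable[OF subalgebra_F[OF u01]])
    have int: "integrable M (\<lambda>w. S w * g w (X w))" if X: "X \<in> borel_measurable M" for X
    proof (rule AE_bounded_integrable[where c="s0 * g0"])
      show "AE w in M. \<bar>S w * g w (X w)\<bar> \<le> s0 * g0"
        using order_trans[OF abs_ge_zero Sb] by (intro AE_I2) (auto simp: abs_mult intro!: mult_mono Sb gb)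
    qed (use gm[OF X] in measurable)
    note [measurable] = version_measurable
    have [measurable]: "B r \<in> borel_measurable M" "B a \<in> borel_measurable M" using r u ab by (auto intro!: B_measurable)
    have cong: "expectation (\<lambda>w. S w * g w (Bm x w)) = expectation (\<lambda>w. S w * g w (B x w))" if "x \<in> {a..b}" for x
    proof (rule integral_cong_AE)
      have [measurable]: "B x \<in> borel_measurable M" using that u ab by (auto intro!: B_measurable)
      show "(\<lambda>w. S w * g w (B x w)) \<in> borel_measurable M" by measurable
      show "AE w in M. S w * g w (Bm x w) = S w * g w (B x w)"
        using Bm_eq by eventually_elim (use that u ab in auto)
    qed measurable
    have "expectation (\<lambda>w. S w * (g w (Bm r w) - g w (Bm a w))) =
        expectation (\<lambda>w. S w * g w (Bm r w)) - expectation (\<lambda>w. S w * g w (Bm a w))"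
      unfolding right_diff_distrib by (intro Bochner_Integration.integral_diff int version_measurable)
    also have "\<dots> = expectation (\<lambda>w. S w * g w (B r w)) - expectation (\<lambda>w. S w * g w (B a w))"
      using r ab by (simp add: cong)
    finally have "\<bar>expectation (\<lambda>w. S w * (g w (Bm r w) - g w (Bm a w)))\<bar> \<le>
        (\<Sum>i\<in>UNIV. c * expectation (\<lambda>w. \<bar>S w\<bar> * smoothing_factor u r a i w))"
      using gaussian_smoothing[OF _ _ S Sb g gb, of a r c] u ab r c gc by simp
    also have "\<dots> = expectation (\<lambda>w. \<Sum>i\<in>UNIV. c * (\<bar>S w\<bar> * smoothing_factor u r a i w))"
    proof -
      have "integrable M (\<lambda>w. \<bar>S w\<bar> * smoothing_factor u r a i w)" for i
      proof (rule square_integrable_mult)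
        show "square_integrable M (smoothing_factor u r a i)"
          using moment_leD[OF sf[OF r, of 1]] by (simp add: square_integrable_def)
        show "square_integrable M (\<lambda>w. \<bar>S w\<bar>)" using Sb by (intro square_integrable_bounded[where c=s0]) auto
      qed
      then show ?thesis by simp
    qed
    also have "\<dots> = expectation (\<lambda>w. \<bar>S w\<bar> * R r w)"
      unfolding R_def sum_distrib_left by (intro Bochner_Integration.integral_cong refl) (simp add: mult_ac)
    finally show "\<bar>expectation (\<lambda>w. S w * (g w (Bm r w) - g w (Bm a w)))\<bar> \<le> expectation (\<lambda>w. \<bar>S w\<bar> * R r w)" .
  qed
  then show ?thesis
    using mult_left_mono[OF h \<rho>0] unfolding \<rho>_def[symmetric] by (rule moment_le_mono)
qed

end

end

end

section \<open>The frozen sum\<close>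

context F_fbm_process
begin

context
  fixes Bm :: "real \<Rightarrow> 'a \<Rightarrow> real ^ 'd" and \<psi> :: "real \<Rightarrow> 'a \<Rightarrow> real ^ 'd" and \<phi> :: "real ^ 'd \<Rightarrow> real"
    and K L \<kappa> :: real
  assumes Bm: "(\<lambda>(r, w). Bm r w) \<in> borel_measurable (borel \<Otimes>\<^sub>M M)"
    and Bm_eq: "AE w in M. \<forall>r\<in>{0..1}. Bm r w = B r w"
    and \<psi>: "adapted_process F \<psi>"
    and \<psi>_lip: "\<And>v z. 0 \<le> v \<Longrightarrow> v \<le> z \<Longrightarrow> z \<le> 1 \<Longrightarrow> AE w in M. norm (\<psi> z w - \<psi> v w) \<le> \<kappa> * (z - v)"
    and \<kappa>: "0 \<le> \<kappa>"
    and \<phi>_meas[measurable]: "\<phi> \<in> borel_measurable borel" and K: "0 < K" "\<And>x. \<bar>\<phi> x\<bar> \<le> K"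
    and L: "0 \<le> L" "\<And>x y. \<bar>\<phi> x - \<phi> y\<bar> \<le> L * norm (x - y)"
begin

lemma shifted_measurable:
  assumes "0 \<le> v" "v \<le> u" "u \<le> 1"
  shows "(\<lambda>(w, x). \<phi> (\<psi> v w + x)) \<in> borel_measurable (F u \<Otimes>\<^sub>M borel)"
proof -
  have [measurable]: "\<psi> v \<in> borel_measurable (F u)"
    using \<psi> assms by (intro F_meas_mono[of v u]) (auto simp: adapted_process_def)
  show ?thesis by measurable
qed

text \<open>\<open>v\<close> is the time at which the drift is frozen. The subtracted term sits at
  the left end \<open>a\<close>; for a grid cell this is \<open>grid_floor h r\<close> for every
  \<open>r\<close> inside the cell.\<close>

definition frozen_cell :: "real \<Rightarrow> real \<Rightarrow> real \<Rightarrow> 'a \<Rightarrow> real" where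
  "frozen_cell v a b w = (LINT r:{a..b}|lborel. \<phi> (\<psi> v w + Bm r w) - \<phi> (\<psi> v w + Bm a w))"

context
  fixes a b v :: real
  assumes v: "0 \<le> v" and ab: "a \<le> b" "b \<le> 1"
begin

lemma frozen_cell_measurable: "v < a \<Longrightarrow> frozen_cell v a b \<in> borel_measurable M"
  unfolding frozen_cell_def[abs_def]
  using cell_measurable[OF Bm Bm_eq _ _ ab shifted_measurable K(2), of v v] v ab by simp

lemma frozen_cell_abs_le: "v < a \<Longrightarrow> w \<in> space M \<Longrightarrow> \<bar>frozen_cell v a b w\<bar> \<le> 2 * K * (b - a)"
  unfolding frozen_cell_def
  using cell_abs_le[OF Bm Bm_eq _ _ ab shifted_measurable K(2), of v v] v ab by simp

lemma frozen_cell_adapted: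
  assumes "v < a" "b \<le> z" "z \<le> 1"
  shows "AE w in M. real_cond_exp M (F z) (frozen_cell v a b) w = frozen_cell v a b w"
  unfolding frozen_cell_def[abs_def]
  using cell_adapted[OF Bm Bm_eq _ _ ab shifted_measurable K(2), of v v z] assms v ab by simp

lemma frozen_cell_moment:
  assumes "v \<le> u" "u < a" "1 \<le> p" "b - a \<le> h"
  shows "moment_le p (real_cond_exp M (F u) (frozen_cell v a b)) (cell_const p * K * (h / (a - u)) * h)"
  unfolding frozen_cell_def[abs_def]
  by (rule cell_moment[OF Bm Bm_eq _ _ ab shifted_measurable K(2)]) (use assms v ab K in \<open>auto intro: AE_I2\<close>)

text \<open>The difference is itself a cell integral, for the function
  \<open>\<phi> (\<psi> u w + x) - \<phi> (\<psi> v w + x)\<close>. The Lipschitz bounds are spent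
  on its sup norm, of order \<open>L * \<kappa> * (u - v)\<close>, and the smoothing gain in the
  \<open>B\<close> variable comes on top.\<close>

lemma frozen_cell_diff_moment:
  assumes "v \<le> u" "u < a" "1 \<le> p" "b - a \<le> h"
  shows "moment_le p (real_cond_exp M (F u) (\<lambda>w. frozen_cell u a b w - frozen_cell v a b w))
    (cell_const p * (L * (\<kappa> * (u - v))) * (h / (a - u)) * h)"
proof -
  define g where "g w x = \<phi> (\<psi> u w + x) - \<phi> (\<psi> v w + x)" for w x
  have u: "0 \<le> u" "u < a" "u \<le> 1" using assms v ab by auto
  have [measurable]: "(\<lambda>(w, x). \<phi> (\<psi> u w + x)) \<in> borel_measurable (F u \<Otimes>\<^sub>M borel)"
      "(\<lambda>(w, x). \<phi> (\<psi> v w + x)) \<in> borel_measurable (F u \<Otimes>\<^sub>M borel)"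
    using assms u v by (auto intro!: shifted_measurable)
  have g: "(\<lambda>(w, x). g w x) \<in> borel_measurable (F u \<Otimes>\<^sub>M borel)" unfolding g_def by measurable
  have gb: "\<bar>g w x\<bar> \<le> 2 * K" for w x using K(2)[of "\<psi> u w + x"] K(2)[of "\<psi> v w + x"] by (simp add: g_def)
  have gc: "AE w in M. \<forall>x. \<bar>g w x\<bar> \<le> L * (\<kappa> * (u - v))"
    using \<psi>_lip[OF v assms(1) u(3)]
  proof eventually_elim
    case (elim w)
    have "\<bar>g w x\<bar> \<le> L * norm (\<psi> u w - \<psi> v w)" for x using L(2)[of "\<psi> u w + x" "\<psi> v w + x"] by (simp add: g_def)
    moreover have "L * norm (\<psi> u w - \<psi> v w) \<le> L * (\<kappa> * (u - v))" using elim L by (intro mult_left_mono) auto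
    ultimately show ?case by (meson order_trans)
  qed
  define C where "C w = (LINT r:{a..b}|lborel. g w (Bm r w) - g w (Bm a w))" for w
  have m: "moment_le p (real_cond_exp M (F u) C) (cell_const p * (L * (\<kappa> * (u - v))) * (h / (a - u)) * h)"
    unfolding C_def[abs_def]
    by (rule cell_moment[OF Bm Bm_eq u(1,2) ab g gb assms(3,4) _ gc]) (use L \<kappa> assms in simp)
  have [measurable]: "C \<in> borel_measurable M"
    unfolding C_def[abs_def] by (rule cell_measurable[OF Bm Bm_eq u(1,2) ab g gb])
  have [measurable]: "frozen_cell u a b \<in> borel_measurable M" "frozen_cell v a b \<in> borel_measurable M"
    using u assms v cell_measurable[OF Bm Bm_eq _ _ ab shifted_measurable K(2), of u u] cell_measurable[OF Bm Bm_eq _ _ ab shifted_measurable K(2), of v v] ab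
    by (auto simp: frozen_cell_def[abs_def])
  have eq: "C w = frozen_cell u a b w - frozen_cell v a b w" if w: "w \<in> space M" for w
  proof -
    have int: "set_integrable lborel {a..b} (\<lambda>r. \<phi> (\<psi> x w + Bm r w) - \<phi> (\<psi> x w + Bm a w))" if x: "x = u \<or> x = v" for x
      unfolding set_integrable_def
    proof (rule integrableI_bounded_set[where A="{a..b}" and B="2 * K"])
      have [measurable]: "(\<lambda>r. \<phi> (\<psi> x w + Bm r w) - \<phi> (\<psi> x w + Bm a w)) \<in> borel_measurable borel"
        by (rule cell_path_measurable[OF Bm Bm_eq _ _ ab shifted_measurable[of x x] K(2) w]) (use x u v assms in auto)
      show "(\<lambda>r. indicator {a..b} r *\<^sub>R (\<phi> (\<psi> x w + Bm r w) - \<phi> (\<psi> x w + Bm a w))) \<in> borel_measurable lborel"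
        by measurable
      have "\<bar>\<phi> (\<psi> x w + Bm r w) - \<phi> (\<psi> x w + Bm a w)\<bar> \<le> 2 * K" for r
        using K(2)[of "\<psi> x w + Bm r w"] K(2)[of "\<psi> x w + Bm a w"] by linarith
      then show "AE r in lborel. r \<in> {a..b} \<longrightarrow> norm (indicator {a..b} r *\<^sub>R (\<phi> (\<psi> x w + Bm r w) - \<phi> (\<psi> x w + Bm a w))) \<le> 2 * K"
        by simp
    qed (auto simp: emeasure_lborel_Icc_eq)
    have "frozen_cell u a b w - frozen_cell v a b w = (LINT r:{a..b}|lborel.
        (\<phi> (\<psi> u w + Bm r w) - \<phi> (\<psi> u w + Bm a w)) - (\<phi> (\<psi> v w + Bm r w) - \<phi> (\<psi> v w + Bm a w)))"
      unfolding frozen_cell_def by (rule set_integral_diff(2)[symmetric]) (intro int disjI1 disjI2 refl)+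
    then show ?thesis unfolding C_def g_def by (simp add: algebra_simps)
  qed
  interpret G: sigma_finite_subalgebra M "F u" using u by (intro sigma_finite_subalgebraI subalgebra_F) auto
  have "AE w in M. real_cond_exp M (F u) C w = real_cond_exp M (F u) (\<lambda>w. frozen_cell u a b w - frozen_cell v a b w) w"
    by (rule G.real_cond_exp_cong) (auto intro: AE_I2 eq)
  then show ?thesis by (intro moment_le_cong_AE[OF m]) simp_all
qed

end

text \<open>Telescoping on the grid: cell \<open>k\<close> starts at \<open>(k0 + k) * h\<close> and
  its drift is frozen at \<open>(k0 + k - j) * h\<close>, at the earliest at \<open>k0 * h\<close>.
  The distance \<open>j * h\<close> between these times is the origin of the decay
  \<open>1 / j\<close>. The last cell is cut at \<open>t\<close>.\<close>

lemma frozen_sum_moment: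
  fixes k0 N :: nat and h t :: real
  assumes h: "0 < h" and N: "1 \<le> N" and t: "real (k0 + N) * h \<le> t" "t \<le> 1" and p: "1 \<le> p"
  defines "S \<equiv> \<Sum>j=1..N. 1 / real j"
  shows "moment_le p (\<lambda>w. \<Sum>k=1..N. frozen_cell (real (k0 + k - 1) * h) (real (k0 + k) * h) (min t (real (k0 + k + 1) * h)) w)
    (8 * sqrt (2 * 4 ^ p * real N) * (2 * K * h + cell_const p * K * h) * S + cell_const p * (L * (\<kappa> * h)) * h * real N * S)"
proof -
  define a where "a k = real (k0 + k) * h" for k
  define b where "b k = min t (real (k0 + k + 1) * h)" for k
  \<comment> \<open>The grid may leave the unit interval after the last cell, while the telescoping
    wants a filtration indexed by all \<open>n\<close>.\<close>
  define G where "G n = F (min (a n) 1)" for n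
  \<comment> \<open>Outside the range \<open>1 \<le> j \<le> k \<le> N\<close> the value 0 makes
    measurability and the sure bound hold for all indices.\<close>
  define y where "y k j = (if 1 \<le> j \<and> j \<le> k \<and> k \<le> N then frozen_cell (a (k - j)) (a k) (b k) else (\<lambda>_. 0))" for k j
  have a_mono: "a m \<le> a n" if "m \<le> n" for m n using that h by (simp add: a_def)
  have a0: "0 \<le> a n" for n using h by (simp add: a_def)
  have aN: "a k \<le> t" if "k \<le> N" for k using a_mono[OF that] t by (simp add: a_def)
  have a_less: "a m < a n" if "m < n" for m n using that h by (simp add: a_def)
  have a_diff: "a k - a (k - j) = real j * h" if "j \<le> k" for k j using that by (simp add: a_def of_nat_diff algebra_simps)
  have b: "a k \<le> b k" "b k \<le> 1" "b k - a k \<le> h" "b k \<le> min (a (Suc k)) 1" if "k \<le> N" for k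
  proof -
    have "a (Suc k) = a k + h" by (simp add: a_def algebra_simps)
    moreover have "b k = min t (a (Suc k))" by (simp add: b_def a_def add.commute)
    ultimately show "a k \<le> b k" "b k \<le> 1" "b k - a k \<le> h" "b k \<le> min (a (Suc k)) 1"
      using aN[OF that] h t by auto
  qed
  have G_eq: "G n = F (a n)" if "n \<le> N" for n using aN[OF that] t by (simp add: G_def min_def)
  have "moment_le p (\<lambda>w. \<Sum>k=1..N. y k 1 w)
    (8 * sqrt (2 * 4 ^ p * real N) * (2 * K * h + cell_const p * K * h) * (\<Sum>j=1..N. 1 / real j) + cell_const p * (L * (\<kappa> * h)) * h * real N * (\<Sum>j=1..N. 1 / real j))"
  proof (rule telescoped_moment[OF p _ _ _ N, where G=G])
    show "0 < 2 * K * h" "0 < cell_const p * K * h" "0 \<le> cell_const p * (L * (\<kappa> * h)) * h"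
      using K h L \<kappa> cell_const_pos[of p] by auto
    show "subalgebra M (G n)" for n unfolding G_def using a0[of n] by (intro subalgebra_F) auto
    show "sets (G m) \<subseteq> sets (G n)" if "m \<le> n" for m n
      unfolding G_def using a_mono[OF that] a0[of m] by (intro F_mono) auto
    fix k j
    have less: "a (k - j) < a k" if "1 \<le> j" "j \<le> k" using a_less[of "k - j" k] that by auto
    show "y k j \<in> borel_measurable M"
      using frozen_cell_measurable[OF a0 b(1,2) less] by (auto simp: y_def)
    have "\<bar>y k j w\<bar> \<le> 2 * K * h" if "w \<in> space M" for w
    proof (cases "1 \<le> j \<and> j \<le> k \<and> k \<le> N")
      case True
      have "\<bar>y k j w\<bar> \<le> 2 * K * (b k - a k)"
        using frozen_cell_abs_le[OF a0 b(1,2) less that] True by (simp add: y_def)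
      also have "\<dots> \<le> 2 * K * h" using b(3)[of k] K True by (intro mult_left_mono) auto
      finally show ?thesis .
    next
      case False
      then have "y k j w = 0" by (auto simp: y_def)
      then show ?thesis using K h by simp
    qed
    then show "AE w in M. \<bar>y k j w\<bar> \<le> 2 * K * h" by (rule AE_I2)
  next
    fix k assume k: "1 \<le> k" "k \<le> N"
    show "AE x in M. real_cond_exp M (G (Suc k)) (y k 1) x = y k 1 x"
      using frozen_cell_adapted[OF a0 b(1,2)[OF k(2)] a_less b(4)[OF k(2)], of "k - 1"] k by (simp add: y_def G_def)
  next
    fix k j assume j: "1 \<le> j" "j \<le> k" "k \<le> N"
    have "moment_le p (real_cond_exp M (F (a (k - j))) (frozen_cell (a (k - j)) (a k) (b k))) (cell_const p * K * (h / (a k - a (k - j))) * h)"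
      by (rule frozen_cell_moment[OF a0 b(1,2)[OF j(3)] _ a_less p b(3)[OF j(3)]]) (use j in auto)
    then show "moment_le p (real_cond_exp M (G (k - j)) (y k j)) (cell_const p * K * h / real j)"
      using j h G_eq[of "k - j"] unfolding a_diff[OF j(2)] by (simp add: y_def)
  next
    fix k j assume j: "1 \<le> j" "j < k" "k \<le> N"
    then have jk: "j \<le> k" by simp
    have y: "y k j = frozen_cell (a (k - j)) (a k) (b k)" "y k (Suc j) = frozen_cell (a (k - Suc j)) (a k) (b k)"
      using j by (simp_all add: y_def)
    have d: "a (k - j) - a (k - Suc j) = h"
      using a_diff[of j k] a_diff[of "Suc j" k] j by (simp add: algebra_simps)
    have "moment_le p (real_cond_exp M (F (a (k - j))) (frozen_cell (a (k - Suc j)) (a k) (b k))) (cell_const p * K * (h / (a k - a (k - j))) * h)"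
      by (rule frozen_cell_moment[OF a0 b(1,2)[OF j(3)] a_mono a_less p b(3)[OF j(3)]]) (use j in auto)
    then show "moment_le p (real_cond_exp M (G (k - j)) (y k (Suc j))) (cell_const p * K * h / real j)"
      using j h G_eq[of "k - j"] unfolding a_diff[OF jk] y by simp
    have "moment_le p (real_cond_exp M (F (a (k - j))) (\<lambda>w. frozen_cell (a (k - j)) (a k) (b k) w - frozen_cell (a (k - Suc j)) (a k) (b k) w))
      (cell_const p * (L * (\<kappa> * (a (k - j) - a (k - Suc j)))) * (h / (a k - a (k - j))) * h)"
      by (rule frozen_cell_diff_moment[OF a0 b(1,2)[OF j(3)] a_mono a_less p b(3)[OF j(3)]]) (use j in auto)
    then show "moment_le p (real_cond_exp M (G (k - j)) (\<lambda>x. y k j x - y k (Suc j) x)) (cell_const p * (L * (\<kappa> * h)) * h / real j)"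
      using j h G_eq[of "k - j"] unfolding a_diff[OF jk] y d by simp
  qed
  moreover have "(\<Sum>k=1..N. y k 1 w) = (\<Sum>k=1..N. frozen_cell (real (k0 + k - 1) * h) (real (k0 + k) * h) (min t (real (k0 + k + 1) * h)) w)" for w
    by (rule sum.cong) (auto simp: y_def a_def b_def)
  ultimately show ?thesis by (simp add: S_def)
qed

end

end

section \<open>From moments to norms\<close>

text \<open>The weighted inequality of means with \<open>\<theta> = m / (2 * p)\<close>, applied to
  \<open>(Z / a) ^ (2 * p)\<close>, compares the power \<open>m\<close> with the power
  \<open>2 * p\<close>. After normalisation by \<open>a\<close> the two terms on the right integrate
  to at most \<open>\<theta> + (1 - \<theta>) = 1\<close>.\<close>

lemma (in prob_space) Lm_norm_le:
  fixes X :: "'a \<Rightarrow> 'b::real_normed_vector"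
  assumes Z: "moment_le p Z a" and le: "AE w in M. norm (X w) \<le> Z w" and a: "0 < a"
    and m: "0 < m" "m \<le> 2 * real p"
  shows "Lm_norm M m X \<le> ennreal a"
proof -
  define \<theta> where "\<theta> = m / (2 * real p)"
  have p: "0 < p" using m by (intro Nat.gr0I) simp
  have \<theta>: "0 < \<theta>" "\<theta> \<le> 1" using m p by (auto simp: \<theta>_def field_simps)
  note Zd = moment_leD[OF Z]
  define U where "U w = a powr m * (\<theta> * (Z w ^ (2 * p) / a ^ (2 * p)) + (1 - \<theta>))" for w
  have U0: "0 \<le> U w" for w using \<theta> a by (auto simp: U_def power_mult intro!: mult_nonneg_nonneg add_nonneg_nonneg divide_nonneg_nonneg)
  have pt: "z powr m \<le> U w" if z: "0 \<le> z" "z \<le> Z w" for z w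
  proof (cases "z = 0")
    case False
    then have z0: "0 < z" and Z0: "0 < Z w" using z by auto
    define x where "x = Z w / a"
    have x: "0 < x" using Z0 a by (simp add: x_def)
    have "(x ^ (2 * p)) powr \<theta> * 1 powr (1 - \<theta>) \<le> \<theta> * x ^ (2 * p) + (1 - \<theta>) * 1"
      using \<theta> x by (intro Youngs_inequality_0) auto
    moreover have "(x ^ (2 * p)) powr \<theta> = x powr m"
      using x p by (simp add: powr_powr \<theta>_def flip: powr_realpow)
    ultimately have "a powr m * x powr m \<le> U w"
      unfolding U_def by (intro mult_left_mono) (auto simp: x_def power_divide)
    moreover have "a powr m * x powr m = Z w powr m" using x a by (simp add: x_def powr_divide)
    moreover have "z powr m \<le> Z w powr m" using z m by (intro powr_mono2) auto
    ultimately show ?thesis by linarith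
  qed (use U0 in simp)
  have "(\<integral>\<^sup>+w. ennreal (norm (X w) powr m) \<partial>M) \<le> (\<integral>\<^sup>+w. ennreal (U w) \<partial>M)"
    using le by (intro nn_integral_mono_AE) (auto elim!: eventually_mono intro!: ennreal_leI pt)
  also have "\<dots> = ennreal (expectation U)"
    using Zd(2) U0 by (intro nn_integral_eq_integral) (auto simp: U_def[abs_def])
  also have "expectation U \<le> a powr m"
  proof -
    have "expectation U = a powr m * (\<theta> * (expectation (\<lambda>w. Z w ^ (2 * p)) / a ^ (2 * p)) + (1 - \<theta>))"
      using Zd(2) by (simp add: U_def[abs_def] prob_space)
    also have "\<dots> \<le> a powr m * (\<theta> * 1 + (1 - \<theta>))"
      using Zd(4) a \<theta> by (intro mult_left_mono add_right_mono) auto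
    finally show ?thesis by simp
  qed
  finally have I: "(\<integral>\<^sup>+w. ennreal (norm (X w) powr m) \<partial>M) \<le> ennreal (a powr m)" by (simp add: ennreal_leI)
  then have fin: "(\<integral>\<^sup>+w. ennreal (norm (X w) powr m) \<partial>M) \<noteq> \<infinity>" by (auto simp: top_unique)
  have "enn2real (\<integral>\<^sup>+w. ennreal (norm (X w) powr m) \<partial>M) \<le> a powr m"
    using enn2real_mono[OF I] by simp
  then have "enn2real (\<integral>\<^sup>+w. ennreal (norm (X w) powr m) \<partial>M) powr (1 / m) \<le> (a powr m) powr (1 / m)"
    using m by (intro powr_mono2) auto
  then show ?thesis using fin a m by (simp add: Lm_norm_def powr_powr ennreal_leI)
qed

section \<open>The constants\<close>

lemma harmonic_sum_le_powr:
  assumes n: "1 \<le> n" and e: "0 < e"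
  shows "(\<Sum>j=1..n. 1 / real j) \<le> (1 + 1 / e) * real n powr e"
proof -
  have "(\<Sum>j=1..n. 1 / real j) \<le> 1 + ln (real n)"
    using euler_mascheroni_sequence_decreasing[of 1 n] n by (simp add: harm_def inverse_eq_divide)
  also have "\<dots> \<le> real n powr e + real n powr e / e"
    using n e ln_powr_bound[of "real n" e] by (intro add_mono) (auto intro: ge_one_powr_ge_zero)
  finally show ?thesis by (simp add: algebra_simps)
qed

lemma powr_grid_le:
  assumes h: "0 < h" "h \<le> \<delta>" and n: "real n \<le> 2 * \<delta> / h" and e: "0 \<le> e" "e \<le> 2"
  shows "real n powr e \<le> 4 * (\<delta> powr e * h powr (- e))"
proof -
  have "real n powr e \<le> (2 * (\<delta> / h)) powr e" using assms by (intro powr_mono2) auto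
  also have "\<dots> = 2 powr e * (\<delta> powr e * h powr (- e))"
    using h by (simp add: powr_mult powr_divide powr_minus divide_simps)
  also have "\<dots> \<le> 2 powr 2 * (\<delta> powr e * h powr (- e))"
    using e by (intro mult_right_mono powr_mono) auto
  finally show ?thesis by simp
qed

text \<open>The logarithm is bounded by a multiple of \<open>n powr (\<epsilon> / 2)\<close>, that
  is, of \<open>(\<delta> / h) powr (\<epsilon> / 2)\<close>; a further
  \<open>h powr (- \<epsilon> / 2)\<close> is given away, since \<open>h < 1\<close>. In
  \<open>key\<close> the pair \<open>x = 1/2, y = 1\<close> is the martingale part and
  \<open>x = 1, y = 2\<close> the drift part.\<close>

lemma grid_sum_bounds:
  fixes h \<delta> \<epsilon> :: real
  assumes h: "0 < h" "h < 1" "h \<le> \<delta>" and \<epsilon>: "0 < \<epsilon>" "\<epsilon> < 1/2" and n: "1 \<le> n" "real n \<le> 2 * \<delta> / h"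
  defines "Q \<equiv> 1 + 2 / \<epsilon>" and "S \<equiv> \<Sum>j=1..n. 1 / real j"
    and "X1 \<equiv> h powr (1/2 - \<epsilon>) * \<delta> powr (1/2 + \<epsilon>/2)" and "X2 \<equiv> h powr (1 - \<epsilon>) * \<delta> powr (1 + \<epsilon>/2)"
  shows "sqrt (real n) * h * S \<le> 4 * Q * X1" "h * h * real n * S \<le> 4 * Q * X2" "h \<le> X1" "h * \<delta> \<le> X2"
proof -
  have S: "S \<le> Q * real n powr (\<epsilon> / 2)"
    using harmonic_sum_le_powr[OF n(1), of "\<epsilon> / 2"] \<epsilon> by (simp add: S_def Q_def)
  have Q: "0 < Q" using \<epsilon> by (simp add: Q_def add_pos_pos)
  have pow: "h powr x \<le> h powr y" if "y \<le> x" for x y using h that by (intro powr_mono') auto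
  have key: "real n powr x * h powr y * S \<le> 4 * Q * (h powr (y - x - \<epsilon>) * \<delta> powr (x + \<epsilon> / 2))" if x: "0 \<le> x" "x \<le> 1" for x y
  proof -
    have "real n powr x * h powr y * S \<le> real n powr x * h powr y * (Q * real n powr (\<epsilon> / 2))"
      using S by (intro mult_left_mono) auto
    also have "\<dots> = Q * h powr y * real n powr (x + \<epsilon> / 2)" by (simp add: powr_add)
    also have "\<dots> \<le> Q * h powr y * (4 * (\<delta> powr (x + \<epsilon> / 2) * h powr (- (x + \<epsilon> / 2))))"
      using Q x \<epsilon> h by (intro mult_left_mono powr_grid_le n) auto
    also have "\<dots> = 4 * Q * (h powr (y - x - \<epsilon> / 2) * \<delta> powr (x + \<epsilon> / 2))"
      by (simp add: powr_add[symmetric] mult_ac algebra_simps)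
    also have "\<dots> \<le> 4 * Q * (h powr (y - x - \<epsilon>) * \<delta> powr (x + \<epsilon> / 2))"
      using Q \<epsilon> by (intro mult_left_mono mult_right_mono pow) auto
    finally show ?thesis .
  qed
  show "sqrt (real n) * h * S \<le> 4 * Q * X1"
    using key[of "1/2" 1] h n by (simp add: X1_def powr_half_sqrt)
  show "h * h * real n * S \<le> 4 * Q * X2"
    using key[of 1 2] h n by (simp add: X2_def powr_numeral power2_eq_square mult_ac)
  have *: "h powr (x + \<epsilon>) \<le> h powr 0 * \<delta> powr (x + \<epsilon> / 2) " if "0 \<le> x" for x
  proof -
    have "h powr (x + \<epsilon>) \<le> h powr (x + \<epsilon> / 2)" using \<epsilon> by (intro pow) auto
    also have "\<dots> \<le> \<delta> powr (x + \<epsilon> / 2)" using h that \<epsilon> by (intro powr_mono2) auto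
    finally show ?thesis using h by simp
  qed
  have "h = h powr (1/2 - \<epsilon>) * h powr (1/2 + \<epsilon>)" using h by (simp flip: powr_add)
  also have "\<dots> \<le> X1" unfolding X1_def using *[of "1/2"] h by (intro mult_left_mono) auto
  finally show "h \<le> X1" .
  have "h * \<delta> = h powr (1 - \<epsilon>) * h powr \<epsilon> * \<delta>" using h by (simp flip: powr_add)
  also have "\<dots> \<le> h powr (1 - \<epsilon>) * \<delta> powr (\<epsilon> / 2) * \<delta>"
    using *[of 0] h by (intro mult_right_mono mult_left_mono) auto
  also have "\<dots> = X2" unfolding X2_def using h by (simp add: powr_add)
  finally show "h * \<delta> \<le> X2" .
qed

section \<open>Comparison along paths\<close>

lemma set_integral_partition:
  fixes G :: "real \<Rightarrow> real"
  assumes G[measurable]: "G \<in> borel_measurable borel" and Gb: "\<And>r. \<bar>G r\<bar> \<le> C" and c: "\<And>k. c k \<le> c (Suc k)"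
  shows "(LINT r:{c 0..c n}|lborel. G r) = (\<Sum>k<n. LINT r:{c k..c (Suc k)}|lborel. G r)"
proof (induction n)
  case 0
  have "(LINT r|lborel. indicator {c 0} r *\<^sub>R G r) = (LINT r::real|lborel. (0::real))"
    by (rule integral_cong_AE) (use AE_lborel_singleton[of "c 0"] in \<open>auto elim!: eventually_mono\<close>)
  then show ?case by (simp add: set_lebesgue_integral_def)
next
  case (Suc n)
  have int: "integrable lborel (\<lambda>r. indicator {x..y} r *\<^sub>R G r)" for x y
    by (rule integrableI_bounded_set[where A="{x..y}" and B=C]) (use Gb in \<open>auto simp: emeasure_lborel_Icc_eq\<close>)
  have c0: "c 0 \<le> c n" by (rule lift_Suc_mono_le[of c, OF c]) simp
  have "(LINT r:{c 0..c (Suc n)}|lborel. G r) =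
      (LINT r|lborel. indicator {c 0..c n} r *\<^sub>R G r + indicator {c n..c (Suc n)} r *\<^sub>R G r)"
    unfolding set_lebesgue_integral_def
  proof (rule integral_cong_AE)
    show "AE r in lborel. indicator {c 0..c (Suc n)} r *\<^sub>R G r = indicator {c 0..c n} r *\<^sub>R G r + indicator {c n..c (Suc n)} r *\<^sub>R G r"
      using AE_lborel_singleton[of "c n"] by eventually_elim (use c0 c[of n] in \<open>auto simp: indicator_def\<close>)
  qed simp_all
  also have "\<dots> = (LINT r:{c 0..c n}|lborel. G r) + (LINT r:{c n..c (Suc n)}|lborel. G r)"
    unfolding set_lebesgue_integral_def by (intro Bochner_Integration.integral_add int)
  finally show ?case using Suc by simp
qed

lemma grid_floor_measurable[measurable]: "grid_floor h \<in> borel_measurable borel"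
  unfolding grid_floor_def[abs_def] by measurable

lemma grid_floor_eq:
  assumes "0 < h" "real k * h \<le> r" "r < real (k + 1) * h"
  shows "grid_floor h r = real k * h"
proof -
  have "\<lfloor>r / h\<rfloor> = int k" using assms by (intro floor_unique) (auto simp: field_simps)
  then show ?thesis by (simp add: grid_floor_def)
qed

lemma grid_floor_bounds: "0 < h \<Longrightarrow> 0 \<le> r \<Longrightarrow> 0 \<le> grid_floor h r \<and> grid_floor h r \<le> r"
  using mult_left_mono[OF of_int_floor_le[of "r / h"], of h] by (auto simp: grid_floor_def)

text \<open>The first cell may be cut by \<open>s\<close> and costs \<open>2 * K * h\<close>; in the others the path \<open>P\<close> is replaced by
  a constant.\<close>

lemma frozen_path_comparison:
  fixes P \<beta> :: "real \<Rightarrow> 'b::euclidean_space" and \<phi> :: "'b \<Rightarrow> real" and x :: "nat \<Rightarrow> 'b"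
  assumes [measurable]: "P \<in> borel_measurable borel" "\<beta> \<in> borel_measurable borel" "\<phi> \<in> borel_measurable borel"
    and K: "\<And>x. \<bar>\<phi> x\<bar> \<le> K" and L: "0 \<le> L" "\<And>x y. \<bar>\<phi> x - \<phi> y\<bar> \<le> L * norm (x - y)"
    and h: "0 < h" and k0: "real k0 * h \<le> s" "s < real (k0 + 1) * h"
    and N: "1 \<le> N" "real (k0 + N) * h \<le> t" "t < real (k0 + N + 1) * h"
    and \<delta>: "0 \<le> \<delta>" and close: "\<And>k. k \<in> {1..N} \<Longrightarrow> AE r in lborel. real (k0 + k) * h \<le> r \<and> r \<le> min t (real (k0 + k + 1) * h) \<longrightarrow> norm (P r - x k) \<le> \<delta>"
  shows "\<bar>LINT r:{s..t}|lborel. \<phi> (P r + \<beta> r) - \<phi> (P r + \<beta> (grid_floor h r))\<bar> \<le>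
    \<bar>\<Sum>k=1..N. LINT r:{real (k0 + k) * h..min t (real (k0 + k + 1) * h)}|lborel. \<phi> (x k + \<beta> r) - \<phi> (x k + \<beta> (real (k0 + k) * h))\<bar>
      + (2 * K * h + 2 * L * \<delta> * (t - s))"
proof -
  define G where "G r = \<phi> (P r + \<beta> r) - \<phi> (P r + \<beta> (grid_floor h r))" for r
  define a where "a k = real (k0 + k) * h" for k
  \<comment> \<open>The grid point \<open>a 0\<close> may lie before \<open>s\<close> and
    \<open>a (N + 1)\<close> lies beyond \<open>t\<close>; the partition uses \<open>s\<close> and
    \<open>t\<close> instead.\<close>
  define c where "c k = (if k = 0 then s else min t (a k))" for k
  have [measurable]: "G \<in> borel_measurable borel" unfolding G_def[abs_def] by measurable
  have K0: "0 \<le> K" by (rule order_trans[OF abs_ge_zero K])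
  have Gb: "\<bar>G r\<bar> \<le> 2 * K" for r using K[of "P r + \<beta> r"] K[of "P r + \<beta> (grid_floor h r)"] by (simp add: G_def)
  have a_mono: "a k \<le> a l" if "k \<le> l" for k l using that h by (simp add: a_def)
  have aN: "a k \<le> t" if "k \<le> N" for k using a_mono[OF that] N by (simp add: a_def)
  have a1: "a (Suc k) = a k + h" for k by (simp add: a_def algebra_simps)
  have s: "s < a 1" "a 0 \<le> s" using k0 by (auto simp: a_def)
  have c_mono: "c k \<le> c (Suc k)" for k
    using a_mono[of k "Suc k"] s(1) aN[of 1] N(1) by (cases k) (auto simp: c_def)
  have ct: "c (Suc N) = t" using N(3) by (simp add: c_def a_def add_ac)
  have ck: "c k = a k" "c (Suc k) = min t (a (Suc k))" if "k \<in> {1..N}" for k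
    using that aN[of k] by (auto simp: c_def)
  define fr where "fr k = (LINT r:{a k..min t (a (Suc k))}|lborel. \<phi> (x k + \<beta> r) - \<phi> (x k + \<beta> (a k)))" for k
  define J where "J k = (LINT r:{c k..c (Suc k)}|lborel. G r)" for k
  have J0: "\<bar>J 0\<bar> \<le> 2 * K * h"
  proof -
    have "\<bar>J 0\<bar> \<le> 2 * K * (c (Suc 0) - c 0)"
      unfolding J_def by (rule set_integral_abs_le) (use Gb K0 c_mono[of 0] in auto)
    also have "\<dots> \<le> 2 * K * h"
      using K0 s a1[of 0] by (intro mult_left_mono) (auto simp: c_def)
    finally show ?thesis .
  qed
  have Jk: "\<bar>J k - fr k\<bar> \<le> 2 * L * \<delta> * (c (Suc k) - c k)" if k: "k \<in> {1..N}" for k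
  proof -
    define G' where "G' r = \<phi> (x k + \<beta> r) - \<phi> (x k + \<beta> (a k))" for r
    have [measurable]: "G' \<in> borel_measurable borel" unfolding G'_def[abs_def] by measurable
    have G'b: "\<bar>G' r\<bar> \<le> 2 * K" for r using K[of "x k + \<beta> r"] K[of "x k + \<beta> (a k)"] by (simp add: G'_def)
    have int: "set_integrable lborel {c k..c (Suc k)} g" if "g \<in> borel_measurable borel" "\<And>r. \<bar>g r\<bar> \<le> 2 * K" for g :: "real \<Rightarrow> real"
      unfolding set_integrable_def
      by (rule integrableI_bounded_set[where A="{c k..c (Suc k)}" and B="2 * K"]) (use that in \<open>auto simp: emeasure_lborel_Icc_eq\<close>)
    have "J k - fr k = (LINT r:{c k..c (Suc k)}|lborel. G r - G' r)"
      using set_integral_diff(2)[OF int[of G] int[of G']] Gb G'b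
      by (simp add: J_def fr_def G'_def ck[OF k])
    moreover have "\<bar>LINT r:{c k..c (Suc k)}|lborel. G r - G' r\<bar> \<le> (2 * L * \<delta>) * (c (Suc k) - c k)"
    proof (rule set_integral_abs_le)
      have "AE r in lborel. a k \<le> r \<and> r \<le> min t (a (Suc k)) \<longrightarrow> norm (P r - x k) \<le> \<delta>"
        using close[OF k] by (simp add: a_def add_ac)
      \<comment> \<open>At the right end of an uncut cell \<open>grid_floor\<close> has already
        jumped to the next point; this single point is a null set.\<close>
      then show "AE r in lborel. r \<in> {c k..c (Suc k)} \<longrightarrow> \<bar>G r - G' r\<bar> \<le> 2 * L * \<delta>"
        using AE_lborel_singleton[of "a (Suc k)"]
      proof eventually_elim
        case (elim r)
        show ?case
        proof
          assume "r \<in> {c k..c (Suc k)}"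
          then have r: "a k \<le> r" "r \<le> min t (a (Suc k))" using ck[OF k] by auto
          then have gf: "grid_floor h r = a k"
            using elim(2) h unfolding a_def by (intro grid_floor_eq) (auto simp: add_ac)
          have *: "\<bar>\<phi> (P r + y) - \<phi> (x k + y)\<bar> \<le> L * \<delta>" for y
            using L(2)[of "P r + y" "x k + y"] mult_left_mono[OF _ L(1), of "norm (P r - x k)" \<delta>] elim(1) r by auto
          show "\<bar>G r - G' r\<bar> \<le> 2 * L * \<delta>"
            using *[of "\<beta> r"] *[of "\<beta> (a k)"] by (simp add: G_def G'_def gf)
        qed
      qed
    qed (use c_mono L \<delta> in auto)
    ultimately show ?thesis by simp
  qed
  have "(LINT r:{s..t}|lborel. G r) = (\<Sum>k<Suc N. J k)"
    using set_integral_partition[of G "2 * K" c "Suc N"] Gb c_mono ct by (simp add: J_def c_def)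
  also have "\<dots> = J 0 + (\<Sum>k=1..N. J k)"
    by (simp add: lessThan_Suc_atMost atMost_atLeast0 sum.atLeast_Suc_atMost)
  also have "\<dots> = J 0 + (\<Sum>k=1..N. J k - fr k) + (\<Sum>k=1..N. fr k)" by (simp add: sum_subtractf)
  finally have "\<bar>LINT r:{s..t}|lborel. G r\<bar> \<le> \<bar>\<Sum>k=1..N. fr k\<bar> + (2 * K * h + \<bar>\<Sum>k=1..N. J k - fr k\<bar>)"
    using J0 by linarith
  moreover have "\<bar>\<Sum>k=1..N. J k - fr k\<bar> \<le> (\<Sum>k=1..N. 2 * L * \<delta> * (c (Suc k) - c k))"
    by (rule order_trans[OF sum_abs sum_mono[OF Jk]])
  moreover have "(\<Sum>k=1..N. c (Suc k) - c k) \<le> t - s"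
  proof -
    have "(\<Sum>k=1..N. c (Suc k) - c k) = c (Suc N) - c 1" using sum_Suc_diff[of 1 "N" c] N by simp
    then show ?thesis using ct c_mono[of 0] by (simp add: c_def)
  qed
  then have "2 * L * \<delta> * (\<Sum>k=1..N. c (Suc k) - c k) \<le> 2 * L * \<delta> * (t - s)" using L \<delta> by (intro mult_left_mono) auto
  ultimately show ?thesis by (simp add: G_def fr_def a_def sum_distrib_left add_ac)
qed

section \<open>A Borel version of the drift\<close>

text \<open>A function measurable for the completed product agrees with a Borel function off a
  product null set, and Fubini's theorem slices that set in both orders. The slices at fixed times
  transfer the Lipschitz bound, the slices along paths allow the drift to be replaced inside the
  time integral.\<close>

lemma (in prob_space) jointly_measurable_version:
  fixes \<psi> :: "real \<Rightarrow> 'a \<Rightarrow> real ^ 'd"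
  assumes "jointly_measurable_process M \<psi>"
  obtains \<psi>' where "(\<lambda>(r, w). \<psi>' r w) \<in> borel_measurable (borel \<Otimes>\<^sub>M M)"
    "AE r in lborel. r \<in> {0..1} \<longrightarrow> (AE w in M. \<psi>' r w = \<psi> r w)"
    "AE w in M. AE r in lborel. r \<in> {0..1} \<longrightarrow> \<psi>' r w = \<psi> r w"
proof -
  define R where "R = restrict_space lborel {0..1::real}"
  have "emeasure R (space R) = 1" by (simp add: R_def space_restrict_space emeasure_restrict_space)
  then interpret R: finite_measure R by (intro finite_measureI) simp
  interpret P: pair_sigma_finite R M ..
  have AER: "(AE r in R. Q r) \<longleftrightarrow> (AE r in lborel. r \<in> {0..1} \<longrightarrow> Q r)" for Q
    unfolding R_def by (rule AE_restrict_space_iff) simp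
  have \<psi>m: "(\<lambda>x. \<psi> (fst x) (snd x)) \<in> borel_measurable (completion (R \<Otimes>\<^sub>M M))"
    using assms by (simp add: jointly_measurable_process_def R_def split_beta')
  have nth: "(\<lambda>v :: real ^ 'd. v $ i) \<in> borel_measurable borel" for i :: 'd by simp
  have "\<exists>g. g \<in> borel_measurable (R \<Otimes>\<^sub>M M) \<and> (AE x in R \<Otimes>\<^sub>M M. \<psi> (fst x) (snd x) $ i = g x)" for i
    using completion_ex_borel_measurable_real[OF measurable_compose[OF \<psi>m nth[of i]]] by auto
  then obtain g where g: "\<And>i. g i \<in> borel_measurable (R \<Otimes>\<^sub>M M)" "\<And>i. AE x in R \<Otimes>\<^sub>M M. \<psi> (fst x) (snd x) $ i = g i x"
    using choice[of "\<lambda>i g. g \<in> borel_measurable (R \<Otimes>\<^sub>M M) \<and> (AE x in R \<Otimes>\<^sub>M M. \<psi> (fst x) (snd x) $ i = g x)"] by auto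
  define \<psi>' where "\<psi>' r w = (\<chi> i. g i (max 0 (min 1 r), w))" for r w
  have "AE x in R \<Otimes>\<^sub>M M. \<forall>i. \<psi> (fst x) (snd x) $ i = g i x" using g(2) by (subst AE_all_countable) simp
  then have "AE x in R \<Otimes>\<^sub>M M. \<psi>' (fst x) (snd x) = \<psi> (fst x) (snd x)"
    using AE_space by eventually_elim (auto simp: \<psi>'_def vec_eq_iff space_pair_measure R_def space_restrict_space)
  then obtain N where N: "{x \<in> space (R \<Otimes>\<^sub>M M). \<psi>' (fst x) (snd x) \<noteq> \<psi> (fst x) (snd x)} \<subseteq> N"
      "emeasure (R \<Otimes>\<^sub>M M) N = 0" "N \<in> sets (R \<Otimes>\<^sub>M M)" by (rule AE_E)
  have "AE x in R \<Otimes>\<^sub>M M. x \<notin> N" using N by (intro AE_not_in) auto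
  then have 1: "AE r in R. AE w in M. (r, w) \<notin> N" by (rule P.AE_pair)
  have 2: "AE w in M. AE r in R. (r, w) \<notin> N"
    by (subst P.AE_commute[symmetric]) (use 1 N(3) in auto)
  show thesis
  proof (rule that[of \<psi>'])
    have [measurable]: "(\<lambda>r. max 0 (min 1 r)) \<in> measurable borel R"
      unfolding R_def by (rule measurable_restrict_space2) auto
    have "(\<lambda>x. \<psi>' (fst x) (snd x)) \<in> borel_measurable (borel \<Otimes>\<^sub>M M)"
      by (rule borel_measurable_vecI) (use g(1) in \<open>simp add: \<psi>'_def\<close>)
    then show "(\<lambda>(r, w). \<psi>' r w) \<in> borel_measurable (borel \<Otimes>\<^sub>M M)" by (simp add: split_beta')
    show "AE r in lborel. r \<in> {0..1} \<longrightarrow> (AE w in M. \<psi>' r w = \<psi> r w)"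
      unfolding AER[symmetric] using 1 AE_space
    proof eventually_elim
      case (elim r)
      from elim(1) AE_space show ?case
        by eventually_elim (use elim(2) N(1) in \<open>auto simp: space_pair_measure\<close>)
    qed
    show "AE w in M. AE r in lborel. r \<in> {0..1} \<longrightarrow> \<psi>' r w = \<psi> r w"
      unfolding AER[symmetric] using 2 AE_space
    proof eventually_elim
      case (elim w)
      from elim(1) AE_space show ?case
        by eventually_elim (use elim(2) N(1) in \<open>auto simp: space_pair_measure\<close>)
    qed
  qed
qed

section \<open>The estimate\<close>

context F_fbm_process
begin

definition estimate_const :: "nat \<Rightarrow> real \<Rightarrow> real" where
  "estimate_const p \<epsilon> = 32 * sqrt (2 * 4 ^ p) * (2 + cell_const p) * (1 + 2 / \<epsilon>) + 4 * cell_const p * (1 + 2 / \<epsilon>) + 4"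

lemma estimate_const_ge: "0 < \<epsilon> \<Longrightarrow> 4 \<le> estimate_const p \<epsilon>"
  using cell_const_pos[of p] by (simp add: estimate_const_def)

lemma frozen_sum_const_le:
  assumes h: "0 < h" "h < 1" "h \<le> \<delta>" and \<epsilon>: "0 < \<epsilon>" "\<epsilon> < 1/2" and n: "1 \<le> n" "real n \<le> 2 * \<delta> / h"
    and K: "0 < K" and L: "0 \<le> L" and \<kappa>: "0 \<le> \<kappa>"
  defines "S \<equiv> \<Sum>j=1..n. 1 / real j"
  shows "8 * sqrt (2 * 4 ^ p * real n) * (2 * K * h + cell_const p * K * h) * S + cell_const p * (L * (\<kappa> * h)) * h * real n * S
      + (2 * K * h + 2 * L * (2 * \<kappa> * h) * \<delta>) \<le>
    estimate_const p \<epsilon> * (K * (h powr (1/2 - \<epsilon>) * \<delta> powr (1/2 + \<epsilon>/2)) + L * \<kappa> * (h powr (1 - \<epsilon>) * \<delta> powr (1 + \<epsilon>/2)))"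
proof -
  define X1 where "X1 = h powr (1/2 - \<epsilon>) * \<delta> powr (1/2 + \<epsilon>/2)"
  define X2 where "X2 = h powr (1 - \<epsilon>) * \<delta> powr (1 + \<epsilon>/2)"
  define Q where "Q = 1 + 2 / \<epsilon>"
  define A where "A = 8 * sqrt (2 * 4 ^ p) * (2 + cell_const p)"
  define D where "D = cell_const p"
  note b = grid_sum_bounds[OF h \<epsilon> n, folded S_def, folded X1_def X2_def, folded Q_def]
  have pos: "0 \<le> X1" "0 \<le> X2" "0 \<le> Q" "0 \<le> A" "0 \<le> D"
    using \<epsilon> cell_const_pos[of p] by (auto simp: X1_def X2_def Q_def A_def D_def)
  have "8 * sqrt (2 * 4 ^ p * real n) * (2 * K * h + cell_const p * K * h) * S = A * K * (sqrt (real n) * h * S)"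
    by (simp add: A_def real_sqrt_mult algebra_simps)
  also have "\<dots> \<le> A * K * (4 * Q * X1)" using b(1) K pos by (intro mult_left_mono) auto
  finally have 1: "8 * sqrt (2 * 4 ^ p * real n) * (2 * K * h + cell_const p * K * h) * S \<le> A * K * (4 * Q * X1)" .
  have "cell_const p * (L * (\<kappa> * h)) * h * real n * S = D * (L * \<kappa>) * (h * h * real n * S)" by (simp add: D_def mult_ac)
  also have "\<dots> \<le> D * (L * \<kappa>) * (4 * Q * X2)" using b(2) L \<kappa> pos by (intro mult_left_mono) auto
  finally have 2: "cell_const p * (L * (\<kappa> * h)) * h * real n * S \<le> D * (L * \<kappa>) * (4 * Q * X2)" .
  have 3: "2 * K * h \<le> 4 * (K * X1)" using mult_left_mono[OF b(3), of K] K pos mult_nonneg_nonneg[of K X1] by simp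
  have 4: "2 * L * (2 * \<kappa> * h) * \<delta> \<le> 4 * (L * \<kappa> * X2)" using mult_left_mono[OF b(4), of "L * \<kappa>"] L \<kappa> by (simp add: mult_ac)
  have E: "estimate_const p \<epsilon> = 4 * A * Q + 4 * D * Q + 4" by (simp add: estimate_const_def A_def D_def Q_def)
  have "0 \<le> 4 * D * Q * (K * X1)" "0 \<le> 4 * A * Q * (L * \<kappa> * X2)" using pos K L \<kappa> by simp_all
  then have "A * K * (4 * Q * X1) + D * (L * \<kappa>) * (4 * Q * X2) + 4 * (K * X1) + 4 * (L * \<kappa> * X2) \<le>
      estimate_const p \<epsilon> * (K * X1 + L * \<kappa> * X2)"
    unfolding E by (simp add: algebra_simps)
  then show ?thesis using 1 2 3 4 unfolding X1_def X2_def by linarith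
qed

context
  fixes \<psi> :: "real \<Rightarrow> 'a \<Rightarrow> real ^ 'd" and \<kappa> L K h s t \<epsilon> :: real
  assumes \<psi>: "adapted_process F \<psi>" and \<psi>_joint: "jointly_measurable_process M \<psi>"
    and \<psi>_lip: "\<And>v z. 0 \<le> v \<Longrightarrow> v \<le> z \<Longrightarrow> z \<le> 1 \<Longrightarrow> AE w in M. norm (\<psi> z w - \<psi> v w) \<le> \<kappa> * (z - v)"
    and \<kappa>: "0 \<le> \<kappa>" and K: "0 < K" and L: "0 \<le> L"
    and h: "0 < h" "h < 1" and st: "0 \<le> s" "s < t" "t \<le> 1" and \<epsilon>: "0 < \<epsilon>" "\<epsilon> < 1/2"
begin

text \<open>The Lipschitz bound of \<open>\<psi>\<close> holds off a null set that depends on the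
  pair of times. For fixed \<open>v\<close>, exchanging the two almost-everywhere quantifiers gives
  it along almost every path for almost every \<open>r\<close>, where the Borel version makes the
  exceptional set measurable.\<close>

lemma drift_path_close:
  fixes \<psi>' :: "real \<Rightarrow> 'a \<Rightarrow> real ^ 'd"
  assumes \<psi>': "(\<lambda>(r, w). \<psi>' r w) \<in> borel_measurable (borel \<Otimes>\<^sub>M M)"
    and eq: "AE r in lborel. r \<in> {0..1} \<longrightarrow> (AE w in M. \<psi>' r w = \<psi> r w)" and v: "v \<in> {0..1}"
  shows "AE w in M. AE r in lborel. v \<le> r \<and> r \<le> 1 \<longrightarrow> norm (\<psi>' r w - \<psi> v w) \<le> \<kappa> * (r - v)"
proof -
  interpret P: pair_sigma_finite lborel M ..
  have [measurable]: "\<psi> v \<in> borel_measurable M" using \<psi> v by (auto simp: adapted_process_def intro: F_meas)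
  have [measurable]: "(\<lambda>x. \<psi>' (fst x) (snd x)) \<in> borel_measurable (lborel \<Otimes>\<^sub>M M)"
    using \<psi>' by (simp add: split_beta' cong: measurable_cong_sets sets_pair_measure_cong)
  define Q where "Q r w \<longleftrightarrow> v \<le> r \<and> r \<le> 1 \<longrightarrow> norm (\<psi>' r w - \<psi> v w) \<le> \<kappa> * (r - v)" for r w
  have "AE r in lborel. AE w in M. Q r w"
    unfolding Q_def
    using eq
  proof eventually_elim
    case (elim r)
    show ?case
    proof (cases "v \<le> r \<and> r \<le> 1")
      case True
      then have "AE w in M. \<psi>' r w = \<psi> r w" using elim v by auto
      moreover have "AE w in M. norm (\<psi> r w - \<psi> v w) \<le> \<kappa> * (r - v)" using v True by (intro \<psi>_lip) auto
      ultimately show ?thesis by eventually_elim simp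
    next
      case False
      then show ?thesis by (intro AE_I2) auto
    qed
  qed
  moreover have "{x \<in> space (lborel \<Otimes>\<^sub>M M). Q (fst x) (snd x)} \<in> sets (lborel \<Otimes>\<^sub>M M)"
    unfolding Q_def by measurable
  ultimately have "AE w in M. AE r in lborel. Q r w" using P.AE_commute[of Q] by blast
  then show ?thesis by (simp only: Q_def)
qed

text \<open>If \<open>h > t - s\<close>, the trivial bound \<open>2 * K * (t - s)\<close> is already
  of the required order. Otherwise at least one grid point lies in \<open>(s, t]\<close>, and the
  path integral is compared with the sum of cells frozen one grid step back.\<close>

lemma scalar_estimate:
  fixes \<psi>' Bm :: "real \<Rightarrow> 'a \<Rightarrow> real ^ 'd" and \<phi> :: "real ^ 'd \<Rightarrow> real"
  assumes \<psi>': "(\<lambda>(r, w). \<psi>' r w) \<in> borel_measurable (borel \<Otimes>\<^sub>M M)"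
    and eq: "AE r in lborel. r \<in> {0..1} \<longrightarrow> (AE w in M. \<psi>' r w = \<psi> r w)"
    and Bm: "(\<lambda>(r, w). Bm r w) \<in> borel_measurable (borel \<Otimes>\<^sub>M M)"
    and Bm_eq: "AE w in M. \<forall>r\<in>{0..1}. Bm r w = B r w"
    and \<phi>[measurable]: "\<phi> \<in> borel_measurable borel" and \<phi>K: "\<And>x. \<bar>\<phi> x\<bar> \<le> K"
    and \<phi>L: "\<And>x y. \<bar>\<phi> x - \<phi> y\<bar> \<le> L * norm (x - y)" and p: "1 \<le> p"
  shows "\<exists>Z. moment_le p Z (estimate_const p \<epsilon> *
        (K * (h powr (1/2 - \<epsilon>) * (t - s) powr (1/2 + \<epsilon>/2)) + L * \<kappa> * (h powr (1 - \<epsilon>) * (t - s) powr (1 + \<epsilon>/2)))) \<and>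
      (AE w in M. \<bar>LINT r:{s..t}|lborel. \<phi> (\<psi>' r w + Bm r w) - \<phi> (\<psi>' r w + Bm (grid_floor h r) w)\<bar> \<le> Z w)"
proof -
  have path: "(\<lambda>r. X r w) \<in> borel_measurable borel"
    if "(\<lambda>(r, w). X r w) \<in> borel_measurable (borel \<Otimes>\<^sub>M M)" "w \<in> space M" for X :: "real \<Rightarrow> 'a \<Rightarrow> real ^ 'd" and w
    using measurable_compose[OF measurable_Pair2'[OF that(2), of borel] that(1)] by simp
  define I where "I w = (LINT r:{s..t}|lborel. \<phi> (\<psi>' r w + Bm r w) - \<phi> (\<psi>' r w + Bm (grid_floor h r) w))" for w
  define X1 where "X1 = h powr (1/2 - \<epsilon>) * (t - s) powr (1/2 + \<epsilon>/2)"
  define X2 where "X2 = h powr (1 - \<epsilon>) * (t - s) powr (1 + \<epsilon>/2)"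
  have X: "0 \<le> X1" "0 \<le> X2" by (simp_all add: X1_def X2_def)
  show ?thesis
  proof (cases "h \<le> t - s")
    case False
    have "t - s = (t - s) powr (1/2 - \<epsilon>/2) * (t - s) powr (1/2 + \<epsilon>/2)" using st by (simp flip: powr_add)
    also have "(t - s) powr (1/2 - \<epsilon>/2) \<le> h powr (1/2 - \<epsilon>/2)" using False st \<epsilon> by (intro powr_mono2) auto
    also have "h powr (1/2 - \<epsilon>/2) \<le> h powr (1/2 - \<epsilon>)" using h \<epsilon> by (intro powr_mono') auto
    finally have "t - s \<le> X1" by (simp add: X1_def mult_right_mono)
    have "2 * K * (t - s) \<le> 4 * (K * X1)" using mult_left_mono[OF \<open>t - s \<le> X1\<close>, of K] K st mult_nonneg_nonneg[of K X1] X by simp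
    also have "\<dots> \<le> estimate_const p \<epsilon> * (K * X1)" using estimate_const_ge[OF \<epsilon>(1)] K X by (intro mult_right_mono) auto
    also have "\<dots> \<le> estimate_const p \<epsilon> * (K * X1 + L * \<kappa> * X2)"
      using estimate_const_ge[OF \<epsilon>(1), of p] X L \<kappa> by (intro mult_left_mono) auto
    finally have "moment_le p (\<lambda>w. 2 * K * (t - s)) (estimate_const p \<epsilon> * (K * X1 + L * \<kappa> * X2))"
      using K st by (intro moment_le_mono[OF moment_le_bounded[where c="2 * K * (t - s)"]]) auto
    moreover have "AE w in M. \<bar>I w\<bar> \<le> 2 * K * (t - s)"
    proof (rule AE_I2)
      fix w assume w: "w \<in> space M"
      note [measurable] = path[OF \<psi>' w] path[OF Bm w]
      have "\<bar>\<phi> (\<psi>' r w + Bm r w) - \<phi> (\<psi>' r w + Bm (grid_floor h r) w)\<bar> \<le> 2 * K" for r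
        using \<phi>K[of "\<psi>' r w + Bm r w"] \<phi>K[of "\<psi>' r w + Bm (grid_floor h r) w"] by linarith
      then show "\<bar>I w\<bar> \<le> 2 * K * (t - s)" unfolding I_def
        by (intro set_integral_abs_le) (use st K in auto)
    qed
    ultimately show ?thesis unfolding I_def X1_def X2_def by blast
  next
    case True
    define k0 where "k0 = nat \<lfloor>s / h\<rfloor>"
    define N where "N = nat \<lfloor>t / h\<rfloor> - k0"
    have "real k0 = of_int \<lfloor>s / h\<rfloor>" using st h by (simp add: k0_def)
    moreover have "of_int \<lfloor>s / h\<rfloor> \<le> s / h" "s / h < of_int \<lfloor>s / h\<rfloor> + 1" by linarith+
    ultimately have k0: "real k0 * h \<le> s" "s < real (k0 + 1) * h"
      unfolding pos_le_divide_eq[OF h(1), symmetric] pos_divide_less_eq[OF h(1), symmetric] by linarith+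
    have "\<lfloor>s / h\<rfloor> + 1 \<le> \<lfloor>t / h\<rfloor>"
    proof -
      have "(s + h) / h \<le> t / h" using True h by (intro divide_right_mono) auto
      then have "s / h + 1 \<le> t / h" using h by (simp add: add_divide_distrib)
      then show ?thesis by linarith
    qed
    moreover have "0 \<le> \<lfloor>s / h\<rfloor>" using st h by simp
    ultimately have N1: "1 \<le> N" and "int (k0 + N) = \<lfloor>t / h\<rfloor>" unfolding N_def k0_def by linarith+
    then have kN: "real (k0 + N) = of_int \<lfloor>t / h\<rfloor>" by (metis of_int_of_nat_eq)
    have "of_int \<lfloor>t / h\<rfloor> \<le> t / h" "t / h < of_int \<lfloor>t / h\<rfloor> + 1" by linarith+
    then have N2: "real (k0 + N) * h \<le> t" "t < real (k0 + N + 1) * h"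
      using kN unfolding pos_le_divide_eq[OF h(1), symmetric] pos_divide_less_eq[OF h(1), symmetric] by linarith+
    \<comment> \<open>\<open>N * h\<close> exceeds \<open>t - s\<close> by at most one mesh
      \<open>h\<close>, and \<open>h \<le> t - s\<close>.\<close>
    have "real N * h \<le> 2 * (t - s)" using N2(1) k0(2) True by (simp add: algebra_simps)
    then have N3: "real N \<le> 2 * (t - s) / h" using h by (simp add: field_simps)
    define a where "a k = real (k0 + k) * h" for k
    define b where "b k = min t (real (k0 + k + 1) * h)" for k
    \<comment> \<open>One grid point before the cell, the case \<open>j = 1\<close> of the
      telescoping. The freezing time has to precede the cell strictly for the smoothing, and within
      the cell it is at most \<open>2 * h\<close> in the past.\<close>
    define v where "v k = real (k0 + k - 1) * h" for k
    define U where "U w = (\<Sum>k=1..N. frozen_cell Bm \<psi> \<phi> (v k) (a k) (b k) w)" for w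
    define c where "c = 2 * K * h + 2 * L * (2 * \<kappa> * h) * (t - s)"
    have c0: "0 \<le> c" using K L \<kappa> h st by (simp add: c_def)
    have U: "moment_le p U (8 * sqrt (2 * 4 ^ p * real N) * (2 * K * h + cell_const p * K * h) * (\<Sum>j=1..N. 1 / real j) +
        cell_const p * (L * (\<kappa> * h)) * h * real N * (\<Sum>j=1..N. 1 / real j))"
      unfolding U_def[abs_def] v_def a_def b_def
      by (rule frozen_sum_moment[OF Bm Bm_eq \<psi> \<psi>_lip \<kappa> \<phi> K \<phi>K L \<phi>L h(1) N1 N2(1) st(3) p])
    have "moment_le p (\<lambda>w. \<bar>U w\<bar> + c) (estimate_const p \<epsilon> * (K * X1 + L * \<kappa> * X2))"
      unfolding X1_def X2_def
      by (rule moment_le_mono[OF moment_le_add[OF moment_le_abs[OF U] moment_le_bounded p]])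
         (use c0 frozen_sum_const_le[OF h True \<epsilon> N1 N3 K L \<kappa>, of p] in \<open>auto simp: c_def\<close>)
    moreover have "AE w in M. \<bar>I w\<bar> \<le> \<bar>U w\<bar> + c"
    proof -
      have "v k \<in> {0..1}" if k: "k \<in> {1..N}" for k
      proof -
        have "real (k0 + k - 1) * h \<le> real (k0 + N) * h" using k h by (intro mult_right_mono) auto
        then have "real (k0 + k - 1) * h \<le> 1" using N2(1) st(3) by linarith
        then show ?thesis using h by (simp add: v_def)
      qed
      then have "AE w in M. \<forall>k\<in>{1..N}. AE r in lborel. v k \<le> r \<and> r \<le> 1 \<longrightarrow> norm (\<psi>' r w - \<psi> (v k) w) \<le> \<kappa> * (r - v k)"
        by (subst AE_finite_all) (auto intro!: drift_path_close[OF \<psi>' eq])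
      then show ?thesis using AE_space
      proof eventually_elim
        case (elim w)
        have close: "AE r in lborel. real (k0 + k) * h \<le> r \<and> r \<le> min t (real (k0 + k + 1) * h) \<longrightarrow> norm (\<psi>' r w - \<psi> (v k) w) \<le> 2 * \<kappa> * h"
          if k: "k \<in> {1..N}" for k
          using elim(1)[rule_format, OF k]
        proof eventually_elim
          case (elim r)
          show ?case
          proof
            assume r: "real (k0 + k) * h \<le> r \<and> r \<le> min t (real (k0 + k + 1) * h)"
            have "v k = real (k0 + k) * h - h" using k by (simp add: v_def of_nat_diff algebra_simps)
            moreover have "real (k0 + k + 1) * h = real (k0 + k) * h + h" by (simp add: algebra_simps)
            ultimately have "v k \<le> r" "r - v k \<le> 2 * h" "r \<le> 1" using r h st by auto
            then have "norm (\<psi>' r w - \<psi> (v k) w) \<le> \<kappa> * (r - v k)" "\<kappa> * (r - v k) \<le> \<kappa> * (2 * h)"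
              using elim \<kappa> by (auto intro: mult_left_mono)
            then show "norm (\<psi>' r w - \<psi> (v k) w) \<le> 2 * \<kappa> * h" by simp
          qed
        qed
        have "0 \<le> 2 * \<kappa> * h" using \<kappa> h by simp
        from frozen_path_comparison[OF path[OF \<psi>' elim(2)] path[OF Bm elim(2)] \<phi> \<phi>K L \<phi>L h(1) k0 N1 N2 this close]
        show ?case unfolding I_def U_def c_def a_def b_def
          by (simp add: frozen_cell_def[OF Bm Bm_eq \<psi> \<psi>_lip \<kappa> \<phi> K \<phi>K L \<phi>L])
      qed
    qed
    ultimately show ?thesis unfolding I_def X1_def X2_def by blast
  qed
qed

text \<open>The coordinates are estimated separately and the norm is bounded by the sum of their
  moduli, hence the factor \<open>CARD('d)\<close>. For almost every path the Lebesgue integral of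
  the original processes equals the Borel integral of their versions.\<close>

lemma vector_estimate:
  fixes f :: "real ^ 'd \<Rightarrow> real ^ 'd"
  assumes f[measurable]: "f \<in> borel_measurable borel" and fK: "\<And>x. norm (f x) \<le> K"
    and fL: "\<And>x y. norm (f x - f y) \<le> L * norm (x - y)" and p: "1 \<le> p" and m: "0 < m" "m \<le> 2 * real p"
  shows "Lm_norm M m (\<lambda>w. LINT r:{s..t}|lebesgue. f (\<psi> r w + B r w) - f (\<psi> r w + B (grid_floor h r) w)) \<le>
    ennreal (real CARD('d) * estimate_const p \<epsilon> *
      (K * (h powr (1/2 - \<epsilon>) * (t - s) powr (1/2 + \<epsilon>/2)) + L * \<kappa> * (h powr (1 - \<epsilon>) * (t - s) powr (1 + \<epsilon>/2))))"
proof -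
  obtain Bm where Bm: "(\<lambda>(r, w). Bm r w) \<in> borel_measurable (borel \<Otimes>\<^sub>M M)"
    and Bm_eq: "AE w in M. \<forall>r\<in>{0..1}. Bm r w = B r w" by (rule measurable_version)
  obtain \<psi>' where \<psi>': "(\<lambda>(r, w). \<psi>' r w) \<in> borel_measurable (borel \<Otimes>\<^sub>M M)"
    and eq: "AE r in lborel. r \<in> {0..1} \<longrightarrow> (AE w in M. \<psi>' r w = \<psi> r w)"
    and eq': "AE w in M. AE r in lborel. r \<in> {0..1} \<longrightarrow> \<psi>' r w = \<psi> r w"
    by (rule jointly_measurable_version[OF \<psi>_joint])
  have path: "(\<lambda>r. X r w) \<in> borel_measurable borel"
    if "(\<lambda>(r, w). X r w) \<in> borel_measurable (borel \<Otimes>\<^sub>M M)" "w \<in> space M" for X :: "real \<Rightarrow> 'a \<Rightarrow> real ^ 'd" and w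
    using measurable_compose[OF measurable_Pair2'[OF that(2), of borel] that(1)] by simp
  define A where "A = estimate_const p \<epsilon> *
      (K * (h powr (1/2 - \<epsilon>) * (t - s) powr (1/2 + \<epsilon>/2)) + L * \<kappa> * (h powr (1 - \<epsilon>) * (t - s) powr (1 + \<epsilon>/2)))"
  have A: "0 < A"
    unfolding A_def using estimate_const_ge[OF \<epsilon>(1), of p] K L \<kappa> h st by (intro mult_pos_pos add_pos_nonneg) auto
  define I where "I i w = (LINT r:{s..t}|lborel. f (\<psi>' r w + Bm r w) $ i - f (\<psi>' r w + Bm (grid_floor h r) w) $ i)" for i w
  have "\<exists>Z. moment_le p Z A \<and> (AE w in M. \<bar>I i w\<bar> \<le> Z w)" for i
    unfolding A_def I_def
  proof (rule scalar_estimate[OF \<psi>' eq Bm Bm_eq _ _ _ p])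
    show "(\<lambda>x. f x $ i) \<in> borel_measurable borel" by (rule measurable_compose[OF f]) simp
    show "\<bar>f x $ i\<bar> \<le> K" for x using component_le_norm_cart[of "f x" i] fK[of x] by linarith
    show "\<bar>f x $ i - f y $ i\<bar> \<le> L * norm (x - y)" for x y
      using component_le_norm_cart[of "f x - f y" i] fL[of x y] by simp
  qed
  then obtain Z where Z: "\<And>i. moment_le p (Z i) A" "\<And>i. AE w in M. \<bar>I i w\<bar> \<le> Z i w"
    using choice[of "\<lambda>i Z. moment_le p Z A \<and> (AE w in M. \<bar>I i w\<bar> \<le> Z w)"] by auto
  have "AE w in M. \<forall>i. \<bar>I i w\<bar> \<le> Z i w" using Z(2) by (subst AE_all_countable) simp
  then have bound: "AE w in M. norm (LINT r:{s..t}|lebesgue. f (\<psi> r w + B r w) - f (\<psi> r w + B (grid_floor h r) w)) \<le> (\<Sum>i\<in>UNIV. Z i w)"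
    using eq' Bm_eq AE_space
  proof eventually_elim
    case (elim w)
    note [measurable] = path[OF \<psi>' elim(4)] path[OF Bm elim(4)]
    define G where "G r = indicator {s..t} r *\<^sub>R (f (\<psi>' r w + Bm r w) - f (\<psi>' r w + Bm (grid_floor h r) w))" for r
    have Gm[measurable]: "G \<in> borel_measurable borel" unfolding G_def[abs_def] by measurable
    have "norm (f x - f y) \<le> 2 * K" for x y using norm_triangle_ineq4[of "f x" "f y"] fK[of x] fK[of y] by linarith
    then have int: "integrable lborel G"
      by (intro integrableI_bounded_set[where A="{s..t}" and B="2 * K"])
         (auto simp: G_def indicator_def emeasure_lborel_Icc_eq)
    have ae: "AE r in lebesgue. G r = indicator {s..t} r *\<^sub>R (f (\<psi> r w + B r w) - f (\<psi> r w + B (grid_floor h r) w))"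
    proof (rule AE_completion)
      show "AE r in lborel. G r = indicator {s..t} r *\<^sub>R (f (\<psi> r w + B r w) - f (\<psi> r w + B (grid_floor h r) w))"
        using elim(2)
      proof eventually_elim
        case (elim r)
        show ?case
        proof (cases "r \<in> {s..t}")
          case True
          then have "r \<in> {0..1}" "grid_floor h r \<in> {0..1}" using grid_floor_bounds[OF h(1), of r] st by auto
          then show ?thesis using elim \<open>\<forall>r\<in>{0..1}. Bm r w = B r w\<close> by (simp add: G_def)
        qed (simp add: G_def)
      qed
    qed
    have Gl: "G \<in> borel_measurable lebesgue" using Gm by (intro measurable_completion) simp
    have "(LINT r:{s..t}|lebesgue. f (\<psi> r w + B r w) - f (\<psi> r w + B (grid_floor h r) w)) = (LINT r|lebesgue. G r)"
      unfolding set_lebesgue_integral_def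
    proof (rule integral_cong_AE[symmetric])
      \<comment> \<open>Paths of the original drift need not be Borel; completeness of
        \<open>lebesgue\<close> makes them measurable because they agree almost everywhere with
        Borel paths.\<close>
      show "(\<lambda>r. indicator {s..t} r *\<^sub>R (f (\<psi> r w + B r w) - f (\<psi> r w + B (grid_floor h r) w))) \<in> borel_measurable lebesgue"
        by (rule borel_measurable_AE[OF Gl ae])
    qed (rule Gl ae)+
    also have "\<dots> = (LINT r|lborel. G r)" by (rule integral_completion) simp
    finally have eqG: "(LINT r:{s..t}|lebesgue. f (\<psi> r w + B r w) - f (\<psi> r w + B (grid_floor h r) w)) = (LINT r|lborel. G r)" .
    have comp: "(LINT r|lborel. G r) $ i = I i w" for i
      unfolding I_def set_lebesgue_integral_def integral_bounded_linear[OF bounded_linear_vec_nth int, symmetric]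
      by (simp add: G_def)
    have "norm (LINT r|lborel. G r) \<le> (\<Sum>i\<in>UNIV. \<bar>I i w\<bar>)" using norm_le_l1_cart[of "LINT r|lborel. G r"] by (simp add: comp)
    also have "\<dots> \<le> (\<Sum>i\<in>UNIV. Z i w)" using elim(1) by (intro sum_mono) auto
    finally show ?case unfolding eqG .
  qed
  have "moment_le p (\<lambda>w. \<Sum>i\<in>UNIV. Z i w) (\<Sum>i::'d\<in>UNIV. A)" by (intro moment_le_sum Z p)
  then have "Lm_norm M m (\<lambda>w. LINT r:{s..t}|lebesgue. f (\<psi> r w + B r w) - f (\<psi> r w + B (grid_floor h r) w)) \<le> ennreal (real CARD('d) * A)"
    using A m bound by (intro Lm_norm_le[where Z="\<lambda>w. \<Sum>i\<in>UNIV. Z i w" and p=p]) auto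
  then show ?thesis by (simp add: A_def mult.assoc)
qed

end

end

section \<open>From extended norms to real constants, and the theorem\<close>

lemma norm_le_sup_norm:
  assumes "sup_norm f < \<infinity>"
  shows "norm (f x) \<le> enn2real (sup_norm f)"
proof -
  have "ennreal (norm (f x)) \<le> sup_norm f" unfolding sup_norm_def by (rule SUP_upper) simp
  then show ?thesis using enn2real_mono[of "ennreal (norm (f x))" "sup_norm f"] assms by simp
qed

lemma C1_norm_lipschitz:
  assumes "C1_norm f < \<infinity>"
  shows "norm (f x - f y) \<le> enn2real (C1_norm f) * norm (x - y)"
proof (cases "x = y")
  case False
  have "ennreal (norm (f x - f y) / norm (x - y)) \<le> (SUP (x, y)\<in>{(x, y). x \<noteq> y}. ennreal (norm (f x - f y) / norm (x - y)))"
    using False by (intro SUP_upper2[of "(x, y)"]) auto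
  also have "\<dots> \<le> C1_norm f" by (simp add: C1_norm_def)
  finally have "norm (f x - f y) / norm (x - y) \<le> enn2real (C1_norm f)"
    using enn2real_mono[of "ennreal (norm (f x - f y) / norm (x - y))" "C1_norm f"] assms by simp
  then show ?thesis using False by (simp add: field_simps)
qed simp

text \<open>Each pair of times has its own null set, from the essential supremum of that increment.
  A bound uniform over paths and times is not claimed; \<open>drift_path_close\<close> bridges the
  gap.\<close>

lemma C1_Linf_seminorm_lipschitz:
  fixes \<psi> :: "real \<Rightarrow> 'a \<Rightarrow> 'b::real_normed_vector"
  assumes fin: "C1_Linf_seminorm M \<psi> < \<infinity>" and vw: "0 \<le> v" "v \<le> z" "z \<le> 1"
  shows "AE w in M. norm (\<psi> z w - \<psi> v w) \<le> enn2real (C1_Linf_seminorm M \<psi>) * (z - v)"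
proof (cases "v = z")
  case False
  then have vw': "v < z" using vw by simp
  define \<kappa> where "\<kappa> = enn2real (C1_Linf_seminorm M \<psi>)"
  define E where "E = Linf_norm M (\<lambda>w. \<psi> z w - \<psi> v w)"
  have "E / ennreal (z - v) \<le> C1_Linf_seminorm M \<psi>"
    unfolding C1_Linf_seminorm_def E_def using vw vw' by (intro SUP_upper2[of "(v, z)"]) auto
  also have "\<dots> = ennreal \<kappa>" using fin by (simp add: \<kappa>_def)
  finally have "E / ennreal (z - v) \<le> ennreal \<kappa>" .
  then have E: "E \<le> ennreal (\<kappa> * (z - v))"
  proof (cases E)
    case (real e)
    then show ?thesis using \<open>E / ennreal (z - v) \<le> ennreal \<kappa>\<close> vw'
      by (simp add: divide_ennreal \<kappa>_def ennreal_le_iff pos_divide_le_eq)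
  qed (use vw' in \<open>simp add: ennreal_top_divide top_unique\<close>)
  have "AE w in M. ennreal (norm (\<psi> z w - \<psi> v w)) \<le> E"
    unfolding E_def Linf_norm_def by (rule esssup_AE)
  then show ?thesis
  proof eventually_elim
    case (elim w)
    then have "ennreal (norm (\<psi> z w - \<psi> v w)) \<le> ennreal (\<kappa> * (z - v))" using E by (rule order_trans)
    then show ?case using vw by (simp add: \<kappa>_def ennreal_le_iff)
  qed
qed simp

theorem proposition4p17:
  fixes M :: "'a measure" and F :: "real \<Rightarrow> 'a measure"
    and B :: "real \<Rightarrow> 'a \<Rightarrow> real ^ 'd"
    and H \<epsilon> m :: real
  assumes "filtered_prob_space M F"
    and "0 < H" "H < 1/2"
    and "F_fbm M F H B"
    and "0 < \<epsilon>" "\<epsilon> < 1/2"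
    and "2 \<le> m"
  shows "\<exists>C>0. \<forall>(\<psi> :: real \<Rightarrow> 'a \<Rightarrow> real ^ 'd) (f :: real ^ 'd \<Rightarrow> real ^ 'd) (h :: real) (s :: real) (t :: real).
     adapted_process F \<psi> \<longrightarrow> jointly_measurable_process M \<psi> \<longrightarrow> C1_bounded f \<longrightarrow>
     0 < h \<longrightarrow> h < 1 \<longrightarrow> 0 \<le> s \<longrightarrow> s < t \<longrightarrow> t \<le> 1 \<longrightarrow>
     Lm_norm M m (\<lambda>\<omega>. LINT r:{s..t}|lebesgue.
         f (\<psi> r \<omega> + B r \<omega>) - f (\<psi> r \<omega> + B (grid_floor h r) \<omega>))
     \<le> ennreal C *
        (sup_norm f * ennreal (h powr (1/2 - \<epsilon>) * (t - s) powr (1/2 + \<epsilon>/2))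
         + C1_norm f * C1_Linf_seminorm M \<psi> * ennreal (h powr (1 - \<epsilon>) * (t - s) powr (1 + \<epsilon>/2)))"
proof -
  interpret F_fbm_process M F B H
    using assms by (simp add: F_fbm_process_def F_fbm_process_axioms_def)
  \<comment> \<open>An integer with \<open>m \<le> 2 * p\<close>, chosen before the drift, the
    function and the times, so that \<open>C\<close> does not depend on them.\<close>
  define p where "p = nat \<lceil>m\<rceil>"
  have p: "1 \<le> p" "m \<le> 2 * real p" using assms(7) by (auto simp: p_def) linarith+
  define C where "C = real CARD('d) * estimate_const p \<epsilon>"
  have C: "0 < C" using estimate_const_ge[OF assms(5), of p] by (simp add: C_def)
  have "Lm_norm M m (\<lambda>\<omega>. LINT r:{s..t}|lebesgue.
         f (\<psi> r \<omega> + B r \<omega>) - f (\<psi> r \<omega> + B (grid_floor h r) \<omega>))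
     \<le> ennreal C *
        (sup_norm f * ennreal (h powr (1/2 - \<epsilon>) * (t - s) powr (1/2 + \<epsilon>/2))
         + C1_norm f * C1_Linf_seminorm M \<psi> * ennreal (h powr (1 - \<epsilon>) * (t - s) powr (1 + \<epsilon>/2)))"
    if \<psi>: "adapted_process F \<psi>" "jointly_measurable_process M \<psi>" and f: "C1_bounded f"
      and h: "0 < h" "h < 1" and st: "0 \<le> s" "s < t" "t \<le> 1"
    for \<psi> :: "real \<Rightarrow> 'a \<Rightarrow> real ^ 'd" and f :: "real ^ 'd \<Rightarrow> real ^ 'd" and h s t :: real
  proof -
    define X1 where "X1 = h powr (1/2 - \<epsilon>) * (t - s) powr (1/2 + \<epsilon>/2)"
    define X2 where "X2 = h powr (1 - \<epsilon>) * (t - s) powr (1 + \<epsilon>/2)"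
    have X: "0 < X1" "0 < X2" using h st by (auto simp: X1_def X2_def)
    have C1: "C1_norm f < \<infinity>" using f by (simp add: C1_bounded_def)
    have sup_le: "sup_norm f \<le> C1_norm f" by (simp add: C1_norm_def)
    then have S: "sup_norm f < \<infinity>" using C1 by (rule le_less_trans)
    define K where "K = enn2real (sup_norm f)"
    define L where "L = enn2real (C1_norm f)"
    have KL: "sup_norm f = ennreal K" "C1_norm f = ennreal L" "0 \<le> K" "0 \<le> L" using S C1 by (simp_all add: K_def L_def)
    have fK: "norm (f x) \<le> K" for x unfolding K_def by (rule norm_le_sup_norm[OF S])
    have fL: "norm (f x - f y) \<le> L * norm (x - y)" for x y unfolding L_def by (rule C1_norm_lipschitz[OF C1])
    have fm: "f \<in> borel_measurable borel"
    proof (rule borel_measurable_continuous_onI)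
      obtain f' where "\<And>x. (f has_derivative blinfun_apply (f' x)) (at x)" using f by (auto simp: C1_bounded_def)
      then show "continuous_on UNIV f" by (intro continuous_at_imp_continuous_on ballI has_derivative_continuous)
    qed
    show ?thesis
    \<comment> \<open>For \<open>K = 0\<close> the function vanishes and so does the left side. The
      case is separated because the scale in the moment bounds must be positive.\<close>
    proof (cases "K = 0")
      case True
      then have "f x = 0" for x using fK[of x] by simp
      then show ?thesis using assms(7) by (simp add: Lm_norm_def)
    next
      case False
      then have K: "0 < K" using KL by simp
      show ?thesis
      proof (cases "C1_Linf_seminorm M \<psi> < \<infinity>")
        case False
        then have "C1_Linf_seminorm M \<psi> = \<infinity>" by (cases "C1_Linf_seminorm M \<psi>") auto
        \<comment> \<open>Positivity of \<open>L\<close> matters because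
          \<open>0 * \<infinity> = 0\<close>; with it the right side is infinite and the inequality
          trivial.\<close>
        moreover have "0 < L" using sup_le K KL by (simp add: ennreal_le_iff)
        ultimately show ?thesis using C X KL unfolding X1_def[symmetric] X2_def[symmetric]
          by (simp add: ennreal_mult_top ennreal_top_mult)
      next
        case True
        define \<kappa> where "\<kappa> = enn2real (C1_Linf_seminorm M \<psi>)"
        have \<kappa>: "C1_Linf_seminorm M \<psi> = ennreal \<kappa>" "0 \<le> \<kappa>" using True by (simp_all add: \<kappa>_def)
        have "Lm_norm M m (\<lambda>\<omega>. LINT r:{s..t}|lebesgue. f (\<psi> r \<omega> + B r \<omega>) - f (\<psi> r \<omega> + B (grid_floor h r) \<omega>)) \<le>
          ennreal (C * (K * X1 + L * \<kappa> * X2))"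
          unfolding C_def X1_def X2_def
          by (rule vector_estimate[OF \<psi> _ \<kappa>(2) K KL(4) h st assms(5,6) fm fK fL p(1) _ p(2)])
             (use C1_Linf_seminorm_lipschitz[OF True] assms(7) in \<open>auto simp: \<kappa>_def\<close>)
        also have "\<dots> = ennreal C * (sup_norm f * ennreal X1 + C1_norm f * C1_Linf_seminorm M \<psi> * ennreal X2)"
          using C X K KL \<kappa> by (simp add: ennreal_mult ennreal_plus)
        finally show ?thesis by (simp add: X1_def X2_def)
      qed
    qed
  qed
  then show ?thesis using C by blast
qed

end
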